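(* Let $M:[0,\infty)\to[0,\infty)$ be continuous, put $\mathscr M(t)=\int_0^t M(\tau)\,d\tau$, and assume: (i) there exists $\theta\in[1,p^*/q)$ such that $tM(t)\le\theta\mathscr M(t)$ for any $t\in[0,\infty)$; (ii) for any $\tau>0$ there exists $\kappa=\kappa(\tau)>0$ such that $M(t)\ge\kappa$ for any $t\ge\tau$. Let $f:\Omega\times\mathbb R\to\mathbb R$ be a Carathéodory function, put $F(x,t)=\int_0^t f(x,\tau)\,d\tau$, and assume (with the $\theta$ of (i)): (iii) there exist an exponent $r\in(p,p^* )$ and $C>0$ such that $|f(x,t)|\le C(1+|t|^{r-1})$ for a.e. $x\in\Omega$ and any $t\in\mathbb R$; (iv) there exist $\sigma\in(q\theta,p^* )$, $c>0$ and $t_0\ge0$ such that $c\le\sigma F(x,t)\le tf(x,t)$ for a.e. $x\in\Omega$ and any $|t|\ge t_0$; (v) $f(x,-t)=-f(x,t)$ for a.e. $x\in\Omega$ and any $t\in\mathbb R$. Then the problem $$-M\left(\int_\Omega|\nabla u|^p\,dx\right)\Delta_p u-M\left(\int_\Omega a(x)|\nabla u|^q\,dx\right)\mathrm{div}\left(a(x)|\nabla u|^{q-2}\nabla u\right)=f(x,u)\ \text{in }\Omega,\qquad u=0\ \text{on }\partial\Omega,$$ has infinitely many weak solutions $\{u_j\}_j\subset W^{1,\mathcal H}_0(\Omega)$ with unbounded energy, i.e. such that the sequence of real numbers $\{I(u_j)\}_j$ is unbounded, where $$I(u)=\frac1p\mathscr M\left(\int_\Omega|\nabla u|^p\,dx\right)+\frac1q\mathscr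 M\left(\int_\Omega a(x)|\nabla u|^q\,dx\right)-\int_\Omega F(x,u)\,dx.$$
   Context: Standing assumptions: $\Omega\subset\mathbb R^N$ is an open, bounded set with Lipschitz boundary, $N\ge2$, $1<p<q<N$, $\frac qp<1+\frac1N$, and $a:\overline\Omega\to[0,\infty)$ is Lipschitz continuous. $p^*=Np/(N-p)$, and $\Delta_p u=\mathrm{div}(|\nabla u|^{p-2}\nabla u)$. Function spaces: $\mathcal H(x,t)=t^p+a(x)t^q$ for $x\in\Omega$, $t\ge0$; $\varrho_{\mathcal H}(u)=\int_\Omega(|u|^p+a(x)|u|^q)\,dx$; $L^{\mathcal H}(\Omega)$ is the space of measurable $u:\Omega\to\mathbb R$ with $\varrho_{\mathcal H}(u)<\infty$, with the Luxemburg norm $\|u\|_{\mathcal H}=\inf\{\lambda>0:\varrho_{\mathcal H}(u/\lambda)\le1\}$. $W^{1,\mathcal H}(\Omega)=\{u\in L^{\mathcal H}(\Omega):|\nabla u|\in L^{\mathcal H}(\Omega)\}$ with norm $\|u\|_{\mathcal H}+\|\,|\nabla u|\,\|_{\mathcal H}$, and $W^{1,\mathcal H}_0(\Omega)$ is the completion (closure) of $C_0^\infty(\Omega)$ in $W^{1,\mathcal H}(\Omega)$, endowed with the equivalent norm $\|u\|=\|\,|\nabla u|\,\|_{\mathcal H}$. Weak solution: writing $\|\nabla u\|_p^p=\int_\Omega|\nabla u|^p\,dx$ and $\|\nabla u\|_{q,a}^q=\int_\Omega a(x)|\nabla u|^q\,dx$, a function $u\in W^{1,\mathcal H}_0(\Omega)$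 is a weak solution of the problem if, for any $\varphi\in W^{1,\mathcal H}_0(\Omega)$, $$M(\|\nabla u\|_p^p)\int_\Omega|\nabla u|^{p-2}\nabla u\cdot\nabla\varphi\,dx+M(\|\nabla u\|_{q,a}^q)\int_\Omega a(x)|\nabla u|^{q-2}\nabla u\cdot\nabla\varphi\,dx=\int_\Omega f(x,u)\varphi\,dx.$$ The energy of $u$ is the value $I(u)$ of the Euler-Lagrange functional $I:W^{1,\mathcal H}_0(\Omega)\to\mathbb R$ of the problem. *)

theory Defs
  imports "HOL-Analysis.Analysis"
begin

section \<open>Geometry of the domain and exponents\<close>

text \<open>Near every boundary point the set is, in suitable orthonormal coordinates, the strict
  epigraph of a Lipschitz function.  The unit vector \<open>e\<close> is the direction of the last coordinate
  and \<open>\<gamma>\<close> lives on the hyperplane orthogonal to \<open>e\<close>.\<close>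

definition lipschitz_boundary :: "'a::euclidean_space set \<Rightarrow> bool" where
  "lipschitz_boundary \<Omega> \<longleftrightarrow>
     (\<forall>z\<in>frontier \<Omega>. \<exists>r>0. \<exists>e \<gamma> L. norm e = 1 \<and>
        L-lipschitz_on {y. y \<bullet> e = 0} \<gamma> \<and>
        \<Omega> \<inter> ball z r = {x \<in> ball z r. \<gamma> (x - (x \<bullet> e) *\<^sub>R e) < x \<bullet> e})"

definition sobolev_conjugate :: "real \<Rightarrow> real \<Rightarrow> real" where
  "sobolev_conjugate N p = N * p / (N - p)"

section \<open>Test functions and weak gradients\<close>

primrec C_k :: "nat \<Rightarrow> ('a::euclidean_space \<Rightarrow> real) \<Rightarrow> bool" where
  "C_k 0 \<phi> \<longleftrightarrow> continuous_on UNIV \<phi>"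
| "C_k (Suc k) \<phi> \<longleftrightarrow> (\<forall>x. \<phi> differentiable (at x)) \<and>
     (\<forall>i\<in>Basis. C_k k (\<lambda>x. frechet_derivative \<phi> (at x) i))"

text \<open>Elements of \<open>C_0^\<infinity>(\<Omega>)\<close> are taken extended by zero to the whole space.\<close>

definition test_functions :: "'a::euclidean_space set \<Rightarrow> ('a \<Rightarrow> real) set" where
  "test_functions \<Omega> = {\<phi>. (\<forall>k. C_k k \<phi>) \<and>
     compact (closure {x. \<phi> x \<noteq> 0}) \<and> closure {x. \<phi> x \<noteq> 0} \<subseteq> \<Omega>}"

definition has_weak_gradient ::
    "'a::euclidean_space set \<Rightarrow> ('a \<Rightarrow> real) \<Rightarrow> ('a \<Rightarrow> 'a) \<Rightarrow> bool" where
  "has_weak_gradient \<Omega> u g \<longleftrightarrow>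
     (\<forall>K. compact K \<and> K \<subseteq> \<Omega> \<longrightarrow> u absolutely_integrable_on K \<and> g absolutely_integrable_on K) \<and>
     (\<forall>\<phi>\<in>test_functions \<Omega>. \<forall>i\<in>Basis.
        (LINT x|lebesgue_on \<Omega>. u x * frechet_derivative \<phi> (at x) i) =
        - (LINT x|lebesgue_on \<Omega>. (g x \<bullet> i) * \<phi> x))"

text \<open>A weak gradient is unique up to null sets; everything below is insensitive to the choice
  of the representative.\<close>

definition weak_gradient :: "'a::euclidean_space set \<Rightarrow> ('a \<Rightarrow> real) \<Rightarrow> 'a \<Rightarrow> 'a" where
  "weak_gradient \<Omega> u = (SOME g. has_weak_gradient \<Omega> u g)"

section \<open>Musielak--Orlicz Sobolev spaces of double phase type\<close>

text \<open>Functions are total on the ambient space and only their values on \<open>\<Omega>\<close> matter; elements of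
  the spaces are representatives, so identity in the space is equality a.e. on \<open>\<Omega>\<close>.\<close>

definition modular_H ::
    "'a::euclidean_space set \<Rightarrow> real \<Rightarrow> real \<Rightarrow> ('a \<Rightarrow> real) \<Rightarrow> ('a \<Rightarrow> real) \<Rightarrow> ennreal" where
  "modular_H \<Omega> p q a u =
     (\<integral>\<^sup>+x. ennreal (\<bar>u x\<bar> powr p + a x * \<bar>u x\<bar> powr q) \<partial>lebesgue_on \<Omega>)"

definition L_H ::
    "'a::euclidean_space set \<Rightarrow> real \<Rightarrow> real \<Rightarrow> ('a \<Rightarrow> real) \<Rightarrow> ('a \<Rightarrow> real) set" where
  "L_H \<Omega> p q a = {u \<in> borel_measurable (lebesgue_on \<Omega>). modular_H \<Omega> p q a u < \<infinity>}"

definition norm_H ::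
    "'a::euclidean_space set \<Rightarrow> real \<Rightarrow> real \<Rightarrow> ('a \<Rightarrow> real) \<Rightarrow> ('a \<Rightarrow> real) \<Rightarrow> real" where
  "norm_H \<Omega> p q a u = Inf {s. s > 0 \<and> modular_H \<Omega> p q a (\<lambda>x. u x / s) \<le> 1}"

definition W1_H ::
    "'a::euclidean_space set \<Rightarrow> real \<Rightarrow> real \<Rightarrow> ('a \<Rightarrow> real) \<Rightarrow> ('a \<Rightarrow> real) set" where
  "W1_H \<Omega> p q a = {u \<in> L_H \<Omega> p q a. (\<exists>g. has_weak_gradient \<Omega> u g) \<and>
     (\<lambda>x. norm (weak_gradient \<Omega> u x)) \<in> L_H \<Omega> p q a}"

definition norm_1H ::
    "'a::euclidean_space set \<Rightarrow> real \<Rightarrow> real \<Rightarrow> ('a \<Rightarrow> real) \<Rightarrow> ('a \<Rightarrow> real) \<Rightarrow> real" where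
  "norm_1H \<Omega> p q a u =
     norm_H \<Omega> p q a u + norm_H \<Omega> p q a (\<lambda>x. norm (weak_gradient \<Omega> u x))"

definition W1_H_0 ::
    "'a::euclidean_space set \<Rightarrow> real \<Rightarrow> real \<Rightarrow> ('a \<Rightarrow> real) \<Rightarrow> ('a \<Rightarrow> real) set" where
  "W1_H_0 \<Omega> p q a = {u \<in> W1_H \<Omega> p q a.
     \<forall>\<epsilon>>0. \<exists>\<phi>\<in>test_functions \<Omega>. norm_1H \<Omega> p q a (\<lambda>x. u x - \<phi> x) < \<epsilon>}"

section \<open>The Kirchhoff problem\<close>

definition primitive :: "(real \<Rightarrow> real) \<Rightarrow> real \<Rightarrow> real" where
  "primitive g t = (LBINT \<tau>=ereal 0..ereal t. g \<tau>)"

definition caratheodory :: "'a::euclidean_space set \<Rightarrow> ('a \<Rightarrow> real \<Rightarrow> real) \<Rightarrow> bool" where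
  "caratheodory \<Omega> f \<longleftrightarrow>
     (\<forall>t. (\<lambda>x. f x t) \<in> borel_measurable (lebesgue_on \<Omega>)) \<and>
     (AE x in lebesgue_on \<Omega>. continuous_on UNIV (f x))"

definition grad_energy_p :: "'a::euclidean_space set \<Rightarrow> real \<Rightarrow> ('a \<Rightarrow> real) \<Rightarrow> real" where
  "grad_energy_p \<Omega> p u = (LINT x|lebesgue_on \<Omega>. norm (weak_gradient \<Omega> u x) powr p)"

definition grad_energy_q ::
    "'a::euclidean_space set \<Rightarrow> real \<Rightarrow> ('a \<Rightarrow> real) \<Rightarrow> ('a \<Rightarrow> real) \<Rightarrow> real" where
  "grad_energy_q \<Omega> q a u = (LINT x|lebesgue_on \<Omega>. a x * norm (weak_gradient \<Omega> u x) powr q)"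

text \<open>Since \<open>0 powr s = 0\<close> for every \<open>s\<close>, the factor \<open>|\<nabla>u|^(p-2) \<nabla>u\<close> is \<open>0\<close> wherever
  \<open>\<nabla>u = 0\<close>, also for \<open>p < 2\<close>, as is customary.\<close>

definition weak_solution ::
    "'a::euclidean_space set \<Rightarrow> real \<Rightarrow> real \<Rightarrow> ('a \<Rightarrow> real) \<Rightarrow> (real \<Rightarrow> real) \<Rightarrow>
     ('a \<Rightarrow> real \<Rightarrow> real) \<Rightarrow> ('a \<Rightarrow> real) \<Rightarrow> bool" where
  "weak_solution \<Omega> p q a M f u \<longleftrightarrow> u \<in> W1_H_0 \<Omega> p q a \<and>
     (\<forall>\<phi>\<in>W1_H_0 \<Omega> p q a.
        M (grad_energy_p \<Omega> p u) *
          (LINT x|lebesgue_on \<Omega>. norm (weak_gradient \<Omega> u x) powr (p - 2) *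
             (weak_gradient \<Omega> u x \<bullet> weak_gradient \<Omega> \<phi> x)) +
        M (grad_energy_q \<Omega> q a u) *
          (LINT x|lebesgue_on \<Omega>. a x * norm (weak_gradient \<Omega> u x) powr (q - 2) *
             (weak_gradient \<Omega> u x \<bullet> weak_gradient \<Omega> \<phi> x)) =
        (LINT x|lebesgue_on \<Omega>. f x (u x) * \<phi> x))"

definition energy ::
    "'a::euclidean_space set \<Rightarrow> real \<Rightarrow> real \<Rightarrow> ('a \<Rightarrow> real) \<Rightarrow> (real \<Rightarrow> real) \<Rightarrow>
     ('a \<Rightarrow> real \<Rightarrow> real) \<Rightarrow> ('a \<Rightarrow> real) \<Rightarrow> real" where
  "energy \<Omega> p q a M f u =
     1 / p * primitive M (grad_energy_p \<Omega> p u) + 1 / q * primitive M (grad_energy_q \<Omega> q a u)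
     - (LINT x|lebesgue_on \<Omega>. primitive (f x) (u x))"

end

theory Submission
  imports Defs "HOL-Homology.Homology" "HOL-Probability.Probability_Measure" "HOL-Library.Function_Algebras"
begin

text \<open>Galerkin approximation along an increasing sequence of spaces of test functions. On each finite
dimensional space the energy is an even coercive functional, and the gradient flow together with the
Borsuk--Ulam theorem links the sphere of gradient norm \<open>P\<close> in a subspace of fixed codimension to a
subspace of one more dimension. A Sobolev--Rellich inequality with finitely many functionals makes
the energy at least \<open>K\<close> on that sphere, so there are Galerkin critical points with energy in
\<open>[K, d]\<close>, uniformly in the dimension. The Ambrosetti--Rabinowitz condition and (i), (ii) bound them, and
the gradients converge strongly: testing with \<open>u\<^sub>m - u\<^sub>n\<close> shows that the midpoint convexity gaps of the two
Dirichlet energies vanish, unless a coefficient \<open>M\<close> degenerates, and then by (ii) the Dirichlet energy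
it multiplies tends to zero anyway. The limit is a weak solution of energy at least \<open>K\<close>, and \<open>K\<close> is
arbitrary. The Borsuk--Ulam theorem is proved by counting simplices with alternating labels (Ky Fan)
in singular chains representing the hemispheres.\<close>

section \<open>The Borsuk--Ulam theorem\<close>

text \<open>Two obstacles shape the proof. The energy carries two separate Kirchhoff coefficients,
  either of which may vanish at 0, so the equation cannot be divided by \<open>M\<close>; and its
  differential is only continuous, so an ascent flow need not be well defined. In finite dimension
  the second one disappears: the energy tends to minus infinity there, slabs between two levels are
  compact, and finitely many explicit ascent steps do the work of the flow. The first is met by
  comparing Galerkin solutions only with one another: for m \<le> n the difference u_m - u_n lies in
  the larger space, and the equation of u_n bounds a weighted sum of two nonnegative gaps, so each
  weighted gap is small by itself. Cauchy sequences and completeness then take the place of weak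
  limits. The upper level \<open>d\<close> bounds the energy on the span of the first k + 1 basis
  functions and so belongs to every dimension; \<open>k\<close> is dictated by \<open>K\<close>
  through the Sobolev--Rellich inequality, where subcriticality of \<open>r\<close> is spent. Only
  the p-energy is prescribed on the linking sphere, because the q-energy enters there with the
  favourable sign.\<close>

fun alternating :: "bool => bool list => bool" where
 "alternating b [] = True"
| "alternating b (x # xs) = (x = b \<and> alternating (\<not> b) xs)"

lemma alternating_exclusive: "xs \<noteq> [] ==> \<not> (alternating b xs \<and> alternating (\<not> b) xs)"
 by (cases xs) auto

lemma alternating_map_Not: "alternating b (map (\<lambda>i. \<not> s i) xs) = alternating (\<not> b) (map s xs)"
 by (induction xs arbitrary: b) auto

text \<open>A list with exactly one pair of equal neighbours becomes alternating by deleting either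
  member of the pair, with the same result, so such deletions come in twos. An alternating list
  stays alternating only if an end is deleted: the last entry, which keeps the first sign, or the
  first entry, which flips it. With the first sign prescribed, exactly one of the two
  counts.\<close>

lemma sum_alternating_remove1:
 assumes "distinct xs"
 shows "odd (\<Sum>x\<in>set xs. of_bool (alternating b (map s (remove1 x xs))) :: int) \<longleftrightarrow>
  xs \<noteq> [] \<and> (alternating b (map s xs) \<or> alternating (\<not> b) (map s xs))"
 using assms
proof (induction xs arbitrary: b)
 case (Cons y ys)
 have "(\<Sum>x\<in>set (y # ys). of_bool (alternating b (map s (remove1 x (y # ys)))) :: int)
   = of_bool (alternating b (map s ys))
    + (\<Sum>x\<in>set ys. of_bool (alternating b (s y # map s (remove1 x ys))))"
 proof -
  have "(\<Sum>x\<in>set ys. of_bool (alternating b (map s (remove1 x (y # ys)))) :: int)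
    = (\<Sum>x\<in>set ys. of_bool (alternating b (s y # map s (remove1 x ys))))"
   using Cons.prems by (intro sum.cong) auto
  moreover have "y \<notin> set ys" using Cons.prems by simp
  ultimately show ?thesis unfolding list.set by (subst sum.insert) (simp_all del: sum_of_bool_eq)
 qed
 also have "(\<Sum>x\<in>set ys. of_bool (alternating b (s y # map s (remove1 x ys)))) =
   (if s y = b then (\<Sum>x\<in>set ys. of_bool (alternating (\<not> b) (map s (remove1 x ys)))) else (0::int))"
  by auto
 finally have *: "(\<Sum>x\<in>set (y # ys). of_bool (alternating b (map s (remove1 x (y # ys)))) :: int)
   = of_bool (alternating b (map s ys))
    + (if s y = b then (\<Sum>x\<in>set ys. of_bool (alternating (\<not> b) (map s (remove1 x ys)))) else 0)" .
 have IH: "odd (\<Sum>x\<in>set ys. of_bool (alternating (\<not> b) (map s (remove1 x ys))) :: int) \<longleftrightarrow>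
  ys \<noteq> [] \<and> (alternating (\<not> b) (map s ys) \<or> alternating b (map s ys))"
  using Cons by simp
 show ?case
  unfolding * using IH alternating_exclusive[of "map s ys" b]
  by (cases "s y = b"; cases "ys = []") (auto simp: even_add)
qed simp

text \<open>Labels are signed indices. After sorting by absolute value, \<open>i \<in> L\<close>
  says that the label of modulus \<open>i\<close> is the positive one, so \<open>b\<close> is the
  sign of the label of least modulus. The demand \<open>card L = k\<close> rules out repeated labels
  on \<open>k\<close> vertices.\<close>

definition alternating_set :: "bool => nat => int set => bool" where
 "alternating_set b k L \<longleftrightarrow> card L = k \<and>
   alternating b (map (\<lambda>i. i \<in> L) (sorted_list_of_set (abs ` L)))"

definition no_antipodes :: "int set => bool" where
 "no_antipodes L \<longleftrightarrow> finite L \<and> (\<forall>x\<in>L. - x \<notin> L)"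

lemma no_antipodes_inj: "no_antipodes L ==> inj_on abs L"
 by (auto simp: no_antipodes_def inj_on_def abs_eq_iff)

lemma alternating_set_uminus:
 assumes "no_antipodes L"
 shows "alternating_set b k (uminus ` L) \<longleftrightarrow> alternating_set (\<not> b) k L"
proof -
 have ab: "abs ` uminus ` L = abs ` L" by (auto simp: image_iff)
 have fin: "finite L" using assms by (auto simp: no_antipodes_def)
 have eq: "map (\<lambda>i. i \<in> uminus ` L) (sorted_list_of_set (abs ` L)) =
    map (\<lambda>i. \<not> i \<in> L) (sorted_list_of_set (abs ` L))"
  using assms fin by (auto simp: no_antipodes_def abs_if image_iff split: if_splits)
 show ?thesis
  unfolding alternating_set_def ab eq alternating_map_Not by (simp add: card_image)
qed

lemma alternating_set_exclusive:
 "no_antipodes L ==> \<not> (alternating_set True (Suc k) L \<and> alternating_set False (Suc k) L)"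
 unfolding alternating_set_def no_antipodes_def
 using alternating_exclusive[of "map (\<lambda>i. i \<in> L) (sorted_list_of_set (abs ` L))" True]
 by (cases "L = {}") auto

lemma sum_alternating_set_facets_inj:
 assumes "no_antipodes L" "card L = Suc k"
 shows "odd (\<Sum>x\<in>L. of_bool (alternating_set b k (L - {x})) :: int) \<longleftrightarrow>
   alternating_set b (Suc k) L \<or> alternating_set (\<not> b) (Suc k) L"
proof -
 have fin: "finite L" and inj: "inj_on abs L" using assms no_antipodes_inj by (auto simp: no_antipodes_def)
 define xs where "xs = sorted_list_of_set (abs ` L)"
 have xs: "distinct xs" "set xs = abs ` L" using fin by (auto simp: xs_def)
 have ne: "xs \<noteq> []" using assms fin xs(2) by (cases xs) auto
 have eq: "alternating_set b k (L - {x}) \<longleftrightarrow> alternating b (map (\<lambda>i. i \<in> L) (remove1 \<bar>x\<bar> xs))" if "x \<in> L" for x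
 proof -
  have a: "abs ` (L - {x}) = abs ` L - {\<bar>x\<bar>}" using inj that by (auto simp: inj_on_def)
  have b: "sorted_list_of_set (abs ` (L - {x})) = remove1 \<bar>x\<bar> xs"
   unfolding a xs_def using fin by (simp add: sorted_list_of_set_remove)
  have c: "map (\<lambda>i. i \<in> L - {x}) (remove1 \<bar>x\<bar> xs) = map (\<lambda>i. i \<in> L) (remove1 \<bar>x\<bar> xs)"
   using xs by auto
  show ?thesis unfolding alternating_set_def b c using that assms fin by simp
 qed
 have "(\<Sum>x\<in>L. of_bool (alternating_set b k (L - {x})) :: int)
   = (\<Sum>x\<in>L. of_bool (alternating b (map (\<lambda>i. i \<in> L) (remove1 \<bar>x\<bar> xs))))"
  using eq by (intro sum.cong) auto
 also have "\<dots> = (\<Sum>x\<in>set xs. of_bool (alternating b (map (\<lambda>i. i \<in> L) (remove1 x xs))))"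
  unfolding xs(2) by (subst sum.reindex[OF inj]) simp
 finally show ?thesis
  using sum_alternating_remove1[OF xs(1), of b "\<lambda>i. i \<in> L"] ne assms
  by (simp add: alternating_set_def xs_def)
qed

text \<open>If two vertices share a label, the facets opposite to them carry the same label set and
  every other facet has too few labels, so the count is even; without repetition this is the
  deletion count for lists of signs.\<close>

lemma sum_alternating_set_facets:
 fixes l :: "nat => int"
 assumes "no_antipodes (l ` {..k})"
 shows "odd (\<Sum>i\<le>k. of_bool (alternating_set b k (l ` ({..k} - {i}))) :: int) \<longleftrightarrow>
   alternating_set b (Suc k) (l ` {..k}) \<or> alternating_set (\<not> b) (Suc k) (l ` {..k})"
proof (cases "inj_on l {..k}")
 case True
 then have c: "card (l ` {..k}) = Suc k" by (simp add: card_image)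
 have "(\<Sum>i\<le>k. of_bool (alternating_set b k (l ` ({..k} - {i}))) :: int)
   = (\<Sum>i\<le>k. of_bool (alternating_set b k (l ` {..k} - {l i})))"
  using True by (intro sum.cong) (auto simp: inj_on_image_set_diff)
 also have "\<dots> = (\<Sum>x\<in>l ` {..k}. of_bool (alternating_set b k (l ` {..k} - {x})))"
  by (subst sum.reindex[OF True]) simp
 finally show ?thesis using sum_alternating_set_facets_inj[OF assms c] by simp
next
 case False
 then obtain i j where ij: "i \<le> k" "j \<le> k" "i \<noteq> j" "l i = l j" by (auto simp: inj_on_def)
 have le: "card (l ` ({..k} - {i})) \<le> k"
  using card_image_le[of "{..k} - {i}" l] ij by simp
 have im: "l ` ({..k} - {i}) = l ` {..k}" "l ` ({..k} - {j}) = l ` {..k}"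
  using ij by (auto simp: image_iff) (metis Diff_iff atMost_iff empty_iff insert_iff)+
 have 0: "\<not> alternating_set b k (l ` ({..k} - {m}))" if "m \<le> k" "m \<noteq> i" "m \<noteq> j" for m
 proof -
  have "l ` ({..k} - {m}) = l ` ({..k} - {m} - {i})"
   using ij that by (auto simp: image_iff)
  also have "card \<dots> \<le> card ({..k} - {m} - {i})" by (rule card_image_le) auto
  also have "\<dots> < k" using that ij by (simp add: card_Diff_singleton)
  finally show ?thesis by (auto simp: alternating_set_def)
 qed
 have "(\<Sum>m\<le>k. of_bool (alternating_set b k (l ` ({..k} - {m}))) :: int)
   = (\<Sum>m\<in>{i,j}. of_bool (alternating_set b k (l ` ({..k} - {m}))))"
  using ij 0 by (intro sum.mono_neutral_right) auto
 also have "even \<dots>" using ij im by (simp del: sum_of_bool_eq)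
 finally show ?thesis using le im by (auto simp: alternating_set_def)
qed

text \<open>Chains have integer coefficients, so a simplex is counted with multiplicity and sign.
  Extending linearly into the free abelian group on one generator gives additivity from
  \<open>frag_extend\<close>. Only the parity of the number matters later.\<close>

definition simplex_count :: "('b => bool) => ('b \<Rightarrow>\<^sub>0 int) => int" where
 "simplex_count Q c = Poly_Mapping.lookup (frag_extend (\<lambda>f. if Q f then frag_of () else 0) c) ()"

lemma simplex_count_simps [simp]:
 "simplex_count Q 0 = 0"
 "simplex_count Q (a + b) = simplex_count Q a + simplex_count Q b"
 "simplex_count Q (a - b) = simplex_count Q a - simplex_count Q b"
 "simplex_count Q (frag_cmul k a) = k * simplex_count Q a"
 "simplex_count Q (frag_of f) = of_bool (Q f)"
 by (simp_all add: simplex_count_def frag_extend_add frag_extend_diff frag_extend_cmul lookup_add lookup_minus)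

lemma simplex_count_sum: "finite I ==> simplex_count Q (sum g I) = (\<Sum>i\<in>I. simplex_count Q (g i))"
 by (induction I rule: finite_induct) simp_all

lemma simplex_count_eq: "simplex_count Q c = (\<Sum>f\<in>Poly_Mapping.keys c. Poly_Mapping.lookup c f * of_bool (Q f))"
 unfolding simplex_count_def frag_extend_def lookup_sum by (rule sum.cong) auto

lemma simplex_count_cong:
 assumes "\<And>f. f \<in> Poly_Mapping.keys c ==> Q f = R f"
 shows "simplex_count Q c = simplex_count R c"
 unfolding simplex_count_eq using assms by (intro sum.cong) simp_all

lemma frag_extend_eq_sum: "frag_extend b c = (\<Sum>f\<in>Poly_Mapping.keys c. frag_cmul (Poly_Mapping.lookup c f) (b f))"
 by (simp add: frag_extend_def)

lemma simplex_count_chain_map: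
 "simplex_count Q (chain_map k g c) = simplex_count (\<lambda>f. Q (simplex_map k g f)) c"
 unfolding chain_map_def frag_extend_eq_sum
 by (simp add: simplex_count_sum simplex_count_eq[of _ c])

section \<open>Vertex labels of singular simplices\<close>

definition vertex :: "nat => nat => real" where
 "vertex j = (\<lambda>i. if i = j then 1 else 0)"

lemma vertex_in: "j \<le> k ==> vertex j \<in> standard_simplex k"
 by (simp add: vertex_def)

definition label_set :: "('b => int) => nat => ((nat => real) => 'b) => int set" where
 "label_set lab k f = (\<lambda>j. lab (f (vertex j))) ` {..k}"

lemma simplical_face_vertex: "simplical_face i (vertex j) = vertex (if j < i then j else Suc j)"
 by (auto simp: simplical_face_def vertex_def fun_eq_iff)

lemma label_set_face:
 assumes "i \<le> Suc k"
 shows "label_set lab k (singular_face (Suc k) i f) = (\<lambda>j. lab (f (vertex j))) ` ({..Suc k} - {i})"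
proof -
 have "label_set lab k (singular_face (Suc k) i f) =
   (\<lambda>j. lab (f (vertex (if j < i then j else Suc j)))) ` {..k}"
  unfolding label_set_def singular_face_def
  by (intro image_cong refl) (simp add: vertex_in simplical_face_vertex)
 also have "\<dots> = (\<lambda>j. lab (f (vertex j))) ` (\<lambda>j. if j < i then j else Suc j) ` {..k}"
  unfolding image_image ..
 also have "(\<lambda>j. if j < i then j else Suc j) ` {..k} = {..Suc k} - {i}"
 proof (intro equalityI subsetI)
  fix j assume j: "j \<in> {..Suc k} - {i}"
  then show "j \<in> (\<lambda>j. if j < i then j else Suc j) ` {..k}"
   by (intro image_eqI[of _ _ "if j < i then j else j - 1"]) (use assms in auto)
 qed auto
 finally show ?thesis .
qed

text \<open>Modulo 2 the signs of the faces disappear, and for a single simplex the claim is the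
  facet count for its vertex labels. Summing over the chain with its coefficients preserves the
  parity.\<close>

lemma fan_boundary_parity:
 assumes "\<And>f. f \<in> Poly_Mapping.keys c ==> no_antipodes (label_set lab (Suc k) f)"
 shows "even (simplex_count (\<lambda>f. alternating_set True (Suc k) (label_set lab k f)) (chain_boundary (Suc k) c)
   - simplex_count (\<lambda>f. alternating_set True (Suc (Suc k)) (label_set lab (Suc k) f)
      \<or> alternating_set False (Suc (Suc k)) (label_set lab (Suc k) f)) c)"
proof -
 let ?P = "\<lambda>f. alternating_set True (Suc k) (label_set lab k f)"
 let ?A = "\<lambda>f. alternating_set True (Suc (Suc k)) (label_set lab (Suc k) f)
      \<or> alternating_set False (Suc (Suc k)) (label_set lab (Suc k) f)"
 have 1: "even ((\<Sum>i\<le>Suc k. (-1) ^ i * of_bool (?P (singular_face (Suc k) i f))) - (of_bool (?A f) :: int))"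
  if "f \<in> Poly_Mapping.keys c" for f
 proof -
  let ?l = "\<lambda>j. lab (f (vertex j))"
  have na: "no_antipodes (?l ` {..Suc k})" using assms[OF that] by (simp add: label_set_def)
  have parity: "even (X - of_bool A)" if "even (X - Y)" "odd Y \<longleftrightarrow> A" for X Y :: int and A
   using that by (cases A) auto
  have 1: "even ((\<Sum>i\<le>Suc k. (-1) ^ i * of_bool (?P (singular_face (Suc k) i f)))
    - (\<Sum>i\<le>Suc k. of_bool (?P (singular_face (Suc k) i f)) :: int))"
   unfolding sum_subtractf[symmetric] by (rule dvd_sum) (auto simp: minus_one_power_iff)
  have 2: "(\<Sum>i\<le>Suc k. of_bool (?P (singular_face (Suc k) i f)) :: int)
    = (\<Sum>i\<le>Suc k. of_bool (alternating_set True (Suc k) (?l ` ({..Suc k} - {i}))))"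
   by (intro sum.cong refl) (simp add: label_set_face)
  have 3: "odd (\<Sum>i\<le>Suc k. of_bool (alternating_set True (Suc k) (?l ` ({..Suc k} - {i}))) :: int) \<longleftrightarrow> ?A f"
   using sum_alternating_set_facets[OF na, of True] by (simp add: label_set_def del: sum.atMost_Suc)
  show ?thesis by (rule parity[OF 1]) (simp only: 2 3)
 qed
 have "simplex_count ?P (chain_boundary (Suc k) c) = (\<Sum>f\<in>Poly_Mapping.keys c. Poly_Mapping.lookup c f *
   (\<Sum>i\<le>Suc k. (-1) ^ i * of_bool (?P (singular_face (Suc k) i f))))"
  unfolding chain_boundary_def frag_extend_eq_sum
  by (simp add: simplex_count_sum del: sum.atMost_Suc)
 then have "simplex_count ?P (chain_boundary (Suc k) c) - simplex_count ?A c =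
   (\<Sum>f\<in>Poly_Mapping.keys c. Poly_Mapping.lookup c f *
   ((\<Sum>i\<le>Suc k. (-1) ^ i * of_bool (?P (singular_face (Suc k) i f))) - of_bool (?A f)))"
  unfolding simplex_count_eq[of ?A] by (simp add: sum_subtractf[symmetric] right_diff_distrib del: sum.atMost_Suc)
 also have "even \<dots>" using 1 by (intro dvd_sum) (simp del: sum.atMost_Suc)
 finally show ?thesis .
qed

section \<open>Chains representing the hemispheres of a sphere\<close>

lemma nsphere_antipode:
 "continuous_map (nsphere n) (nsphere n) (\<lambda>x i. - x i)"
proof -
 have "continuous_map (powertop_real UNIV) (powertop_real UNIV) (\<lambda>x i. - x i)"
  by (auto simp: continuous_map_componentwise_UNIV intro!: continuous_map_minus continuous_map_product_projection)
 then show ?thesis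
  unfolding nsphere by (auto simp: continuous_map_in_subtopology intro!: continuous_map_from_subtopology)
qed

text \<open>The two points are the ends of the half circle \<open>\<gamma>\<close> in the first two
  coordinates, which fits into the sphere because n > 0. Its image is path connected, so the points
  are homologous there, and the filling chain is also one of the sphere.\<close>

lemma nsphere_antipodal_path:
 assumes "0 < n" "singular_simplex 0 (nsphere n) f" "singular_simplex 0 (nsphere n) g"
  and "f (vertex 0) = vertex 0" "g (vertex 0) = (\<lambda>i. - vertex 0 i)"
 obtains d where "singular_chain (Suc 0) (nsphere n) d" "chain_boundary (Suc 0) d = frag_of f - frag_of g"
proof -
 define \<gamma> where "\<gamma> = (\<lambda>t::real. \<lambda>i::nat. if i = 0 then cos (pi * t) else if i = 1 then sin (pi * t) else 0)"
 have sum: "(\<Sum>i\<le>n. (\<gamma> t i)\<^sup>2) = 1" for t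
 proof -
  have "(\<Sum>i\<le>n. (\<gamma> t i)\<^sup>2) = (\<Sum>i\<in>{0,1}. (\<gamma> t i)\<^sup>2)"
   using assms(1) by (intro sum.mono_neutral_right) (auto simp: \<gamma>_def)
  then show ?thesis by (simp add: \<gamma>_def)
 qed
 have cont: "continuous_map (top_of_set {0..1}) (powertop_real UNIV) \<gamma>"
  unfolding continuous_map_componentwise_UNIV
 proof
  fix k show "continuous_map (top_of_set {0..1}) euclideanreal (\<lambda>x. \<gamma> x k)"
   unfolding \<gamma>_def by (cases "k = 0"; cases "k = 1") (auto intro!: continuous_intros)
 qed
 have cont_sphere: "continuous_map (top_of_set {0..1}) (nsphere n) \<gamma>"
  unfolding nsphere using cont sum assms(1) by (auto simp: continuous_map_in_subtopology) (simp add: \<gamma>_def)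
 define X where "X = subtopology (nsphere n) (\<gamma> ` {0..1})"
 have "path_connectedin (nsphere n) (\<gamma> ` {0..1})"
  by (rule path_connectedin_continuous_map_image[OF cont_sphere])
    (simp add: path_connectedin_subtopology convex_imp_path_connected)
 then have "path_connected_space X" unfolding X_def by (simp add: path_connectedin_def)
 moreover have "vertex 0 = \<gamma> 0" "(\<lambda>i. - vertex 0 i) = \<gamma> 1"
  by (auto simp: \<gamma>_def vertex_def fun_eq_iff)
 then have "singular_simplex 0 X f" "singular_simplex 0 X g"
  using assms unfolding X_def singular_simplex_subtopology
  by (auto simp: standard_simplex_0 vertex_def[symmetric] eq_commute)
 ultimately have "homologous_rel 0 X {} (frag_of f) (frag_of g)"
  by (rule iso_integer_zeroth_homology_group_aux)
 then show ?thesis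
  using that by (auto simp: homologous_rel_def singular_boundary X_def singular_chain_subtopology)
qed

text \<open>This is the vanishing of the homology of the n-sphere strictly between the degrees 0 and
  n, read at the level of chains.\<close>

lemma nsphere_boundary_exists:
 assumes "0 < k" "k < n" "singular_chain k (nsphere n) c" "chain_boundary k c = 0"
 obtains d where "singular_chain (Suc k) (nsphere n) d" "chain_boundary (Suc k) d = c"
proof -
 have "trivial_group (homology_group (int k) (nsphere n))"
  using reduced_homology_group_nsphere(2)[of "int k" n] assms
  by (simp add: un_reduced_homology_group)
 then have triv: "carrier (homology_group (int k) (nsphere n)) = {\<one>\<^bsub>homology_group (int k) (nsphere n)\<^esub>}"
  by (simp add: trivial_group_def)
 have cyc: "singular_relcycle k (nsphere n) {} c"
  using assms by (simp add: singular_cycle)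
 have "homologous_rel_set k (nsphere n) {} c \<in> carrier (homology_group (int k) (nsphere n))"
  using cyc by (simp add: carrier_relative_homology_group)
 then have "homologous_rel_set k (nsphere n) {} c = singular_relboundary_set k (nsphere n) {}"
  using triv by simp
 then have "singular_relboundary k (nsphere n) {} c"
  using homologous_rel_set_eq_relboundary by blast
 then show ?thesis using that by (auto simp: singular_boundary)
qed

text \<open>The chain \<open>c k\<close> plays the role of a \<open>k\<close>-dimensional hemisphere: its boundary is the
 sum of the \<open>(k-1)\<close>-dimensional hemisphere and its antipode.\<close>

lemma hemisphere_chains:
 fixes n :: nat
 defines "A \<equiv> (\<lambda>k. chain_map k (\<lambda>(x::nat => real) i. - x i))"
 obtains c f where "\<And>k. k \<le> n ==> singular_chain k (nsphere n) (c k)"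
  "singular_simplex 0 (nsphere n) f" "c 0 = frag_of f"
  "\<And>k. k < n ==> chain_boundary (Suc k) (c (Suc k)) = c k - frag_cmul ((-1) ^ k) (A k (c k))"
proof -
 let ?f = "restrict (\<lambda>_. vertex 0) (standard_simplex 0)"
 have v: "vertex 0 \<in> topspace (nsphere n)"
  using in_topspace_nsphere unfolding vertex_def .
 have f: "singular_simplex 0 (nsphere n) ?f"
  using v by (auto simp: singular_simplex_def)
 have anti: "chain_map k (\<lambda>(x::nat => real) i. - x i) (chain_map k (\<lambda>x i. - x i) d) = d"
  if "singular_chain k (nsphere n) d" for k d
  using that by (simp add: chain_map_compose[symmetric, unfolded o_def fun_eq_iff] chain_map_id_gen comp_def)
 \<comment> \<open>The last conjunct is what the next filling needs: the combination that
   \<open>c (Suc k)\<close> has to bound must be a cycle.\<close>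
 define P where "P = (\<lambda>k d. singular_chain k (nsphere n) d \<and> (k = 0 \<longrightarrow> d = frag_of ?f) \<and>
   chain_boundary k (d - frag_cmul ((-1) ^ k) (A k d)) = 0)"
 have step: "\<exists>d'. P (Suc k) d' \<and> chain_boundary (Suc k) d' = d - frag_cmul ((-1) ^ k) (A k d)"
  if Pk: "P k d" "k < n" for k d
 proof -
  have sc: "singular_chain k (nsphere n) d" and bd: "chain_boundary k (d - frag_cmul ((-1) ^ k) (A k d)) = 0"
   using Pk by (auto simp: P_def)
  have scA: "singular_chain k (nsphere n) (A k d)"
   unfolding A_def by (rule singular_chain_chain_map[OF sc nsphere_antipode])
  have "\<exists>d'. singular_chain (Suc k) (nsphere n) d' \<and> chain_boundary (Suc k) d' = d - frag_cmul ((-1) ^ k) (A k d)"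
  \<comment> \<open>Degree 0 is separate, since the homology does not vanish there; the two
    antipodal points are joined by an explicit path instead.\<close>
  proof (cases "k = 0")
   case True
   have "singular_simplex 0 (nsphere n) (simplex_map 0 (\<lambda>x i. - x i) ?f)"
    by (rule singular_simplex_simplex_map[OF f nsphere_antipode])
   moreover have "?f (vertex 0) = vertex 0" "simplex_map 0 (\<lambda>x i. - x i) ?f (vertex 0) = (\<lambda>i. - vertex 0 i)"
    by (simp_all add: simplex_map_def vertex_in)
   ultimately obtain d' where "singular_chain (Suc 0) (nsphere n) d'"
     "chain_boundary (Suc 0) d' = frag_of ?f - frag_of (simplex_map 0 (\<lambda>x i. - x i) ?f)"
    using nsphere_antipodal_path[OF _ f] Pk(2) True by metis
   then show ?thesis using Pk(1) True by (auto simp: P_def A_def)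
  next
   case False
   have "singular_chain k (nsphere n) (d - frag_cmul ((- 1) ^ k) (A k d))"
    by (intro singular_chain_diff singular_chain_cmul sc scA)
   from nsphere_boundary_exists[OF _ Pk(2) this bd] False show ?thesis by blast
  qed
  then obtain d' where d': "singular_chain (Suc k) (nsphere n) d'"
    "chain_boundary (Suc k) d' = d - frag_cmul ((-1) ^ k) (A k d)" by blast
  have "chain_boundary (Suc k) (A (Suc k) d') = A k (chain_boundary (Suc k) d')"
   unfolding A_def using chain_boundary_chain_map[OF d'(1)] by simp
  also have "\<dots> = A k d - frag_cmul ((-1) ^ k) d"
   unfolding d'(2) using anti[OF sc] by (simp add: A_def chain_map_diff)
  \<comment> \<open>With s = (-1)^k the boundary is (d - s A d) + s (A d - s d), which vanishes
    because s^2 = 1.\<close>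
  finally have "chain_boundary (Suc k) (d' - frag_cmul ((-1) ^ Suc k) (A (Suc k) d')) = 0"
   unfolding chain_boundary_diff chain_boundary_cmul d'(2)
   by (cases "even k") (simp_all add: minus_one_power_iff)
  then show ?thesis using d' by (auto simp: P_def)
 qed
 have "P 0 (frag_of ?f)" using f by (simp add: P_def singular_chain_of chain_boundary_def)
 define c where "c = rec_nat (frag_of ?f) (\<lambda>k d. SOME d'. P (Suc k) d' \<and> chain_boundary (Suc k) d' = d - frag_cmul ((-1) ^ k) (A k d))"
 have c0: "c 0 = frag_of ?f" by (simp add: c_def)
 have cS: "c (Suc k) = (SOME d'. P (Suc k) d' \<and> chain_boundary (Suc k) d' = c k - frag_cmul ((-1) ^ k) (A k (c k)))" for k
  by (simp add: c_def)
 have Pc: "P k (c k)" if "k \<le> n" for k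
  using that
 proof (induction k)
  case 0
  then show ?case using \<open>P 0 (frag_of ?f)\<close> c0 by simp
 next
  case (Suc k)
  then show ?case unfolding cS using someI_ex[OF step[of k "c k"]] by auto
 qed
 have "chain_boundary (Suc k) (c (Suc k)) = c k - frag_cmul ((-1) ^ k) (A k (c k))" if "k < n" for k
  unfolding cS[of k] using someI_ex[OF step[of k "c k"]] Pc that by auto
 then show ?thesis using that[of c ?f] Pc f c0 by (auto simp: P_def)
qed

text \<open>Induction on \<open>k\<close>. The antipode exchanges the two signs, so the positive
  alternating simplices in the boundary of \<open>c (Suc k)\<close> are as many, modulo 2, as all
  alternating ones in \<open>c k\<close>; by \<open>fan_boundary_parity\<close> they are also as
  many as the alternating simplices of \<open>c (Suc k)\<close>. The start is the single simplex of
  \<open>c 0\<close>, whose one label always alternates.\<close>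

lemma fan_hemisphere_parity:
 assumes bd: "\<And>k. k < n ==> chain_boundary (Suc k) (c (Suc k)) =
   c k - frag_cmul ((-1) ^ k) (chain_map k (\<lambda>x i. - x i) (c k))"
  and c0: "c 0 = frag_of f"
  and ok: "\<And>k g. k \<le> n ==> g \<in> Poly_Mapping.keys (c k) ==> no_antipodes (label_set lab k g)"
  and lab: "\<And>k g j. k \<le> n ==> g \<in> Poly_Mapping.keys (c k) ==> j \<le> k ==>
    lab (\<lambda>i. - g (vertex j) i) = - lab (g (vertex j))"
  and "k \<le> n"
 shows "odd (simplex_count (\<lambda>f. alternating_set True (Suc k) (label_set lab k f)
      \<or> alternating_set False (Suc k) (label_set lab k f)) (c k))"
 using \<open>k \<le> n\<close>
proof (induction k)
 case 0
 have "alternating_set True (Suc 0) {x} \<or> alternating_set False (Suc 0) {x}" for x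
  by (auto simp: alternating_set_def)
 then show ?case using c0 by (simp add: label_set_def)
next
 case (Suc k)
 let ?P = "\<lambda>b f. alternating_set b (Suc k) (label_set lab k f)"
 have neg: "label_set lab k (simplex_map k (\<lambda>x i. - x i) g) = uminus ` label_set lab k g"
  if "g \<in> Poly_Mapping.keys (c k)" for g
  unfolding label_set_def image_image using that Suc.prems lab[of k g]
  by (intro image_cong refl) (simp add: simplex_map_def vertex_in)
 have "simplex_count (?P True) (chain_map k (\<lambda>x i. - x i) (c k)) = simplex_count (?P False) (c k)"
  unfolding simplex_count_chain_map using Suc.prems ok[of k]
  by (intro simplex_count_cong) (simp add: neg alternating_set_uminus)
 then have 1: "even (simplex_count (?P True) (chain_boundary (Suc k) (c (Suc k))) -
    (simplex_count (?P True) (c k) + simplex_count (?P False) (c k)))"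
  using Suc.prems bd[of k] by (simp add: minus_one_power_iff)
 have "simplex_count (?P True) (c k) + simplex_count (?P False) (c k)
   = simplex_count (\<lambda>f. ?P True f \<or> ?P False f) (c k)"
  unfolding simplex_count_eq sum.distrib[symmetric]
 proof (rule sum.cong)
  fix g assume "g \<in> Poly_Mapping.keys (c k)"
  then have "\<not> (?P True g \<and> ?P False g)"
   using alternating_set_exclusive[OF ok[of k g]] Suc.prems by simp
  then show "Poly_Mapping.lookup (c k) g * of_bool (?P True g) + Poly_Mapping.lookup (c k) g * of_bool (?P False g)
   = Poly_Mapping.lookup (c k) g * of_bool (?P True g \<or> ?P False g)" by auto
 qed simp
 moreover have "even (simplex_count (?P True) (chain_boundary (Suc k) (c (Suc k)))
   - simplex_count (\<lambda>f. alternating_set True (Suc (Suc k)) (label_set lab (Suc k) f)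
      \<or> alternating_set False (Suc (Suc k)) (label_set lab (Suc k) f)) (c (Suc k)))"
  by (rule fan_boundary_parity) (use ok Suc.prems in auto)
 ultimately show ?case using Suc 1 by auto
qed

text \<open>Barycentric subdivision commutes with the boundary and with the antipodal map and fixes
  0-chains, so the boundary relations survive any number of subdivisions. The number
  \<open>m\<close> is the same in all degrees and large enough for each of them.\<close>

lemma small_hemisphere_chains:
 assumes C: "\<And>U. U \<in> \<C> ==> openin (nsphere n) U" "topspace (nsphere n) \<subseteq> \<Union>\<C>"
 obtains c f where "\<And>k. k < n ==> chain_boundary (Suc k) (c (Suc k)) =
   c k - frag_cmul ((-1) ^ k) (chain_map k (\<lambda>x i. - x i) (c k))"
  "c 0 = frag_of f"
  "\<And>k g. k \<le> n ==> g \<in> Poly_Mapping.keys (c k) ==> g \<in> standard_simplex k \<rightarrow> topspace (nsphere n) \<and>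
    (\<exists>V\<in>\<C>. g \<in> standard_simplex k \<rightarrow> V)"
proof -
 obtain d f where d: "\<And>k. k \<le> n ==> singular_chain k (nsphere n) (d k)"
  "singular_simplex 0 (nsphere n) f" "d 0 = frag_of f"
  "\<And>k. k < n ==> chain_boundary (Suc k) (d (Suc k)) = d k - frag_cmul ((-1) ^ k) (chain_map k (\<lambda>x i. - x i) (d k))"
  using hemisphere_chains[of n] by metis
 have "\<exists>N. \<forall>m f. N \<le> m \<and> f \<in> Poly_Mapping.keys ((singular_subdivision k ^^ m) (d k)) \<longrightarrow>
     (\<exists>V \<in> \<C>. f \<in> standard_simplex k \<rightarrow> V)" if "k \<le> n" for k
  using sufficient_iterated_singular_subdivision_exists[OF C d(1)[OF that]] by metis
 then obtain N where N: "\<And>k m f. k \<le> n ==> N k \<le> m ==>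
   f \<in> Poly_Mapping.keys ((singular_subdivision k ^^ m) (d k)) ==> \<exists>V \<in> \<C>. f \<in> standard_simplex k \<rightarrow> V"
  by metis
 define m where "m = Max (N ` {..n})"
 have m: "N k \<le> m" if "k \<le> n" for k using that by (auto simp: m_def)
 define c where "c = (\<lambda>k. (singular_subdivision k ^^ m) (d k))"
 have sub0: "(singular_subdivision 0 ^^ j) e = e" if "singular_chain 0 (nsphere n) e" for j and e :: "(nat => real) chain"
  using that by (induction j) (auto simp: singular_subdivision_zero)
 have sc: "singular_chain k (nsphere n) ((singular_subdivision k ^^ j) e)" if "singular_chain k (nsphere n) e" for k j e
  using that by (induction j) (auto intro: singular_chain_singular_subdivision)
 have bd: "chain_boundary (Suc k) ((singular_subdivision (Suc k) ^^ j) e) = (singular_subdivision k ^^ j) (chain_boundary (Suc k) e)"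
  if "singular_chain (Suc k) (nsphere n) e" for k j e
  using that sc by (induction j) (simp_all add: chain_boundary_singular_subdivision[of _ "nsphere n"])
 have nat: "(singular_subdivision k ^^ j) (chain_map k (\<lambda>x i. - x i) e) = chain_map k (\<lambda>x i. - x i) ((singular_subdivision k ^^ j) e)"
  if "singular_chain k (nsphere n) e" for k j e
  using that sc by (induction j) (simp_all add: naturality_singular_subdivision[of _ "nsphere n"])
 have cmul: "(singular_subdivision k ^^ j) (frag_cmul ((-1) ^ i) e) = frag_cmul ((-1) ^ i) ((singular_subdivision k ^^ j) e)"
  for k j i and e :: "(nat => real) chain"
  using singular_subdivision_power_diff[of j k 0 e] by (auto simp: minus_one_power_iff)
 show thesis
 proof (rule that[of c f])
  fix k assume k: "k < n"
  show "chain_boundary (Suc k) (c (Suc k)) = c k - frag_cmul ((-1) ^ k) (chain_map k (\<lambda>x i. - x i) (c k))"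
   using k d(1)[of k] d(1)[of "Suc k"]
   by (simp add: c_def bd d(4) singular_subdivision_power_diff cmul nat del: minus_frag_cmul)
 next
  show "c 0 = frag_of f" using d(1)[of 0] d(3) by (simp add: c_def sub0)
 next
  fix k g assume k: "k \<le> n" and g: "g \<in> Poly_Mapping.keys (c k)"
  have "singular_simplex k (nsphere n) g"
   using sc[OF d(1)[OF k], of m] g by (auto simp: singular_chain_def c_def)
  then show "g \<in> standard_simplex k \<rightarrow> topspace (nsphere n) \<and> (\<exists>V\<in>\<C>. g \<in> standard_simplex k \<rightarrow> V)"
   using N[OF k m[OF k]] g by (auto simp: singular_simplex_def c_def continuous_map_def)
 qed
qed

text \<open>Without a common zero, each point is labelled by the index of a largest coordinate of
  \<open>g\<close> together with its sign. Antipodal points get opposite labels, while no small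
  simplex carries two opposite labels. Fan's parity count then produces a simplex whose labels have
  n + 1 distinct absolute values, although only n indices exist.\<close>

theorem borsuk_ulam:
 fixes g :: "nat => (nat => real) => real"
 assumes cont: "\<And>i. i < n ==> continuous_map (nsphere n) euclideanreal (g i)"
  and oddg: "\<And>i x. i < n ==> x \<in> topspace (nsphere n) ==> g i (\<lambda>j. - x j) = - g i x"
 obtains x where "x \<in> topspace (nsphere n)" "\<And>i. i < n ==> g i x = 0"
proof (rule ccontr)
 assume no: "\<not> thesis"
 note zero = that
 have nz: "\<exists>i<n. g i x \<noteq> 0" if "x \<in> topspace (nsphere n)" for x
  using zero[OF that] no by blast
 define m where "m = (\<lambda>x. Max ((\<lambda>i. \<bar>g i x\<bar>) ` {..<n}))"
 have mge: "\<bar>g i x\<bar> \<le> m x" if "i < n" for i x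
  using that by (auto simp: m_def)
 have m: "0 < m x" if "x \<in> topspace (nsphere n)" for x
  using nz[OF that] mge[of _ x] by force
 have mex: "\<exists>i<n. \<bar>g i x\<bar> = m x" if "x \<in> topspace (nsphere n)" for x
 proof -
  have "m x \<in> (\<lambda>i. \<bar>g i x\<bar>) ` {..<n}" unfolding m_def using nz[OF that] by (intro Max_in) auto
  then show ?thesis by auto
 qed
 have mneg: "m (\<lambda>j. - x j) = m x" if "x \<in> topspace (nsphere n)" for x
  unfolding m_def using oddg that by (intro arg_cong[of _ _ Max] image_cong) auto
 \<comment> \<open>The least index depends only on the absolute values, hence agrees at antipodal
   points.\<close>
 define idx where "idx = (\<lambda>x. LEAST i. i < n \<and> \<bar>g i x\<bar> = m x)"
 have idx: "idx x < n \<and> \<bar>g (idx x) x\<bar> = m x" if "x \<in> topspace (nsphere n)" for x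
  unfolding idx_def by (rule LeastI_ex) (use mex[OF that] in auto)
 have idxneg: "idx (\<lambda>j. - x j) = idx x" if "x \<in> topspace (nsphere n)" for x
 proof -
  have "(i < n \<and> \<bar>g i (\<lambda>j. - x j)\<bar> = m (\<lambda>j. - x j)) = (i < n \<and> \<bar>g i x\<bar> = m x)" for i
   using that oddg mneg by auto
  then show ?thesis by (simp add: idx_def)
 qed
 define lab where "lab = (\<lambda>x. if 0 < g (idx x) x then int (Suc (idx x)) else - int (Suc (idx x)))"
 have labneg: "lab (\<lambda>j. - x j) = - lab x" if "x \<in> topspace (nsphere n)" for x
  unfolding lab_def idxneg[OF that] using idx[OF that] m[OF that] oddg[of "idx x" x] that by auto
 \<comment> \<open>On \<open>V x\<close> each coordinate stays in an interval of length
   \<open>m x\<close>. Opposite labels at two of its points would mean values of one coordinate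
   above \<open>m x / 2\<close> and below \<open>- m x / 2\<close>, which are more than
   \<open>m x\<close> apart.\<close>
 define V where "V = (\<lambda>x. {y \<in> topspace (nsphere n). \<forall>i\<in>{..<n}. g i y \<in> {g i x - m x / 2 <..< g i x + m x / 2}})"
 have openV: "openin (nsphere n) (V x)" for x
 proof -
  have "openin (nsphere n) {y \<in> topspace (nsphere n). g i y \<in> {g i x - m x / 2 <..< g i x + m x / 2}}"
   if "i < n" for i
   by (rule openin_continuous_map_preimage[OF cont[OF that]]) auto
  moreover have "V x = topspace (nsphere n) \<inter> (\<Inter>i\<in>{..<n}. {y \<in> topspace (nsphere n). g i y \<in> {g i x - m x / 2 <..< g i x + m x / 2}})"
   by (auto simp: V_def)
  moreover have "openin (nsphere n) (topspace (nsphere n) \<inter> (\<Inter>i\<in>{..<n}. {y \<in> topspace (nsphere n). g i y \<in> {g i x - m x / 2 <..< g i x + m x / 2}}))"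
   if "n > 0"
   using calculation(1) that by (intro openin_Int openin_topspace openin_INT2) auto
  ultimately show ?thesis by (cases "n = 0") auto
 qed
 have sep: "lab y \<noteq> - lab z" if x: "x \<in> topspace (nsphere n)" and "y \<in> V x" "z \<in> V x" for x y z
 proof
  assume eq: "lab y = - lab z"
  have y: "y \<in> topspace (nsphere n)" and z: "z \<in> topspace (nsphere n)" using that by (auto simp: V_def)
  have idxeq: "idx y = idx z" using eq by (auto simp: lab_def split: if_splits)
  have big: "m x / 2 < m y" if "y \<in> V x" for y
  proof -
   obtain i where i: "i < n" "\<bar>g i x\<bar> = m x" using mex[OF x] by auto
   then have "g i y \<in> {g i x - m x / 2 <..< g i x + m x / 2}" using that by (auto simp: V_def)
   then have "m x / 2 < \<bar>g i y\<bar>" using i m[OF x] by (auto simp: abs_if split: if_splits)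
   then show ?thesis using mge[OF i(1), of y] by simp
  qed
  have near: "g (idx y) y \<in> {g (idx y) x - m x / 2 <..< g (idx y) x + m x / 2}"
   "g (idx y) z \<in> {g (idx y) x - m x / 2 <..< g (idx y) x + m x / 2}"
   using that idx[OF y] by (auto simp: V_def)
  have "m x / 2 < \<bar>g (idx y) y\<bar>" "m x / 2 < \<bar>g (idx y) z\<bar>"
   using idx[OF y] idx[OF z] idxeq big[OF that(2)] big[OF that(3)] by auto
  moreover have "0 < g (idx y) y \<longleftrightarrow> \<not> 0 < g (idx y) z"
   using eq idxeq by (auto simp: lab_def split: if_splits)
  ultimately show False using near m[OF x] by (auto simp: abs_if split: if_splits)
 qed
 obtain c f where c: "\<And>k. k < n ==> chain_boundary (Suc k) (c (Suc k)) =
   c k - frag_cmul ((-1) ^ k) (chain_map k (\<lambda>x i. - x i) (c k))"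
  "c 0 = frag_of f"
  "\<And>k g. k \<le> n ==> g \<in> Poly_Mapping.keys (c k) ==> g \<in> standard_simplex k \<rightarrow> topspace (nsphere n) \<and>
    (\<exists>U\<in>V ` topspace (nsphere n). g \<in> standard_simplex k \<rightarrow> U)"
 proof (rule small_hemisphere_chains[of "V ` topspace (nsphere n)" n])
  show "topspace (nsphere n) \<subseteq> \<Union> (V ` topspace (nsphere n))"
   using m by (fastforce simp: V_def)
 qed (use openV in auto)
 have ok: "no_antipodes (label_set lab k h)" if kh: "k \<le> n" "h \<in> Poly_Mapping.keys (c k)" for k h
 proof -
  obtain x where x: "x \<in> topspace (nsphere n)" and h: "h \<in> standard_simplex k \<rightarrow> V x"
   using c(3)[OF kh] by blast
  have "lab (h (vertex i)) \<noteq> - lab (h (vertex j))" if "i \<le> k" "j \<le> k" for i j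
   using h that vertex_in by (intro sep[OF x]) blast+
  from this[symmetric] show ?thesis by (auto simp: no_antipodes_def label_set_def)
 qed
 have lb: "lab (\<lambda>i. - h (vertex j) i) = - lab (h (vertex j))"
  if "k \<le> n" "h \<in> Poly_Mapping.keys (c k)" "j \<le> k" for k h j
  using c(3)[OF that(1,2)] vertex_in[OF that(3)] by (intro labneg) blast
 have "odd (simplex_count (\<lambda>f. alternating_set True (Suc n) (label_set lab n f)
      \<or> alternating_set False (Suc n) (label_set lab n f)) (c n))"
  by (rule fan_hemisphere_parity[where c = c and n = n and k = n and f = f]) (use c(1,2) ok lb in auto)
 then have "simplex_count (\<lambda>f. alternating_set True (Suc n) (label_set lab n f)
      \<or> alternating_set False (Suc n) (label_set lab n f)) (c n) \<noteq> 0" by (auto simp del: One_nat_def)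
 then obtain h where h: "h \<in> Poly_Mapping.keys (c n)" and "card (label_set lab n h) = Suc n"
  unfolding simplex_count_eq by (force simp: alternating_set_def elim!: sum.not_neutral_contains_not_neutral)
 then have "card (abs ` label_set lab n h) = Suc n"
  using no_antipodes_inj[OF ok[OF order_refl h]] by (simp add: card_image)
 moreover have "abs ` label_set lab n h \<subseteq> {1..int n}"
 proof -
  have "\<bar>lab (h (vertex j))\<bar> \<in> {1..int n}" if "j \<le> n" for j
  proof -
   have "h (vertex j) \<in> topspace (nsphere n)" using c(3)[OF order_refl h] vertex_in[OF that] by blast
   from idx[OF this] show ?thesis by (auto simp: lab_def)
  qed
  then show ?thesis by (auto simp: label_set_def)
 qed
 then have "card (abs ` label_set lab n h) \<le> n" using card_mono[of "{1..int n}"] by fastforce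
 ultimately show False by simp
qed

section \<open>Test functions\<close>

lemma C_k_mono: "C_k (Suc k) u ==> C_k k u"
proof (induction k arbitrary: u)
 case 0
 then show ?case
  by (auto intro!: continuous_at_imp_continuous_on differentiable_imp_continuous_within)
qed auto

lemma C_k_cong_partial:
 assumes "\<And>x. (u has_derivative u' x) (at x)" "\<And>i. i \<in> Basis ==> C_k k (\<lambda>x. u' x i)"
 shows "C_k (Suc k) u"
proof -
 have "frechet_derivative u (at x) = u' x" for x
  using frechet_derivative_at[OF assms(1)] by simp
 then show ?thesis using assms by (auto simp: differentiable_def)
qed

lemma C_k_partial:
 assumes "C_k (Suc k) u"
 shows "(u has_derivative frechet_derivative u (at x)) (at x)" "\<And>i. i \<in> Basis ==> C_k k (\<lambda>x. frechet_derivative u (at x) i)"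
 using assms by (auto simp: frechet_derivative_works[symmetric])

lemma C_k_const: "C_k k (\<lambda>x. c)"
proof (induction k arbitrary: c)
 case (Suc k)
 show ?case by (rule C_k_cong_partial[where u' = "\<lambda>_ _. 0"]) (auto intro: Suc)
qed auto

lemma C_k_inner: "C_k k (\<lambda>x. x \<bullet> i)"
proof (cases k)
 case (Suc j)
 show ?thesis unfolding Suc
  by (rule C_k_cong_partial[where u' = "\<lambda>_ h. h \<bullet> i"]) (auto intro!: derivative_eq_intros C_k_const)
qed (auto intro!: continuous_intros)

lemma C_k_add: "C_k k u ==> C_k k v ==> C_k k (\<lambda>x. u x + v x)"
proof (induction k arbitrary: u v)
 case (Suc k)
 show ?case
  by (rule C_k_cong_partial[where u' = "\<lambda>x h. frechet_derivative u (at x) h + frechet_derivative v (at x) h"])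
    (use Suc in \<open>auto intro!: has_derivative_add C_k_partial simp del: C_k.simps\<close>)
qed (auto intro!: continuous_intros)

lemma C_k_mult: "C_k k u ==> C_k k v ==> C_k k (\<lambda>x. u x * v x)"
proof (induction k arbitrary: u v)
 case (Suc k)
 show ?case
 proof (rule C_k_cong_partial)
  fix x
  show "((\<lambda>x. u x * v x) has_derivative
    (\<lambda>h. u x * frechet_derivative v (at x) h + frechet_derivative u (at x) h * v x)) (at x)"
   by (intro has_derivative_mult C_k_partial(1)[OF Suc.prems(1)] C_k_partial(1)[OF Suc.prems(2)])
  fix i :: 'a assume "i \<in> Basis"
  then show "C_k k (\<lambda>x. u x * frechet_derivative v (at x) i + frechet_derivative u (at x) i * v x)"
   by (intro C_k_add Suc.IH C_k_mono[OF Suc.prems(1)] C_k_mono[OF Suc.prems(2)]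
    C_k_partial(2)[OF Suc.prems(1)] C_k_partial(2)[OF Suc.prems(2)])
 qed
qed (auto intro!: continuous_intros)

lemma C_k_minus: "C_k k u ==> C_k k (\<lambda>x. - u x)"
 using C_k_mult[OF C_k_const[of k "-1"]] by simp

lemma C_k_diff: "C_k k u ==> C_k k v ==> C_k k (\<lambda>x. u x - v x)"
 using C_k_add[OF _ C_k_minus] by fastforce

lemma C_k_power: "C_k k u ==> C_k k (\<lambda>x. u x ^ n)"
 by (induction n) (auto intro!: C_k_const C_k_mult)

lemma C_k_prod: "finite I ==> (\<And>i. i \<in> I ==> C_k k (u i)) ==> C_k k (\<lambda>x. \<Prod>i\<in>I. u i x)"
 by (induction I rule: finite_induct) (auto intro!: C_k_const C_k_mult)

text \<open>The family \<open>t\<^sup>-\<^sup>m exp (-1/t)\<close>, extended by zero, is closed under differentiation up to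
 linear combinations; hence all its members are smooth.\<close>

definition flat_exp :: "nat => real => real" where
 "flat_exp m t = (if t > 0 then inverse t ^ m * exp (- inverse t) else 0)"

lemma flat_exp_tendsto_0: "(flat_exp m \<longlongrightarrow> 0) (at 0)"
proof -
 have "((\<lambda>x::real. x ^ m / exp x) \<longlongrightarrow> 0) at_top" by (rule tendsto_power_div_exp_0)
 then have "((\<lambda>t::real. inverse t ^ m / exp (inverse t)) \<longlongrightarrow> 0) (at_right 0)"
  by (rule filterlim_compose[OF _ filterlim_inverse_at_top_right])
 then have "(flat_exp m \<longlongrightarrow> 0) (at_right 0)"
  by (rule Lim_transform_eventually)
    (auto simp: eventually_at_right_field flat_exp_def exp_minus field_simps intro!: exI[of _ 1])
 moreover have "(flat_exp m \<longlongrightarrow> 0) (at_left 0)"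
  by (rule tendsto_eventually) (auto simp: eventually_at_left_field flat_exp_def intro!: exI[of _ "-1"])
 ultimately show ?thesis by (simp add: filterlim_split_at)
qed

lemma flat_exp_deriv:
 "(flat_exp m has_field_derivative (flat_exp (m + 2) t - real m * flat_exp (m + 1) t)) (at t)"
proof -
 consider "t > 0" | "t < 0" | "t = 0" by linarith
 then show ?thesis
 proof cases
  case 1
  have "((\<lambda>t. inverse t ^ m * exp (- inverse t)) has_field_derivative
    (flat_exp (m + 2) t - real m * flat_exp (m + 1) t)) (at t)"
   using 1 by (auto intro!: derivative_eq_intros simp: flat_exp_def power2_eq_square field_simps
    power_Suc[symmetric] simp del: power_Suc)
    (cases m; simp add: field_simps power_add)
  then show ?thesis
   by (rule has_field_derivative_transform_within_open[where S = "{0<..}"]) (use 1 in \<open>auto simp: flat_exp_def\<close>)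
 next
  case 2
  have "((\<lambda>t. 0) has_field_derivative (flat_exp (m + 2) t - real m * flat_exp (m + 1) t)) (at t)"
   using 2 by (auto simp: flat_exp_def)
  then show ?thesis
   by (rule has_field_derivative_transform_within_open[where S = "{..<0}"]) (use 2 in \<open>auto simp: flat_exp_def\<close>)
 next
  case 3
  \<comment> \<open>At 0 the difference quotient of \<open>flat_exp m\<close> is the next member of
    the family, which tends to 0; both derivative terms also vanish there.\<close>
  have "(\<lambda>h. (flat_exp m (0 + h) - flat_exp m 0) / h) = flat_exp (Suc m)"
   by (auto simp: fun_eq_iff flat_exp_def divide_inverse)
  then show ?thesis using flat_exp_tendsto_0[of "Suc m"] 3
   unfolding DERIV_def by (simp add: flat_exp_def)
 qed
qed

lemma flat_exp_bounds: "0 \<le> flat_exp 0 t" "flat_exp 0 t \<le> 1" "0 < flat_exp 0 t \<longleftrightarrow> 0 < t"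
 by (auto simp: flat_exp_def)

lemma C_k_flat_exp: "C_k k u ==> C_k k (\<lambda>x. flat_exp m (u x))"
proof (induction k arbitrary: u m)
 case 0
 have "continuous_on UNIV (flat_exp m)"
  using flat_exp_deriv by (intro continuous_at_imp_continuous_on ballI DERIV_isCont)
 then show ?case using 0 by (auto intro: continuous_on_compose2)
next
 case (Suc k)
 note u = Suc.prems
 have v: "C_k k (\<lambda>x. (flat_exp (m + 2) (u x) - real m * flat_exp (m + 1) (u x)))"
  by (intro C_k_diff C_k_mult C_k_const Suc.IH C_k_mono[OF u])
 show ?case
 proof (rule C_k_cong_partial)
  fix x
  show "((\<lambda>x. flat_exp m (u x)) has_derivative
    (\<lambda>h. frechet_derivative u (at x) h * (flat_exp (m + 2) (u x) - real m * flat_exp (m + 1) (u x)))) (at x)"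
   by (rule DERIV_compose_FDERIV[OF flat_exp_deriv C_k_partial(1)[OF u]])
  fix i :: 'a assume "i \<in> Basis"
  then show "C_k k (\<lambda>x. frechet_derivative u (at x) i * (flat_exp (m + 2) (u x) - real m * flat_exp (m + 1) (u x)))"
   by (intro C_k_mult v C_k_partial(2)[OF u])
 qed
qed

section \<open>Gradients and supports of test functions\<close>

definition grad :: "('a::euclidean_space => real) => 'a => 'a" where
 "grad u x = (\<Sum>i\<in>Basis. frechet_derivative u (at x) i *\<^sub>R i)"

lemma grad_inner_Basis: "i \<in> Basis ==> grad u x \<bullet> i = frechet_derivative u (at x) i"
 by (simp add: grad_def inner_sum_left inner_Basis if_distrib cong: if_cong)

lemma has_derivative_inner_eqI:
 assumes "(u has_derivative (\<lambda>h. g \<bullet> h)) (at x)"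
 shows "grad u x = g"
proof (rule euclidean_eqI)
 fix i :: 'a assume "i \<in> Basis"
 then show "grad u x \<bullet> i = g \<bullet> i"
  using frechet_derivative_at[OF assms] by (simp add: grad_inner_Basis)
qed

lemma test_functionsI:
 assumes "\<And>k. C_k k u" "compact K" "K \<subseteq> \<Omega>" "\<And>x. x \<notin> K ==> u x = 0"
 shows "u \<in> test_functions \<Omega>"
proof -
 have "closure {x. u x \<noteq> 0} \<subseteq> K"
  using assms by (intro closure_minimal) (auto intro: compact_imp_closed)
 moreover from this have "compact (closure {x. u x \<noteq> 0})"
  using assms(2) closed_closure compact_Int_closed inf.absorb_iff2 by metis
 ultimately show ?thesis using assms by (auto simp: test_functions_def)
qed

lemma test_functionsE:
 assumes "u \<in> test_functions \<Omega>"
 obtains K where "compact K" "K \<subseteq> \<Omega>" "\<And>x. x \<notin> K ==> u x = 0" "\<And>x. x \<notin> K ==> grad u x = 0"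
proof (rule that[of "closure {x. u x \<noteq> 0}"])
 let ?K = "closure {x. u x \<noteq> 0}"
 show z: "u x = 0" if "x \<notin> ?K" for x
  using that closure_subset[of "{x. u x \<noteq> 0}"] by auto
 show "grad u x = 0" if "x \<notin> ?K" for x
 proof (rule has_derivative_inner_eqI)
  have x: "x \<in> - ?K" using that by blast
  have 0: "((\<lambda>_. 0) has_derivative (\<lambda>h. 0 \<bullet> h)) (at x)" by (simp add: has_derivative_const)
  have op: "open (- ?K)" by (intro open_Compl closed_closure)
  show "(u has_derivative (\<lambda>h. 0 \<bullet> h)) (at x)"
   by (rule has_derivative_transform_within_open[OF 0 op x]) (metis z ComplD)
 qed
 show "compact ?K" "?K \<subseteq> \<Omega>" using assms unfolding test_functions_def by blast+
qed

lemma test_functions_C_k: "u \<in> test_functions \<Omega> ==> C_k k u"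
 by (simp add: test_functions_def)

lemma test_functions_has_derivative:
 assumes "u \<in> test_functions \<Omega>"
 shows "(u has_derivative (\<lambda>h. grad u x \<bullet> h)) (at x)"
proof -
 have d: "(u has_derivative frechet_derivative u (at x)) (at x)"
  by (rule C_k_partial(1)[OF test_functions_C_k[OF assms]])
 interpret linear "frechet_derivative u (at x)" by (rule has_derivative_linear[OF d])
 have "frechet_derivative u (at x) h = grad u x \<bullet> h" for h
 proof -
  have "frechet_derivative u (at x) h = frechet_derivative u (at x) (\<Sum>i\<in>Basis. (h \<bullet> i) *\<^sub>R i)"
   by (simp add: euclidean_representation)
  also have "\<dots> = grad u x \<bullet> h"
   unfolding grad_def inner_sum_left sum by (intro sum.cong refl) (simp add: scale inner_commute)
  finally show ?thesis .
 qed
 then have "frechet_derivative u (at x) = (\<lambda>h. grad u x \<bullet> h)" by (rule ext)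
 then show ?thesis using d by simp
qed

lemma test_functions_continuous:
 assumes "u \<in> test_functions \<Omega>"
 shows "continuous_on S u" "continuous_on S (grad u)"
proof -
 have "continuous_on UNIV u" using test_functions_C_k[OF assms, of 0] by simp
 then show "continuous_on S u" by (rule continuous_on_subset) simp
 have "continuous_on UNIV (\<lambda>x. frechet_derivative u (at x) i)" if "i \<in> Basis" for i
  using C_k_partial(2)[OF test_functions_C_k[OF assms, of "Suc 0"] that] by simp
 then have "continuous_on UNIV (\<lambda>x. \<Sum>i\<in>Basis. frechet_derivative u (at x) i *\<^sub>R i)"
  by (intro continuous_intros) auto
 then have "continuous_on UNIV (grad u)" by (simp add: grad_def[abs_def])
 then show "continuous_on S (grad u)" by (rule continuous_on_subset) simp
qed

lemma test_functions_grad_bounded: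
 assumes "u \<in> test_functions \<Omega>"
 obtains C where "\<And>x. \<bar>u x\<bar> \<le> C" "\<And>x. norm (grad u x) \<le> C"
proof -
 obtain K where K: "compact K" "\<And>x. x \<notin> K ==> u x = 0" "\<And>x. x \<notin> K ==> grad u x = 0"
  using test_functionsE[OF assms] by metis
 have "bounded (u ` K)" "bounded (grad u ` K)"
  using K test_functions_continuous[OF assms] by (auto intro!: compact_imp_bounded compact_continuous_image)
 then obtain C D where "\<And>x. x \<in> K ==> \<bar>u x\<bar> \<le> C" "\<And>x. x \<in> K ==> norm (grad u x) \<le> D"
  by (auto simp: bounded_iff)
 then show ?thesis
  using K(2,3) by (intro that[of "max 0 (max C D)"]) (metis abs_zero max.cobounded1 max.coboundedI2 norm_zero order.trans)+
qed

lemma test_functions_borel: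
 "u \<in> test_functions \<Omega> ==> u \<in> borel_measurable borel"
 "u \<in> test_functions \<Omega> ==> grad u \<in> borel_measurable borel"
 by (auto intro!: borel_measurable_continuous_onI test_functions_continuous)

lemma test_functions_0: "(\<lambda>x. 0) \<in> test_functions \<Omega>"
 by (rule test_functionsI[where K = "{}"]) (auto intro: C_k_const)

lemma test_functions_add:
 assumes u: "u \<in> test_functions \<Omega>" and v: "v \<in> test_functions \<Omega>"
 shows "(\<lambda>x. u x + v x) \<in> test_functions \<Omega>"
proof -
 obtain K where K: "compact K" "K \<subseteq> \<Omega>" "\<And>x. x \<notin> K ==> u x = 0" using test_functionsE[OF u] by metis
 obtain L where L: "compact L" "L \<subseteq> \<Omega>" "\<And>x. x \<notin> L ==> v x = 0" using test_functionsE[OF v] by metis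
 show ?thesis
  by (rule test_functionsI[where K = "K \<union> L"]) (use K L in \<open>auto intro!: C_k_add test_functions_C_k[OF u] test_functions_C_k[OF v]\<close>)
qed

lemma test_functions_mult:
 assumes u: "u \<in> test_functions \<Omega>" and v: "\<And>k. C_k k v"
 shows "(\<lambda>x. v x * u x) \<in> test_functions \<Omega>"
proof -
 obtain K where K: "compact K" "K \<subseteq> \<Omega>" "\<And>x. x \<notin> K ==> u x = 0" using test_functionsE[OF u] by metis
 show ?thesis
  by (rule test_functionsI[where K = K]) (use K in \<open>auto intro!: C_k_mult v test_functions_C_k[OF u]\<close>)
qed

lemma test_functions_cmult: "u \<in> test_functions \<Omega> ==> (\<lambda>x. c * u x) \<in> test_functions \<Omega>"
 by (intro test_functions_mult C_k_const)

lemma test_functions_diff: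
 "u \<in> test_functions \<Omega> ==> v \<in> test_functions \<Omega> ==> (\<lambda>x. u x - v x) \<in> test_functions \<Omega>"
 using test_functions_add[OF _ test_functions_cmult[of v \<Omega> "-1"]] by simp

lemma test_functions_sum:
 "finite I ==> (\<And>i. i \<in> I ==> u i \<in> test_functions \<Omega>) ==> (\<lambda>x. \<Sum>i\<in>I. c i * u i x) \<in> test_functions \<Omega>"
 by (induction I rule: finite_induct) (auto intro!: test_functions_0 test_functions_add test_functions_cmult)

lemma grad_add:
 assumes "u \<in> test_functions \<Omega>" "v \<in> test_functions \<Omega>"
 shows "grad (\<lambda>x. u x + v x) x = grad u x + grad v x"
 by (rule has_derivative_inner_eqI)
   (use assms in \<open>auto intro!: derivative_eq_intros test_functions_has_derivative simp: inner_add_left\<close>)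

lemma grad_cmult:
 assumes "u \<in> test_functions \<Omega>"
 shows "grad (\<lambda>x. c * u x) x = c *\<^sub>R grad u x"
 by (rule has_derivative_inner_eqI)
   (use assms in \<open>auto intro!: derivative_eq_intros test_functions_has_derivative\<close>)

lemma grad_0: "grad (\<lambda>x. 0) x = 0"
 by (rule has_derivative_inner_eqI) auto

lemma grad_diff:
 assumes "u \<in> test_functions \<Omega>" "v \<in> test_functions \<Omega>"
 shows "grad (\<lambda>x. u x - v x) x = grad u x - grad v x"
 by (rule has_derivative_inner_eqI)
   (use assms in \<open>auto intro!: derivative_eq_intros test_functions_has_derivative simp: inner_diff_left\<close>)

lemma grad_sum:
 assumes "finite I" "\<And>i. i \<in> I ==> u i \<in> test_functions \<Omega>"
 shows "grad (\<lambda>x. \<Sum>i\<in>I. c i * u i x) x = (\<Sum>i\<in>I. c i *\<^sub>R grad (u i) x)"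
 using assms
proof (induction I rule: finite_induct)
 case (insert j I)
 then show ?case
  using grad_add[OF test_functions_cmult[of "u j" \<Omega> "c j"] test_functions_sum[of I u \<Omega> c]]
  by (simp add: grad_cmult[where \<Omega> = \<Omega>])
qed (simp add: grad_0)

section \<open>Smooth approximation of the indicators of boxes\<close>

definition bump :: "'a::euclidean_space => 'a => 'a => real" where
 "bump l r x = (\<Prod>i\<in>Basis. flat_exp 0 (x \<bullet> i - l \<bullet> i) * flat_exp 0 (r \<bullet> i - x \<bullet> i))"

lemma bump_C_k: "C_k k (bump l r)"
 unfolding bump_def[abs_def]
 by (intro C_k_prod C_k_mult C_k_flat_exp C_k_diff C_k_inner C_k_const) auto

lemma bump_bounds: "0 \<le> bump l r x" "bump l r x \<le> 1"
 unfolding bump_def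
 by (auto intro!: prod_nonneg prod_le_1 mult_nonneg_nonneg mult_le_one simp: flat_exp_bounds)

lemma bump_pos: "0 < bump l r x \<longleftrightarrow> x \<in> box l r"
proof
 assume "x \<in> box l r"
 then show "0 < bump l r x" unfolding bump_def
  by (intro prod_pos mult_pos_pos) (auto simp: flat_exp_bounds mem_box)
next
 assume pos: "0 < bump l r x"
 show "x \<in> box l r"
 proof (rule ccontr)
  assume "x \<notin> box l r"
  then obtain i where i: "i \<in> Basis" "\<not> (l \<bullet> i < x \<bullet> i \<and> x \<bullet> i < r \<bullet> i)" by (auto simp: mem_box)
  then have "flat_exp 0 (x \<bullet> i - l \<bullet> i) * flat_exp 0 (r \<bullet> i - x \<bullet> i) = 0" by (auto simp: flat_exp_def)
  then have "bump l r x = 0" unfolding bump_def using i by (meson finite_Basis prod_zero)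
  with pos show False by simp
 qed
qed

lemma bump_zero: "x \<notin> box l r ==> bump l r x = 0"
 using bump_pos[of l r x] bump_bounds(1)[of l r x] by linarith

text \<open>A polynomial in \<open>bump\<close> without constant term, hence smooth and zero outside
  the box. On the open box 0 < \<open>bump\<close> \<le> 1, so the power tends to 0 there and the
  values tend to 1.\<close>

definition box_approx :: "'a::euclidean_space => 'a => nat => 'a => real" where
 "box_approx l r n x = 1 - (1 - bump l r x) ^ n"

lemma box_approx_test:
 assumes "cbox l r \<subseteq> \<Omega>"
 shows "box_approx l r n \<in> test_functions \<Omega>"
proof (rule test_functionsI[where K = "cbox l r"])
 show "C_k k (box_approx l r n)" for k
  unfolding box_approx_def[abs_def] by (intro C_k_diff C_k_power C_k_const bump_C_k)
 fix x assume "x \<notin> cbox l r"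
 then have "bump l r x = 0" using bump_zero box_subset_cbox by blast
 then show "box_approx l r n x = 0" by (simp add: box_approx_def)
qed (use assms in auto)

lemma box_approx_bounds: "0 \<le> box_approx l r n x" "box_approx l r n x \<le> 1"
 using bump_bounds[of l r x] by (auto simp: box_approx_def power_le_one)

lemma box_approx_tendsto: "(\<lambda>n. box_approx l r n x) \<longlonglongrightarrow> indicator (box l r) x"
proof (cases "x \<in> box l r")
 case True
 then have "\<bar>1 - bump l r x\<bar> < 1" using bump_bounds[of l r x] bump_pos[of l r x] by auto
 then have "(\<lambda>n. (1 - bump l r x) ^ n) \<longlonglongrightarrow> 0" by (rule LIMSEQ_abs_realpow_zero2)
 then have "(\<lambda>n. 1 - (1 - bump l r x) ^ n) \<longlonglongrightarrow> 1 - 0" by (intro tendsto_diff tendsto_const)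
 then show ?thesis unfolding box_approx_def using True by simp
next
 case False
 then show ?thesis by (simp add: box_approx_def bump_zero)
qed

section \<open>Integration by parts for test functions\<close>

lemma integral_translate:
 fixes w :: "'a::euclidean_space => real"
 assumes [measurable]: "w \<in> borel_measurable borel"
 shows "(LINT x|lborel. w (x + c)) = (LINT x|lborel. w x)"
proof -
 have "(LINT x|lborel. w x) = (\<integral>x. w x \<partial>distr lborel borel ((+) c))" by (simp add: lborel_distr_plus)
 also have "\<dots> = (LINT x|lborel. w (c + x))" by (subst integral_distr) auto
 finally show ?thesis by (simp add: add.commute)
qed

lemma integrable_lborel_bounded_support:
 fixes w :: "'a::euclidean_space => 'b::{banach,second_countable_topology}"
 assumes [measurable]: "w \<in> borel_measurable borel" and "\<And>x. norm (w x) \<le> C" "\<And>x. x \<notin> K ==> w x = 0" "bounded K"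
 shows "integrable lborel w"
proof -
 obtain b where K: "K \<subseteq> cbox (-b) b" using bounded_subset_cbox_symmetric[OF assms(4)] by metis
 have C: "0 \<le> C" using assms(2)[of undefined] norm_ge_zero order.trans by blast
 have "integrable lborel (\<lambda>x. C * indicator (cbox (-b) b) x :: real)"
  using emeasure_bounded_finite[of "cbox (-b) b"] by (intro integrable_mult_right integrable_real_indicator) auto
 then show ?thesis
 proof (rule Bochner_Integration.integrable_bound)
  have "norm (w x) \<le> norm (C * indicator (cbox (-b) b) x :: real)" for x
   using assms(2)[of x] assms(3)[of x] K C by (cases "x \<in> cbox (-b) b") auto
  then show "AE x in lborel. norm (w x) \<le> norm (C * indicator (cbox (-b) b) x :: real)" by simp
 qed simp
qed

lemma test_functions_integrable:
 assumes "u \<in> test_functions \<Omega>"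
 shows "integrable lborel u" "integrable lborel (grad u)"
proof -
 obtain K where K: "compact K" "\<And>x. x \<notin> K ==> u x = 0" "\<And>x. x \<notin> K ==> grad u x = 0"
  using test_functionsE[OF assms] by metis
 obtain C where C: "\<And>x. \<bar>u x\<bar> \<le> C" "\<And>x. norm (grad u x) \<le> C" using test_functions_grad_bounded[OF assms] by metis
 show "integrable lborel u"
  by (rule integrable_lborel_bounded_support[where C = C and K = K])
   (use K C test_functions_borel[OF assms] compact_imp_bounded in auto)
 show "integrable lborel (grad u)"
  by (rule integrable_lborel_bounded_support[where C = C and K = K])
   (use K C test_functions_borel[OF assms] compact_imp_bounded in auto)
qed

lemma test_functions_Lipschitz:
 assumes "u \<in> test_functions \<Omega>" "\<And>x. norm (grad u x) \<le> C"
 shows "\<bar>u x - u y\<bar> \<le> C * norm (x - y)"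
proof -
 have "norm (u x - u y) \<le> C * norm (x - y)"
 proof (rule differentiable_bound[of UNIV u "\<lambda>x h. grad u x \<bullet> h"])
  fix z show "onorm (\<lambda>h. grad u z \<bullet> h) \<le> C"
   using assms(2)[of z] by (intro onorm_bound) (auto intro!: order.trans[OF Cauchy_Schwarz_ineq2] mult_right_mono order.trans[OF norm_ge_zero])
 qed (use test_functions_has_derivative[OF assms(1)] in auto)
 then show ?thesis by simp
qed

text \<open>Difference quotients have integral zero by translation invariance. They are bounded by
  the Lipschitz constant and, for steps of length at most 1, supported in a fixed ball, so dominated
  convergence passes to the derivative.\<close>

lemma integral_partial_derivative_zero:
 assumes u: "u \<in> test_functions \<Omega>" and i: "i \<in> Basis"
 shows "(LINT x|lborel. grad u x \<bullet> i) = 0"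
proof -
 let ?x = "\<lambda>x n. x + inverse (real (Suc n)) *\<^sub>R i"
 note [measurable] = test_functions_borel[OF u]
 obtain K where K: "compact K" "\<And>x. x \<notin> K ==> u x = 0"
  using test_functionsE[OF u] by metis
 obtain C where C: "\<And>x. norm (grad u x) \<le> C" using test_functions_grad_bounded[OF u] by metis
 obtain R where R: "\<And>x. x \<in> K ==> norm x \<le> R" using compact_imp_bounded[OF K(1)] by (auto simp: bounded_iff)
 define D where "D = (\<lambda>n x. real (Suc n) * (u (?x x n) - u x))"
 have Dbound: "\<bar>D n x\<bar> \<le> C" for n x
 proof -
  have "\<bar>u (?x x n) - u x\<bar> \<le> C * norm (inverse (real (Suc n)) *\<^sub>R i)"
   using test_functions_Lipschitz[OF u C, of "x + inverse (real (Suc n)) *\<^sub>R i" x] by simp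
  then have "real (Suc n) * \<bar>u (?x x n) - u x\<bar> \<le> real (Suc n) * (C * inverse (real (Suc n)))"
   using i by (intro mult_left_mono) (auto simp: )
  also have "\<dots> = C" by (simp add: field_simps)
  finally show ?thesis by (simp add: D_def abs_mult)
 qed
 have Dsupp: "D n x = 0" if "x \<notin> cball 0 (R + 1)" for n x
 proof -
  have "norm x \<le> norm (?x x n) + norm (inverse (real (Suc n)) *\<^sub>R i)"
   using norm_triangle_ineq4[of "x + inverse (real (Suc n)) *\<^sub>R i" "inverse (real (Suc n)) *\<^sub>R i"] by simp
  moreover have "norm (inverse (real (Suc n)) *\<^sub>R i) \<le> 1" using i by (simp add: inverse_eq_divide)
  ultimately have "x + inverse (real (Suc n)) *\<^sub>R i \<notin> K" "x \<notin> K"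
   using that R[of x] R[of "x + inverse (real (Suc n)) *\<^sub>R i"] by fastforce+
  then show ?thesis using K by (simp add: D_def)
 qed
 have "(\<lambda>n. \<integral>x. D n x \<partial>lborel) \<longlonglongrightarrow> (LINT x|lborel. grad u x \<bullet> i)"
 proof (rule integral_dominated_convergence[where w = "\<lambda>x. C * indicator (cball 0 (R + 1)) x"])
  show "integrable lborel (\<lambda>x. C * indicator (cball 0 (R + 1)) x :: real)"
   using emeasure_bounded_finite[of "cball 0 (R + 1)"] by (intro integrable_mult_right integrable_real_indicator) auto
  have "(\<lambda>n. D n x) \<longlonglongrightarrow> grad u x \<bullet> i" for x
  proof -
   have "((\<lambda>t. u (x + t *\<^sub>R i)) has_derivative (\<lambda>t. grad u x \<bullet> (t *\<^sub>R i))) (at 0)"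
    by (rule has_derivative_compose[where f = "\<lambda>t. x + t *\<^sub>R i" and g = u, of "\<lambda>t. t *\<^sub>R i"])
     (auto intro!: derivative_eq_intros test_functions_has_derivative[OF u])
   then have "((\<lambda>t. u (x + t *\<^sub>R i)) has_field_derivative (grad u x \<bullet> i)) (at 0)"
    by (simp add: has_field_derivative_def mult_commute_abs)
   then have lim: "((\<lambda>h. (u (x + h *\<^sub>R i) - u x) / h) \<longlongrightarrow> grad u x \<bullet> i) (at 0)"
    by (simp add: DERIV_def)
   have "filterlim (\<lambda>n. inverse (real (Suc n))) (at 0) sequentially"
    by (rule filterlim_atI[OF LIMSEQ_inverse_real_of_nat]) auto
   from filterlim_compose[OF lim this] show ?thesis
    by (simp add: D_def divide_inverse mult.commute)
  qed
  then show "AE x in lborel. (\<lambda>n. D n x) \<longlonglongrightarrow> grad u x \<bullet> i" by simp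
  show "AE x in lborel. norm (D n x) \<le> C * indicator (cball 0 (R + 1)) x" for n
   using Dbound[of n] Dsupp[of _ n] by (intro AE_I2) (auto simp: indicator_def split: if_splits)
 qed (auto simp: D_def)
 moreover have "(LINT x|lborel. D n x) = 0" for n
 proof -
  have int: "integrable lborel u" by (rule test_functions_integrable[OF u])
  have "integrable lborel (\<lambda>x. u (?x x n))"
  proof -
   have "integrable (distr lborel borel ((+) (inverse (real (Suc n)) *\<^sub>R i))) u" using int by (simp add: lborel_distr_plus)
   then show ?thesis by (subst (asm) integrable_distr_eq) (auto simp: add.commute)
  qed
  then show ?thesis unfolding D_def
   using int integral_translate[of u "inverse (real (Suc n)) *\<^sub>R i"] by simp
 qed
 ultimately show ?thesis by (simp add: LIMSEQ_const_iff)
qed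

text \<open>The problem is posed with \<open>lebesgue_on \<Omega>\<close>, while translation,
  scaling and Fubini arguments are carried out in \<open>lborel\<close>; for Borel functions
  vanishing off \<open>\<Omega>\<close> one may pass between the two.\<close>

lemma integral_lebesgue_on_eq_lborel:
 fixes w :: "'a::euclidean_space => 'b::{banach,second_countable_topology}"
 assumes "open \<Omega>" "w \<in> borel_measurable borel" "\<And>x. x \<notin> \<Omega> ==> w x = 0"
 shows "integral\<^sup>L (lebesgue_on \<Omega>) w = integral\<^sup>L lborel w"
  and "integrable (lebesgue_on \<Omega>) w \<longleftrightarrow> integrable lborel w"
proof -
 have m: "\<Omega> \<in> sets lebesgue" using assms(1) by (auto intro: borel_open)
 have eq: "(\<lambda>x. indicator \<Omega> x *\<^sub>R w x) = w" using assms(3) by (auto simp: fun_eq_iff indicator_def)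
 show "integral\<^sup>L (lebesgue_on \<Omega>) w = integral\<^sup>L lborel w"
  using m assms(2) by (subst integral_restrict_space) (auto simp: eq integral_completion)
 show "integrable (lebesgue_on \<Omega>) w \<longleftrightarrow> integrable lborel w"
  using m assms(2) by (subst integrable_restrict_space) (auto simp: eq integrable_completion)
qed

lemma grad_mult:
 assumes "u \<in> test_functions \<Omega>" "v \<in> test_functions \<Omega>"
 shows "grad (\<lambda>x. u x * v x) x = u x *\<^sub>R grad v x + v x *\<^sub>R grad u x"
 by (rule has_derivative_inner_eqI)
   (use assms in \<open>auto intro!: derivative_eq_intros test_functions_has_derivative simp: inner_add_left inner_diff_left\<close>)

text \<open>The product of two test functions is a test function, so its partial derivatives have
  integral zero; the product rule splits this integral into the two sides.\<close>

lemma test_function_has_weak_gradient: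
 assumes \<Omega>: "open \<Omega>" and u: "u \<in> test_functions \<Omega>"
 shows "has_weak_gradient \<Omega> u (grad u)"
 unfolding has_weak_gradient_def
proof (intro conjI allI impI ballI)
 fix K assume K: "compact K \<and> K \<subseteq> \<Omega>"
 then have S: "K \<in> sets lebesgue" by (simp add: lmeasurable_compact fmeasurableD)
 have "integrable lebesgue u" "integrable lebesgue (grad u)"
  using test_functions_integrable[OF u] test_functions_borel[OF u] by (auto simp: integrable_completion)
 then show "u absolutely_integrable_on K" "grad u absolutely_integrable_on K"
  unfolding set_integrable_def by (blast intro: integrable_mult_indicator[OF S])+
next
 fix v and i :: 'a assume v: "v \<in> test_functions \<Omega>" and i: "i \<in> Basis"
 note [measurable] = test_functions_borel[OF u] test_functions_borel[OF v]
 obtain K where K: "K \<subseteq> \<Omega>" "compact K" "\<And>x. x \<notin> K ==> v x = 0" "\<And>x. x \<notin> K ==> grad v x = 0" using test_functionsE[OF v] by metis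
 obtain C where C: "\<And>x. \<bar>u x\<bar> \<le> C" "\<And>x. norm (grad u x) \<le> C" using test_functions_grad_bounded[OF u] by metis
 obtain D where D: "\<And>x. \<bar>v x\<bar> \<le> D" "\<And>x. norm (grad v x) \<le> D" using test_functions_grad_bounded[OF v] by metis
 have C0: "0 \<le> C" using C(1)[of 0] by simp
 have uv: "(\<lambda>x. u x * v x) \<in> test_functions \<Omega>" by (rule test_functions_mult[OF v test_functions_C_k[OF u]])
 have nK: "v x = 0" "grad v x = 0" if "x \<notin> \<Omega>" for x using K that by blast+
 have e1: "(LINT x|lebesgue_on \<Omega>. u x * frechet_derivative v (at x) i) = (LINT x|lborel. u x * (grad v x \<bullet> i))"
  unfolding grad_inner_Basis[OF i, symmetric]
  by (rule integral_lebesgue_on_eq_lborel[OF \<Omega>]) (use nK in \<open>auto\<close>)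
 have e2: "(LINT x|lebesgue_on \<Omega>. grad u x \<bullet> i * v x) = (LINT x|lborel. grad u x \<bullet> i * v x)"
  by (rule integral_lebesgue_on_eq_lborel[OF \<Omega>]) (use nK in auto)
 have gi: "\<bar>grad u x \<bullet> i\<bar> \<le> C" "\<bar>grad v x \<bullet> i\<bar> \<le> D" for x
  using Basis_le_norm[OF i] C(2) D(2) order.trans by blast+
 have "integrable lborel (\<lambda>x. u x * (grad v x \<bullet> i))"
  by (rule integrable_lborel_bounded_support[where C = "C * D" and K = K])
    (use K C D C0 gi compact_imp_bounded in \<open>auto simp: abs_mult intro!: mult_mono\<close>)
 moreover have "integrable lborel (\<lambda>x. grad u x \<bullet> i * v x)"
  by (rule integrable_lborel_bounded_support[where C = "C * D" and K = K])
    (use K C D C0 gi compact_imp_bounded in \<open>auto simp: abs_mult intro!: mult_mono\<close>)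
 ultimately have "(LINT x|lborel. u x * (grad v x \<bullet> i)) + (LINT x|lborel. grad u x \<bullet> i * v x) = (LINT x|lborel. grad (\<lambda>x. u x * v x) x \<bullet> i)"
  by (simp add: grad_mult[OF u v] inner_add_left mult.commute)
 also have "\<dots> = 0" by (rule integral_partial_derivative_zero[OF uv i])
 finally show "(LINT x|lebesgue_on \<Omega>. u x * frechet_derivative v (at x) i) = - (LINT x|lebesgue_on \<Omega>. grad u x \<bullet> i * v x)"
  unfolding e1 e2 by simp
qed

section \<open>The fundamental lemma of the calculus of variations\<close>

lemma box_integrals_zero_AE:
 fixes g :: "'a::euclidean_space => real"
 assumes g: "integrable lborel g" and z: "\<And>l r. (LINT x:box l r|lborel. g x) = 0" and u: "(LINT x|lborel. g x) = 0"
 shows "AE x in lborel. g x = 0"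
proof -
 have "(LINT x:A|lborel. g x) = 0" if "A \<in> sets borel" for A
 proof -
  have A: "A \<in> sigma_sets UNIV (range (\<lambda>(l, r). box l r :: 'a set))"
   using that by (simp add: borel_eq_box case_prod_unfold)
  have meas: "B \<in> sets borel" if "B \<in> sigma_sets UNIV (range (\<lambda>(l, r). box l r :: 'a set))" for B
   using that by (simp add: borel_eq_box case_prod_unfold)
  have int: "set_integrable lborel B g" if "B \<in> sets borel" for B
   unfolding set_integrable_def by (rule integrable_mult_indicator) (use that g in auto)
  have "Int_stable (range (\<lambda>(l, r). box l r :: 'a set))"
   by (auto simp: Int_stable_def box_Int_box)
  moreover have "range (\<lambda>(l, r). box l r :: 'a set) \<subseteq> Pow UNIV" by simp
  ultimately show ?thesis using A
  proof (induction rule: sigma_sets_induct_disjoint)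
   case (compl B)
   have "(LINT x:UNIV|lborel. g x) = (LINT x:B|lborel. g x) + (LINT x:UNIV - B|lborel. g x)"
    by (subst set_integral_Un[symmetric]) (use compl meas[of B] in \<open>auto intro!: int\<close>)
   then show ?case using compl u by (simp add: set_lebesgue_integral_def)
  next
   case (union B)
   have B: "B i \<in> sets borel" for i using union by (intro meas) auto
   have "(LINT x:(\<Union>i. B i)|lborel. g x) = suminf (\<lambda>i. (LINT x:(B i)|lborel. g x))"
    by (rule lebesgue_integral_countable_add)
     (use union B in \<open>auto simp: disjoint_family_on_def intro!: int\<close>)
   then show ?case using union by simp
  qed (auto simp: z, simp add: set_lebesgue_integral_def)
 qed
 then have "AE x in lborel. g x = (\<lambda>_. 0) x"
  by (intro density_unique_real) (use g in \<open>auto simp: set_lebesgue_integral_def\<close>)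
 then show ?thesis by simp
qed

text \<open>Testing with \<open>box_approx\<close> and passing to the limit makes the integral over
  every smaller box vanish. Boxes generate the Borel sets and are stable under intersection, so a
  Borel version of the restricted function is zero almost everywhere.\<close>

lemma fundamental_lemma_box:
 fixes h :: "'a::euclidean_space => real"
 assumes \<Omega>: "open \<Omega>" "cbox l r \<subseteq> \<Omega>"
  and h: "h absolutely_integrable_on cbox l r"
  and z: "\<And>v. v \<in> test_functions \<Omega> ==> (LINT x|lebesgue_on \<Omega>. h x * v x) = 0"
 shows "AE x in lebesgue. x \<in> box l r \<longrightarrow> h x = 0"
proof -
 have m: "\<Omega> \<in> sets lebesgue" using \<Omega> by (auto intro: borel_open)
 define k where "k = (\<lambda>x. indicator (cbox l r) x * h x)"
 have k: "integrable lebesgue k" using h by (simp add: k_def set_integrable_def)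
 have sub: "(LINT x:box c d|lebesgue. k x) = 0" if cd: "cbox c d \<subseteq> cbox l r" for c d
 proof -
  have "(LINT x|lebesgue. k x * box_approx c d n x) = 0" for n
  proof -
   have eq: "indicator \<Omega> x *\<^sub>R (h x * box_approx c d n x) = k x * box_approx c d n x" for x
   proof (cases "x \<in> box c d")
    case True
    then have "x \<in> cbox l r" "x \<in> \<Omega>" using cd \<Omega>(2) box_subset_cbox[of c d] by blast+
    then show ?thesis by (simp add: k_def)
   qed (simp add: box_approx_def bump_zero)
   have "box_approx c d n \<in> test_functions \<Omega>" by (rule box_approx_test) (use cd \<Omega> in auto)
   from z[OF this] show ?thesis
    using m by (subst (asm) integral_restrict_space) (auto simp: eq[unfolded real_scaleR_def])
  qed
  moreover have "(\<lambda>n. (LINT x|lebesgue. k x * box_approx c d n x)) \<longlonglongrightarrow> (LINT x|lebesgue. k x * indicator (box c d) x)"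
  proof (rule integral_dominated_convergence[where w = "\<lambda>x. \<bar>k x\<bar>"])
   show "integrable lebesgue (\<lambda>x. \<bar>k x\<bar>)" using k by simp
   show "AE x in lebesgue. (\<lambda>n. k x * box_approx c d n x) \<longlonglongrightarrow> k x * indicator (box c d) x"
    by (intro AE_I2 tendsto_mult tendsto_const box_approx_tendsto)
   have "\<bar>k x\<bar> * \<bar>box_approx c d n x\<bar> \<le> \<bar>k x\<bar> * 1" for n x
    using box_approx_bounds[of c d n x] by (intro mult_left_mono) auto
   then show "AE x in lebesgue. norm (k x * box_approx c d n x) \<le> \<bar>k x\<bar>" for n
    by (simp add: abs_mult)
   have "box_approx c d n \<in> borel_measurable borel" for n
    using bump_C_k[of 0 c d] unfolding box_approx_def[abs_def] by (auto intro!: borel_measurable_continuous_onI continuous_intros)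
   then show "(\<lambda>x. k x * box_approx c d n x) \<in> borel_measurable lebesgue" for n
    using k by (intro borel_measurable_times) (auto simp: measurable_completion)
   have "box c d \<in> sets lebesgue" by (auto intro: borel_open)
   then show "(\<lambda>x. k x * indicator (box c d) x) \<in> borel_measurable lebesgue"
    using k by (intro borel_measurable_times borel_measurable_indicator) auto
  qed
  ultimately have "(LINT x|lebesgue. k x * indicator (box c d) x) = 0"
   by (simp add: LIMSEQ_const_iff)
  then show ?thesis by (simp add: set_lebesgue_integral_def mult.commute)
 qed
 \<comment> \<open>The generator argument runs over all boxes and over \<open>lborel\<close>. The
   function is therefore cut to the open box, whose intersections with boxes are boxes again, and
   then replaced by a Borel version \<open>g\<close>.\<close>
 define k' where "k' = (\<lambda>x. indicator (box l r) x * h x)"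
 have k'_eq: "k' x = indicator (box l r) x * k x" for x
  using box_subset_cbox[of l r] by (auto simp: k'_def k_def indicator_def)
 have "box l r \<in> sets lebesgue" by (auto intro: borel_open)
 then have k'int: "integrable lebesgue k'"
  unfolding k'_eq[abs_def] using integrable_mult_indicator[OF _ k, of "box l r"] by simp
 obtain g where g: "g \<in> borel_measurable lborel" "AE x in lborel. k' x = g x"
  using completion_ex_borel_measurable_real[of k' lborel] k'int by (auto simp: integrable_iff_bounded)
 have AEc: "AE x in lebesgue. k' x = g x" using AE_completion[OF g(2)] .
 have gint: "integrable lborel g"
 proof -
  have "integrable lebesgue g"
   using k'int AEc g(1) by (subst integrable_cong_AE[of g lebesgue k']) (auto simp: measurable_completion)
  then show ?thesis using g(1) by (simp add: integrable_completion)
 qed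
 have gset: "(LINT x:box c d|lborel. g x) = 0" for c d
 proof -
  obtain c' d' where cd: "box c d \<inter> box l r = box c' d'" by (auto simp: box_Int_box)
  have sub': "(LINT x:box c' d'|lebesgue. k x) = 0"
  proof (cases "box c' d' = {}")
   case False
   then have "cbox c' d' \<subseteq> cbox l r" using cd by (metis closure_box closure_mono inf.cobounded2 closure_subset box_subset_cbox closed_cbox closure_minimal order_trans)
   then show ?thesis by (rule sub)
  qed (simp add: set_lebesgue_integral_def)
  have mb: "box c d \<in> sets borel" by auto
  have "(LINT x:box c d|lborel. g x) = (LINT x|lborel. indicator (box c d) x * g x)"
   by (simp add: set_lebesgue_integral_def)
  also have "\<dots> = (LINT x|lebesgue. indicator (box c d) x * g x)"
   using g(1) by (subst integral_completion) auto
  also have "\<dots> = (LINT x|lebesgue. indicator (box c d) x * k' x)"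
   by (rule integral_cong_AE) (use AEc g(1) k'int mb in \<open>auto simp: measurable_completion intro!: borel_measurable_times borel_measurable_indicator\<close>)
  also have "\<dots> = (LINT x|lebesgue. indicator (box c' d') x * k x)"
   unfolding k'_eq cd[symmetric] by (simp add: indicator_inter_arith mult.assoc)
  also have "\<dots> = 0" using sub' by (simp add: set_lebesgue_integral_def)
  finally show ?thesis .
 qed
 have "(LINT x|lborel. g x) = (LINT x|lborel. indicator (box l r) x * g x)"
 proof (rule integral_cong_AE)
  show "AE x in lborel. g x = indicator (box l r) x * g x"
   using g(2) by eventually_elim (auto simp: k'_def indicator_def)
 qed (use g in auto)
 also have "\<dots> = 0" using gset[of l r] by (simp add: set_lebesgue_integral_def)
 finally have "AE x in lborel. g x = 0"
  by (intro box_integrals_zero_AE gint gset)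
 from AE_completion[OF this] AEc show ?thesis
  by eventually_elim (auto simp: k'_def)
qed

text \<open>By the Lindeloef property countably many open boxes with closed boxes inside
  \<open>\<Omega>\<close> cover \<open>\<Omega>\<close>, so the exceptional null sets of the boxes
  add up to a null set.\<close>

lemma fundamental_lemma_variations:
 fixes h :: "'a::euclidean_space => real"
 assumes \<Omega>: "open \<Omega>"
  and h: "\<And>K. compact K ==> K \<subseteq> \<Omega> ==> h absolutely_integrable_on K"
  and z: "\<And>v. v \<in> test_functions \<Omega> ==> (LINT x|lebesgue_on \<Omega>. h x * v x) = 0"
 shows "AE x in lebesgue_on \<Omega>. h x = 0"
proof -
 have m: "\<Omega> \<in> sets lebesgue" using \<Omega> by (auto intro: borel_open)
 obtain B where B: "countable B" "\<And>X. X \<in> B ==> \<exists>l r. X = box l r \<and> cbox l r \<subseteq> \<Omega>" "\<Union>B = \<Omega>"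
 proof -
  obtain D where D: "D \<subseteq> Pow \<Omega>" "\<And>X. X \<in> D ==> \<exists>a b. X = box a b \<and> cbox a b \<subseteq> \<Omega>" "\<Union>D = \<Omega>"
  proof (rule that[of "{box a b |a b. cbox a b \<subseteq> \<Omega>}"])
   show "\<Union> {box a b |a b. cbox a b \<subseteq> \<Omega>} = \<Omega>"
   proof (intro equalityI subsetI)
    fix x assume "x \<in> \<Omega>"
    then obtain a b where "x \<in> box a b" "cbox a b \<subseteq> \<Omega>"
     using open_contains_cbox[OF \<Omega>] by metis
    then show "x \<in> \<Union> {box a b |a b. cbox a b \<subseteq> \<Omega>}" by auto
   qed (use box_subset_cbox in fastforce)
  qed (use box_subset_cbox in fastforce)+
  have "\<And>X. X \<in> D ==> open X" using D(2) by force
  from Lindelof[OF this] obtain D' where "D' \<subseteq> D" "countable D'" "\<Union>D' = \<Union>D" by metis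
  then show ?thesis using D by (intro that[of D']) auto
 qed
 have "AE x in lebesgue. \<forall>X\<in>B. x \<in> X \<longrightarrow> h x = 0"
 proof (subst AE_ball_countable[OF B(1)], intro ballI)
  fix X assume "X \<in> B"
  then obtain l r where "X = box l r" "cbox l r \<subseteq> \<Omega>" using B by blast
  then show "AE x in lebesgue. x \<in> X \<longrightarrow> h x = 0"
   using fundamental_lemma_box[OF \<Omega> _ h z] by auto
 qed
 then have "AE x in lebesgue. x \<in> \<Omega> \<longrightarrow> h x = 0"
  by eventually_elim (use B(3) in blast)
 then show ?thesis using m by (subst AE_restrict_space_iff) auto
qed

section \<open>Convergence in Lebesgue spaces\<close>

lemma powr_add_le:
 fixes a b s :: real
 assumes "0 \<le> a" "0 \<le> b" "0 \<le> s"
 shows "(a + b) powr s \<le> 2 powr s * (a powr s + b powr s)"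
proof -
 have "(a + b) powr s \<le> (2 * max a b) powr s" using assms by (intro powr_mono2) auto
 also have "\<dots> = 2 powr s * max a b powr s" using assms by (simp add: powr_mult)
 also have "max a b powr s \<le> a powr s + b powr s" by (auto simp: max_def)
 finally show ?thesis by simp
qed

lemma norm_add_powr_le:
 fixes x y :: "'b::real_normed_vector"
 assumes "0 \<le> s"
 shows "norm (x + y) powr s \<le> 2 powr s * (norm x powr s + norm y powr s)"
 using powr_add_le[of "norm x" "norm y" s] assms norm_triangle_ineq[of x y]
 by (meson norm_ge_zero order.trans powr_mono2)

text \<open>A Young inequality with a free parameter: either v is at most \<delta> t and the first
  term dominates, or t is at most v / \<delta> and the second one does. It does the work of
  Hoelder's inequality below and includes the exponent 1.\<close>

lemma powr_mult_le_epsilon: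
 fixes t v s \<delta> :: real
 assumes "0 \<le> t" "0 \<le> v" "0 < \<delta>" "1 \<le> s"
 shows "t powr (s - 1) * v \<le> \<delta> * t powr s + \<delta> powr (1 - s) * v powr s"
proof (cases "v \<le> \<delta> * t")
 case True
 have "t powr (s - 1) * v \<le> t powr (s - 1) * (\<delta> * t)" using True by (intro mult_left_mono) auto
 also have "\<dots> = \<delta> * t powr s" using assms by (cases "t = 0") (auto simp: powr_diff)
 also have "\<dots> \<le> \<delta> * t powr s + \<delta> powr (1 - s) * v powr s" by simp
 finally show ?thesis .
next
 case False
 then have "t \<le> v / \<delta>" and v: "0 < v" using assms by (auto simp: field_simps) (metis mult_nonneg_nonneg less_eq_real_def not_le order.trans)
 then have "t powr (s - 1) * v \<le> (v / \<delta>) powr (s - 1) * v"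
  using assms by (intro mult_right_mono powr_mono2) auto
 also have "\<dots> = \<delta> powr (1 - s) * v powr s"
  using assms v by (simp add: powr_divide powr_diff field_simps)
 also have "\<dots> \<le> \<delta> * t powr s + \<delta> powr (1 - s) * v powr s" using assms by simp
 finally show ?thesis .
qed

lemma powr_le_1_powr:
 fixes t r s :: real
 assumes "0 \<le> t" "0 \<le> r" "r \<le> s"
 shows "t powr r \<le> 1 + t powr s"
proof (cases "t \<le> 1")
 case True
 then have "t powr r \<le> 1" using assms by (simp add: powr_le1)
 then show ?thesis by (simp add: add_increasing2)
next
 case False
 then have "t powr r \<le> t powr s" using assms by (intro powr_mono) auto
 then show ?thesis by simp
qed

text \<open>Along a subsequence whose integrals stay below (1/2)^k the sum of all terms is
  integrable. This sum \<open>S\<close> dominates each term, and its convergence forces the terms to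
  0 almost everywhere.\<close>

lemma rapid_subsequence:
 fixes f :: "nat => 'x => 'b::{banach, second_countable_topology}"
 assumes int: "\<And>n. integrable M (\<lambda>x. norm (f n x - g x) powr s)" and s: "0 < s"
  and lim: "(\<lambda>n. \<integral>x. norm (f n x - g x) powr s \<partial>M) \<longlonglongrightarrow> 0"
 obtains r S where "strict_mono (r :: nat => nat)" "integrable M (S :: 'x => real)"
  "AE x in M. (\<forall>n. norm (f (r n) x - g x) powr s \<le> S x) \<and> (\<lambda>n. f (r n) x) \<longlonglongrightarrow> g x"
proof -
 let ?I = "\<lambda>n. \<integral>x. norm (f n x - g x) powr s \<partial>M"
 have I0: "0 \<le> ?I n" for n by (intro integral_nonneg_AE) auto
 have ex: "\<exists>n>m. ?I n < (1/2) ^ k" for m k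
 proof -
  have "\<forall>\<^sub>F n in sequentially. ?I n < (1/2) ^ k" by (rule order_tendstoD(2)[OF lim]) simp
  with eventually_gt_at_top[of m] have "\<forall>\<^sub>F n in sequentially. m < n \<and> ?I n < (1/2) ^ k" by eventually_elim auto
  then show ?thesis by (auto simp: eventually_sequentially)
 qed
 have "\<exists>r. \<forall>k. ?I (r k) < (1/2) ^ k \<and> r k < r (Suc k)"
  by (rule dependent_nat_choice) (use ex in blast)+
 then obtain r where r: "\<And>k. ?I (r k) < (1/2) ^ k" "\<And>k. r k < r (Suc k)" by blast
 have mono: "strict_mono r" using r(2) by (simp add: strict_mono_Suc_iff)
 define h where "h = (\<lambda>n x. norm (f (r n) x - g x) powr s)"
 have hint: "integrable M (h n)" for n using int by (simp add: h_def)
 then have [measurable]: "h n \<in> borel_measurable M" for n by auto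
 have sumI: "summable (\<lambda>n. ?I (r n))"
  by (rule summable_comparison_test[of _ "\<lambda>n. (1/2) ^ n"]) (use r(1) I0 less_imp_le in \<open>auto intro!: summable_geometric\<close>)
 have "(\<integral>\<^sup>+x. suminf (\<lambda>n. ennreal (h n x)) \<partial>M) = suminf (\<lambda>n. \<integral>\<^sup>+x. ennreal (h n x) \<partial>M)"
  by (intro nn_integral_suminf) auto
 also have "\<dots> = suminf (\<lambda>n. ennreal (?I (r n)))"
  using hint by (intro suminf_cong) (simp add: h_def nn_integral_eq_integral)
 also have "\<dots> < \<infinity>"
  using suminf_ennreal2[OF I0 sumI] by (simp add: ennreal_suminf_neq_top[OF sumI I0] less_top[symmetric])
 finally have "AE x in M. suminf (\<lambda>n. ennreal (h n x)) \<noteq> \<infinity>"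
  by (intro nn_integral_noteq_infinite) (auto simp: less_top)
 then have sm: "AE x in M. summable (\<lambda>n. h n x)"
  by eventually_elim (auto intro: summable_suminf_not_top simp: h_def infinity_ennreal_def)
 define S where "S = (\<lambda>x. suminf (\<lambda>n. h n x))"
 have "integrable M S" unfolding S_def
  by (rule integrable_suminf) (use hint sm sumI in \<open>auto simp: h_def\<close>)
 moreover have "AE x in M. (\<forall>n. norm (f (r n) x - g x) powr s \<le> S x) \<and> (\<lambda>n. f (r n) x) \<longlonglongrightarrow> g x"
  using sm
 proof eventually_elim
  case (elim x)
  have "h n x \<le> S x" for n
   using sum_le_suminf[OF elim, of "{n}"] by (simp add: S_def h_def)
  moreover have "(\<lambda>n. h n x powr (1 / s)) \<longlonglongrightarrow> 0 powr (1 / s)"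
   using summable_LIMSEQ_zero[OF elim] s by (intro tendsto_powr') (auto simp: h_def)
  then have "(\<lambda>n. norm (f (r n) x - g x)) \<longlonglongrightarrow> 0"
   using s by (simp add: h_def powr_powr)
  then have "(\<lambda>n. f (r n) x) \<longlonglongrightarrow> g x" by (rule LIM_zero_cancel[OF tendsto_norm_zero_cancel])
  ultimately show ?case by (simp add: h_def)
 qed
 ultimately show ?thesis using that mono by blast
qed

lemma LIMSEQ_subsubseq:
 fixes X :: "nat => real"
 assumes "\<And>r. strict_mono r ==> \<exists>s. strict_mono (s :: nat => nat) \<and> (\<lambda>n. X (r (s n))) \<longlonglongrightarrow> L"
 shows "X \<longlonglongrightarrow> L"
proof (rule ccontr)
 assume "\<not> X \<longlonglongrightarrow> L"
 then obtain e where e: "e > 0" "\<forall>N. \<exists>n\<ge>N. \<not> dist (X n) L < e" by (auto simp: lim_sequentially)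
 then have ex: "\<exists>n>m. \<not> dist (X n) L < e" for m by (metis Suc_le_eq)
 have "\<exists>r. \<forall>k. \<not> dist (X (r k)) L < e \<and> r k < r (Suc k)"
  by (rule dependent_nat_choice) (use ex in blast)+
 then obtain r where r: "\<And>k. \<not> dist (X (r k)) L < e" "\<And>k. r k < r (Suc k)" by blast
 then have "strict_mono r" by (simp add: strict_mono_Suc_iff)
 from assms[OF this] obtain s where "(\<lambda>n. X (r (s n))) \<longlonglongrightarrow> L" by blast
 then show False using e(1) r(1) by (auto simp: lim_sequentially)
qed

text \<open>Every subsequence has a further one with an integrable majorant; along it the growth
  bound dominates the integrands and dominated convergence applies. Since the limit is always the
  same, the whole sequence converges.\<close>

lemma nemytskii:
 fixes f :: "nat => 'x => 'b::{banach, second_countable_topology}" and \<Phi> :: "'x => 'b => real"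
 assumes int: "\<And>n. integrable M (\<lambda>x. norm (f n x - g x) powr s)" and s: "0 < s"
  and lim: "(\<lambda>n. \<integral>x. norm (f n x - g x) powr s \<partial>M) \<longlonglongrightarrow> 0"
  and g: "integrable M (\<lambda>x. norm (g x) powr s)" and w: "integrable M w"
  and cont: "AE x in M. continuous_on UNIV (\<Phi> x)"
  and growth: "AE x in M. \<forall>t. \<bar>\<Phi> x t\<bar> \<le> C * (w x + norm t powr s)"
  and meas: "\<And>n. (\<lambda>x. \<Phi> x (f n x)) \<in> borel_measurable M" "(\<lambda>x. \<Phi> x (g x)) \<in> borel_measurable M"
 shows "(\<lambda>n. \<integral>x. \<Phi> x (f n x) \<partial>M) \<longlonglongrightarrow> (LINT x|M. \<Phi> x (g x))"
  and "integrable M (\<lambda>x. \<Phi> x (g x))" and "\<And>n. integrable M (\<lambda>x. \<Phi> x (f n x))"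
proof -
 let ?D = "\<lambda>S x. \<bar>C\<bar> * (\<bar>w x\<bar> + 2 powr s * (S x + norm (g x) powr s))"
 have D: "integrable M (?D S)" if "integrable M S" for S
  using that g w by (intro integrable_mult_right Bochner_Integration.integrable_add) auto
 have bd: "\<bar>\<Phi> x t\<bar> \<le> \<bar>C\<bar> * (\<bar>w x\<bar> + 2 powr s * (S + norm y powr s))"
  if "\<forall>t. \<bar>\<Phi> x t\<bar> \<le> C * (w x + norm t powr s)" "norm (t - y) powr s \<le> S" for x t y S
 proof -
  have "\<bar>\<Phi> x t\<bar> \<le> C * (w x + norm t powr s)" using that by blast
  also have "\<dots> \<le> \<bar>C\<bar> * \<bar>w x + norm t powr s\<bar>" by (metis abs_ge_self abs_mult)
  also have "\<bar>w x + norm t powr s\<bar> \<le> \<bar>w x\<bar> + norm t powr s"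
   using abs_triangle_ineq[of "w x" "norm t powr s"] by simp
  also have "norm t powr s \<le> 2 powr s * (norm (t - y) powr s + norm y powr s)"
   using norm_add_powr_le[of s "t - y" y] s by simp
  also have "\<dots> \<le> 2 powr s * (S + norm y powr s)" using that by (intro mult_left_mono) auto
  finally show ?thesis by (simp add: mult_left_mono)
 qed
 show ig: "integrable M (\<lambda>x. \<Phi> x (g x))"
  by (rule Bochner_Integration.integrable_bound[OF D[of "\<lambda>_. 0"] meas(2)])
    (use growth bd[of _ "g _" "g _" 0] in \<open>auto elim!: eventually_mono intro: order.trans[OF _ abs_ge_self]\<close>)
 show "integrable M (\<lambda>x. \<Phi> x (f n x))" for n
  by (rule Bochner_Integration.integrable_bound[OF D[OF int[of n]] meas(1)])
    (use growth bd[of _ "f n _" "g _" "norm (f n _ - g _) powr s"] in \<open>auto elim!: eventually_mono intro: order.trans[OF _ abs_ge_self]\<close>)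
 show "(\<lambda>n. \<integral>x. \<Phi> x (f n x) \<partial>M) \<longlonglongrightarrow> (LINT x|M. \<Phi> x (g x))"
 proof (rule LIMSEQ_subsubseq)
  fix r :: "nat => nat" assume r: "strict_mono r"
  have lim': "(\<lambda>n. \<integral>x. norm (f (r n) x - g x) powr s \<partial>M) \<longlonglongrightarrow> 0"
   using LIMSEQ_subseq_LIMSEQ[OF lim r] by (simp add: o_def)
  obtain r' S where r': "strict_mono (r' :: nat => nat)" "integrable M (S :: 'x => real)"
   "AE x in M. (\<forall>n. norm (f (r (r' n)) x - g x) powr s \<le> S x) \<and> (\<lambda>n. f (r (r' n)) x) \<longlonglongrightarrow> g x"
   by (rule rapid_subsequence[of M "\<lambda>n. f (r n)" g s, OF int s lim']) (rule that)
  have "(\<lambda>n. \<integral>x. \<Phi> x (f (r (r' n)) x) \<partial>M) \<longlonglongrightarrow> (LINT x|M. \<Phi> x (g x))"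
  proof (rule integral_dominated_convergence[OF meas(2) meas(1) D[OF r'(2)]])
   show "AE x in M. (\<lambda>n. \<Phi> x (f (r (r' n)) x)) \<longlonglongrightarrow> \<Phi> x (g x)"
    using r'(3) cont by eventually_elim (auto intro: continuous_on_tendsto_compose)
   show "AE x in M. norm (\<Phi> x (f (r (r' n)) x)) \<le> ?D S x" for n
    using r'(3) growth
   proof eventually_elim
    case (elim x)
    then show ?case unfolding real_norm_def by (intro bd) blast+
   qed
  qed
  then show "\<exists>s. strict_mono (s :: nat => nat) \<and> (\<lambda>n. \<integral>x. \<Phi> x (f (r (s n)) x) \<partial>M) \<longlonglongrightarrow> (LINT x|M. \<Phi> x (g x))"
   using r'(1) by blast
 qed
qed

lemma norm_diff_powr:
 fixes f g :: "'x => 'b::{real_normed_vector, second_countable_topology}"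
 assumes [measurable]: "f \<in> borel_measurable M" "g \<in> borel_measurable M"
  and i: "integrable M (\<lambda>x. norm (f x) powr s)" "integrable M (\<lambda>x. norm (g x) powr s)" and s: "0 \<le> s"
 shows "integrable M (\<lambda>x. norm (f x - g x) powr s)"
  "(LINT x|M. norm (f x - g x) powr s) \<le> 2 powr s * ((LINT x|M. norm (f x) powr s) + (LINT x|M. norm (g x) powr s))"
proof -
 let ?R = "\<lambda>x. 2 powr s * (norm (f x) powr s + norm (g x) powr s)"
 have R: "integrable M ?R" using i by simp
 have le: "norm (f x - g x) powr s \<le> ?R x" for x using norm_add_powr_le[OF s, of "f x" "- g x"] by simp
 show I: "integrable M (\<lambda>x. norm (f x - g x) powr s)"
  by (rule Bochner_Integration.integrable_bound[OF R]) (use le in auto)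
 have "(LINT x|M. norm (f x - g x) powr s) \<le> (LINT x|M. ?R x)" by (rule integral_mono[OF I R le])
 then show "(LINT x|M. norm (f x - g x) powr s) \<le> 2 powr s * ((LINT x|M. norm (f x) powr s) + (LINT x|M. norm (g x) powr s))"
  using i by simp
qed

lemma young_integral_bound:
 fixes \<Phi> :: "'x => real" and G :: "'x => real" and H :: "'x => 'b::real_normed_vector"
 assumes \<Phi>: "\<Phi> \<in> borel_measurable M" "AE x in M. \<bar>\<Phi> x\<bar> \<le> K * (\<bar>G x\<bar> powr (s - 1) * norm (H x))" and K: "0 \<le> K"
  and G: "integrable M (\<lambda>x. \<bar>G x\<bar> powr s)" and H: "integrable M (\<lambda>x. norm (H x) powr s)" and s: "1 \<le> s" and \<delta>: "0 < \<delta>"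
 shows "integrable M \<Phi>" "\<bar>\<integral>x. \<Phi> x \<partial>M\<bar> \<le> K * (\<delta> * (LINT x|M. \<bar>G x\<bar> powr s) + \<delta> powr (1 - s) * (LINT x|M. norm (H x) powr s))"
proof -
 let ?R = "\<lambda>x. K * (\<delta> * \<bar>G x\<bar> powr s + \<delta> powr (1 - s) * norm (H x) powr s)"
 have R: "integrable M ?R" using G H by auto
 have le: "AE x in M. \<bar>\<Phi> x\<bar> \<le> ?R x"
  using \<Phi>(2)
 proof eventually_elim
  case (elim x)
  also have "K * (\<bar>G x\<bar> powr (s - 1) * norm (H x)) \<le> ?R x"
   using powr_mult_le_epsilon[of "\<bar>G x\<bar>" "norm (H x)" \<delta> s] s \<delta> K by (intro mult_left_mono) auto
  finally show ?case .
 qed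
 show i: "integrable M \<Phi>"
  by (rule Bochner_Integration.integrable_bound[OF R \<Phi>(1)]) (use le in \<open>eventually_elim, simp\<close>)
 have "\<bar>\<integral>x. \<Phi> x \<partial>M\<bar> \<le> (LINT x|M. \<bar>\<Phi> x\<bar>)" by (rule integral_abs_bound)
 also have "\<dots> \<le> (LINT x|M. ?R x)" by (rule integral_mono_AE[OF integrable_abs[OF i] R le])
 also have "\<dots> = K * (\<delta> * (LINT x|M. \<bar>G x\<bar> powr s) + \<delta> powr (1 - s) * (LINT x|M. norm (H x) powr s))"
  using G H by simp
 finally show "\<bar>\<integral>x. \<Phi> x \<partial>M\<bar> \<le> K * (\<delta> * (LINT x|M. \<bar>G x\<bar> powr s) + \<delta> powr (1 - s) * (LINT x|M. norm (H x) powr s))" .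
qed

text \<open>The threshold has to be uniform in the measure and in \<open>G\<close>, so the order of
  choice matters: \<open>\<delta>\<close> is fixed from \<open>K\<close> and \<open>B\<close> alone
  and keeps the first Young term below e/2, and only then \<open>\<eta>\<close> is chosen for the
  second. The summand 1 in the denominators covers vanishing constants.\<close>

lemma young_integral_small:
 fixes K B s e :: real
 assumes K: "0 \<le> K" and B: "0 \<le> B" and s: "1 \<le> s" and e: "0 < e"
 obtains \<eta> where "0 < \<eta>"
  "\<And>M \<Phi> (G :: 'x => real) (H :: 'x => 'b::real_normed_vector). \<Phi> \<in> borel_measurable M ==>
   (AE x in M. \<bar>\<Phi> x\<bar> \<le> K * (\<bar>G x\<bar> powr (s - 1) * norm (H x))) ==>
   integrable M (\<lambda>x. \<bar>G x\<bar> powr s) ==> integrable M (\<lambda>x. norm (H x) powr s) ==>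
   (LINT x|M. \<bar>G x\<bar> powr s) \<le> B ==> (LINT x|M. norm (H x) powr s) < \<eta> ==> \<bar>\<integral>x. \<Phi> x \<partial>M\<bar> < e"
proof -
 have pos: "0 < e / 2 / (b + 1)" "b * (e / 2 / (b + 1)) < e / 2" if "0 \<le> b" for b
  using that e by (simp_all add: field_simps)
 define \<delta> where "\<delta> = e / 2 / (K * B + 1)"
 have KB: "0 \<le> K * B" using K B by simp
 have \<delta>: "0 < \<delta>" "K * B * \<delta> < e / 2" unfolding \<delta>_def by (rule pos[OF KB])+
 define L where "L = K * \<delta> powr (1 - s)"
 have L: "0 \<le> L" using K by (simp add: L_def)
 show thesis
 proof (rule that[OF pos(1)[OF L]])
  fix M \<Phi> and G :: "'x => real" and H :: "'x => 'b"
  assume h: "\<Phi> \<in> borel_measurable M" "AE x in M. \<bar>\<Phi> x\<bar> \<le> K * (\<bar>G x\<bar> powr (s - 1) * norm (H x))"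
   "integrable M (\<lambda>x. \<bar>G x\<bar> powr s)" "integrable M (\<lambda>x. norm (H x) powr s)"
   and le: "(LINT x|M. \<bar>G x\<bar> powr s) \<le> B" "(LINT x|M. norm (H x) powr s) < e / 2 / (L + 1)"
  have "\<bar>\<integral>x. \<Phi> x \<partial>M\<bar> \<le> K * \<delta> * (LINT x|M. \<bar>G x\<bar> powr s) + L * (LINT x|M. norm (H x) powr s)"
   using young_integral_bound(2)[OF h(1,2) K h(3,4) s \<delta>(1)] by (simp add: L_def algebra_simps)
  also have "\<dots> \<le> K * \<delta> * B + L * (e / 2 / (L + 1))" using le K \<delta> L by (intro add_mono mult_left_mono) auto
  also have "K * \<delta> * B = K * B * \<delta>" by simp
  also have "K * B * \<delta> + L * (e / 2 / (L + 1)) < e" using \<delta>(2) pos(2)[OF L] by linarith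
  finally show "\<bar>\<integral>x. \<Phi> x \<partial>M\<bar> < e" .
 qed
qed

text \<open>On a finite measure space a Cauchy sequence in L^s is Cauchy in L^1, which supplies a
  subsequence converging almost everywhere; its limit is the limit in L^s by Fatou's lemma.\<close>

lemma Ls_complete:
 fixes f :: "nat => 'x => 'b::{banach, second_countable_topology}"
 assumes fin: "finite_measure M" and s: "1 \<le> s" and f: "\<And>n. integrable M (f n)"
  and int: "\<And>m n. integrable M (\<lambda>x. norm (f m x - f n x) powr s)"
  and Cauchy: "\<And>e. e > 0 ==> \<exists>N. \<forall>m\<ge>N. \<forall>n\<ge>N. (LINT x|M. norm (f m x - f n x) powr s) < e"
 obtains g where "g \<in> borel_measurable M" "\<And>n. integrable M (\<lambda>x. norm (f n x - g x) powr s)"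
  "(\<lambda>n. \<integral>x. norm (f n x - g x) powr s \<partial>M) \<longlonglongrightarrow> 0"
proof -
 let ?D = "\<lambda>m n. \<integral>x. norm (f m x - f n x) powr s \<partial>M" and ?G = "\<lambda>n g. \<integral>x. norm (f n x - g x) powr s \<partial>M"
 interpret finite_measure M by fact
 have [measurable]: "f n \<in> borel_measurable M" for n using f by auto
 have L1: "\<exists>N. \<forall>m\<ge>N. \<forall>n\<ge>N. (LINT x|M. norm (f m x - f n x)) < e" if "e > 0" for e
 proof -
  have B: "0 \<le> measure M (space M)" by simp
  show ?thesis
  proof (rule young_integral_small[where ?'b = 'b and ?'x = 'x, OF zero_le_one B s that], goal_cases)
   case (1 \<eta>)
   have "\<bar>\<integral>x. norm (f m x - f n x) \<partial>M\<bar> < e" if "?D m n < \<eta>" for m n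
    by (rule 1(2)[where G = "\<lambda>_. 1", OF _ _ _ int[of m n] _ that]) auto
   then show ?case using Cauchy[OF 1(1)] by fastforce
  qed
 qed
 obtain r where r: "strict_mono r" "AE x in M. Cauchy (\<lambda>i. f (r i) x)"
  using cauchy_L1_AE_cauchy_subseq[of M f] f L1 by metis
 define g where "g = (\<lambda>x. lim (\<lambda>i. f (r i) x))"
 have [measurable]: "g \<in> borel_measurable M" unfolding g_def by (rule borel_measurable_lim_metric) auto
 have lim: "AE x in M. (\<lambda>i. f (r i) x) \<longlonglongrightarrow> g x"
  using r(2) by eventually_elim (simp add: g_def Cauchy_convergent_iff convergent_LIMSEQ_iff)
 \<comment> \<open>The second index runs along the subsequence that converges almost everywhere, so
   Fatou's lemma carries the Cauchy bound over to \<open>g\<close>.\<close>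
 have bound: "(\<integral>\<^sup>+x. ennreal (norm (f n x - g x) powr s) \<partial>M) \<le> ennreal e"
  if N: "\<And>m n. m \<ge> N ==> n \<ge> N ==> ?D m n < e" and n: "n \<ge> N" for N n e
 proof -
  have "(\<integral>\<^sup>+x. ennreal (norm (f n x - g x) powr s) \<partial>M)
    = (\<integral>\<^sup>+x. liminf (\<lambda>i. ennreal (norm (f n x - f (r i) x) powr s)) \<partial>M)"
  proof (rule nn_integral_cong_AE, use lim in eventually_elim)
   case (elim x)
   have "(\<lambda>i. ennreal (norm (f n x - f (r i) x) powr s)) \<longlonglongrightarrow> ennreal (norm (f n x - g x) powr s)"
    using s by (intro tendsto_ennrealI tendsto_powr' tendsto_norm tendsto_diff tendsto_const elim) auto
   from lim_imp_Liminf[OF trivial_limit_sequentially this] show ?case by (rule sym)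
  qed
  also have "\<dots> \<le> liminf (\<lambda>i. \<integral>\<^sup>+x. ennreal (norm (f n x - f (r i) x) powr s) \<partial>M)"
   by (rule nn_integral_liminf) auto
  also have "\<dots> = liminf (\<lambda>i. ennreal (?D n (r i)))"
   by (intro arg_cong[of _ _ liminf] ext nn_integral_eq_integral int) auto
  also have "\<dots> \<le> ennreal e"
  proof (rule Liminf_le)
   show "\<forall>\<^sub>F i in sequentially. ennreal (?D n (r i)) \<le> ennreal e"
    using eventually_ge_at_top[of N]
   proof eventually_elim
    case (elim i)
    then have "N \<le> r i" using seq_suble[OF r(1), of i] by simp
    from N[OF n this] show ?case by (intro ennreal_leI) simp
   qed
  qed auto
  finally show ?thesis .
 qed
 obtain N0 where N0: "\<And>m n. m \<ge> N0 ==> n \<ge> N0 ==> ?D m n < 1"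
  using Cauchy[of 1] by auto
 have "(\<integral>\<^sup>+x. ennreal (norm (f N0 x - g x) powr s) \<partial>M) \<le> ennreal 1"
  by (rule bound[OF _ order_refl]) (rule N0)
 then have ig0: "integrable M (\<lambda>x. norm (f N0 x - g x) powr s)"
  by (intro integrableI_nonneg) (auto simp: less_top[symmetric] top_unique)
 have ig: "integrable M (\<lambda>x. norm (f n x - g x) powr s)" for n
  using norm_diff_powr(1)[of "\<lambda>x. f n x - f N0 x" M "\<lambda>x. g x - f N0 x" s] int ig0 s by (simp add: norm_minus_commute)
 have "(\<lambda>n. ?G n g) \<longlonglongrightarrow> 0"
 proof (rule LIMSEQ_I)
  fix e :: real assume "0 < e"
  then obtain N where N: "\<And>m n. m \<ge> N ==> n \<ge> N ==> ?D m n < e / 2"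
   using Cauchy[of "e / 2"] by auto
  have "norm (?G n g - 0) < e" if "n \<ge> N" for n
  proof -
   have "ennreal (?G n g) \<le> ennreal (e / 2)"
    using bound[OF N that] ig by (subst nn_integral_eq_integral[symmetric]) auto
   then have "?G n g \<le> e / 2" using \<open>0 < e\<close> by simp
   moreover have "0 \<le> ?G n g" by (intro integral_nonneg_AE) auto
   ultimately show ?thesis using \<open>0 < e\<close> by simp
  qed
  then show "\<exists>N. \<forall>n\<ge>N. norm (?G n g - 0) < e" by blast
 qed
 then show ?thesis by (intro that[OF _ ig]) simp_all
qed

section \<open>Convexity gaps of powers of the norm\<close>

lemma powr_tangent:
 fixes m t s :: real
 assumes s: "1 < s" and "0 < m" "0 \<le> t"
 shows "m powr s + s * m powr (s - 1) * (t - m) \<le> t powr s"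
proof -
 have "t * m powr (s - 1) \<le> t powr s / s + (m powr (s - 1)) powr (s / (s - 1)) / (s / (s - 1))"
  by (rule Youngs_inequality) (use assms in \<open>auto simp: field_simps\<close>)
 also have "(m powr (s - 1)) powr (s / (s - 1)) = m powr s" using s by (simp add: powr_powr)
 finally have "s * (t * m powr (s - 1)) \<le> s * (t powr s / s + m powr s / (s / (s - 1)))"
  using s by (intro mult_left_mono) auto
 also have "\<dots> = t powr s + (s - 1) * m powr s" using s by (simp add: field_simps)
 finally show ?thesis using assms powr_mult_base[of m "s - 1"] by (simp add: algebra_simps)
qed

text \<open>The norm of the midpoint is at most the mean of the norms, and the power of this mean is
  compared with the mean of the powers by the tangent at the mean. Equality forces equal norms by
  strict convexity, then equality in the triangle inequality, hence equal vectors.\<close>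

lemma convex_gap_nonneg:
 fixes x y :: "'b::real_inner"
 assumes s: "1 < s"
 shows "norm ((1/2) *\<^sub>R (x + y)) powr s \<le> (norm x powr s + norm y powr s) / 2"
  and "norm ((1/2) *\<^sub>R (x + y)) powr s = (norm x powr s + norm y powr s) / 2 ==> x = y"
proof -
 let ?h = "(1/2) *\<^sub>R (x + y)"
 let ?m = "(norm x + norm y) / 2"
 have tri: "norm ?h \<le> ?m" using norm_triangle_ineq[of x y] by simp
 have conv: "?m powr s \<le> (norm x powr s + norm y powr s) / 2"
  and strict: "norm x \<noteq> norm y ==> ?m powr s < (norm x powr s + norm y powr s) / 2"
 proof -
  note tangent = powr_tangent[OF s]
  have tangent': "m powr s + s * m powr (s - 1) * (t - m) < t powr s" if "0 < m" "0 \<le> t" "t \<noteq> m" for m t :: real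
  proof -
   define z where "z = (t + m) / 2"
   have z: "0 < z" "0 \<le> z" using that by (auto simp: z_def)
   have "m powr s + s * m powr (s - 1) * (z - m) \<le> z powr s" using tangent[of m z] that z by simp
   moreover have "z powr s + s * z powr (s - 1) * (t - z) \<le> t powr s" using tangent[of z t] that z by simp
   moreover have "s * m powr (s - 1) * (t - z) < s * z powr (s - 1) * (t - z)"
   proof (cases "m < t")
    case True
    then have "m powr (s - 1) < z powr (s - 1)" using that s by (intro powr_less_mono2) (auto simp: z_def)
    then show ?thesis using s True by (intro mult_strict_right_mono mult_strict_left_mono) (auto simp: z_def)
   next
    case False
    then have "z powr (s - 1) < m powr (s - 1)" using that s by (intro powr_less_mono2) (auto simp: z_def)
    then show ?thesis using s False that by (intro mult_strict_right_mono_neg mult_strict_left_mono) (auto simp: z_def)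
   qed
   moreover have "s * m powr (s - 1) * (t - m) = s * m powr (s - 1) * (z - m) + s * m powr (s - 1) * (t - z)"
    by (simp add: algebra_simps)
   ultimately show ?thesis by linarith
  qed
  show "?m powr s \<le> (norm x powr s + norm y powr s) / 2"
  proof (cases "0 < ?m")
   case True
   have "s * ?m powr (s - 1) * (norm x - ?m) + s * ?m powr (s - 1) * (norm y - ?m) = 0"
    by (simp add: algebra_simps)
   then show ?thesis using tangent[OF True, of "norm x"] tangent[OF True, of "norm y"] by simp
  next
   case False
   then have "?m = 0" using norm_ge_zero[of x] norm_ge_zero[of y] by argo
   then show ?thesis by simp
  qed
  assume ne: "norm x \<noteq> norm y"
  then have pos: "0 < ?m" using norm_ge_zero[of x] norm_ge_zero[of y] by argo
  have "s * ?m powr (s - 1) * (norm x - ?m) + s * ?m powr (s - 1) * (norm y - ?m) = 0"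
   by (simp add: algebra_simps)
  then show "?m powr s < (norm x powr s + norm y powr s) / 2"
   using tangent'[OF pos, of "norm x"] tangent[OF pos, of "norm y"] ne by (simp add: field_simps)
 qed
 have mono: "norm ?h powr s \<le> ?m powr s" using tri s by (intro powr_mono2) auto
 show "norm ?h powr s \<le> (norm x powr s + norm y powr s) / 2" using mono conv by linarith
 assume eq: "norm ?h powr s = (norm x powr s + norm y powr s) / 2"
 have nn: "norm x = norm y" using strict mono eq by linarith
 then have "norm ?h powr s = norm x powr s" using eq by simp
 then have "norm ?h = norm x"
  using s powr_less_mono2[of s "norm ?h" "norm x"] powr_less_mono2[of s "norm x" "norm ?h"]
  by (cases "norm ?h" "norm x" rule: linorder_cases) auto
 then have nxy: "norm (x + y) = norm x + norm y" using nn by simp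
 then have "norm x *\<^sub>R y = norm y *\<^sub>R x" by (simp add: norm_triangle_eq)
 then show "x = y" using nn by (cases "norm x = 0") auto
qed

text \<open>Both sides are homogeneous of degree s, so pairs on the unit sphere suffice. Those for
  which the left side is at least the \<epsilon>-term form a compact set without points of the
  diagonal; there the gap has a positive minimum, and a large factor does the rest. All exponents s
  > 1 are treated alike, without cases for s below and above 2.\<close>

lemma convex_gap:
 fixes s \<epsilon> :: real
 assumes s: "1 < s" and \<epsilon>: "0 < \<epsilon>"
 obtains C where "0 \<le> C" "\<And>x y :: 'b::euclidean_space. norm (x - y) powr s \<le>
   \<epsilon> * (norm x powr s + norm y powr s) +
   C * ((norm x powr s + norm y powr s) / 2 - norm ((1/2) *\<^sub>R (x + y)) powr s)"
proof -
 let ?n = "\<lambda>z::'b \<times> 'b. norm (fst z) powr s + norm (snd z) powr s"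
 define gap where "gap = (\<lambda>z::'b \<times> 'b. ?n z / 2 - norm ((1/2) *\<^sub>R (fst z + snd z)) powr s)"
 define A where "A = sphere (0::'b \<times> 'b) 1 \<inter> {z. \<epsilon> * ?n z \<le> norm (fst z - snd z) powr s}"
 have cont: "continuous_on UNIV gap" unfolding gap_def
  by (intro continuous_intros continuous_on_powr') (use s in auto)
 have "closed {z::'b \<times> 'b. \<epsilon> * ?n z \<le> norm (fst z - snd z) powr s}"
  by (intro closed_Collect_le continuous_intros continuous_on_powr') (use s in auto)
 then have cA: "compact A" unfolding A_def by (intro compact_Int_closed compact_sphere)
 have gap0: "0 \<le> gap z" for z using convex_gap_nonneg(1)[OF s, of "fst z" "snd z"] by (simp add: gap_def)
 have posA: "0 < gap z" if "z \<in> A" for z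
 proof (rule ccontr)
  assume "\<not> 0 < gap z"
  then have "gap z = 0" using gap0[of z] by linarith
  then have eq: "fst z = snd z" using convex_gap_nonneg(2)[OF s, of "fst z" "snd z"] by (simp add: gap_def)
  then have "\<epsilon> * ?n z \<le> 0" using that by (simp add: A_def)
  then have "fst z = 0" using \<epsilon> eq by (simp add: mult_le_0_iff)
  then have "z = 0" using eq by (simp add: prod_eq_iff)
  then show False using that by (simp add: A_def)
 qed
 obtain m where m: "0 < m" "\<And>z. z \<in> A ==> m \<le> gap z"
 proof (cases "A = {}")
  case False
  obtain z where "z \<in> A" "\<And>y. y \<in> A ==> gap z \<le> gap y"
   using continuous_attains_inf[OF cA False continuous_on_subset[OF cont]] by auto
  then show ?thesis using that posA by blast
 qed (use that[of 1] in auto)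
 \<comment> \<open>On the unit sphere both norms are at most 1, so the left side is at most 2 times
   2^s; dividing by the minimum \<open>m\<close> of the gap gives the constant.\<close>
 define C where "C = 2 powr s * 2 / m"
 have C: "0 \<le> C" using m by (simp add: C_def)
 have unit: "norm (fst z - snd z) powr s \<le> \<epsilon> * ?n z + C * gap z"
  if z: "norm z = 1" for z :: "'b \<times> 'b"
 proof (cases "z \<in> A")
  case True
  have n1: "norm (fst z) powr s \<le> 1" "norm (snd z) powr s \<le> 1"
   using norm_fst_le[of "fst z" "snd z"] norm_snd_le[of "snd z" "fst z"] z s by (auto intro!: powr_le1)
  have "norm (fst z - snd z) powr s \<le> 2 powr s * ?n z"
   using norm_add_powr_le[of s "fst z" "- snd z"] s by simp
  also have "\<dots> \<le> 2 powr s * 2" using n1 by (intro mult_left_mono) auto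
  also have "\<dots> = C * m" using m by (simp add: C_def)
  also have "\<dots> \<le> C * gap z" using m(2)[OF True] C by (intro mult_left_mono)
  also have "\<dots> \<le> \<epsilon> * ?n z + C * gap z" using \<epsilon> by simp
  finally show ?thesis .
 next
  case False
  then have "norm (fst z - snd z) powr s \<le> \<epsilon> * ?n z"
   using z by (auto simp: A_def)
  then show ?thesis using mult_nonneg_nonneg[OF C gap0[of z]] by linarith
 qed
 show thesis
 proof (rule that[OF C])
  fix x y :: 'b
  show "norm (x - y) powr s \<le> \<epsilon> * (norm x powr s + norm y powr s) +
   C * ((norm x powr s + norm y powr s) / 2 - norm ((1/2) *\<^sub>R (x + y)) powr s)"
  proof (cases "(x, y) = 0")
   case False
   define t where "t = norm (x, y)"
   have t: "0 < t" using False by (simp add: t_def)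
   define z where "z = inverse t *\<^sub>R (x, y)"
   have z1: "norm z = 1" using t unfolding z_def norm_scaleR t_def by simp
   have xy: "x = t *\<^sub>R fst z" "y = t *\<^sub>R snd z" using t by (auto simp: z_def)
   have d: "norm (x - y) powr s = t powr s * norm (fst z - snd z) powr s"
    "norm ((1/2) *\<^sub>R (x + y)) powr s = t powr s * norm ((1/2) *\<^sub>R (fst z + snd z)) powr s"
    "norm x powr s = t powr s * norm (fst z) powr s" "norm y powr s = t powr s * norm (snd z) powr s"
    unfolding xy scaleR_diff_right[symmetric] scaleR_add_right[symmetric] using t
    by (simp_all add: powr_mult powr_divide)
   have "t powr s * norm (fst z - snd z) powr s \<le> t powr s * (\<epsilon> * ?n z + C * gap z)"
    using unit[OF z1] by (intro mult_left_mono) auto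
   then show ?thesis unfolding d gap_def by (simp add: algebra_simps)
  qed (auto simp: zero_prod_def)
 qed
qed

text \<open>The \<epsilon>-term of \<open>convex_gap\<close> is kept below e/2 by the common bound
  \<open>B\<close>, the other term by the vanishing gap. The gap is required only for m \<le> n, the
  order in which Galerkin solutions can be tested against each other; symmetry of the conclusion
  supplies the other order.\<close>

lemma convex_gap_Cauchy:
 fixes f :: "nat => 'x => 'b::euclidean_space"
 assumes s: "1 < s" and int: "\<And>n. integrable M (\<lambda>x. norm (f n x) powr s)"
  and meas: "\<And>n. f n \<in> borel_measurable M"
  and bd: "\<And>n. (LINT x|M. norm (f n x) powr s) \<le> B"
  and gap: "\<And>e. e > 0 ==> \<exists>N. \<forall>m\<ge>N. \<forall>n\<ge>m. ((LINT x|M. norm (f m x) powr s) + (LINT x|M. norm (f n x) powr s)) / 2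
    - (LINT x|M. norm ((1/2) *\<^sub>R (f m x + f n x)) powr s) < e"
  and e: "e > 0"
 shows "\<exists>N. \<forall>m\<ge>N. \<forall>n\<ge>N. (LINT x|M. norm (f m x - f n x) powr s) < e"
proof -
 let ?N = "\<lambda>n. \<integral>x. norm (f n x) powr s \<partial>M" and ?D = "\<lambda>m n. \<integral>x. norm (f m x - f n x) powr s \<partial>M" and ?h = "\<lambda>m n x. norm ((1/2) *\<^sub>R (f m x + f n x)) powr s"
 note [measurable] = meas
 define \<epsilon> where "\<epsilon> = e / (4 * (\<bar>B\<bar> + 1))"
 have \<epsilon>: "0 < \<epsilon>" using e by (simp add: \<epsilon>_def add_nonneg_pos)
 obtain C where C: "0 \<le> C" "\<And>x y :: 'b. norm (x - y) powr s \<le>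
   \<epsilon> * (norm x powr s + norm y powr s) +
   C * ((norm x powr s + norm y powr s) / 2 - norm ((1/2) *\<^sub>R (x + y)) powr s)"
  using convex_gap[OF s \<epsilon>] by metis
 obtain N where N: "\<And>m n. m \<ge> N ==> n \<ge> m ==> (?N m + ?N n) / 2
    - (LINT x|M. ?h m n x) < e / (2 * (C + 1))"
  using gap[of "e / (2 * (C + 1))"] e C(1) by auto
 have imid: "integrable M (\<lambda>x. ?h m n x)" for m n
 proof (rule Bochner_Integration.integrable_bound)
  show "integrable M (\<lambda>x. (norm (f m x) powr s + norm (f n x) powr s) / 2)" using int by simp
  show "AE x in M. norm (?h m n x) \<le> norm ((norm (f m x) powr s + norm (f n x) powr s) / 2)"
   using convex_gap_nonneg(1)[OF s] by (intro AE_I2) simp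
 qed auto
 have idiff: "integrable M (\<lambda>x. norm (f m x - f n x) powr s)" for m n
  by (rule norm_diff_powr(1)[OF meas meas int int]) (use s in simp)
 have main: "?D m n < e" if "m \<ge> N" "n \<ge> m" for m n
 proof -
  have "?D m n \<le> (LINT x|M. \<epsilon> * (norm (f m x) powr s + norm (f n x) powr s) +
    C * ((norm (f m x) powr s + norm (f n x) powr s) / 2 - ?h m n x))"
   using int imid idiff by (intro integral_mono C(2)) auto
  also have "\<dots> = \<epsilon> * (?N m + ?N n) +
    C * ((?N m + ?N n) / 2 - (LINT x|M. ?h m n x))"
   using int imid by simp
  also have "\<dots> \<le> \<epsilon> * (2 * (\<bar>B\<bar> + 1)) + C * (e / (2 * (C + 1)))"
  proof (intro add_mono mult_left_mono)
   show "?N m + ?N n \<le> 2 * (\<bar>B\<bar> + 1)"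
    using bd[of m] bd[of n] abs_ge_self[of B] by argo
  qed (use N[OF that] \<epsilon> C(1) in auto)
  also have "\<epsilon> * (2 * (\<bar>B\<bar> + 1)) = e / 2" by (simp add: \<epsilon>_def field_simps)
  also have "C * (e / (2 * (C + 1))) < e / 2" using C(1) e by (simp add: field_simps)
  finally show ?thesis by simp
 qed
 show ?thesis
 proof (intro exI[of _ N] allI impI)
  fix m n assume "N \<le> m" "N \<le> n"
  then show "?D m n < e"
   using main[of m n] main[of n m] by (cases "m \<le> n") (auto simp: norm_minus_commute)
 qed
qed

lemma has_field_derivative_integral:
 fixes k k' :: "'x => real => real"
 assumes int: "\<And>t. integrable M (\<lambda>x. k x t)" and meas: "(\<lambda>x. k' x a) \<in> borel_measurable M"
  and deriv: "AE x in M. \<forall>t. (k x has_field_derivative k' x t) (at t)"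
  and bound: "AE x in M. \<forall>t\<in>{a - 1..a + 1}. \<bar>k' x t\<bar> \<le> w x" and w: "integrable M w"
 shows "((\<lambda>t. \<integral>x. k x t \<partial>M) has_field_derivative (LINT x|M. k' x a)) (at a)"
proof -
 have "((\<lambda>h. ((LINT x|M. k x (a + h)) - (LINT x|M. k x a)) / h) \<longlongrightarrow> (LINT x|M. k' x a)) (at 0)"
  unfolding tendsto_at_iff_sequentially
 proof (intro allI impI)
  fix h :: "nat => real" assume h: "\<forall>i. h i \<in> UNIV - {0}" "h \<longlonglongrightarrow> 0"
  \<comment> \<open>Only finitely many increments exceed 1 in modulus. They are replaced by 1, so
    that all points stay in the interval on which the derivative is dominated.\<close>
  define h' where "h' = (\<lambda>n. if \<bar>h n\<bar> \<le> 1 then h n else 1)"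
  have h'nz: "h' n \<noteq> 0" "\<bar>h' n\<bar> \<le> 1" for n using h(1) by (auto simp: h'_def)
  have ev: "\<forall>\<^sub>F n in sequentially. h' n = h n"
   using order_tendstoD(2)[OF tendsto_rabs[OF h(2)], of 1] by (auto elim!: eventually_mono simp: h'_def)
  then have h'lim: "h' \<longlonglongrightarrow> 0" using h(2) by (simp add: tendsto_cong)
  have "(\<lambda>n. \<integral>x. (k x (a + h' n) - k x a) / h' n \<partial>M) \<longlonglongrightarrow> (LINT x|M. k' x a)"
  proof (rule integral_dominated_convergence[OF meas _ w])
   show "AE x in M. (\<lambda>n. (k x (a + h' n) - k x a) / h' n) \<longlonglongrightarrow> k' x a"
    using deriv
   proof eventually_elim
    case (elim x)
    then have "((\<lambda>h. (k x (a + h) - k x a) / h) \<longlongrightarrow> k' x a) (at 0)" by (simp add: DERIV_def)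
    then show ?case using h'lim h'nz
     unfolding tendsto_at_iff_sequentially by (auto simp: o_def)
   qed
   show "AE x in M. norm ((k x (a + h' n) - k x a) / h' n) \<le> w x" for n
    using deriv bound
   proof eventually_elim
    case (elim x)
    have "norm (k x (a + h' n) - k x a) \<le> w x * norm (a + h' n - a)"
     by (rule field_differentiable_bound[of "{a - 1..a + 1}" "k x" "k' x"])
       (use elim h'nz[of n] in \<open>auto intro: has_field_derivative_at_within\<close>)
    then show ?case using h'nz(1)[of n] by (simp add: divide_simps)
   qed
  qed (use int in auto)
  then have "(\<lambda>n. ((LINT x|M. k x (a + h' n)) - (LINT x|M. k x a)) / h' n) \<longlonglongrightarrow> (LINT x|M. k' x a)"
   using int by simp
  then show "((\<lambda>h. ((LINT x|M. k x (a + h)) - (LINT x|M. k x a)) / h) \<circ> h) \<longlonglongrightarrow> (LINT x|M. k' x a)"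
   by (rule Lim_transform_eventually) (use ev in \<open>auto elim!: eventually_mono\<close>)
 qed
 then show ?thesis by (simp add: DERIV_def)
qed

lemma young_integral_tendsto:
 fixes \<Phi> :: "nat => 'x => real" and G :: "'x => real" and H :: "nat => 'x => 'b::real_normed_vector"
 assumes \<Phi>: "\<And>j. \<Phi> j \<in> borel_measurable M" "\<And>j. AE x in M. \<bar>\<Phi> j x\<bar> \<le> K * (\<bar>G x\<bar> powr (s - 1) * norm (H j x))" and K: "0 \<le> K"
  and G: "integrable M (\<lambda>x. \<bar>G x\<bar> powr s)" and H: "\<And>j. integrable M (\<lambda>x. norm (H j x) powr s)" and s: "1 \<le> s"
  and lim: "(\<lambda>j. \<integral>x. norm (H j x) powr s \<partial>M) \<longlonglongrightarrow> 0"
 shows "(\<lambda>j. \<integral>x. \<Phi> j x \<partial>M) \<longlonglongrightarrow> 0"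
proof (rule tendstoI)
 fix e :: real assume e: "0 < e"
 have B: "0 \<le> (LINT x|M. \<bar>G x\<bar> powr s)" by (simp add: integral_nonneg_AE)
 show "\<forall>\<^sub>F j in sequentially. dist (LINT x|M. \<Phi> j x) 0 < e"
 proof (rule young_integral_small[where ?'b = 'b and ?'x = 'x, OF K B s e], goal_cases)
  case (1 \<eta>)
  show ?case using order_tendstoD(2)[OF lim 1(1)] by eventually_elim (simp add: 1(2)[OF \<Phi> G H order.refl])
 qed
qed

text \<open>A common subsequence converges almost everywhere both to \<open>g\<close> and to the
  limit found in the second space, so the two agree. In this way one limit function serves for
  several exponents and for the weighted measure.\<close>

lemma Ls_Cauchy_limit:
 fixes f :: "nat => 'x => 'b::{banach, second_countable_topology}"
 assumes conv: "\<And>n. integrable M (\<lambda>x. norm (f n x - g x) powr s)" "0 < s" "(\<lambda>n. \<integral>x. norm (f n x - g x) powr s \<partial>M) \<longlonglongrightarrow> 0"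
  and fin: "finite_measure M'" and s': "1 \<le> s'" and f: "\<And>n. integrable M' (f n)"
  and int: "\<And>m n. integrable M' (\<lambda>x. norm (f m x - f n x) powr s')"
  and Cauchy: "\<And>e. e > 0 ==> \<exists>N. \<forall>m\<ge>N. \<forall>n\<ge>N. (LINT x|M'. norm (f m x - f n x) powr s') < e"
  and AE: "\<And>P. AE x in M. P x ==> AE x in M'. P x" and g: "g \<in> borel_measurable M'"
 shows "integrable M' (\<lambda>x. norm (f n x - g x) powr s')" "(\<lambda>n. \<integral>x. norm (f n x - g x) powr s' \<partial>M') \<longlonglongrightarrow> 0"
proof -
 obtain g' where g': "g' \<in> borel_measurable M'" "\<And>n. integrable M' (\<lambda>x. norm (f n x - g' x) powr s')"
  "(\<lambda>n. \<integral>x. norm (f n x - g' x) powr s' \<partial>M') \<longlonglongrightarrow> 0"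
  by (rule Ls_complete[OF fin s' f int Cauchy]) (assumption | rule that)+
 obtain \<rho> S where \<rho>: "strict_mono (\<rho> :: nat => nat)" "AE x in M. (\<forall>n. norm (f (\<rho> n) x - g x) powr s \<le> S x) \<and> (\<lambda>n. f (\<rho> n) x) \<longlonglongrightarrow> g x"
  by (rule rapid_subsequence[OF conv]) (rule that)
 have s'0: "0 < s'" using s' by simp
 obtain \<tau> S' where \<tau>: "strict_mono (\<tau> :: nat => nat)" "AE x in M'. (\<forall>n. norm (f (\<rho> (\<tau> n)) x - g' x) powr s' \<le> S' x) \<and> (\<lambda>n. f (\<rho> (\<tau> n)) x) \<longlonglongrightarrow> g' x"
  by (rule rapid_subsequence[OF g'(2) s'0 LIMSEQ_subseq_LIMSEQ[OF g'(3) \<rho>(1), unfolded o_def]]) (rule that)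
 have eq: "AE x in M'. g' x = g x"
  using \<tau>(2) AE[OF \<rho>(2)]
 proof eventually_elim
  case (elim x)
  have "(\<lambda>n. f (\<rho> (\<tau> n)) x) \<longlonglongrightarrow> g x" using LIMSEQ_subseq_LIMSEQ[OF conjunct2[OF elim(2)] \<tau>(1)] by (simp add: o_def)
  with elim(1) show ?case by (auto intro: LIMSEQ_unique)
 qed
 have fm: "f n \<in> borel_measurable M'" for n using f by (rule borel_measurable_integrable)
 have eqn: "AE x in M'. norm (f n x - g' x) powr s' = norm (f n x - g x) powr s'" for n
  using eq by eventually_elim simp
 have m: "(\<lambda>x. norm (f n x - g x) powr s') \<in> borel_measurable M'" "(\<lambda>x. norm (f n x - g' x) powr s') \<in> borel_measurable M'" for n
  using fm g g'(1) by measurable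
 show "integrable M' (\<lambda>x. norm (f n x - g x) powr s')" for n
  by (rule integrable_cong_AE_imp[OF g'(2)[of n] m(1)]) (use eqn[of n] in \<open>eventually_elim, simp\<close>)
 have "(LINT x|M'. norm (f n x - g' x) powr s') = (LINT x|M'. norm (f n x - g x) powr s')" for n
  by (rule integral_cong_AE[OF m(2) m(1) eqn])
 then show "(\<lambda>n. \<integral>x. norm (f n x - g x) powr s' \<partial>M') \<longlonglongrightarrow> 0" using g'(3) by simp
qed

lemma Ls_lower_exponent:
 fixes f :: "nat => 'x => 'b::{banach, second_countable_topology}"
 assumes fin: "finite_measure M" and f: "\<And>n. f n \<in> borel_measurable M" "\<And>n. integrable M (\<lambda>x. norm (f n x) powr s)"
  and lim: "(\<lambda>n. \<integral>x. norm (f n x) powr s \<partial>M) \<longlonglongrightarrow> 0" and s: "0 < s'" "s' \<le> s"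
 shows "integrable M (\<lambda>x. norm (f n x) powr s')" "(\<lambda>n. \<integral>x. norm (f n x) powr s' \<partial>M) \<longlonglongrightarrow> 0"
proof -
 interpret finite_measure M by (rule fin)
 note [measurable] = f(1)
 have growth: "AE x in M. \<forall>t::'b. \<bar>norm t powr s'\<bar> \<le> 1 * (1 + norm t powr s)"
  using powr_le_1_powr[of _ s' s] s by (intro AE_I2) auto
 have cont: "AE x in M. continuous_on UNIV (\<lambda>t::'b. norm t powr s')"
  using s by (intro AE_I2 continuous_on_powr' continuous_intros) auto
 have s0: "0 < s" using s by simp
 note N = nemytskii[where M = M and f = f and g = "\<lambda>_. 0" and s = s and \<Phi> = "\<lambda>_ t. norm t powr s'" and w = "\<lambda>_. 1" and C = 1, OF _ s0 _ _ _ cont growth]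
 show "integrable M (\<lambda>x. norm (f n x) powr s')" by (rule N(3)) (use f lim s in auto)
 have "(\<lambda>n. \<integral>x. norm (f n x) powr s' \<partial>M) \<longlonglongrightarrow> (LINT x|M. norm (0::'b) powr s')" by (rule N(1)) (use f lim s in auto)
 then show "(\<lambda>n. \<integral>x. norm (f n x) powr s' \<partial>M) \<longlonglongrightarrow> 0" using s by simp
qed

section \<open>The Sobolev--Rellich inequality\<close>

text \<open>Integrating the tangent inequality for the power, taken at the mean of \<open>X\<close>,
  removes the linear term.\<close>

lemma (in prob_space) jensen_powr:
 fixes X :: "'a => real"
 assumes X: "integrable M X" "AE x in M. 0 \<le> X x" "integrable M (\<lambda>x. X x powr s)" and s: "1 < s"
 shows "(LINT x|M. X x) powr s \<le> (LINT x|M. X x powr s)"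
proof -
 let ?m = "\<integral>x. X x \<partial>M"
 have m0: "0 \<le> ?m" using X by (intro integral_nonneg_AE) auto
 show ?thesis
 proof (cases "?m = 0")
  case True
  then show ?thesis by (simp add: integral_nonneg_AE)
 next
  case False
  then have m: "0 < ?m" using m0 by simp
  have "(LINT x|M. ?m powr s + s * ?m powr (s - 1) * (X x - ?m)) \<le> (LINT x|M. X x powr s)"
   by (rule integral_mono_AE)
    (use X powr_tangent[OF s m] in \<open>auto elim!: eventually_mono\<close>)
  then show ?thesis using X(1) by (simp add: prob_space)
 qed
qed

abbreviation ball_unif :: "'a::euclidean_space measure" where
 "ball_unif \<equiv> uniform_measure lborel (cball 0 1)"

abbreviation icc_unif :: "real measure" where
 "icc_unif \<equiv> uniform_measure lborel {0..1}"

abbreviation ball_vol :: "'a::euclidean_space itself => real" where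
 "ball_vol _ \<equiv> measure lborel (cball (0::'a) 1)"

lemma ball_vol_pos: "0 < ball_vol TYPE('a::euclidean_space)"
 using content_cball_pos[of 1 "0::'a"] by simp

lemma prob_space_unit_ball: "prob_space (ball_unif :: 'a::euclidean_space measure)"
proof (rule prob_space_uniform_measure)
 show "emeasure lborel (cball (0::'a) 1) \<noteq> 0"
  using ball_vol_pos[where 'a = 'a] by (metis Sigma_Algebra.measure_def enn2real_0 less_irrefl)
 show "emeasure lborel (cball (0::'a) 1) \<noteq> \<infinity>" using emeasure_bounded_finite[of "cball (0::'a) 1"] by auto
qed

lemma prob_space_unit_interval: "prob_space icc_unif"
 by (rule prob_space_uniform_measure) auto

lemma integrable_prob_bounded:
 fixes f :: "'x => real"
 assumes "prob_space M" "f \<in> borel_measurable M" "\<And>x. \<bar>f x\<bar> \<le> C"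
 shows "integrable M f"
proof -
 interpret prob_space M by fact
 show ?thesis using assms by (intro integrable_const_bound[where B = C]) auto
qed

lemma nn_integral_scale_translate:
 fixes w :: "'a::euclidean_space => ennreal"
 assumes [measurable]: "w \<in> borel_measurable borel" and s: "s > 0"
 shows "(\<integral>\<^sup>+z. w (x + s *\<^sub>R z) \<partial>lborel) = ennreal (s powr - real DIM('a)) * (\<integral>\<^sup>+z. w z \<partial>lborel)"
proof -
 have "(\<integral>\<^sup>+z. w z \<partial>lborel) = (\<integral>\<^sup>+z. w z \<partial>density (distr lborel borel (\<lambda>z. x + s *\<^sub>R z)) (\<lambda>_. \<bar>s\<bar> ^ DIM('a)))"
  using lborel_affine[of s x] s by simp
 also have "\<dots> = (\<integral>\<^sup>+z. ennreal (s ^ DIM('a)) * w (x + s *\<^sub>R z) \<partial>lborel)"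
  using s by (simp add: nn_integral_density nn_integral_distr)
 also have "\<dots> = ennreal (s ^ DIM('a)) * (\<integral>\<^sup>+z. w (x + s *\<^sub>R z) \<partial>lborel)"
  by (rule nn_integral_cmult) auto
 finally have "ennreal (s powr - real DIM('a)) * (\<integral>\<^sup>+z. w z \<partial>lborel)
   = (ennreal (s powr - real DIM('a)) * ennreal (s ^ DIM('a))) * (\<integral>\<^sup>+z. w (x + s *\<^sub>R z) \<partial>lborel)"
  by (simp add: mult.assoc)
 also have "ennreal (s powr - real DIM('a)) * ennreal (s ^ DIM('a)) = 1"
  using s by (simp add: ennreal_mult[symmetric] powr_minus powr_realpow)
 finally show ?thesis by simp
qed

lemma nn_integral_translate:
 fixes w :: "'a::euclidean_space => ennreal"
 assumes "w \<in> borel_measurable borel"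
 shows "(\<integral>\<^sup>+x. w (x + c) \<partial>lborel) = (\<integral>\<^sup>+x. w x \<partial>lborel)"
 using nn_integral_scale_translate[OF assms, of 1 c] by (simp add: add.commute)

text \<open>The mean over the ball of radius \<open>h\<close> about \<open>x\<close>, written as an
  expectation over the unit ball: Jensen's inequality applies directly, radius and centre act on the
  argument only, and h = 0 returns the function itself.\<close>

definition ball_mean :: "real => ('a::euclidean_space => real) => 'a => real" where
 "ball_mean h w x = (LINT z|ball_unif. w (x + h *\<^sub>R z))"

text \<open>The bound is the Jensen inequality followed by enlarging the domain of integration.\<close>

lemma ball_mean_powr_le:
 fixes w :: "'a::euclidean_space => real"
 assumes [measurable]: "w \<in> borel_measurable borel" and w: "\<And>x. 0 \<le> w x" "\<And>x. w x \<le> C" and p: "1 < p"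
 shows "ball_mean s w x powr p \<le> (LINT z|ball_unif. w (x + s *\<^sub>R z) powr p)"
  and "s > 0 ==> integrable lborel (\<lambda>x. w x powr p) ==>
   (LINT z|ball_unif. w (x + s *\<^sub>R z) powr p) \<le> s powr - real DIM('a) / ball_vol TYPE('a) * (LINT x|lborel. w x powr p)"
proof -
 interpret prob_space "ball_unif :: 'a measure" by (rule prob_space_unit_ball)
 have C: "0 \<le> C" using w order.trans by blast
 have i1: "integrable ball_unif (\<lambda>z. w (x + s *\<^sub>R z))"
  by (rule integrable_prob_bounded[OF prob_space_unit_ball, of _ C]) (use w in auto)
 have "w y powr p \<le> C powr p" for y using w p by (intro powr_mono2) auto
 then have i2: "integrable ball_unif (\<lambda>z. w (x + s *\<^sub>R z) powr p)"
  by (intro integrable_prob_bounded[OF prob_space_unit_ball, of _ "C powr p"]) auto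
 show "ball_mean s w x powr p \<le> (LINT z|ball_unif. w (x + s *\<^sub>R z) powr p)"
  unfolding ball_mean_def by (rule jensen_powr[OF i1 _ i2 p]) (use w in auto)
 assume s: "s > 0" and int: "integrable lborel (\<lambda>x. w x powr p)"
 have fin: "emeasure lborel (cball (0::'a) 1) = ennreal (ball_vol TYPE('a))"
  using emeasure_bounded_finite[of "cball (0::'a) 1"] by (intro emeasure_eq_ennreal_measure) auto
 have "ennreal (LINT z|ball_unif. w (x + s *\<^sub>R z) powr p) = (\<integral>\<^sup>+z. ennreal (w (x + s *\<^sub>R z) powr p) \<partial>ball_unif)"
  by (rule nn_integral_eq_integral[symmetric]) (use i2 in auto)
 also have "\<dots> = (\<integral>\<^sup>+z. ennreal (w (x + s *\<^sub>R z) powr p) * indicator (cball 0 1) z \<partial>lborel) / ennreal (ball_vol TYPE('a))"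
  by (subst nn_integral_uniform_measure) (auto simp: fin)
 also have "\<dots> \<le> (\<integral>\<^sup>+z. ennreal (w (x + s *\<^sub>R z) powr p) \<partial>lborel) / ennreal (ball_vol TYPE('a))"
  by (intro divide_right_mono_ennreal nn_integral_mono) (auto simp: indicator_def)
 also have "(\<integral>\<^sup>+z. ennreal (w (x + s *\<^sub>R z) powr p) \<partial>lborel) = ennreal (s powr - real DIM('a)) * (\<integral>\<^sup>+z. ennreal (w z powr p) \<partial>lborel)"
  by (rule nn_integral_scale_translate[OF _ s, of "\<lambda>z. ennreal (w z powr p)"]) simp
 also have "(\<integral>\<^sup>+z. ennreal (w z powr p) \<partial>lborel) = ennreal (LINT z|lborel. w z powr p)"
  by (rule nn_integral_eq_integral[OF int]) simp
 also have "ennreal (s powr - real DIM('a)) * ennreal (LINT z|lborel. w z powr p) / ennreal (ball_vol TYPE('a))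
   = ennreal (s powr - real DIM('a) / ball_vol TYPE('a) * (LINT x|lborel. w x powr p))"
  using ball_vol_pos[where 'a = 'a] by (simp add: ennreal_mult[symmetric] divide_ennreal mult.commute)
 finally show "(LINT z|ball_unif. w (x + s *\<^sub>R z) powr p) \<le> s powr - real DIM('a) / ball_vol TYPE('a) * (LINT x|lborel. w x powr p)"
  by (subst (asm) ennreal_le_iff) (auto intro!: mult_nonneg_nonneg integral_nonneg_AE)
qed

lemma ball_mean_borel [measurable]:
 fixes w :: "'a::euclidean_space => real"
 assumes [measurable]: "w \<in> borel_measurable borel"
 shows "ball_mean h w \<in> borel_measurable borel"
proof -
 interpret prob_space "ball_unif :: 'a measure" by (rule prob_space_unit_ball)
 have "(\<lambda>x. \<integral>z. w (x + h *\<^sub>R z) \<partial>ball_unif) \<in> borel_measurable (borel :: 'a measure)"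
  by (rule borel_measurable_lebesgue_integral) measurable
 then show ?thesis by (simp add: ball_mean_def[abs_def])
qed

text \<open>Interpolating the pointwise bound and the \<open>L\<^sup>p\<close> bound of the ball means gives their
 \<open>L\<^sup>r\<close> bound.\<close>

lemma ball_mean_Lr_le:
 fixes w :: "'a::euclidean_space => real"
 assumes [measurable]: "w \<in> borel_measurable borel" and w: "\<And>x. 0 \<le> w x" "\<And>x. w x \<le> C" and p: "1 < p" "p \<le> r"
  and int: "integrable lborel (\<lambda>x. w x powr p)" and s: "s > 0"
 shows "(\<integral>\<^sup>+x. ennreal (ball_mean s w x powr r) \<partial>lborel) \<le>
   ennreal ((s powr - real DIM('a) / ball_vol TYPE('a)) powr ((r - p) / p) * (LINT x|lborel. w x powr p) powr (r / p))"
proof -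
 let ?w = "\<lambda>x z. w (x + s *\<^sub>R z) powr p" and ?e = "(r - p) / p"
 interpret B: prob_space "ball_unif :: 'a measure" by (rule prob_space_unit_ball)
 interpret P: pair_sigma_finite "lborel :: 'a measure" "ball_unif :: 'a measure"
  by (simp add: pair_sigma_finite_def sigma_finite_lborel B.sigma_finite_measure_axioms)
 define c where "c = s powr - real DIM('a) / ball_vol TYPE('a)"
 have c: "0 < c" using s ball_vol_pos[where 'a = 'a] by (simp add: c_def)
 define \<Gamma> where "\<Gamma> = (LINT x|lborel. w x powr p)"
 have \<Gamma>: "0 \<le> \<Gamma>" unfolding \<Gamma>_def by (intro integral_nonneg_AE) auto
 note le1 = ball_mean_powr_le(1)[of w C p s, OF assms(1) w p(1)]
 note le2 = ball_mean_powr_le(2)[of w C p s, OF assms(1) w p(1) s int]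
 have A0: "0 \<le> ball_mean s w x" for x unfolding ball_mean_def using w by (intro integral_nonneg_AE) auto
 have pw: "ball_mean s w x powr r \<le> (c * \<Gamma>) powr ?e * (LINT z|ball_unif. ?w x z)" for x
 proof -
  have "ball_mean s w x powr p \<le> c * \<Gamma>" using le1[of x] le2[of x] by (simp add: c_def \<Gamma>_def)
  then have "(ball_mean s w x powr p) powr ?e \<le> (c * \<Gamma>) powr ?e"
   using p by (intro powr_mono2) auto
  then have "ball_mean s w x powr (r - p) \<le> (c * \<Gamma>) powr ?e"
   using p by (simp add: powr_powr)
  then have "ball_mean s w x powr (r - p) * ball_mean s w x powr p \<le> (c * \<Gamma>) powr ?e * (LINT z|ball_unif. ?w x z)"
   using le1[of x] by (intro mult_mono) auto
  then show ?thesis by (simp add: powr_add[symmetric])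
 qed
 have "w y powr p \<le> C powr p" for y using w p by (intro powr_mono2) auto
 then have i2: "integrable ball_unif (\<lambda>z. ?w x z)" for x
  by (intro integrable_prob_bounded[OF prob_space_unit_ball, of _ "C powr p"]) auto
 have "(\<integral>\<^sup>+x. ennreal (ball_mean s w x powr r) \<partial>lborel) \<le>
   (\<integral>\<^sup>+x. ennreal ((c * \<Gamma>) powr ?e) * (\<integral>\<^sup>+z. ennreal (?w x z) \<partial>ball_unif) \<partial>lborel)"
 proof (intro nn_integral_mono)
  fix x :: 'a
  have "ennreal (ball_mean s w x powr r) \<le> ennreal ((c * \<Gamma>) powr ?e) * ennreal (LINT z|ball_unif. ?w x z)"
   using pw[of x] by (subst ennreal_mult[symmetric]) (auto intro!: integral_nonneg_AE ennreal_leI)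
  also have "ennreal (LINT z|ball_unif. ?w x z) = (\<integral>\<^sup>+z. ennreal (?w x z) \<partial>ball_unif)"
   by (rule nn_integral_eq_integral[symmetric]) (use i2 in auto)
  finally show "ennreal (ball_mean s w x powr r) \<le> ennreal ((c * \<Gamma>) powr ?e) * (\<integral>\<^sup>+z. ennreal (?w x z) \<partial>ball_unif)" .
 qed
 also have "\<dots> = ennreal ((c * \<Gamma>) powr ?e) * (\<integral>\<^sup>+x. (\<integral>\<^sup>+z. ennreal (?w x z) \<partial>ball_unif) \<partial>lborel)"
  by (rule nn_integral_cmult) measurable
 also have "(\<integral>\<^sup>+x. (\<integral>\<^sup>+z. ennreal (?w x z) \<partial>ball_unif) \<partial>lborel)
   = (\<integral>\<^sup>+z. (\<integral>\<^sup>+x. ennreal (?w x z) \<partial>lborel) \<partial>ball_unif)"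
  by (rule P.Fubini'[symmetric]) measurable
 also have "\<dots> = (\<integral>\<^sup>+z. ennreal \<Gamma> \<partial>(ball_unif :: 'a measure))"
 proof (intro nn_integral_cong)
  fix z :: 'a
  have "(\<integral>\<^sup>+x. ennreal (?w x z) \<partial>lborel) = (\<integral>\<^sup>+x. ennreal (w x powr p) \<partial>lborel)"
   by (rule nn_integral_translate[of "\<lambda>x. ennreal (w x powr p)"]) simp
  also have "\<dots> = ennreal \<Gamma>" unfolding \<Gamma>_def by (rule nn_integral_eq_integral[OF int]) simp
  finally show "(\<integral>\<^sup>+x. ennreal (?w x z) \<partial>lborel) = ennreal \<Gamma>" .
 qed
 also have "\<dots> = ennreal \<Gamma>" using B.emeasure_space_1 by simp
 also have "ennreal ((c * \<Gamma>) powr ?e) * ennreal \<Gamma> = ennreal (c powr ?e * \<Gamma> powr (r / p))"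
 proof -
  have "\<Gamma> powr ?e * \<Gamma> = \<Gamma> powr (r / p)"
  proof (cases "\<Gamma> = 0")
   case False
   then have "\<Gamma> powr ?e * \<Gamma> powr 1 = \<Gamma> powr ((r - p) / p + 1)" by (simp add: powr_add)
   moreover have "(r - p) / p + 1 = r / p" using p by (simp add: field_simps)
   ultimately show ?thesis using False \<Gamma> by simp
  qed simp
  then show ?thesis using c \<Gamma> by (simp add: ennreal_mult[symmetric] powr_mult mult.assoc)
 qed
 finally show ?thesis by (simp add: c_def \<Gamma>_def)
qed

text \<open>Reparametrising the segment by \<open>\<tau> ^ m\<close> tames the singularity of the potential estimate
 at the starting point.\<close>

lemma test_function_increment_le:
 assumes u: "u \<in> test_functions \<Omega>" and m: "1 \<le> m"
 shows "\<bar>u (y + w) - u y\<bar> \<le> (LINT \<tau>|icc_unif. real m * \<tau> ^ (m - 1) * norm w * norm (grad u (y + \<tau> ^ m *\<^sub>R w)))"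
proof -
 let ?y = "\<lambda>\<tau>. y + \<tau> ^ m *\<^sub>R w" and ?k = "\<lambda>\<tau>. real m * \<tau> ^ (m - 1) * norm w * norm (grad u (y + \<tau> ^ m *\<^sub>R w))"
 note [measurable] = test_functions_borel[OF u]
 let ?d = "\<lambda>\<tau>. grad u (?y \<tau>) \<bullet> ((real m * \<tau> ^ (m - 1)) *\<^sub>R w)"
 have deriv: "((\<lambda>\<tau>. u (?y \<tau>)) has_real_derivative ?d \<tau>) (at \<tau>)" for \<tau>
 proof -
  have "((\<lambda>\<tau>. u (?y \<tau>)) has_derivative (\<lambda>h. grad u (?y \<tau>) \<bullet> ((h * (real m * \<tau> ^ (m - 1))) *\<^sub>R w))) (at \<tau>)"
   by (rule has_derivative_compose[where f = "\<lambda>\<tau>. y + \<tau> ^ m *\<^sub>R w" and g = u, of "\<lambda>h. (h * (real m * \<tau> ^ (m - 1))) *\<^sub>R w"])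
    (auto intro!: derivative_eq_intros test_functions_has_derivative[OF u] simp: algebra_simps)
  then show ?thesis by (simp add: has_field_derivative_def mult.assoc mult_commute_abs)
 qed
 have contg: "continuous_on UNIV (\<lambda>\<tau>::real. grad u (?y \<tau>))"
  by (rule continuous_on_compose2[OF test_functions_continuous(2)[OF u, of UNIV]]) (auto intro!: continuous_intros)
 have contd: "isCont ?d \<tau>" for \<tau>
  using contg by (intro continuous_intros) (auto simp: continuous_on_eq_continuous_at)
 have int: "(LINT \<tau>|lborel. ?d \<tau> * indicator {0..1} \<tau>) = u (y + 1 ^ m *\<^sub>R w) - u (y + 0 ^ m *\<^sub>R w)"
  by (rule integral_FTC_Icc_real) (use deriv contd in auto)
 have um: "(LINT \<tau>|icc_unif. g \<tau>) = (LINT \<tau>|lborel. g \<tau> * indicator {0..1} \<tau>)" if "g \<in> borel_measurable borel" for g :: "real => real"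
 proof -
  have "icc_unif = density lborel (\<lambda>x. ennreal (indicator {0..1} x))"
   unfolding uniform_measure_def by (intro density_cong) (auto simp: indicator_def divide_ennreal_def)
  then show ?thesis using that by (simp add: integral_density mult.commute)
 qed
 have nrm: "\<bar>?d \<tau> * indicator {0..1} \<tau>\<bar> \<le> ?k \<tau> * indicator {0..1} \<tau>" for \<tau>
  using Cauchy_Schwarz_ineq2[of "grad u (?y \<tau>)" "(real m * \<tau> ^ (m - 1)) *\<^sub>R w"]
  by (auto simp: indicator_def abs_mult mult_ac)
 have "\<bar>u (y + w) - u y\<bar> = \<bar>\<integral>\<tau>. ?d \<tau> * indicator {0..1} \<tau> \<partial>lborel\<bar>"
  unfolding int using m by (simp add: power_0_left)
 also have "\<dots> \<le> (LINT \<tau>|lborel. \<bar>?d \<tau> * indicator {0..1} \<tau>\<bar>)" by (rule integral_abs_bound)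
 also have "\<dots> \<le> (LINT \<tau>|lborel. ?k \<tau> * indicator {0..1} \<tau>)"
 proof (rule integral_mono)
  have c: "continuous_on {0..1} ?d" "continuous_on {0..1} (\<lambda>\<tau>. ?k \<tau>)"
   using contg by (auto intro!: continuous_intros elim: continuous_on_subset)
  show "integrable lborel (\<lambda>\<tau>. \<bar>?d \<tau> * indicator {0..1} \<tau>\<bar>)"
   using borel_integrable_compact[OF compact_Icc c(1)] by (intro integrable_abs) (simp only: real_scaleR_def mult.commute)
  show "integrable lborel (\<lambda>\<tau>. ?k \<tau> * indicator {0..1} \<tau>)"
   using borel_integrable_compact[OF compact_Icc c(2)] by (simp only: real_scaleR_def mult.commute)
 qed (use nrm in blast)
 also have "\<dots> = (LINT \<tau>|icc_unif. ?k \<tau>)"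
  by (rule um[symmetric]) measurable
 finally show ?thesis .
qed

lemma AE_unit_interval: "AE \<tau> in icc_unif. 0 < \<tau> \<and> \<tau> \<le> 1"
proof (rule AE_uniform_measureI)
 have "AE \<tau> in lborel. \<tau> \<noteq> (0::real)" by (rule AE_lborel_singleton)
 then show "AE \<tau> in lborel. \<tau> \<in> {0..1} \<longrightarrow> 0 < \<tau> \<and> \<tau> \<le> (1::real)" by eventually_elim auto
qed auto

lemma AE_unit_ball: "AE z in ball_unif. norm (z :: 'a::euclidean_space) \<le> 1"
 by (rule AE_uniform_measureI) auto

lemma unit_interval_kernel_integrable:
 fixes g :: "real => real"
 assumes [measurable]: "g \<in> borel_measurable borel" and "\<And>\<tau>. 0 < \<tau> ==> \<tau> \<le> 1 ==> \<bar>g \<tau>\<bar> \<le> C"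
 shows "integrable icc_unif g"
proof -
 interpret prob_space icc_unif by (rule prob_space_unit_interval)
 show ?thesis
 proof (rule integrable_const_bound[where B = C])
  show "AE \<tau> in icc_unif. norm (g \<tau>) \<le> C"
   by (rule eventually_mono[OF AE_unit_interval]) (use assms in auto)
 qed measurable
qed

lemma test_function_increment_nn_le:
 assumes u: "u \<in> test_functions \<Omega>" and m: "1 \<le> m"
 shows "ennreal \<bar>u (y + w) - u y\<bar> \<le> (\<integral>\<^sup>+\<tau>. ennreal (real m * \<tau> ^ (m - 1) * norm w * norm (grad u (y + \<tau> ^ m *\<^sub>R w))) \<partial>icc_unif)"
proof -
 let ?k = "\<lambda>\<tau>. real m * \<tau> ^ (m - 1) * norm w * norm (grad u (y + \<tau> ^ m *\<^sub>R w))"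
 note [measurable] = test_functions_borel[OF u]
 obtain C where C: "\<And>x. norm (grad u x) \<le> C" using test_functions_grad_bounded[OF u] by metis
 have "integrable icc_unif (\<lambda>\<tau>. ?k \<tau>)"
 proof (rule unit_interval_kernel_integrable)
  fix \<tau> :: real assume "0 < \<tau>" "\<tau> \<le> 1"
  then have "?k \<tau> \<le> real m * 1 * norm w * C"
   using C by (intro mult_mono) (auto intro: power_le_one)
  then show "\<bar>?k \<tau>\<bar> \<le> real m * 1 * norm w * C"
   using \<open>0 < \<tau>\<close> by simp
 qed measurable
 then have "(\<integral>\<^sup>+\<tau>. ennreal (?k \<tau>) \<partial>icc_unif)
   = ennreal (LINT \<tau>|icc_unif. ?k \<tau>)"
  by (rule nn_integral_eq_integral) (use AE_unit_interval in \<open>auto elim!: eventually_mono\<close>)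
 then show ?thesis using test_function_increment_le[OF u m, of y w] by (simp add: ennreal_leI)
qed

lemma sigma_finite_unit: "sigma_finite_measure icc_unif" "sigma_finite_measure (ball_unif :: 'a::euclidean_space measure)"
 using prob_space_unit_interval prob_space_unit_ball
 by (auto intro: prob_space_imp_sigma_finite)

lemma ball_mean_diff_nn_le:
 fixes u :: "'a::euclidean_space => real"
 assumes [measurable]: "u \<in> borel_measurable borel" and "\<And>x. \<bar>u x\<bar> \<le> C"
 shows "ennreal \<bar>ball_mean h u x - ball_mean k u y\<bar> \<le> (\<integral>\<^sup>+z. ennreal \<bar>u (x + h *\<^sub>R z) - u (y + k *\<^sub>R z)\<bar> \<partial>ball_unif)"
proof -
 have i: "integrable ball_unif (\<lambda>z. u (x + h *\<^sub>R z))" for x h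
  by (rule integrable_prob_bounded[OF prob_space_unit_ball, of _ C]) (use assms in auto)
 have "ball_mean h u x - ball_mean k u y = (LINT z|ball_unif. u (x + h *\<^sub>R z) - u (y + k *\<^sub>R z))"
  unfolding ball_mean_def using i by simp
 then have "ennreal \<bar>ball_mean h u x - ball_mean k u y\<bar> \<le> ennreal (LINT z|ball_unif. \<bar>u (x + h *\<^sub>R z) - u (y + k *\<^sub>R z)\<bar>)"
  by (auto intro!: ennreal_leI integral_abs_bound)
 also have "\<dots> = (\<integral>\<^sup>+z. ennreal \<bar>u (x + h *\<^sub>R z) - u (y + k *\<^sub>R z)\<bar> \<partial>ball_unif)"
  using i by (intro nn_integral_eq_integral[symmetric]) auto
 finally show ?thesis .
qed

lemma ball_mean_0: "ball_mean 0 u x = u x"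
proof -
 interpret prob_space "ball_unif :: 'a measure" by (rule prob_space_unit_ball)
 show ?thesis using prob_space by (simp add: ball_mean_def)
qed

lemma ball_mean_bounds:
 fixes w :: "'a::euclidean_space => real"
 assumes [measurable]: "w \<in> borel_measurable borel" and "\<And>x. 0 \<le> w x" "\<And>x. w x \<le> C"
 shows "0 \<le> ball_mean s w x" "ball_mean s w x \<le> C"
  "(\<integral>\<^sup>+z. ennreal (w (x + s *\<^sub>R z)) \<partial>ball_unif) = ennreal (ball_mean s w x)"
proof -
 interpret prob_space "ball_unif :: 'a measure" by (rule prob_space_unit_ball)
 have i: "integrable ball_unif (\<lambda>z. w (x + s *\<^sub>R z))"
  by (rule integrable_prob_bounded[OF prob_space_unit_ball, of _ C]) (use assms in auto)
 show "0 \<le> ball_mean s w x" using assms by (auto simp: ball_mean_def intro!: integral_nonneg_AE)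
 have "ball_mean s w x \<le> (\<integral>z. C \<partial>(ball_unif :: 'a measure))"
  unfolding ball_mean_def by (rule integral_mono) (use assms i in auto)
 then show "ball_mean s w x \<le> C" using prob_space by simp
 show "(\<integral>\<^sup>+z. ennreal (w (x + s *\<^sub>R z)) \<partial>ball_unif) = ennreal (ball_mean s w x)"
  unfolding ball_mean_def using i assms by (intro nn_integral_eq_integral) auto
qed

text \<open>The increments along the segments from x to x + h z are averaged over z before the
  parameter is integrated. This turns the gradient at parameter \<open>\<tau>\<close> into a ball
  mean of radius \<open>\<tau> ^ m * h\<close>; Jensen's inequality in \<open>\<tau>\<close> then
  takes the power inside.\<close>

lemma ball_mean_error_powr:
 assumes u: "u \<in> test_functions \<Omega>" and m: "1 \<le> m" and h: "0 < h" and r: "1 < r"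
 shows "ennreal (\<bar>u x - ball_mean h u x\<bar> powr r) \<le>
   (\<integral>\<^sup>+\<tau>. ennreal ((real m * \<tau> ^ (m - 1) * h) powr r * ball_mean (\<tau> ^ m * h) (\<lambda>x. norm (grad u x)) x powr r) \<partial>icc_unif)"
proof -
 let ?k = "\<lambda>\<tau>. real m * \<tau> ^ (m - 1)" and ?x = "\<lambda>\<tau> z. x + (\<tau> ^ m * h) *\<^sub>R z"
 note [measurable] = test_functions_borel[OF u]
 obtain C where C: "\<And>x. \<bar>u x\<bar> \<le> C" "\<And>x. norm (grad u x) \<le> C" using test_functions_grad_bounded[OF u] by metis
 let ?G = "\<lambda>x. norm (grad u x)"
 let ?X = "\<lambda>\<tau>. ?k \<tau> * h * ball_mean (\<tau> ^ m * h) ?G x"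
 interpret P: pair_sigma_finite "ball_unif :: 'a measure" icc_unif
  by (simp add: pair_sigma_finite_def sigma_finite_unit)
 interpret T: prob_space icc_unif by (rule prob_space_unit_interval)
 interpret B: prob_space "ball_unif :: 'a measure" by (rule prob_space_unit_ball)
 have bm: "0 \<le> ball_mean s ?G x" "ball_mean s ?G x \<le> C"
  "(\<integral>\<^sup>+z. ennreal (?G (x + s *\<^sub>R z)) \<partial>ball_unif) = ennreal (ball_mean s ?G x)" for s
  using ball_mean_bounds[where w = ?G and C = C and s = s and x = x] C(2) by auto
 have Xb: "0 \<le> ?X \<tau>" "?X \<tau> \<le> real m * 1 * h * C" if "0 < \<tau>" "\<tau> \<le> 1" for \<tau>
 proof -
  have "\<tau> ^ (m - 1) \<le> 1" using that by (intro power_le_one) auto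
  then show "?X \<tau> \<le> real m * 1 * h * C"
   using bm that h by (intro mult_mono mult_left_mono) auto
  show "0 \<le> ?X \<tau>" using bm that h by simp
 qed
 have AE0: "AE \<tau> in icc_unif. 0 \<le> ?X \<tau>"
  by (rule eventually_mono[OF AE_unit_interval]) (use Xb in blast)
 have Xm: "?X \<in> borel_measurable borel"
  unfolding ball_mean_def by measurable
 have Xi: "integrable icc_unif ?X"
  by (rule unit_interval_kernel_integrable[OF Xm, of "real m * 1 * h * C"]) (use Xb in \<open>auto simp: abs_of_nonneg\<close>)
 have Xpb: "?X \<tau> powr r \<le> (real m * 1 * h * C) powr r" if "0 < \<tau>" "\<tau> \<le> 1" for \<tau>
  using Xb[OF that] r by (intro powr_mono2) auto
 have Xpi: "integrable icc_unif (\<lambda>\<tau>. ?X \<tau> powr r)"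
  using Xm by (intro unit_interval_kernel_integrable[of _ "(real m * 1 * h * C) powr r"]) (use Xpb in auto)
 have "ennreal \<bar>u x - ball_mean h u x\<bar> \<le> (\<integral>\<^sup>+z. ennreal \<bar>u (x + h *\<^sub>R z) - u x\<bar> \<partial>ball_unif)"
  using ball_mean_diff_nn_le[where u = u and C = C and h = 0 and k = h and x = x and y = x] C(1) by (simp add: ball_mean_0 abs_minus_commute)
 also have "\<dots> \<le> (\<integral>\<^sup>+z. \<integral>\<^sup>+\<tau>. ennreal (?k \<tau> * h) * ennreal (?G (?x \<tau> z)) \<partial>icc_unif \<partial>ball_unif)"
 proof (rule nn_integral_mono_AE, use AE_unit_ball in eventually_elim)
  fix z :: 'a assume z: "norm z \<le> 1"
  have "ennreal \<bar>u (x + h *\<^sub>R z) - u x\<bar> \<le> (\<integral>\<^sup>+\<tau>. ennreal (?k \<tau> * norm (h *\<^sub>R z) * ?G (x + \<tau> ^ m *\<^sub>R (h *\<^sub>R z))) \<partial>icc_unif)"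
   by (rule test_function_increment_nn_le[OF u m])
  also have "\<dots> \<le> (\<integral>\<^sup>+\<tau>. ennreal (?k \<tau> * h) * ennreal (?G (?x \<tau> z)) \<partial>icc_unif)"
  proof (rule nn_integral_mono_AE, use AE_unit_interval in eventually_elim)
   fix \<tau> :: real assume \<tau>: "0 < \<tau> \<and> \<tau> \<le> 1"
   have "norm (h *\<^sub>R z) \<le> h" using z h by (simp add: mult_left_le)
   then have "?k \<tau> * norm (h *\<^sub>R z) * ?G (x + \<tau> ^ m *\<^sub>R (h *\<^sub>R z)) \<le> ?k \<tau> * h * ?G (?x \<tau> z)"
    using \<tau> h by (auto intro!: mult_mono)
   then show "ennreal (?k \<tau> * norm (h *\<^sub>R z) * ?G (x + \<tau> ^ m *\<^sub>R (h *\<^sub>R z))) \<le> ennreal (?k \<tau> * h) * ennreal (?G (?x \<tau> z))"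
    using \<tau> h by (subst ennreal_mult[symmetric]) (auto intro!: ennreal_leI)
  qed
  finally show "ennreal \<bar>u (x + h *\<^sub>R z) - u x\<bar> \<le> (\<integral>\<^sup>+\<tau>. ennreal (?k \<tau> * h) * ennreal (?G (?x \<tau> z)) \<partial>icc_unif)" .
 qed
 also have "\<dots> = (\<integral>\<^sup>+\<tau>. \<integral>\<^sup>+z. ennreal (?k \<tau> * h) * ennreal (?G (?x \<tau> z)) \<partial>ball_unif \<partial>icc_unif)"
  by (rule P.Fubini'[symmetric]) measurable
 also have "\<dots> = (\<integral>\<^sup>+\<tau>. ennreal (?X \<tau>) \<partial>icc_unif)"
 proof (rule nn_integral_cong_AE, use AE_unit_interval in eventually_elim)
  fix \<tau> :: real assume \<tau>: "0 < \<tau> \<and> \<tau> \<le> 1"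
  show "(\<integral>\<^sup>+z. ennreal (?k \<tau> * h) * ennreal (?G (?x \<tau> z)) \<partial>ball_unif) = ennreal (?X \<tau>)"
   using \<tau> h bm by (subst nn_integral_cmult) (auto simp: ennreal_mult[symmetric])
 qed
 also have "\<dots> = ennreal (LINT \<tau>|icc_unif. ?X \<tau>)"
  by (rule nn_integral_eq_integral[OF Xi AE0])
 finally have le: "\<bar>u x - ball_mean h u x\<bar> \<le> (LINT \<tau>|icc_unif. ?X \<tau>)"
  using AE0 by (subst (asm) ennreal_le_iff) (auto intro!: integral_nonneg_AE)
 then have "\<bar>u x - ball_mean h u x\<bar> powr r \<le> (LINT \<tau>|icc_unif. ?X \<tau>) powr r"
  using r by (intro powr_mono2) auto
 also have "\<dots> \<le> (LINT \<tau>|icc_unif. ?X \<tau> powr r)"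
  by (rule T.jensen_powr[OF Xi AE0 Xpi r])
 finally have "ennreal (\<bar>u x - ball_mean h u x\<bar> powr r) \<le> ennreal (LINT \<tau>|icc_unif. ?X \<tau> powr r)"
  by (rule ennreal_leI)
 also have "\<dots> = (\<integral>\<^sup>+\<tau>. ennreal (?X \<tau> powr r) \<partial>icc_unif)"
  by (rule nn_integral_eq_integral[symmetric, OF Xpi]) simp
 also have "\<dots> = (\<integral>\<^sup>+\<tau>. ennreal ((?k \<tau> * h) powr r * ball_mean (\<tau> ^ m * h) ?G x powr r) \<partial>icc_unif)"
  by (rule nn_integral_cong_AE, use AE_unit_interval in eventually_elim) (use h bm in \<open>simp add: powr_mult\<close>)
 finally show ?thesis .
qed

lemma test_functions_powr_integrable:
 assumes u: "u \<in> test_functions \<Omega>" and p: "0 < p"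
 shows "integrable lborel (\<lambda>x. norm (grad u x) powr p)" "integrable lborel (\<lambda>x. \<bar>u x\<bar> powr p)"
proof -
 note [measurable] = test_functions_borel[OF u]
 obtain K where K: "compact K" "\<And>x. x \<notin> K ==> u x = 0" "\<And>x. x \<notin> K ==> grad u x = 0"
  using test_functionsE[OF u] by metis
 obtain C where C: "\<And>x. \<bar>u x\<bar> \<le> C" "\<And>x. norm (grad u x) \<le> C" using test_functions_grad_bounded[OF u] by metis
 show "integrable lborel (\<lambda>x. norm (grad u x) powr p)"
  by (rule integrable_lborel_bounded_support[where C = "C powr p" and K = K])
   (use K C p compact_imp_bounded in \<open>auto intro: powr_mono2\<close>)
 show "integrable lborel (\<lambda>x. \<bar>u x\<bar> powr p)"
  by (rule integrable_lborel_bounded_support[where C = "C powr p" and K = K])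
   (use K C p compact_imp_bounded in \<open>auto intro: powr_mono2\<close>)
qed

text \<open>The exponent in the hypothesis is positive exactly for subcritical r. It is the power of
  h left over when the L^r bound for ball means of radius \<open>\<tau> ^ m * h\<close> is inserted.
  The same bound leaves a power of \<open>\<tau>\<close>, which has to have nonnegative exponent to
  be harmless.\<close>

lemma ball_mean_error_Lr:
 fixes u :: "'a::euclidean_space => real"
 assumes p: "1 < p" "p \<le> r" and \<gamma>: "0 < r - real DIM('a) * (r - p) / p"
 obtains K where "0 \<le> K" "\<And>u h. u \<in> test_functions \<Omega> ==> 0 < h ==>
   (\<integral>\<^sup>+x. ennreal (\<bar>u x - ball_mean h u x\<bar> powr r) \<partial>lborel) \<le>
    ennreal (K * h powr (r - real DIM('a) * (r - p) / p) * (LINT x|lborel. norm (grad u x :: 'a) powr p) powr (r / p))"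
proof -
 let ?k = "\<lambda>\<tau> m h. (real m * \<tau> ^ (m - 1) * h) powr r" and ?e = "(r - p) / p"
 define N where "N = real DIM('a)"
 define \<gamma> where "\<gamma> = r - N * (r - p) / p"
 have \<gamma>0: "0 < \<gamma>" using \<gamma> by (simp add: \<gamma>_def N_def)
 \<comment> \<open>The exponent of \<open>\<tau>\<close> will be m \<gamma> - r, which is
   nonnegative for such \<open>m\<close>.\<close>
 obtain m :: nat where m: "r / \<gamma> < real m" using reals_Archimedean2 by blast
 have m1: "1 \<le> m" using m p \<gamma>0 by (cases m) (auto simp: field_simps)
 have mexp: "0 \<le> real (m - 1) * r - real m * (N * (r - p) / p)"
 proof -
  have "r \<le> real m * \<gamma>" using m \<gamma>0 by (simp add: field_simps)
  then show ?thesis using m1 by (simp add: \<gamma>_def of_nat_diff algebra_simps)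
 qed
 define V where "V = ball_vol TYPE('a)"
 have V: "0 < V" unfolding V_def by (rule ball_vol_pos)
 have powr_mult3: "(x * y * z) powr e = x powr e * y powr e * z powr e" if "0 \<le> x" "0 \<le> y" "0 \<le> z" for x y z e :: real
  using that by (simp add: powr_mult)
 define K where "K = real m powr r * V powr (- (r - p) / p)"
 show thesis
 proof (rule that[of K])
  show "0 \<le> K" by (simp add: K_def)
  fix u :: "'a => real" and h :: real assume u: "u \<in> test_functions \<Omega>" and h: "0 < h"
  note [measurable] = test_functions_borel[OF u]
  let ?G = "\<lambda>x. norm (grad u x)"
  obtain C where C: "\<And>x. ?G x \<le> C" using test_functions_grad_bounded[OF u] by metis
  define \<Gamma> where "\<Gamma> = (LINT x|lborel. ?G x powr p)"
  interpret P: pair_sigma_finite "lborel :: 'a measure" icc_unif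
   by (simp add: pair_sigma_finite_def sigma_finite_unit sigma_finite_lborel)
  interpret T: prob_space icc_unif by (rule prob_space_unit_interval)
  interpret B: prob_space "ball_unif :: 'a measure" by (rule prob_space_unit_ball)
  have "(\<integral>\<^sup>+x. ennreal (\<bar>u x - ball_mean h u x\<bar> powr r) \<partial>lborel) \<le>
    (\<integral>\<^sup>+x. (\<integral>\<^sup>+\<tau>. ennreal (?k \<tau> m h * ball_mean (\<tau> ^ m * h) ?G x powr r) \<partial>icc_unif) \<partial>lborel)"
   by (intro nn_integral_mono ball_mean_error_powr[OF u m1 h]) (use p in auto)
  also have "\<dots> = (\<integral>\<^sup>+\<tau>. (\<integral>\<^sup>+x. ennreal (?k \<tau> m h * ball_mean (\<tau> ^ m * h) ?G x powr r) \<partial>lborel) \<partial>icc_unif)"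
   by (rule P.Fubini'[symmetric]) (unfold ball_mean_def, measurable)
  also have "\<dots> \<le> (\<integral>\<^sup>+\<tau>. ennreal (K * h powr \<gamma> * \<Gamma> powr (r / p)) \<partial>icc_unif)"
  proof (rule nn_integral_mono_AE, use AE_unit_interval in eventually_elim)
   fix \<tau> :: real assume \<tau>: "0 < \<tau> \<and> \<tau> \<le> 1"
   define s where "s = \<tau> ^ m * h"
   have s: "0 < s" using \<tau> h by (simp add: s_def)
   have "(\<integral>\<^sup>+x. ennreal (?k \<tau> m h * ball_mean s ?G x powr r) \<partial>lborel)
    = ennreal (?k \<tau> m h) * (\<integral>\<^sup>+x. ennreal (ball_mean s ?G x powr r) \<partial>lborel)"
    by (subst nn_integral_cmult[symmetric]) (auto simp: ennreal_mult)
   also have "\<dots> \<le> ennreal (?k \<tau> m h) * ennreal ((s powr - N / V) powr ?e * \<Gamma> powr (r / p))"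
    unfolding N_def V_def \<Gamma>_def
    by (intro mult_left_mono ball_mean_Lr_le[OF _ _ C p test_functions_powr_integrable(1)[OF u] s]) (use p in auto)
   also have "\<dots> = ennreal (?k \<tau> m h * ((s powr - N / V) powr ?e * \<Gamma> powr (r / p)))"
    by (rule ennreal_mult[symmetric]) auto
   also have "\<dots> \<le> ennreal (K * h powr \<gamma> * \<Gamma> powr (r / p))"
   proof (rule ennreal_leI)
    have "?k \<tau> m h = real m powr r * \<tau> powr (real (m - 1) * r) * h powr r"
     using \<tau> h by (simp add: powr_mult powr_realpow[symmetric] powr_powr)
    moreover have "(s powr - N / V) powr ?e = \<tau> powr (- real m * (N * (r - p) / p)) * h powr (- N * (r - p) / p) * V powr (- (r - p) / p)"
    proof -
     have "s powr - N / V = \<tau> powr (- real m * N) * h powr - N * V powr - 1"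
      using \<tau> h V by (simp add: s_def powr_mult powr_realpow[symmetric] powr_powr powr_minus divide_inverse)
     also have "\<dots> powr ?e = \<tau> powr (- real m * N * ?e) * h powr (- N * ?e) * V powr (- 1 * ?e)"
      unfolding powr_mult3[OF powr_ge_zero powr_ge_zero powr_ge_zero] powr_powr ..
     finally show ?thesis by (simp add: mult.assoc)
    qed
    ultimately have "?k \<tau> m h * ((s powr - N / V) powr ?e * \<Gamma> powr (r / p)) =
      K * (h powr r * h powr (- N * (r - p) / p)) * \<Gamma> powr (r / p) * (\<tau> powr (real (m - 1) * r) * \<tau> powr (- real m * (N * (r - p) / p)))"
     by (simp add: K_def mult_ac)
    also have "h powr r * h powr (- N * (r - p) / p) = h powr \<gamma>" by (simp add: powr_add[symmetric] \<gamma>_def)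
    also have "\<tau> powr (real (m - 1) * r) * \<tau> powr (- real m * (N * (r - p) / p)) = \<tau> powr (real (m - 1) * r - real m * (N * (r - p) / p))"
     by (simp add: powr_add[symmetric])
    also have "K * h powr \<gamma> * \<Gamma> powr (r / p) * \<tau> powr (real (m - 1) * r - real m * (N * (r - p) / p)) \<le> K * h powr \<gamma> * \<Gamma> powr (r / p) * 1"
     using \<tau> mexp by (intro mult_left_mono powr_le1) (auto simp: K_def)
    finally show "?k \<tau> m h * ((s powr - N / V) powr ?e * \<Gamma> powr (r / p)) \<le> K * h powr \<gamma> * \<Gamma> powr (r / p)" by simp
   qed
   finally show "(\<integral>\<^sup>+x. ennreal (?k \<tau> m h * ball_mean (\<tau> ^ m * h) ?G x powr r) \<partial>lborel) \<le> ennreal (K * h powr \<gamma> * \<Gamma> powr (r / p))"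
    by (simp add: s_def)
  qed
  also have "\<dots> = ennreal (K * h powr \<gamma> * \<Gamma> powr (r / p))" using T.emeasure_space_1 by simp
  finally show "(\<integral>\<^sup>+x. ennreal (\<bar>u x - ball_mean h u x\<bar> powr r) \<partial>lborel) \<le>
    ennreal (K * h powr (r - real DIM('a) * (r - p) / p) * (LINT x|lborel. norm (grad u x) powr p) powr (r / p))"
   by (simp add: \<gamma>_def \<Gamma>_def N_def)
 qed
qed

text \<open>The difference of the means at two centres is bounded by an integral of ball means of
  the gradient along the segment between the centres, and each of these is controlled by the
  p-energy through Jensen's inequality.\<close>

lemma ball_mean_Lipschitz:
 fixes u :: "'a::euclidean_space => real"
 assumes u: "u \<in> test_functions \<Omega>" and p: "1 < p" and h: "0 < h"
 shows "\<bar>ball_mean h u x - ball_mean h u y\<bar> \<le> norm (x - y) *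
  (h powr - real DIM('a) / ball_vol TYPE('a) * (LINT x|lborel. norm (grad u x) powr p)) powr (1 / p)"
proof -
 let ?y = "\<lambda>\<tau>. y + \<tau> *\<^sub>R (x - y)"
 note [measurable] = test_functions_borel[OF u]
 obtain C where C: "\<And>x. \<bar>u x\<bar> \<le> C" "\<And>x. norm (grad u x) \<le> C" using test_functions_grad_bounded[OF u] by metis
 let ?G = "\<lambda>x. norm (grad u x)"
 let ?B = "h powr - real DIM('a) / ball_vol TYPE('a) * (LINT x|lborel. norm (grad u x) powr p)"
 interpret P: pair_sigma_finite "ball_unif :: 'a measure" icc_unif
  by (simp add: pair_sigma_finite_def sigma_finite_unit)
 interpret T: prob_space icc_unif by (rule prob_space_unit_interval)
 interpret B: prob_space "ball_unif :: 'a measure" by (rule prob_space_unit_ball)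
 have bm: "0 \<le> ball_mean h ?G x" "(\<integral>\<^sup>+z. ennreal (?G (x + h *\<^sub>R z)) \<partial>ball_unif) = ennreal (ball_mean h ?G x)" for x
  using ball_mean_bounds[where w = ?G and C = C and s = h and x = x] C(2) by auto
 have le: "ball_mean h ?G x \<le> ?B powr (1 / p)" for x
 proof -
  have "ball_mean h ?G x powr p \<le> ?B"
   using ball_mean_powr_le(1)[where w = ?G and C = C and p = p and s = h and x = x] ball_mean_powr_le(2)[where w = ?G and C = C and p = p and s = h and x = x] C(2) p h test_functions_powr_integrable(1)[OF u, of p]
   by simp
  then have "(ball_mean h ?G x powr p) powr (1 / p) \<le> ?B powr (1 / p)" using p by (intro powr_mono2) auto
  then show ?thesis using p bm by (simp add: powr_powr)
 qed
 have "ennreal \<bar>ball_mean h u x - ball_mean h u y\<bar> \<le> (\<integral>\<^sup>+z. ennreal \<bar>u (x + h *\<^sub>R z) - u (y + h *\<^sub>R z)\<bar> \<partial>ball_unif)"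
  by (rule ball_mean_diff_nn_le) (use C in auto)
 also have "\<dots> \<le> (\<integral>\<^sup>+z. \<integral>\<^sup>+\<tau>. ennreal (norm (x - y)) * ennreal (?G (?y \<tau> + h *\<^sub>R z)) \<partial>icc_unif \<partial>ball_unif)"
 proof (rule nn_integral_mono)
  fix z :: 'a
  have "ennreal \<bar>u ((y + h *\<^sub>R z) + (x - y)) - u (y + h *\<^sub>R z)\<bar> \<le> (\<integral>\<^sup>+\<tau>. ennreal (real 1 * \<tau> ^ (1 - 1) * norm (x - y) * ?G ((y + h *\<^sub>R z) + \<tau> ^ 1 *\<^sub>R (x - y))) \<partial>icc_unif)"
   by (rule test_function_increment_nn_le[OF u]) simp
  then show "ennreal \<bar>u (x + h *\<^sub>R z) - u (y + h *\<^sub>R z)\<bar> \<le> (\<integral>\<^sup>+\<tau>. ennreal (norm (x - y)) * ennreal (?G (?y \<tau> + h *\<^sub>R z)) \<partial>icc_unif)"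
   by (simp add: ennreal_mult[symmetric] algebra_simps)
 qed
 also have "\<dots> = (\<integral>\<^sup>+\<tau>. \<integral>\<^sup>+z. ennreal (norm (x - y)) * ennreal (?G (?y \<tau> + h *\<^sub>R z)) \<partial>ball_unif \<partial>icc_unif)"
  by (rule P.Fubini'[symmetric]) measurable
 also have "\<dots> \<le> (\<integral>\<^sup>+\<tau>. ennreal (norm (x - y) * ?B powr (1 / p)) \<partial>icc_unif)"
 proof (rule nn_integral_mono)
  fix \<tau> :: real
  have "(\<integral>\<^sup>+z. ennreal (norm (x - y)) * ennreal (?G (?y \<tau> + h *\<^sub>R z)) \<partial>ball_unif)
   = ennreal (norm (x - y)) * ennreal (ball_mean h ?G (?y \<tau>))"
   by (subst nn_integral_cmult) (auto simp: bm)
  also have "\<dots> = ennreal (norm (x - y) * ball_mean h ?G (?y \<tau>))"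
   by (rule ennreal_mult[symmetric]) (use bm in auto)
  also have "\<dots> \<le> ennreal (norm (x - y) * ?B powr (1 / p))"
   by (intro ennreal_leI mult_left_mono le) auto
  finally show "(\<integral>\<^sup>+z. ennreal (norm (x - y)) * ennreal (?G (?y \<tau> + h *\<^sub>R z)) \<partial>ball_unif)
   \<le> ennreal (norm (x - y) * ?B powr (1 / p))" .
 qed
 also have "\<dots> = ennreal (norm (x - y) * ?B powr (1 / p))" using T.emeasure_space_1 by simp
 finally show ?thesis by (subst (asm) ennreal_le_iff) auto
qed

text \<open>This contains the Sobolev inequality, the Rellich compactness theorem and the decay of the
 embedding constant on subspaces of large finite codimension.\<close>

theorem sobolev_rellich:
 fixes \<Omega> :: "'a::euclidean_space set"
 assumes \<Omega>: "open \<Omega>" "bounded \<Omega>" and p: "1 < p" "p \<le> r" and \<gamma>: "0 < r - real DIM('a) * (r - p) / p" and \<epsilon>: "0 < \<epsilon>"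
 obtains k :: nat and l :: "nat => ('a => real) => real" and C where "0 \<le> C"
  "\<And>i u v c d. u \<in> test_functions \<Omega> ==> v \<in> test_functions \<Omega> ==> l i (\<lambda>x. c * u x + d * v x) = c * l i u + d * l i v"
  "\<And>i u. i < k ==> u \<in> test_functions \<Omega> ==> \<bar>l i u\<bar> powr p \<le> C * (LINT x|lborel. norm (grad u x) powr p)"
  "\<And>u. u \<in> test_functions \<Omega> ==> (LINT x|lborel. \<bar>u x\<bar> powr r) \<le>
    \<epsilon> * (LINT x|lborel. norm (grad u x) powr p) powr (r / p) + C * (\<Sum>i<k. \<bar>l i u\<bar> powr r)"
proof -
 let ?A = "\<lambda>u::'a => real. \<integral>x. norm (grad u x) powr p \<partial>lborel"
 define N where "N = real DIM('a)"
 define \<gamma>' where "\<gamma>' = r - N * (r - p) / p"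
 have \<gamma>': "0 < \<gamma>'" using \<gamma> by (simp add: \<gamma>'_def N_def)
 define V where "V = ball_vol TYPE('a)"
 have V: "0 < V" unfolding V_def by (rule ball_vol_pos)
 obtain K where K: "0 \<le> K" "\<And>u h. u \<in> test_functions \<Omega> ==> 0 < h ==>
   (\<integral>\<^sup>+x. ennreal (\<bar>u x - ball_mean h u x\<bar> powr r) \<partial>lborel) \<le>
    ennreal (K * h powr \<gamma>' * ?A u powr (r / p))"
  by (rule ball_mean_error_Lr[OF p \<gamma>, of \<Omega>, folded N_def, folded \<gamma>'_def]) (rule that)
 \<comment> \<open>The radius at which replacing a function by its ball means costs at most half of
   \<open>\<epsilon>\<close>, including the factor 2^r of the power inequality; the summand 1 covers
   K = 0.\<close>
 define h where "h = (\<epsilon> / (2 * 2 powr r * (K + 1))) powr (1 / \<gamma>')"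
 have h: "0 < h" using \<epsilon> K(1) by (simp add: h_def)
 have hK: "2 powr r * (K * h powr \<gamma>') \<le> \<epsilon> / 2"
 proof -
  have "h powr \<gamma>' = \<epsilon> / (2 * 2 powr r * (K + 1))" using \<gamma>' \<epsilon> K(1) by (simp add: h_def powr_powr)
  then have "2 powr r * (K * h powr \<gamma>') = \<epsilon> / 2 * (K / (K + 1))" using K(1) by (simp only:) (simp add: divide_simps)
  also have "\<dots> \<le> \<epsilon> / 2 * 1" using \<epsilon> K(1) by (intro mult_left_mono) auto
  finally show ?thesis by simp
 qed
 define b where "b = h powr - N / V"
 have b: "0 < b" using h V by (simp add: b_def)
 define W where "W = measure lborel \<Omega>"
 have fin: "emeasure lborel \<Omega> = ennreal W" unfolding W_def
  using emeasure_bounded_finite[OF \<Omega>(2)] by (intro emeasure_eq_ennreal_measure) auto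
 have W: "0 \<le> W" by (simp add: W_def)
 define Q where "Q = W * 2 powr r * 2 powr r"
 have Q: "0 \<le> Q" using W by (simp add: Q_def)
 \<comment> \<open>The mesh of the net: over this distance the ball means vary so little that
   integration over \<open>\<Omega>\<close> costs the other half of
   \<open>\<epsilon>\<close>.\<close>
 define \<delta> where "\<delta> = (\<epsilon> / (2 * (Q * b powr (r / p) + 1))) powr (1 / r)"
 have den: "0 < Q * b powr (r / p) + 1" using Q by (simp add: add_nonneg_pos)
 have \<delta>: "0 < \<delta>" using \<epsilon> den by (simp add: \<delta>_def)
 have \<delta>Q: "Q * (\<delta> powr r * b powr (r / p)) \<le> \<epsilon> / 2"
 proof -
  have "\<delta> powr r = \<epsilon> / (2 * (Q * b powr (r / p) + 1))" using p \<epsilon> den by (simp add: \<delta>_def powr_powr)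
  then have "Q * (\<delta> powr r * b powr (r / p)) = \<epsilon> / (2 * (Q * b powr (r / p) + 1)) * (Q * b powr (r / p))"
   by (simp only: mult_ac)
  also have "\<dots> = \<epsilon> / 2 * (Q * b powr (r / p) / (Q * b powr (r / p) + 1))" by simp
  also have "\<dots> \<le> \<epsilon> / 2 * 1" using \<epsilon> Q den by (intro mult_left_mono) (auto simp: divide_le_eq_1)
  finally show ?thesis by simp
 qed
 have "compact (closure \<Omega>)" using \<Omega>(2) by simp
 with \<delta> obtain F where F: "finite F" "closure \<Omega> \<subseteq> (\<Union>x\<in>F. ball x \<delta>)"
  unfolding compact_eq_totally_bounded by blast
 obtain xs where xs: "set xs = F" using finite_list[OF F(1)] by blast
 define k where "k = length xs"
 define l where "l = (\<lambda>i u. ball_mean h u (xs ! i))"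
 obtain R where R: "0 < R" "\<And>x. x \<in> \<Omega> ==> norm x \<le> R" using \<Omega>(2) by (auto simp: bounded_pos)
 \<comment> \<open>The ball of radius \<open>h\<close> about \<open>y0\<close> misses
   \<open>\<Omega>\<close>, so the ball means of test functions vanish there. The Lipschitz estimate
   against \<open>y0\<close> then bounds each functional by the p-energy.\<close>
 obtain y0 :: 'a where y0: "norm y0 = R + h + 1" using vector_choose_size[of "R + h + 1"] R(1) h by auto
 define D where "D = (\<Sum>x\<in>F. norm (x - y0) powr p)"
 show thesis
 proof (rule that[of "max (b * D) Q" l k])
  show "0 \<le> max (b * D) Q" using Q by simp
 next
  fix i u v and c d :: real assume u: "u \<in> test_functions \<Omega>" and v: "v \<in> test_functions \<Omega>"
  note [measurable] = test_functions_borel[OF u] test_functions_borel[OF v]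
  obtain A where A: "\<And>x. \<bar>u x\<bar> \<le> A" using test_functions_grad_bounded[OF u] by metis
  obtain B where B: "\<And>x. \<bar>v x\<bar> \<le> B" using test_functions_grad_bounded[OF v] by metis
  have "integrable ball_unif (\<lambda>z. u (x + h *\<^sub>R z))" "integrable ball_unif (\<lambda>z. v (x + h *\<^sub>R z))" for x
   by (rule integrable_prob_bounded[OF prob_space_unit_ball, of _ A]; use A in simp)
     (rule integrable_prob_bounded[OF prob_space_unit_ball, of _ B]; use B in simp)
  then show "l i (\<lambda>x. c * u x + d * v x) = c * l i u + d * l i v"
   by (simp add: l_def ball_mean_def)
 next
  fix i u assume i: "i < k" and u: "u \<in> test_functions \<Omega>"
  note [measurable] = test_functions_borel[OF u]
  obtain L where L: "L \<subseteq> \<Omega>" "\<And>x. x \<notin> L ==> u x = 0" using test_functionsE[OF u] by metis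
  have "u (y0 + h *\<^sub>R z) = 0" if "norm z \<le> 1" for z
  proof -
   have "norm (h *\<^sub>R z) \<le> h" using that h by (simp add: mult_left_le)
   then have "R < norm (y0 + h *\<^sub>R z)" using norm_triangle_ineq4[of "y0 + h *\<^sub>R z" "h *\<^sub>R z"] y0 by simp
   then show ?thesis using L R(2) by force
  qed
  then have far: "ball_mean h u y0 = 0"
   unfolding ball_mean_def by (intro integral_eq_zero_AE eventually_mono[OF AE_unit_ball])
  define \<Gamma> where "\<Gamma> = ?A u"
  have \<Gamma>: "0 \<le> \<Gamma>" unfolding \<Gamma>_def by (intro integral_nonneg_AE) auto
  have "\<bar>l i u\<bar> \<le> norm (xs ! i - y0) * (b * \<Gamma>) powr (1 / p)"
   using ball_mean_Lipschitz[OF u p(1) h, of "xs ! i" y0] by (simp add: far l_def b_def N_def V_def \<Gamma>_def)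
  then have "\<bar>l i u\<bar> powr p \<le> (norm (xs ! i - y0) * (b * \<Gamma>) powr (1 / p)) powr p" using p by (intro powr_mono2) auto
  also have "\<dots> = norm (xs ! i - y0) powr p * (b * \<Gamma>)" using p b \<Gamma> by (simp add: powr_mult powr_powr)
  also have "\<dots> \<le> max (b * D) Q * \<Gamma>"
  proof -
   have "norm (xs ! i - y0) powr p \<le> D" unfolding D_def by (rule member_le_sum) (use F xs i in \<open>auto simp: k_def\<close>)
   then have "norm (xs ! i - y0) powr p * (b * \<Gamma>) \<le> D * (b * \<Gamma>)" using b \<Gamma> by (intro mult_right_mono) auto
   also have "\<dots> = (b * D) * \<Gamma>" by simp
   also have "\<dots> \<le> max (b * D) Q * \<Gamma>" using \<Gamma> by (intro mult_right_mono) auto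
   finally show ?thesis .
  qed
  finally show "\<bar>l i u\<bar> powr p \<le> max (b * D) Q * ?A u" by (simp add: \<Gamma>_def)
 next
  fix u assume u: "u \<in> test_functions \<Omega>"
  note [measurable] = test_functions_borel[OF u]
  obtain L where L: "L \<subseteq> \<Omega>" "\<And>x. x \<notin> L ==> u x = 0" using test_functionsE[OF u] by metis
  define \<Gamma> where "\<Gamma> = ?A u"
  have \<Gamma>: "0 \<le> \<Gamma>" unfolding \<Gamma>_def by (intro integral_nonneg_AE) auto
  define S where "S = (\<Sum>i<k. \<bar>l i u\<bar> powr r)"
  have S0: "0 \<le> S" by (auto simp: S_def intro!: sum_nonneg)
  define Z where "Z = 2 powr r * (2 powr r * (\<delta> powr r * (b * \<Gamma>) powr (r / p) + S))"
  have Z0: "0 \<le> Z" using S0 by (simp add: Z_def)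
  have mean: "2 powr r * \<bar>ball_mean h u x\<bar> powr r \<le> Z" if x: "x \<in> \<Omega>" for x
  proof -
   have "x \<in> closure \<Omega>" using x closure_subset by blast
   then obtain y where y: "y \<in> F" "dist y x < \<delta>" using F(2) by auto
   then obtain i where i: "i < k" "y = xs ! i" using xs by (auto simp: k_def in_set_conv_nth)
   have "\<bar>ball_mean h u x - ball_mean h u y\<bar> \<le> norm (x - y) * (b * \<Gamma>) powr (1 / p)"
    using ball_mean_Lipschitz[OF u p(1) h, of x y] by (simp add: b_def N_def V_def \<Gamma>_def)
   also have "\<dots> \<le> \<delta> * (b * \<Gamma>) powr (1 / p)" using y by (intro mult_right_mono) (auto simp: dist_norm norm_minus_commute)
   finally have "\<bar>ball_mean h u x - ball_mean h u y\<bar> powr r \<le> (\<delta> * (b * \<Gamma>) powr (1 / p)) powr r"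
    using p by (intro powr_mono2) auto
   also have "\<dots> = \<delta> powr r * (b * \<Gamma>) powr (r / p)" using \<delta> by (simp add: powr_mult powr_powr)
   finally have 1: "\<bar>ball_mean h u x - ball_mean h u y\<bar> powr r \<le> \<delta> powr r * (b * \<Gamma>) powr (r / p)" .
   have 2: "\<bar>ball_mean h u y\<bar> powr r \<le> S"
    unfolding S_def i l_def by (rule member_le_sum[where f = "\<lambda>i. \<bar>ball_mean h u (xs ! i)\<bar> powr r"]) (use i in auto)
   have "\<bar>ball_mean h u x\<bar> powr r \<le> 2 powr r * (\<bar>ball_mean h u x - ball_mean h u y\<bar> powr r + \<bar>ball_mean h u y\<bar> powr r)"
    using norm_add_powr_le[of r "ball_mean h u x - ball_mean h u y" "ball_mean h u y"] p by simp
   also have "\<dots> \<le> 2 powr r * (\<delta> powr r * (b * \<Gamma>) powr (r / p) + S)" using 1 2 by (intro mult_left_mono) auto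
   finally show ?thesis by (simp add: Z_def)
  qed
  have "ennreal (LINT x|lborel. \<bar>u x\<bar> powr r) = (\<integral>\<^sup>+x. ennreal (\<bar>u x\<bar> powr r) \<partial>lborel)"
   by (rule nn_integral_eq_integral[symmetric]) (use test_functions_powr_integrable[OF u, of r] p in auto)
  also have "\<dots> \<le> (\<integral>\<^sup>+x. (ennreal (2 powr r) * ennreal (\<bar>u x - ball_mean h u x\<bar> powr r) + ennreal Z * indicator \<Omega> x) \<partial>lborel)"
  proof (rule nn_integral_mono)
   fix x
   show "ennreal (\<bar>u x\<bar> powr r) \<le> ennreal (2 powr r) * ennreal (\<bar>u x - ball_mean h u x\<bar> powr r) + ennreal Z * indicator \<Omega> x"
   proof (cases "x \<in> \<Omega>")
    case True
    have "\<bar>u x\<bar> powr r \<le> 2 powr r * (\<bar>u x - ball_mean h u x\<bar> powr r + \<bar>ball_mean h u x\<bar> powr r)"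
     using norm_add_powr_le[of r "u x - ball_mean h u x" "ball_mean h u x"] p by simp
    also have "\<dots> \<le> 2 powr r * \<bar>u x - ball_mean h u x\<bar> powr r + Z" using mean[OF True] by (simp add: algebra_simps)
    finally show ?thesis using True Z0 by (simp add: ennreal_mult[symmetric] ennreal_plus[symmetric] ennreal_leI del: ennreal_plus)
   next
    case False
    then have "u x = 0" using L by blast
    then show ?thesis by simp
   qed
  qed
  also have "\<dots> = ennreal (2 powr r) * (\<integral>\<^sup>+x. ennreal (\<bar>u x - ball_mean h u x\<bar> powr r) \<partial>lborel) + ennreal Z * ennreal W"
   using \<Omega>(1) by (subst nn_integral_add) (auto simp: nn_integral_cmult nn_integral_cmult_indicator fin)
  also have "\<dots> \<le> ennreal (2 powr r) * ennreal (K * h powr \<gamma>' * \<Gamma> powr (r / p)) + ennreal Z * ennreal W"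
   unfolding \<Gamma>_def by (intro add_right_mono mult_left_mono K(2)[OF u h]) auto
  also have "\<dots> = ennreal (2 powr r * (K * h powr \<gamma>' * \<Gamma> powr (r / p)) + Z * W)"
   using Z0 W K(1) by (simp add: ennreal_mult[symmetric] ennreal_plus[symmetric] del: ennreal_plus)
  finally have "(LINT x|lborel. \<bar>u x\<bar> powr r) \<le> 2 powr r * (K * h powr \<gamma>' * \<Gamma> powr (r / p)) + Z * W"
   using Z0 W K(1) by (subst (asm) ennreal_le_iff) auto
  also have "\<dots> = (2 powr r * (K * h powr \<gamma>') + Q * (\<delta> powr r * b powr (r / p))) * \<Gamma> powr (r / p) + Q * S"
   using b \<Gamma> by (simp add: Z_def Q_def powr_mult algebra_simps)
  also have "\<dots> \<le> (\<epsilon> / 2 + \<epsilon> / 2) * \<Gamma> powr (r / p) + max (b * D) Q * S"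
   using hK \<delta>Q S0 by (intro add_mono mult_right_mono) auto
  finally show "(LINT x|lborel. \<bar>u x\<bar> powr r) \<le>
    \<epsilon> * ?A u powr (r / p) + max (b * D) Q * (\<Sum>i<k. \<bar>l i u\<bar> powr r)"
   by (simp add: \<Gamma>_def S_def)
 qed
qed

section \<open>Weak gradients and the double phase space\<close>

lemma borel_lebesgue_on: "f \<in> borel_measurable borel ==> f \<in> borel_measurable (lebesgue_on S)"
 by (intro measurable_restrict_space1 measurable_completion) simp

lemma finite_measure_lebesgue_on:
 assumes "bounded S" "S \<in> sets lebesgue"
 shows "finite_measure (lebesgue_on S)"
proof
 have "S \<in> lmeasurable" using assms by (simp add: bounded_set_imp_lmeasurable)
 then show "emeasure (lebesgue_on S) (space (lebesgue_on S)) \<noteq> \<infinity>"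
  using assms(2) by (auto simp: emeasure_restrict_space fmeasurable_def)
qed

lemma integrable_times_test:
 fixes g :: "'a::euclidean_space => real"
 assumes \<Omega>: "open \<Omega>" and K: "compact K" "K \<subseteq> \<Omega>" and g: "g absolutely_integrable_on K"
  and v: "v \<in> borel_measurable borel" "\<And>x. \<bar>v x\<bar> \<le> C" "\<And>x. x \<notin> K ==> v x = 0"
 shows "integrable (lebesgue_on \<Omega>) (\<lambda>x. g x * v x)"
proof -
 have m: "\<Omega> \<in> sets lebesgue" using \<Omega> by (auto intro: borel_open)
 have i: "integrable lebesgue (\<lambda>x. indicator K x * g x)" using g by (simp add: set_integrable_def)
 have "integrable lebesgue (\<lambda>x. (indicator K x * g x) * v x)"
 proof (rule Bochner_Integration.integrable_bound)
  show "integrable lebesgue (\<lambda>x. C * \<bar>indicator K x * g x\<bar>)" using i by simp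
  show "(\<lambda>x. (indicator K x * g x) * v x) \<in> borel_measurable lebesgue"
   using v(1) by (intro borel_measurable_times borel_measurable_integrable[OF i] measurable_completion) simp
  have "\<bar>indicator K x * g x\<bar> * \<bar>v x\<bar> \<le> C * \<bar>indicator K x * g x\<bar>" for x
   using mult_left_mono[OF v(2)[of x], of "\<bar>indicator K x * g x\<bar>"] by (simp add: mult.commute)
  then show "AE x in lebesgue. norm (indicator K x * g x * v x) \<le> norm (C * \<bar>indicator K x * g x\<bar>)"
   using order.trans[OF abs_ge_zero v(2)] by (intro AE_I2) (simp add: abs_mult)
 qed
 moreover have "(\<lambda>x. (indicator K x * g x) * v x) = (\<lambda>x. indicator \<Omega> x *\<^sub>R (g x * v x))"
  using K v(3) by (auto simp: fun_eq_iff indicator_def)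
 ultimately show ?thesis using m by (subst integrable_restrict_space) auto
qed

lemma absolutely_integrable_inner:
 fixes g :: "'a::euclidean_space => 'b::euclidean_space"
 shows "g absolutely_integrable_on K ==> (\<lambda>x. g x \<bullet> i) absolutely_integrable_on K"
 using absolutely_integrable_linear[OF _ bounded_linear_inner_left] by (simp add: o_def)

lemma has_weak_gradientD:
 assumes "has_weak_gradient \<Omega> u g"
 shows "\<And>K. compact K ==> K \<subseteq> \<Omega> ==> u absolutely_integrable_on K"
  "\<And>K. compact K ==> K \<subseteq> \<Omega> ==> g absolutely_integrable_on K"
  "\<And>v i. v \<in> test_functions \<Omega> ==> i \<in> Basis ==>
    (LINT x|lebesgue_on \<Omega>. u x * (grad v x \<bullet> i)) = - (LINT x|lebesgue_on \<Omega>. (g x \<bullet> i) * v x)"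
 using assms by (auto simp: has_weak_gradient_def grad_inner_Basis)

lemma has_weak_gradientI:
 assumes "\<And>K. compact K ==> K \<subseteq> \<Omega> ==> u absolutely_integrable_on K"
  "\<And>K. compact K ==> K \<subseteq> \<Omega> ==> g absolutely_integrable_on K"
  "\<And>v i. v \<in> test_functions \<Omega> ==> i \<in> Basis ==>
    (LINT x|lebesgue_on \<Omega>. u x * (grad v x \<bullet> i)) = - (LINT x|lebesgue_on \<Omega>. (g x \<bullet> i) * v x)"
 shows "has_weak_gradient \<Omega> u g"
 using assms by (auto simp: has_weak_gradient_def grad_inner_Basis)

lemma weak_gradient_integrable_test:
 assumes \<Omega>: "open \<Omega>" and g: "has_weak_gradient \<Omega> u g" and v: "v \<in> test_functions \<Omega>" and i: "i \<in> Basis"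
 shows "integrable (lebesgue_on \<Omega>) (\<lambda>x. (g x \<bullet> i) * v x)" "integrable (lebesgue_on \<Omega>) (\<lambda>x. u x * (grad v x \<bullet> i))"
proof -
 obtain K where K: "compact K" "K \<subseteq> \<Omega>" "\<And>x. x \<notin> K ==> v x = 0" "\<And>x. x \<notin> K ==> grad v x = 0" using test_functionsE[OF v] by metis
 obtain C where C: "\<And>x. \<bar>v x\<bar> \<le> C" "\<And>x. norm (grad v x) \<le> C" using test_functions_grad_bounded[OF v] by metis
 show "integrable (lebesgue_on \<Omega>) (\<lambda>x. (g x \<bullet> i) * v x)"
  by (rule integrable_times_test[OF \<Omega> K(1,2) absolutely_integrable_inner[OF has_weak_gradientD(2)[OF g K(1,2)]]
    test_functions_borel(1)[OF v] C(1) K(3)])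
 have [measurable]: "grad v \<in> borel_measurable borel" by (rule test_functions_borel(2)[OF v])
 show "integrable (lebesgue_on \<Omega>) (\<lambda>x. u x * (grad v x \<bullet> i))"
  by (rule integrable_times_test[OF \<Omega> K(1,2) has_weak_gradientD(1)[OF g K(1,2)], of _ C])
   (use K C order.trans[OF Basis_le_norm[OF i] C(2)] in auto)
qed

lemma has_weak_gradient_diff:
 assumes \<Omega>: "open \<Omega>" and g: "has_weak_gradient \<Omega> u g" and h: "has_weak_gradient \<Omega> v h"
 shows "has_weak_gradient \<Omega> (\<lambda>x. u x - v x) (\<lambda>x. g x - h x)"
proof (rule has_weak_gradientI)
 fix K assume K: "compact K" "K \<subseteq> \<Omega>"
 show "(\<lambda>x. u x - v x) absolutely_integrable_on K" "(\<lambda>x. g x - h x) absolutely_integrable_on K"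
  using has_weak_gradientD(1,2)[OF g K] has_weak_gradientD(1,2)[OF h K] by (auto intro: set_integral_diff(1))
next
 fix w and i :: 'a assume w: "w \<in> test_functions \<Omega>" and i: "i \<in> Basis"
 show "(LINT x|lebesgue_on \<Omega>. (u x - v x) * (grad w x \<bullet> i)) = - (LINT x|lebesgue_on \<Omega>. (g x - h x) \<bullet> i * w x)"
  using has_weak_gradientD(3)[OF g w i] has_weak_gradientD(3)[OF h w i]
   weak_gradient_integrable_test[OF \<Omega> g w i] weak_gradient_integrable_test[OF \<Omega> h w i]
  by (simp add: inner_diff_left left_diff_distrib)
qed

lemma weak_gradient_zero:
 assumes \<Omega>: "open \<Omega>" and g: "has_weak_gradient \<Omega> u g" and u: "AE x in lebesgue_on \<Omega>. u x = 0"
 shows "AE x in lebesgue_on \<Omega>. g x = 0"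
proof -
 have "AE x in lebesgue_on \<Omega>. \<forall>i\<in>Basis. g x \<bullet> i = 0"
 proof (subst AE_finite_all, simp, intro ballI)
  fix i :: 'a assume i: "i \<in> Basis"
  show "AE x in lebesgue_on \<Omega>. g x \<bullet> i = 0"
  proof (rule fundamental_lemma_variations[OF \<Omega>])
   show "(\<lambda>x. g x \<bullet> i) absolutely_integrable_on K" if "compact K" "K \<subseteq> \<Omega>" for K
    by (rule absolutely_integrable_inner[OF has_weak_gradientD(2)[OF g that]])
   fix v assume v: "v \<in> test_functions \<Omega>"
   have "(LINT x|lebesgue_on \<Omega>. u x * (grad v x \<bullet> i)) = 0"
    by (rule integral_eq_zero_AE) (use u in \<open>auto elim!: eventually_mono\<close>)
   then show "(LINT x|lebesgue_on \<Omega>. g x \<bullet> i * v x) = 0" using has_weak_gradientD(3)[OF g v i] by simp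
  qed
 qed
 then show ?thesis by eventually_elim (simp add: euclidean_all_zero_iff)
qed

lemma weak_gradient_unique:
 assumes \<Omega>: "open \<Omega>" and g: "has_weak_gradient \<Omega> u g" and h: "has_weak_gradient \<Omega> v h"
  and uv: "AE x in lebesgue_on \<Omega>. u x = v x"
 shows "AE x in lebesgue_on \<Omega>. g x = h x"
proof -
 have "AE x in lebesgue_on \<Omega>. u x - v x = 0" using uv by eventually_elim simp
 from weak_gradient_zero[OF \<Omega> has_weak_gradient_diff[OF \<Omega> g h] this] show ?thesis
  by eventually_elim simp
qed

lemma has_weak_gradient_weak_gradient:
 "has_weak_gradient \<Omega> u g ==> has_weak_gradient \<Omega> u (weak_gradient \<Omega> u)"
 unfolding weak_gradient_def by (rule someI[of "has_weak_gradient \<Omega> u"])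

lemma weak_gradient_AE:
 assumes "open \<Omega>" "has_weak_gradient \<Omega> u g"
 shows "AE x in lebesgue_on \<Omega>. weak_gradient \<Omega> u x = g x"
 using weak_gradient_unique[OF assms(1) has_weak_gradient_weak_gradient[OF assms(2)] assms(2)] by simp

text \<open>Weak gradients come only with integrability on compact sets; a countable cover of the
  open set by closed boxes glues the local measurability together.\<close>

lemma locally_integrable_measurable:
 fixes g :: "'a::euclidean_space => 'b::euclidean_space"
 assumes \<Omega>: "open \<Omega>" and g: "\<And>K. compact K ==> K \<subseteq> \<Omega> ==> g absolutely_integrable_on K"
 shows "g \<in> borel_measurable (lebesgue_on \<Omega>)"
proof -
 have m: "\<Omega> \<in> sets lebesgue" using \<Omega> by (auto intro: borel_open)
 obtain D where D: "countable D" "\<And>X. X \<in> D ==> X \<subseteq> \<Omega>" "\<And>X. X \<in> D ==> \<exists>a b. X = cbox a b" "\<Union>D = \<Omega>"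
  by (rule open_countable_Union_open_cbox[OF \<Omega>]) (rule that, auto)
 have "(\<lambda>x. if x \<in> \<Omega> then g x else 0) \<in> borel_measurable lebesgue"
 proof (rule measurable_piecewise_restrict[where C = "insert (- \<Omega>) D"])
  show "countable (insert (- \<Omega>) D)" using D(1) by simp
  show "space lebesgue \<subseteq> \<Union> (insert (- \<Omega>) D)" using D(4) by auto
  fix X assume X: "X \<in> insert (- \<Omega>) D"
  then show "X \<inter> space lebesgue \<in> sets lebesgue"
  proof
   assume "X \<in> D" then show ?thesis using D(3)[of X] by auto
  qed (use sets.compl_sets[OF m] in \<open>simp add: Compl_eq_Diff_UNIV\<close>)
  show "(\<lambda>x. if x \<in> \<Omega> then g x else 0) \<in> measurable (restrict_space lebesgue X) borel"
  proof (cases "X = - \<Omega>")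
   case True
   have "(\<lambda>x. 0::'b) \<in> measurable (restrict_space lebesgue X) borel" by simp
   then show ?thesis by (rule subst[OF measurable_cong, rotated]) (use True in \<open>auto simp: space_restrict_space\<close>)
  next
   case False
   with X have XD: "X \<in> D" by simp
   then have "compact X" using D(3) by force
   from g[OF this D(2)[OF XD]] have "g \<in> measurable (restrict_space lebesgue X) borel"
    using absolutely_integrable_measurable[of X g] D(3)[OF XD] by auto
   then show ?thesis by (rule subst[OF measurable_cong, rotated]) (use D(2)[OF XD] in \<open>auto simp: space_restrict_space\<close>)
  qed
 qed
 then show ?thesis using m by (subst borel_measurable_if[symmetric]) auto
qed

lemma integrable_lebesgue_on_absolutely:
 fixes g :: "'a::euclidean_space => 'b::euclidean_space"
 assumes "\<Omega> \<in> sets lebesgue" "integrable (lebesgue_on \<Omega>) g" "compact K" "K \<subseteq> \<Omega>"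
 shows "g absolutely_integrable_on K"
proof -
 have "set_integrable lebesgue \<Omega> g"
  using assms(1,2) unfolding set_integrable_def by (subst (asm) integrable_restrict_space) auto
 then show ?thesis
  by (rule set_integrable_subset) (use assms in \<open>auto simp: lmeasurable_compact fmeasurableD\<close>)
qed

section \<open>The double phase space as an intersection of two Lebesgue spaces\<close>

locale double_phase =
 fixes \<Omega> :: "'a::euclidean_space set" and p q A :: real and a :: "'a => real"
 assumes open_domain: "open \<Omega>" and bounded_domain: "bounded \<Omega>"
  and p_gt_1: "1 < p" and p_less_q: "p < q"
  and a_measurable: "a \<in> borel_measurable (lebesgue_on \<Omega>)"
  and a_bounds: "\<And>x. x \<in> \<Omega> ==> 0 \<le> a x" "\<And>x. x \<in> \<Omega> ==> a x \<le> A"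
begin

abbreviation \<mu> :: "'a measure" where "\<mu> \<equiv> lebesgue_on \<Omega>"

text \<open>The weight \<open>a\<close> is put into the measure, so the q-phase is an ordinary L^q
  space and each lemma on L^s serves both phases. Null sets of \<open>\<mu>\<close> are null for
  \<open>\<nu>\<close>, which transfers statements holding almost everywhere.\<close>

definition \<nu> :: "'a measure" where "\<nu> = density \<mu> (\<lambda>x. ennreal (a x))"

abbreviation \<T> :: "('a => real) set" where "\<T> \<equiv> test_functions \<Omega>"

lemma domain_sets: "\<Omega> \<in> sets lebesgue"
 using open_domain by (auto intro: borel_open)

lemma space_\<mu> [simp]: "space \<mu> = \<Omega>"
 using domain_sets by (simp add: space_restrict_space)

lemma sets_\<nu> [measurable_cong, simp]: "sets \<nu> = sets \<mu>"
 by (simp add: \<nu>_def)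

lemma space_\<nu> [simp]: "space \<nu> = \<Omega>"
 by (simp add: \<nu>_def)

lemma measurable_\<nu> [simp]: "f \<in> measurable \<nu> N \<longleftrightarrow> f \<in> measurable \<mu> N"
 by (simp add: \<nu>_def)

lemma finite_\<mu>: "finite_measure \<mu>"
 by (rule finite_measure_lebesgue_on[OF bounded_domain domain_sets])

lemma AE_a: "AE x in \<mu>. 0 \<le> a x \<and> a x \<le> A"
 using a_bounds by (intro AE_I2) auto

lemma integral_\<nu>:
 fixes f :: "'a => real"
 assumes "f \<in> borel_measurable \<mu>"
 shows "(LINT x|\<nu>. f x) = (LINT x|\<mu>. a x * f x)"
 unfolding \<nu>_def using assms a_measurable a_bounds by (subst integral_density) (auto intro!: AE_I2)

lemma integrable_\<nu>:
 fixes f :: "'a => real"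
 assumes "f \<in> borel_measurable \<mu>"
 shows "integrable \<nu> f \<longleftrightarrow> integrable \<mu> (\<lambda>x. a x * f x)"
 unfolding \<nu>_def using assms a_measurable a_bounds by (subst integrable_density) (auto intro!: AE_I2)

lemma integrable_\<nu>I:
 fixes f :: "'a => real"
 assumes f: "integrable \<mu> f"
 shows "integrable \<nu> f" "\<bar>LINT x|\<nu>. f x\<bar> \<le> \<bar>A\<bar> * (LINT x|\<mu>. \<bar>f x\<bar>)"
proof -
 have m: "f \<in> borel_measurable \<mu>" using f by auto
 have bd: "AE x in \<mu>. norm (a x * f x) \<le> norm (\<bar>A\<bar> * \<bar>f x\<bar>)"
  using AE_a by eventually_elim (auto simp: abs_mult intro!: mult_right_mono)
 have i: "integrable \<mu> (\<lambda>x. a x * f x)"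
  by (rule Bochner_Integration.integrable_bound[OF _ _ bd]) (use f m a_measurable in auto)
 then show "integrable \<nu> f" using m by (simp add: integrable_\<nu>)
 have "\<bar>LINT x|\<nu>. f x\<bar> \<le> (LINT x|\<mu>. \<bar>a x * f x\<bar>)"
  unfolding integral_\<nu>[OF m] by (rule integral_abs_bound)
 also have "\<dots> \<le> (LINT x|\<mu>. \<bar>A\<bar> * \<bar>f x\<bar>)"
  by (rule integral_mono_AE) (use i f bd in auto)
 finally show "\<bar>LINT x|\<nu>. f x\<bar> \<le> \<bar>A\<bar> * (LINT x|\<mu>. \<bar>f x\<bar>)" by simp
qed

lemma finite_\<nu>: "finite_measure \<nu>"
proof -
 interpret finite_measure \<mu> by (rule finite_\<mu>)
 have "integrable \<nu> (indicator \<Omega> :: 'a => real)"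
  using domain_sets by (intro integrable_\<nu>I) (auto simp: sets_restrict_space_iff emeasure_finite less_top[symmetric])
 then have "emeasure \<nu> (space \<nu>) < \<infinity>" by (simp add: integrable_indicator_iff)
 then show ?thesis by (intro finite_measureI) auto
qed

lemma AE_\<nu>: "AE x in \<mu>. P x ==> AE x in \<nu>. P x"
 unfolding \<nu>_def using a_measurable by (subst AE_density) auto

definition Lpq :: "('a => 'b::euclidean_space) => bool" where
 "Lpq f \<longleftrightarrow> f \<in> borel_measurable \<mu> \<and> integrable \<mu> (\<lambda>x. norm (f x) powr p) \<and> integrable \<nu> (\<lambda>x. norm (f x) powr q)"

text \<open>Convergence in the modular, phase by phase: the form in which integral estimates produce
  it. By \<open>norm_H_bounds\<close> it amounts to convergence in the Luxemburg norm.\<close>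

definition converges_pq :: "(nat => 'a => 'b::euclidean_space) => ('a => 'b) => bool" where
 "converges_pq f g \<longleftrightarrow> (\<forall>n. Lpq (\<lambda>x. f n x - g x)) \<and>
   (\<lambda>n. LINT x|\<mu>. norm (f n x - g x) powr p) \<longlonglongrightarrow> 0 \<and> (\<lambda>n. LINT x|\<nu>. norm (f n x - g x) powr q) \<longlonglongrightarrow> 0"

lemma Lpq_scaleR: "Lpq f ==> Lpq (\<lambda>x. c *\<^sub>R f x)"
 by (auto simp: Lpq_def powr_mult)

lemma Lpq_diff: "Lpq f ==> Lpq g ==> Lpq (\<lambda>x. f x - g x)"
 using norm_diff_powr(1)[of f \<mu> g p] norm_diff_powr(1)[of f \<nu> g q] p_gt_1 p_less_q by (auto simp: Lpq_def)

lemma Lpq_cong_AE: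
 assumes "Lpq f" "AE x in \<mu>. norm (f x) = norm (g x)" "g \<in> borel_measurable \<mu>"
 shows "Lpq g"
proof -
 have [measurable]: "f \<in> borel_measurable \<mu>" "g \<in> borel_measurable \<mu>" using assms by (auto simp: Lpq_def)
 have "integrable \<mu> (\<lambda>x. norm (g x) powr p)"
  by (rule integrable_cong_AE_imp[of \<mu> "\<lambda>x. norm (f x) powr p"]) (use assms in \<open>auto simp: Lpq_def\<close>)
 moreover have "integrable \<nu> (\<lambda>x. norm (g x) powr q)"
  by (rule integrable_cong_AE_imp[of \<nu> "\<lambda>x. norm (f x) powr q"]) (use assms AE_\<nu>[OF assms(2)] in \<open>auto simp: Lpq_def\<close>)
 ultimately show ?thesis using assms(3) by (simp add: Lpq_def)
qed

lemma bounded_Lpq: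
 assumes "f \<in> borel_measurable \<mu>" "\<And>x. norm (f x) \<le> C"
 shows "Lpq f"
proof -
 interpret m: finite_measure \<mu> by (rule finite_\<mu>)
 interpret n: finite_measure \<nu> by (rule finite_\<nu>)
 show ?thesis unfolding Lpq_def
 proof (intro conjI assms(1))
  show "integrable \<mu> (\<lambda>x. norm (f x) powr p)"
   by (rule m.integrable_const_bound[of _ "C powr p"]) (use assms p_gt_1 in \<open>auto intro!: AE_I2 powr_mono2\<close>)
  show "integrable \<nu> (\<lambda>x. norm (f x) powr q)"
   by (rule n.integrable_const_bound[of _ "C powr q"]) (use assms p_gt_1 p_less_q in \<open>auto intro!: AE_I2 powr_mono2\<close>)
 qed
qed

lemma test_borel_\<mu>:
 assumes "u \<in> \<T>"
 shows "u \<in> borel_measurable \<mu>" "grad u \<in> borel_measurable \<mu>"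
 using test_functions_borel[OF assms] by (auto intro: borel_lebesgue_on)

lemma test_Lpq:
 assumes "u \<in> \<T>"
 shows "Lpq u" "Lpq (grad u)"
proof -
 obtain C where "\<And>x. \<bar>u x\<bar> \<le> C" "\<And>x. norm (grad u x) \<le> C" using test_functions_grad_bounded[OF assms] by metis
 then show "Lpq u" "Lpq (grad u)" using test_borel_\<mu>[OF assms] by (auto intro!: bounded_Lpq)
qed

lemma test_integral_lborel:
 assumes u: "u \<in> \<T>" and s: "0 < s"
 shows "(LINT x|lborel. \<bar>u x\<bar> powr s) = (LINT x|\<mu>. \<bar>u x\<bar> powr s)"
  "(LINT x|lborel. norm (grad u x) powr s) = (LINT x|\<mu>. norm (grad u x) powr s)"
proof -
 note [measurable] = test_functions_borel[OF u]
 obtain K where K: "K \<subseteq> \<Omega>" "\<And>x. x \<notin> K ==> u x = 0" "\<And>x. x \<notin> K ==> grad u x = 0" using test_functionsE[OF u] by metis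
 have z: "u x = 0" "grad u x = 0" if "x \<notin> \<Omega>" for x using K that by blast+
 show "(LINT x|lborel. \<bar>u x\<bar> powr s) = (LINT x|\<mu>. \<bar>u x\<bar> powr s)"
  by (rule integral_lebesgue_on_eq_lborel(1)[OF open_domain, symmetric]) (use z s in auto)
 show "(LINT x|lborel. norm (grad u x) powr s) = (LINT x|\<mu>. norm (grad u x) powr s)"
  by (rule integral_lebesgue_on_eq_lborel(1)[OF open_domain, symmetric]) (use z s in auto)
qed

lemma Lpq_integrable:
 assumes "Lpq f"
 shows "integrable \<mu> f" "integrable \<nu> f"
proof -
 interpret m: finite_measure \<mu> by (rule finite_\<mu>)
 interpret n: finite_measure \<nu> by (rule finite_\<nu>)
 have le: "norm y \<le> 1 + norm y powr s" if "1 < s" for y :: 'b and s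
  using powr_le_1_powr[of "norm y" 1 s] that by simp
 have f: "f \<in> borel_measurable \<mu>" using assms by (simp add: Lpq_def)
 show "integrable \<mu> f"
  by (rule Bochner_Integration.integrable_bound[of _ "\<lambda>x. 1 + norm (f x) powr p"])
   (use assms le p_gt_1 f in \<open>auto simp: Lpq_def\<close>)
 show "integrable \<nu> f"
  by (rule Bochner_Integration.integrable_bound[of _ "\<lambda>x. 1 + norm (f x) powr q"])
   (use assms le p_gt_1 p_less_q f in \<open>auto simp: Lpq_def\<close>)
qed

text \<open>Both sides of the integration by parts formula are superposition operators, linear in
  the function with bounded coefficients, hence continuous under L^p convergence.\<close>

lemma has_weak_gradient_limit:
 assumes \<phi>: "\<And>n. \<phi> n \<in> \<T>" and c: "converges_pq \<phi> u" "converges_pq (\<lambda>n. grad (\<phi> n)) g" and L: "Lpq u" "Lpq g"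
 shows "has_weak_gradient \<Omega> u g"
proof (rule has_weak_gradientI)
 show "u absolutely_integrable_on K" "g absolutely_integrable_on K" if "compact K" "K \<subseteq> \<Omega>" for K
  using integrable_lebesgue_on_absolutely[OF domain_sets _ that] Lpq_integrable(1)[OF L(1)] Lpq_integrable(1)[OF L(2)] by auto
 interpret m: finite_measure \<mu> by (rule finite_\<mu>)
 fix w and i :: 'a assume w: "w \<in> \<T>" and i: "i \<in> Basis"
 obtain C where C: "\<And>x. \<bar>w x\<bar> \<le> C" "\<And>x. norm (grad w x) \<le> C" using test_functions_grad_bounded[OF w] by metis
 note [measurable] = test_borel_\<mu>[OF \<phi>] test_borel_\<mu>[OF w]
 have [measurable]: "u \<in> borel_measurable \<mu>" "g \<in> borel_measurable \<mu>" using L by (simp_all add: Lpq_def)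
 have p0: "0 < p" and o: "integrable \<mu> (\<lambda>x. 1::real)" using p_gt_1 by auto
 have le: "b * d \<le> C * (1 + t powr p)" if "b \<le> t" "d \<le> C" "0 \<le> b" "0 \<le> d" for b d t :: real
 proof -
  have "b \<le> 1 + t powr p" using powr_le_1_powr[of t 1 p] p_gt_1 that by simp
  then have "b * d \<le> (1 + t powr p) * C" using that by (intro mult_mono) auto
  then show ?thesis by (simp add: mult.commute)
 qed
 note c' = c[unfolded converges_pq_def Lpq_def] and L' = L[unfolded Lpq_def]
 have c1: "(\<lambda>n. LINT x|\<mu>. \<phi> n x * (grad w x \<bullet> i)) \<longlonglongrightarrow> (LINT x|\<mu>. u x * (grad w x \<bullet> i))"
 proof (rule nemytskii(1)[where s = p and \<Phi> = "\<lambda>x t. t * (grad w x \<bullet> i)" and w = "\<lambda>_. 1" and C = C, OF _ p0 _ _ o])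
  show "AE x in \<mu>. \<forall>t. \<bar>t * (grad w x \<bullet> i)\<bar> \<le> C * (1 + norm t powr p)"
   using order.trans[OF Basis_le_norm[OF i] C(2)] by (intro AE_I2 allI) (auto simp: abs_mult intro!: le)
 qed (use c' L' in \<open>auto intro!: continuous_intros\<close>)
 have c2: "(\<lambda>n. LINT x|\<mu>. (grad (\<phi> n) x \<bullet> i) * w x) \<longlonglongrightarrow> (LINT x|\<mu>. (g x \<bullet> i) * w x)"
 proof (rule nemytskii(1)[where s = p and \<Phi> = "\<lambda>x t. (t \<bullet> i) * w x" and w = "\<lambda>_. 1" and C = C, OF _ p0 _ _ o])
  show "AE x in \<mu>. \<forall>t. \<bar>(t \<bullet> i) * w x\<bar> \<le> C * (1 + norm t powr p)"
   using C(1) Basis_le_norm[OF i] by (intro AE_I2 allI) (auto simp: abs_mult intro!: le)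
 qed (use c' L' in \<open>auto intro!: continuous_intros\<close>)
 have "(\<lambda>n. LINT x|\<mu>. \<phi> n x * (grad w x \<bullet> i)) \<longlonglongrightarrow> - (LINT x|\<mu>. (g x \<bullet> i) * w x)"
  using tendsto_minus[OF c2] has_weak_gradientD(3)[OF test_function_has_weak_gradient[OF open_domain \<phi>] w i] by simp
 from LIMSEQ_unique[OF c1 this] show "(LINT x|\<mu>. u x * (grad w x \<bullet> i)) = - (LINT x|\<mu>. (g x \<bullet> i) * w x)" .
qed

lemma modular_H_eq:
 fixes f :: "'a => 'b::euclidean_space"
 assumes "Lpq f"
 shows "modular_H \<Omega> p q a (\<lambda>x. norm (f x)) = ennreal ((LINT x|\<mu>. norm (f x) powr p) + (LINT x|\<nu>. norm (f x) powr q))"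
proof -
 have [measurable]: "f \<in> borel_measurable \<mu>" "a \<in> borel_measurable \<mu>" using assms a_measurable by (auto simp: Lpq_def)
 have i: "integrable \<mu> (\<lambda>x. norm (f x) powr p)" "integrable \<mu> (\<lambda>x. a x * norm (f x) powr q)"
  using assms by (auto simp: Lpq_def integrable_\<nu>)
 show ?thesis unfolding modular_H_def
  by (subst nn_integral_eq_integral) (use i a_bounds in \<open>auto simp: integral_\<nu> intro!: AE_I2\<close>)
qed

lemma L_H_iff_Lpq:
 fixes f :: "'a => 'b::euclidean_space"
 assumes f[measurable]: "f \<in> borel_measurable \<mu>"
 shows "modular_H \<Omega> p q a (\<lambda>x. norm (f x)) < \<infinity> \<longleftrightarrow> Lpq f"
proof
 assume fin: "modular_H \<Omega> p q a (\<lambda>x. norm (f x)) < \<infinity>"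
 have [measurable]: "a \<in> borel_measurable \<mu>" by (rule a_measurable)
 have 1: "(\<integral>\<^sup>+x. ennreal (norm (f x) powr p) \<partial>\<mu>) \<le> modular_H \<Omega> p q a (\<lambda>x. norm (f x))"
  "(\<integral>\<^sup>+x. ennreal (a x * norm (f x) powr q) \<partial>\<mu>) \<le> modular_H \<Omega> p q a (\<lambda>x. norm (f x))"
  unfolding modular_H_def using a_bounds by (auto intro!: nn_integral_mono ennreal_leI)
 have "integrable \<mu> (\<lambda>x. norm (f x) powr p)"
  using 1(1) fin by (intro integrableI_nonneg) auto
 moreover have "integrable \<mu> (\<lambda>x. a x * norm (f x) powr q)"
  using 1(2) fin a_bounds by (intro integrableI_nonneg) (auto intro!: AE_I2)
 ultimately show "Lpq f" using f by (simp add: Lpq_def integrable_\<nu>)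
qed (simp add: modular_H_eq)

text \<open>For 0 < s \<le> 1 one has s^q \<le> s^p \<le> s, which compares the modular with powers
  of the norm near 0; this is enough to translate limits. For s \<ge> 1 the powers dominate s, which
  shows that the set in the definition of the norm is nonempty.\<close>

lemma norm_H_bounds:
 fixes f :: "'a => 'b::euclidean_space"
 assumes f: "Lpq f"
 defines "\<rho> \<equiv> (LINT x|\<mu>. norm (f x) powr p) + (LINT x|\<nu>. norm (f x) powr q)"
 shows "0 \<le> norm_H \<Omega> p q a (\<lambda>x. norm (f x))"
  "\<epsilon> \<le> 1 ==> norm_H \<Omega> p q a (\<lambda>x. norm (f x)) < \<epsilon> ==> \<rho> \<le> \<epsilon>"
  "0 < \<epsilon> ==> \<epsilon> \<le> 1 ==> \<rho> \<le> \<epsilon> powr q ==> norm_H \<Omega> p q a (\<lambda>x. norm (f x)) \<le> \<epsilon>"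
proof -
 define P where "P = (LINT x|\<mu>. norm (f x) powr p)"
 define Q where "Q = (LINT x|\<nu>. norm (f x) powr q)"
 have PQ: "0 \<le> P" "0 \<le> Q" by (auto simp: P_def Q_def intro!: integral_nonneg_AE)
 have mod: "modular_H \<Omega> p q a (\<lambda>x. norm (f x) / s) = ennreal (P / s powr p + Q / s powr q)" if s: "s > 0" for s
 proof -
  have "modular_H \<Omega> p q a (\<lambda>x. norm (f x) / s) = modular_H \<Omega> p q a (\<lambda>x. norm (inverse s *\<^sub>R f x))"
   using s by (simp add: divide_inverse mult.commute)
  also have "\<dots> = ennreal ((LINT x|\<mu>. norm (inverse s *\<^sub>R f x) powr p) + (LINT x|\<nu>. norm (inverse s *\<^sub>R f x) powr q))"
   by (rule modular_H_eq[OF Lpq_scaleR[OF f]])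
  also have "(LINT x|\<mu>. norm (inverse s *\<^sub>R f x) powr p) = P / s powr p"
   using s by (simp add: powr_mult P_def inverse_powr divide_inverse mult.commute)
  also have "(LINT x|\<nu>. norm (inverse s *\<^sub>R f x) powr q) = Q / s powr q"
   using s by (simp add: powr_mult Q_def inverse_powr divide_inverse mult.commute)
  finally show ?thesis .
 qed
 define S where "S = {s. s > 0 \<and> modular_H \<Omega> p q a (\<lambda>x. norm (f x) / s) \<le> 1}"
 have S: "s \<in> S \<longleftrightarrow> s > 0 \<and> P / s powr p + Q / s powr q \<le> 1" for s
  using PQ by (auto simp: S_def mod ennreal_le_1 ennreal_plus[symmetric] simp del: ennreal_plus)
 have nrm: "norm_H \<Omega> p q a (\<lambda>x. norm (f x)) = Inf S" by (simp add: norm_H_def S_def)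
 have bb: "bdd_below S" by (rule bdd_belowI[of _ 0]) (auto simp: S)
 have "P + Q + 1 \<in> S"
 proof -
  define s where "s = P + Q + 1"
  have s: "1 \<le> s" using PQ by (simp add: s_def)
  have "s powr 1 \<le> s powr p" using s p_gt_1 by (intro powr_mono) auto
  moreover have "s powr 1 \<le> s powr q" using s p_gt_1 p_less_q by (intro powr_mono) auto
  ultimately have "P / s powr p + Q / s powr q \<le> P / s + Q / s" using s PQ by (intro add_mono divide_left_mono) auto
  also have "\<dots> \<le> 1" using s by (simp add: s_def add_divide_distrib[symmetric])
  finally show ?thesis using s by (simp add: S s_def)
 qed
 then have ne: "S \<noteq> {}" by blast
 show "0 \<le> norm_H \<Omega> p q a (\<lambda>x. norm (f x))" unfolding nrm by (rule cInf_greatest[OF ne]) (auto simp: S)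
 show "\<rho> \<le> \<epsilon>" if eps: "\<epsilon> \<le> 1" "norm_H \<Omega> p q a (\<lambda>x. norm (f x)) < \<epsilon>"
 proof -
  obtain s where s: "s \<in> S" "s < \<epsilon>" using eps(2) cInf_lessD[OF ne] unfolding nrm by blast
  then have s0: "0 < s" "s \<le> 1" using eps by (auto simp: S)
  have "s powr p \<le> s powr 1" using s0 p_gt_1 by (intro powr_mono') auto
  moreover have "s powr q \<le> s powr 1" using s0 p_gt_1 p_less_q by (intro powr_mono') auto
  ultimately have "P / s + Q / s \<le> P / s powr p + Q / s powr q" using s0 PQ by (intro add_mono divide_left_mono) auto
  also have "\<dots> \<le> 1" using s by (simp add: S)
  finally have "P + Q \<le> s" using s0 by (simp add: add_divide_distrib[symmetric])
  then show ?thesis using s by (simp add: \<rho>_def P_def Q_def)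
 qed
 show "norm_H \<Omega> p q a (\<lambda>x. norm (f x)) \<le> \<epsilon>" if \<epsilon>: "0 < \<epsilon>" "\<epsilon> \<le> 1" "\<rho> \<le> \<epsilon> powr q"
  unfolding nrm
 proof (rule cInf_lower[OF _ bb])
  have "\<epsilon> powr q \<le> \<epsilon> powr p" using \<epsilon> p_less_q by (intro powr_mono') auto
  then have "P / \<epsilon> powr p + Q / \<epsilon> powr q \<le> P / \<epsilon> powr q + Q / \<epsilon> powr q" using \<epsilon> PQ by (intro add_mono divide_left_mono) auto
  also have "\<dots> \<le> 1" using \<epsilon> by (simp add: \<rho>_def P_def Q_def add_divide_distrib[symmetric])
  finally show "\<epsilon> \<in> S" using \<epsilon> by (simp add: S)
 qed
qed

lemma norm_H_abs: "norm_H \<Omega> p q a f = norm_H \<Omega> p q a (\<lambda>x. norm (f x))"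
proof -
 have "modular_H \<Omega> p q a (\<lambda>x. f x / s) = modular_H \<Omega> p q a (\<lambda>x. norm (f x) / s)" for s
  by (simp add: modular_H_def)
 then show ?thesis by (simp add: norm_H_def)
qed

lemma W1_H_iff:
 "u \<in> W1_H \<Omega> p q a \<longleftrightarrow> (\<exists>g. has_weak_gradient \<Omega> u g) \<and> Lpq u \<and> Lpq (weak_gradient \<Omega> u)"
proof (cases "\<exists>g. has_weak_gradient \<Omega> u g")
 case True
 then have "has_weak_gradient \<Omega> u (weak_gradient \<Omega> u)" using has_weak_gradient_weak_gradient by blast
 then have m: "weak_gradient \<Omega> u \<in> borel_measurable \<mu>"
  using locally_integrable_measurable[OF open_domain] has_weak_gradientD(2) by blast
 have "u \<in> L_H \<Omega> p q a \<longleftrightarrow> Lpq u"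
  using L_H_iff_Lpq[of u] by (auto simp: L_H_def modular_H_def Lpq_def)
 moreover have "(\<lambda>x. norm (weak_gradient \<Omega> u x)) \<in> L_H \<Omega> p q a \<longleftrightarrow> Lpq (weak_gradient \<Omega> u)"
  using L_H_iff_Lpq[OF m] m by (auto simp: L_H_def)
 ultimately show ?thesis using True by (auto simp: W1_H_def)
qed (simp add: W1_H_def)

text \<open>The gradient is a separate argument, so limits can be formed before \<open>g\<close> is
  identified with the chosen representative \<open>weak_gradient \<Omega> u\<close>. Membership in
  \<open>W1_H_0 \<Omega> p q a\<close> is equivalent to the existence of such a sequence for
  \<open>u\<close> and its weak gradient.\<close>

definition approximates :: "(nat => 'a => real) => ('a => real) => ('a => 'a) => bool" where
 "approximates \<phi> u g \<longleftrightarrow> (\<forall>n. \<phi> n \<in> \<T>) \<and> u \<in> borel_measurable \<mu> \<and> g \<in> borel_measurable \<mu> \<and>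
   converges_pq \<phi> u \<and> converges_pq (\<lambda>n. grad (\<phi> n)) g"

lemma approximatesD:
 assumes "approximates \<phi> u g"
 shows "\<And>n. \<phi> n \<in> \<T>" "Lpq u" "Lpq g" "converges_pq \<phi> u" "converges_pq (\<lambda>n. grad (\<phi> n)) g" "has_weak_gradient \<Omega> u g"
proof -
 show t: "\<phi> n \<in> \<T>" for n using assms by (simp add: approximates_def)
 show c: "converges_pq \<phi> u" "converges_pq (\<lambda>n. grad (\<phi> n)) g" using assms by (auto simp: approximates_def)
 show u: "Lpq u" using Lpq_diff[OF test_Lpq(1)[OF t], of "\<lambda>x. \<phi> 0 x - u x" 0] c(1) by (simp add: converges_pq_def)
 show g: "Lpq g" using Lpq_diff[OF test_Lpq(2)[OF t], of "\<lambda>x. grad (\<phi> 0) x - g x" 0] c(2) by (simp add: converges_pq_def)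
 show "has_weak_gradient \<Omega> u g"
  by (rule has_weak_gradient_limit[OF t c u g])
qed

lemma weak_gradient_Lpq:
 assumes h: "has_weak_gradient \<Omega> u h" and L: "Lpq h"
 shows "AE x in \<mu>. weak_gradient \<Omega> u x = h x" "Lpq (weak_gradient \<Omega> u)"
  "(LINT x|\<mu>. norm (weak_gradient \<Omega> u x) powr p) = (LINT x|\<mu>. norm (h x) powr p)"
  "(LINT x|\<nu>. norm (weak_gradient \<Omega> u x) powr q) = (LINT x|\<nu>. norm (h x) powr q)"
proof -
 show AE: "AE x in \<mu>. weak_gradient \<Omega> u x = h x" by (rule weak_gradient_AE[OF open_domain h])
 have [measurable]: "weak_gradient \<Omega> u \<in> borel_measurable \<mu>" "h \<in> borel_measurable \<mu>"
  using locally_integrable_measurable[OF open_domain] has_weak_gradientD(2)[OF has_weak_gradient_weak_gradient[OF h]] L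
  by (blast, simp add: Lpq_def)
 show "Lpq (weak_gradient \<Omega> u)" by (rule Lpq_cong_AE[OF L]) (use AE in \<open>auto elim!: eventually_mono\<close>)
 show "(LINT x|\<mu>. norm (weak_gradient \<Omega> u x) powr p) = (LINT x|\<mu>. norm (h x) powr p)"
  by (rule integral_cong_AE) (use AE in \<open>auto elim!: eventually_mono\<close>)
 show "(LINT x|\<nu>. norm (weak_gradient \<Omega> u x) powr q) = (LINT x|\<nu>. norm (h x) powr q)"
  by (rule integral_cong_AE) (use AE_\<nu>[OF AE] in \<open>auto elim!: eventually_mono\<close>)
qed

lemma weak_gradient_minus_test:
 assumes h: "has_weak_gradient \<Omega> u g" "Lpq g" and v: "v \<in> \<T>"
 defines "w \<equiv> weak_gradient \<Omega> (\<lambda>x. u x - v x)"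
 shows "Lpq w" "(LINT x|\<mu>. norm (w x) powr p) = (LINT x|\<mu>. norm (grad v x - g x) powr p)"
  "(LINT x|\<nu>. norm (w x) powr q) = (LINT x|\<nu>. norm (grad v x - g x) powr q)"
 using weak_gradient_Lpq(2-4)[OF has_weak_gradient_diff[OF open_domain h(1) test_function_has_weak_gradient[OF open_domain v]]
   Lpq_diff[OF h(2) test_Lpq(2)[OF v]]]
 by (simp_all add: w_def norm_minus_commute)

lemma approximates_W1_H_0:
 assumes ap: "approximates \<phi> u g"
 shows "u \<in> W1_H_0 \<Omega> p q a" "AE x in \<mu>. weak_gradient \<Omega> u x = g x"
proof -
 note D = approximatesD[OF ap]
 show "AE x in \<mu>. weak_gradient \<Omega> u x = g x" by (rule weak_gradient_Lpq(1)[OF D(6,3)])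
 show "u \<in> W1_H_0 \<Omega> p q a" unfolding W1_H_0_def
 proof (intro CollectI conjI allI impI)
  show "u \<in> W1_H \<Omega> p q a" using D weak_gradient_Lpq(2)[OF D(6,3)] by (auto simp: W1_H_iff)
  fix \<epsilon> :: real assume "0 < \<epsilon>"
  define \<delta> where "\<delta> = min 1 (\<epsilon> / 3)"
  have \<delta>: "0 < \<delta>" "\<delta> \<le> 1" "\<delta> \<le> \<epsilon> / 3" using \<open>0 < \<epsilon>\<close> by (auto simp: \<delta>_def)
  let ?E = "\<lambda>n. (LINT x|\<mu>. norm (\<phi> n x - u x) powr p) + (LINT x|\<nu>. norm (\<phi> n x - u x) powr q)"
  let ?G = "\<lambda>n. (LINT x|\<mu>. norm (grad (\<phi> n) x - g x) powr p) + (LINT x|\<nu>. norm (grad (\<phi> n) x - g x) powr q)"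
  have "?E \<longlonglongrightarrow> 0" "?G \<longlonglongrightarrow> 0"
   using D(4,5) tendsto_add[of _ "0::real" sequentially _ 0] unfolding converges_pq_def by force+
  then have "\<forall>\<^sub>F n in sequentially. ?E n < \<delta> powr q" "\<forall>\<^sub>F n in sequentially. ?G n < \<delta> powr q"
   using \<delta> by (auto intro!: order_tendstoD(2))
  then have "\<forall>\<^sub>F n in sequentially. ?E n < \<delta> powr q \<and> ?G n < \<delta> powr q" by eventually_elim simp
  then obtain n where n: "?E n < \<delta> powr q" "?G n < \<delta> powr q" by (auto simp: eventually_sequentially)
  let ?w = "weak_gradient \<Omega> (\<lambda>x. u x - \<phi> n x)"
  note w = weak_gradient_minus_test[OF D(6,3) D(1)[of n]]
  have "norm_H \<Omega> p q a (\<lambda>x. norm (u x - \<phi> n x)) \<le> \<delta>"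
   by (rule norm_H_bounds(3)[OF Lpq_diff[OF D(2) test_Lpq(1)[OF D(1)]]]) (use \<delta> n(1) in \<open>auto simp: abs_minus_commute\<close>)
  moreover have "norm_H \<Omega> p q a (\<lambda>x. norm (?w x)) \<le> \<delta>"
   by (rule norm_H_bounds(3)[OF w(1)]) (use \<delta> n(2) in \<open>auto simp: w(2,3)\<close>)
  ultimately have "norm_1H \<Omega> p q a (\<lambda>x. u x - \<phi> n x) \<le> \<delta> + \<delta>"
   unfolding norm_1H_def using norm_H_abs[of "\<lambda>x. u x - \<phi> n x"] by simp
  then show "\<exists>\<phi>\<in>\<T>. norm_1H \<Omega> p q a (\<lambda>x. u x - \<phi> x) < \<epsilon>" using \<delta> \<open>0 < \<epsilon>\<close> by (intro bexI[OF _ D(1)[of n]]) linarith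
 qed
qed

lemma W1_H_0_approximates:
 assumes u: "u \<in> W1_H_0 \<Omega> p q a"
 obtains \<phi> where "approximates \<phi> u (weak_gradient \<Omega> u)"
proof -
 let ?g = "weak_gradient \<Omega> u"
 have W: "u \<in> W1_H \<Omega> p q a" using u by (simp add: W1_H_0_def)
 then have L: "Lpq u" "Lpq ?g" and hw: "has_weak_gradient \<Omega> u ?g"
  using has_weak_gradient_weak_gradient by (auto simp: W1_H_iff)
 have "\<exists>\<phi>. \<forall>n. \<phi> n \<in> \<T> \<and> norm_1H \<Omega> p q a (\<lambda>x. u x - \<phi> n x) < inverse (real (Suc n))"
 proof (rule choice, intro allI)
  fix n
  have "0 < inverse (real (Suc n))" by simp
  then show "\<exists>\<phi>. \<phi> \<in> \<T> \<and> norm_1H \<Omega> p q a (\<lambda>x. u x - \<phi> x) < inverse (real (Suc n))"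
   using u unfolding W1_H_0_def by blast
 qed
 then obtain \<phi> where \<phi>: "\<And>n. \<phi> n \<in> \<T>" "\<And>n. norm_1H \<Omega> p q a (\<lambda>x. u x - \<phi> n x) < inverse (real (Suc n))" by blast
 let ?E = "\<lambda>n. (LINT x|\<mu>. norm (\<phi> n x - u x) powr p) + (LINT x|\<nu>. norm (\<phi> n x - u x) powr q)"
 let ?G = "\<lambda>n. (LINT x|\<mu>. norm (grad (\<phi> n) x - ?g x) powr p) + (LINT x|\<nu>. norm (grad (\<phi> n) x - ?g x) powr q)"
 have bound: "?E n \<le> inverse (real (Suc n)) \<and> ?G n \<le> inverse (real (Suc n))" for n
 proof -
  let ?w = "weak_gradient \<Omega> (\<lambda>x. u x - \<phi> n x)"
  note w = weak_gradient_minus_test[OF hw L(2) \<phi>(1)[of n]]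
  have Ld: "Lpq (\<lambda>x. u x - \<phi> n x)" by (rule Lpq_diff[OF L(1) test_Lpq(1)[OF \<phi>(1)]])
  have lt: "norm_H \<Omega> p q a (\<lambda>x. norm (u x - \<phi> n x)) + norm_H \<Omega> p q a (\<lambda>x. norm (?w x)) < inverse (real (Suc n))"
   using \<phi>(2)[of n] norm_H_abs[of "\<lambda>x. u x - \<phi> n x"] by (simp add: norm_1H_def)
  have i1: "inverse (real (Suc n)) \<le> 1" by (simp add: inverse_eq_divide)
  have "(LINT x|\<mu>. norm (u x - \<phi> n x) powr p) + (LINT x|\<nu>. norm (u x - \<phi> n x) powr q) \<le> inverse (real (Suc n))"
   by (rule norm_H_bounds(2)[OF Ld i1]) (use lt norm_H_bounds(1)[OF w(1)] in linarith)
  moreover have "(LINT x|\<mu>. norm (?w x) powr p) + (LINT x|\<nu>. norm (?w x) powr q) \<le> inverse (real (Suc n))"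
   by (rule norm_H_bounds(2)[OF w(1) i1]) (use lt norm_H_bounds(1)[OF Ld] in linarith)
  ultimately show ?thesis unfolding w(2,3) by (simp add: abs_minus_commute)
 qed
 have nn: "0 \<le> (LINT x|M. norm (f x) powr s)" for M and f :: "'a => 'c::real_normed_vector" and s by (intro integral_nonneg_AE) auto
 have lim: "X \<longlonglongrightarrow> 0 \<and> Y \<longlonglongrightarrow> 0" if "\<And>n. X n + Y n \<le> inverse (real (Suc n))" "\<And>n. 0 \<le> X n" "\<And>n. 0 \<le> Y n" for X Y :: "nat => real"
 proof -
  have "X n \<le> inverse (real (Suc n))" "Y n \<le> inverse (real (Suc n))" for n using that(1)[of n] that(2)[of n] that(3)[of n] by linarith+
  then show ?thesis using that(2,3)
   by (intro conjI tendsto_sandwich[OF _ _ tendsto_const LIMSEQ_inverse_real_of_nat]) auto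
 qed
 have "converges_pq \<phi> u" "converges_pq (\<lambda>n. grad (\<phi> n)) ?g"
  unfolding converges_pq_def
  using Lpq_diff[OF test_Lpq(1)[OF \<phi>(1)] L(1)] Lpq_diff[OF test_Lpq(2)[OF \<phi>(1)] L(2)]
   lim[OF conjunct1[OF bound] nn nn] lim[OF conjunct2[OF bound] nn nn] by blast+
 then show ?thesis using that \<phi>(1) L by (auto simp: approximates_def Lpq_def)
qed

end

section \<open>A dense independent sequence of test functions\<close>

lemma sum_fun_apply: "(\<Sum>i\<in>I. f i) x = (\<Sum>i\<in>I. f i x)"
 for f :: "'i => 'x => 'b::comm_monoid_add"
 by (induction I rule: infinite_finite_induct) auto

interpretation real_fun: vector_space "\<lambda>(c::real) (f::'x => real) x. c * f x"
 by unfold_locales (auto simp: fun_eq_iff algebra_simps)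

text \<open>Uniform continuity and finitely many rounded values determine the gradient of a test
 function up to a small error, so countably many test functions suffice.\<close>

lemma countable_dense_test_functions:
 fixes \<Omega> :: "'a::euclidean_space set"
 assumes \<Omega>: "bounded \<Omega>"
 obtains D where "countable D" "D \<subseteq> test_functions \<Omega>"
  "\<And>u \<epsilon>. u \<in> test_functions \<Omega> ==> 0 < \<epsilon> ==> \<exists>v\<in>D. \<forall>x. norm (grad u x - grad v x) \<le> \<epsilon>"
proof -
 let ?T = "test_functions \<Omega>"
 define r where "r = (\<lambda>k. inverse (real (Suc k)))"
 have r: "0 < r k" for k by (simp add: r_def)
 have "\<exists>xs. closure \<Omega> \<subseteq> (\<Union>x\<in>set xs. ball x (r k))" for k
 proof -
  have "compact (closure \<Omega>)" using \<Omega> by simp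
  then obtain F where "finite F" "closure \<Omega> \<subseteq> (\<Union>x\<in>F. ball x (r k))"
   using r[of k] unfolding compact_eq_totally_bounded by blast
  then show ?thesis using finite_list by metis
 qed
 then obtain xs where xs: "\<And>k. closure \<Omega> \<subseteq> (\<Union>x\<in>set (xs k). ball x (r k))" by metis
 obtain bs :: "'a list" where bs: "set bs = Basis" using finite_list[OF finite_Basis] by blast
 \<comment> \<open>Rounded gradient components at the points of a net. They are lists of integers,
   so only countably many codes exist.\<close>
 define code where "code = (\<lambda>k m u. map (\<lambda>x. map (\<lambda>i. \<lfloor>real (Suc m) * (grad u x \<bullet> i)\<rfloor>) bs) (xs k))"
 define cls where "cls = (\<lambda>k m cd. {u \<in> ?T. (\<forall>x y. dist x y < r k \<longrightarrow> norm (grad u x - grad u y) < r m) \<and> code k m u = cd})"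
 define rep where "rep = (\<lambda>(k, m, cd). SOME u. u \<in> cls k m cd)"
 define D where "D = rep ` {(k, m, cd). cls k m cd \<noteq> {}}"
 have "countable D" unfolding D_def by (intro countable_image) auto
 moreover have "D \<subseteq> ?T"
 proof
  fix v assume "v \<in> D"
  then obtain k m cd where "cls k m cd \<noteq> {}" "v = rep (k, m, cd)" by (auto simp: D_def)
  then have "v \<in> cls k m cd" by (simp add: rep_def some_in_eq)
  then show "v \<in> ?T" by (simp add: cls_def)
 qed
 moreover have "\<exists>v\<in>D. \<forall>x. norm (grad u x - grad v x) \<le> \<epsilon>" if u: "u \<in> ?T" and \<epsilon>: "0 < \<epsilon>" for u \<epsilon>
 proof -
  define N where "N = real DIM('a)"
  \<comment> \<open>In 2 + N the 2 stands for the passage from x to a net point, once for each of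
    the two functions, and N for the rounding errors of the components.\<close>
  obtain m where m: "r m < \<epsilon> / (2 + N)"
   using reals_Archimedean[of "\<epsilon> / (2 + N)"] \<epsilon> by (auto simp: r_def N_def add_pos_nonneg)
  obtain K where K: "compact K" "K \<subseteq> \<Omega>" "\<And>x. x \<notin> K ==> grad u x = 0" using test_functionsE[OF u] by metis
  obtain R where R: "0 < R" "\<And>x. x \<in> K ==> norm x \<le> R" using compact_imp_bounded[OF K(1)] by (auto simp: bounded_pos)
  have "uniformly_continuous_on (cball 0 (R + 1)) (grad u)"
   by (intro compact_uniformly_continuous test_functions_continuous[OF u]) auto
  then obtain d where d: "0 < d" "\<And>x y. x \<in> cball 0 (R + 1) ==> y \<in> cball 0 (R + 1) ==> dist y x < d ==> dist (grad u y) (grad u x) < r m"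
   unfolding uniformly_continuous_on_def using r by metis
  obtain k where k: "r k < min d 1" using reals_Archimedean[of "min d 1"] d(1) by (auto simp: r_def)
  have uc: "norm (grad u x - grad u y) < r m" if "dist x y < r k" for x y
  proof (cases "x \<in> cball 0 (R + 1) \<and> y \<in> cball 0 (R + 1)")
   case True
   then show ?thesis using d(2)[of y x] that k by (simp add: dist_norm)
  next
   case False
   have "norm x \<le> norm y + dist x y" "norm y \<le> norm x + dist x y"
    using norm_triangle_ineq2[of x y] norm_triangle_ineq2[of y x] by (auto simp: dist_norm norm_minus_commute)
   then have "R < norm x" "R < norm y" using False that k by auto
   then have "x \<notin> K" "y \<notin> K" using R(2) by force+
   then show ?thesis using K(3) r by simp
  qed
  have ucls: "u \<in> cls k m (code k m u)" using u uc by (auto simp: cls_def)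
  define v where "v = rep (k, m, code k m u)"
  have v: "v \<in> cls k m (code k m u)" unfolding v_def rep_def using someI[of "\<lambda>u'. u' \<in> cls k m (code k m u)", OF ucls] by simp
  have vD: "v \<in> D" unfolding D_def v_def using ucls by blast
  have vT: "v \<in> ?T" using v by (simp add: cls_def)
  obtain L where L: "L \<subseteq> \<Omega>" "\<And>x. x \<notin> L ==> grad v x = 0" using test_functionsE[OF vT] by metis
  have "norm (grad u x - grad v x) \<le> \<epsilon>" for x
  proof (cases "x \<in> \<Omega>")
   case True
   then obtain y where y: "y \<in> set (xs k)" "dist y x < r k" using xs[of k] closure_subset[of \<Omega>] by fastforce
   have "\<bar>(grad u y - grad v y) \<bullet> i\<bar> \<le> r m" if "i \<in> Basis" for i
   proof -
    have "\<lfloor>real (Suc m) * (grad u y \<bullet> i)\<rfloor> = \<lfloor>real (Suc m) * (grad v y \<bullet> i)\<rfloor>"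
    proof -
     have "code k m v = code k m u" using v by (simp add: cls_def)
     then show ?thesis using y(1) that bs by (auto simp: code_def)
    qed
    then have "\<bar>real (Suc m) * (grad u y \<bullet> i) - real (Suc m) * (grad v y \<bullet> i)\<bar> \<le> 1" by linarith
    then have "real (Suc m) * \<bar>(grad u y - grad v y) \<bullet> i\<bar> \<le> 1"
     by (simp add: inner_diff_left right_diff_distrib[symmetric] abs_mult del: of_nat_Suc)
    then show ?thesis by (simp add: r_def field_simps del: of_nat_Suc)
   qed
   then have "(\<Sum>i\<in>Basis. \<bar>(grad u y - grad v y) \<bullet> i\<bar>) \<le> N * r m"
    using sum_bounded_above[of Basis "\<lambda>i. \<bar>(grad u y - grad v y) \<bullet> i\<bar>" "r m"] by (simp add: N_def)
   then have 1: "norm (grad u y - grad v y) \<le> N * r m" using norm_le_l1 order.trans by blast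
   have 2: "norm (grad u x - grad u y) < r m" using uc y(2) by (simp add: dist_commute)
   have 3: "norm (grad v y - grad v x) < r m" using v y(2) by (auto simp: cls_def)
   have "grad u x - grad v x = (grad u x - grad u y) + (grad u y - grad v y) + (grad v y - grad v x)" by simp
   then have "norm (grad u x - grad v x) \<le> norm (grad u x - grad u y) + norm (grad u y - grad v y) + norm (grad v y - grad v x)"
    using norm_triangle_ineq[of "grad u x - grad u y + (grad u y - grad v y)" "grad v y - grad v x"]
     norm_triangle_ineq[of "grad u x - grad u y" "grad u y - grad v y"] by simp
   also have "\<dots> \<le> r m + N * r m + r m" using 1 2 3 by linarith
   also have "\<dots> = (2 + N) * r m" by (simp add: algebra_simps)
   also have "\<dots> \<le> \<epsilon>" using m by (simp add: N_def field_simps add_pos_nonneg)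
   finally show ?thesis .
  next
   case False
   then have "x \<notin> K" "x \<notin> L" using K L by auto
   then show ?thesis using K L \<epsilon> by simp
  qed
  then show ?thesis using vD by blast
 qed
 ultimately show thesis by (rule that)
qed

text \<open>The functions live in disjoint slabs of a box inside \<open>\<Omega>\<close> that
  accumulate at one of its faces, and \<open>y k\<close> is a point in the middle of the k-th slab.
  They make the family infinite, so that a countable basis can be numbered by all natural
  numbers.\<close>

lemma infinitely_many_independent_test_functions:
 fixes \<Omega> :: "'a::euclidean_space set"
 assumes \<Omega>: "open \<Omega>" "\<Omega> \<noteq> {}"
 obtains \<eta> :: "nat => 'a => real" and y where "\<And>k. \<eta> k \<in> test_functions \<Omega>" "\<And>j k. \<eta> j (y k) = 0 \<longleftrightarrow> j \<noteq> k"
proof -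
 obtain x0 where "x0 \<in> \<Omega>" using \<Omega>(2) by blast
 from open_contains_cbox[OF \<Omega>(1) this] obtain l r where lr: "cbox l r \<subseteq> \<Omega>" "x0 \<in> box l r" by metis
 obtain e :: 'a where e: "e \<in> Basis" using nonempty_Basis by blast
 define L where "L = l \<bullet> e"
 define W where "W = r \<bullet> e - l \<bullet> e"
 have W: "0 < W" using lr(2) e by (auto simp: W_def mem_box)
 define s where "s = (\<lambda>k::nat. L + W / real (k + 2))"
 have sdec: "s j \<le> s k" if "k \<le> j" for j k using W that by (auto simp: s_def intro!: divide_left_mono)
 have sstrict: "s (Suc k) < s k" for k using W by (auto simp: s_def intro!: divide_strict_left_mono)
 define \<eta> where "\<eta> = (\<lambda>k x. (flat_exp 0 (x \<bullet> e - s (Suc k)) * flat_exp 0 (s k - x \<bullet> e)) * box_approx l r 1 x)"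
 define y where "y = (\<lambda>k. x0 + ((s (Suc k) + s k) / 2 - x0 \<bullet> e) *\<^sub>R e)"
 have ye: "y k \<bullet> e = (s (Suc k) + s k) / 2" for k using e by (simp add: y_def inner_add_left)
 have yi: "y k \<bullet> i = x0 \<bullet> i" if "i \<in> Basis" "i \<noteq> e" for k i using e that by (simp add: y_def inner_add_left inner_Basis)
 have L_less: "L < s k" and s_less: "s k < L + W" for k
 proof -
  have "W / real (k + 2) < W / 1" using W by (intro divide_strict_left_mono) auto
  then show "s k < L + W" by (simp add: s_def)
  show "L < s k" using W by (simp add: s_def)
 qed
 have ybox: "y k \<in> box l r" for k
 proof -
  have "l \<bullet> i < y k \<bullet> i \<and> y k \<bullet> i < r \<bullet> i" if "i \<in> Basis" for i
  proof (cases "i = e")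
   case True
   show ?thesis using L_less[of k] L_less[of "Suc k"] s_less[of k] s_less[of "Suc k"] unfolding True ye by (simp add: L_def W_def)
  next
   case False
   then show ?thesis using yi[OF that False] lr(2) that by (auto simp: mem_box)
  qed
  then show ?thesis by (simp add: mem_box)
 qed
 have "\<eta> k \<in> test_functions \<Omega>" for k
  unfolding \<eta>_def
  by (intro test_functions_mult box_approx_test lr C_k_mult C_k_flat_exp C_k_diff C_k_inner C_k_const)
 moreover have "\<eta> j (y k) = 0 \<longleftrightarrow> j \<noteq> k" for j k
 proof -
  have b: "box_approx l r 1 (y k) \<noteq> 0" using bump_pos[of l r "y k"] ybox[of k] by (simp add: box_approx_def)
  have f0: "flat_exp 0 t = 0 \<longleftrightarrow> t \<le> 0" for t by (simp add: flat_exp_def)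
  have "\<eta> j (y k) = 0 \<longleftrightarrow> \<not> (s (Suc j) < (s (Suc k) + s k) / 2 \<and> (s (Suc k) + s k) / 2 < s j)"
   using b by (auto simp: \<eta>_def ye f0)
  also have "\<dots> \<longleftrightarrow> j \<noteq> k"
  proof (cases j k rule: linorder_cases)
   case less
   then have "s k \<le> s (Suc j)" by (intro sdec) simp
   then show ?thesis using less sstrict[of k] by auto
  next
   case equal
   then show ?thesis using sstrict[of k] by auto
  next
   case greater
   then have "s j \<le> s (Suc k)" by (intro sdec) simp
   then show ?thesis using greater sstrict[of k] by auto
  qed
  finally show ?thesis .
 qed
 ultimately show thesis by (rule that)
qed

text \<open>A maximal independent set between the range of \<open>\<eta>\<close> and its union with
  the dense set \<open>D\<close> spans \<open>D\<close>. It is infinite because of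
  \<open>\<eta>\<close> and countable because of \<open>D\<close>, hence can be listed as a
  sequence.\<close>

lemma independent_dense_sequence:
 fixes \<Omega> :: "'a::euclidean_space set"
 assumes \<Omega>: "open \<Omega>" "bounded \<Omega>" "\<Omega> \<noteq> {}"
 obtains \<phi> :: "nat => 'a => real" where "\<And>j. \<phi> j \<in> test_functions \<Omega>"
  "\<forall>n c. (\<forall>x. (\<Sum>j<n. c j * \<phi> j x) = 0) \<longrightarrow> (\<forall>j<n. c j = 0)"
  "\<And>u \<epsilon>. u \<in> test_functions \<Omega> ==> 0 < \<epsilon> ==>
   \<exists>n c. \<forall>x. norm (grad u x - grad (\<lambda>x. \<Sum>j<n. c j * \<phi> j x) x) \<le> \<epsilon>"
proof -
 obtain D where D: "countable D" "D \<subseteq> test_functions \<Omega>"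
  "\<And>u \<epsilon>. u \<in> test_functions \<Omega> ==> 0 < \<epsilon> ==> \<exists>v\<in>D. \<forall>x. norm (grad u x - grad v x) \<le> \<epsilon>"
  using countable_dense_test_functions[OF \<Omega>(2)] by blast
 obtain \<eta> :: "nat => 'a => real" and y where \<eta>: "\<And>k. \<eta> k \<in> test_functions \<Omega>" "\<And>j k. \<eta> j (y k) = 0 \<longleftrightarrow> j \<noteq> k"
  using infinitely_many_independent_test_functions[OF \<Omega>(1,3)] by blast
 have inj\<eta>: "inj \<eta>" using \<eta>(2) by (metis injI)
 have ind: "real_fun.independent (range \<eta>)"
  unfolding real_fun.independent_explicit_module
 proof (intro allI impI)
  fix t u v assume t: "finite t" "t \<subseteq> range \<eta>" "(\<Sum>w\<in>t. (\<lambda>x. u w * w x)) = 0" "v \<in> t"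
  obtain k where k: "v = \<eta> k" using t by auto
  have "(\<Sum>w\<in>t. u w * w (y k)) = (\<Sum>w\<in>{v}. u w * w (y k))"
   using t k \<eta>(2) by (intro sum.mono_neutral_right) auto
  moreover have "(\<Sum>w\<in>t. u w * w (y k)) = 0"
   using fun_cong[OF t(3), of "y k"] by (simp add: sum_fun_apply)
  ultimately show "u v = 0" using \<eta>(2)[of k k] k by simp
 qed
 obtain B where B: "range \<eta> \<subseteq> B" "B \<subseteq> range \<eta> \<union> D" "real_fun.independent B" "range \<eta> \<union> D \<subseteq> real_fun.span B"
  using real_fun.maximal_independent_subset_extend[OF _ ind, of "range \<eta> \<union> D"] by blast
 have "infinite B" using B(1) inj\<eta> finite_subset range_inj_infinite by blast
 moreover have "countable B" by (rule countable_subset[OF B(2)]) (use D(1) in auto)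
 ultimately have bij: "bij_betw (from_nat_into B) UNIV B" by (rule bij_betw_from_nat_into[rotated])
 define \<phi> where "\<phi> = from_nat_into B"
 have inj: "inj \<phi>" and ran: "range \<phi> = B" using bij by (auto simp: \<phi>_def bij_betw_def)
 show thesis
 proof (rule that[of \<phi>])
  fix j
  have "\<phi> j \<in> range \<eta> \<union> D" using B(2) unfolding ran[symmetric] by auto
  then show "\<phi> j \<in> test_functions \<Omega>" using \<eta>(1) D(2) by auto
 next
  show "\<forall>n c. (\<forall>x. (\<Sum>j<n. c j * \<phi> j x) = 0) \<longrightarrow> (\<forall>j<n. c j = 0)"
  proof (intro allI impI)
  fix n j :: nat and c :: "nat => real" assume z: "\<forall>x. (\<Sum>j<n. c j * \<phi> j x) = 0" and j: "j < n"
  have "(\<Sum>v\<in>\<phi> ` {..<n}. (\<lambda>x. c (inv_into UNIV \<phi> v) * v x)) = (\<Sum>j<n. (\<lambda>x. c j * \<phi> j x))"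
   using inj by (subst sum.reindex) (auto simp: inj_on_def)
  also have "\<dots> = 0" using z by (simp add: fun_eq_iff sum_fun_apply)
  finally have "c (inv_into UNIV \<phi> (\<phi> j)) = 0"
   by (rule real_fun.independentD[OF B(3), rotated 2]) (use j ran in auto)
  then show "c j = 0" using inj by simp
  qed
 next
  fix u and \<epsilon> :: real assume u: "u \<in> test_functions \<Omega>" "0 < \<epsilon>"
  obtain v where v: "v \<in> D" "\<And>x. norm (grad u x - grad v x) \<le> \<epsilon>" using D(3)[OF u] by blast
  have "v \<in> real_fun.span B" using v B(4) by blast
  then obtain t c where t: "finite t" "t \<subseteq> B" "v = (\<Sum>w\<in>t. (\<lambda>x. c w * w x))"
   unfolding real_fun.span_explicit by blast
  have "finite (inv_into UNIV \<phi> ` t)" using t(1) by simp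
  then obtain n where n: "\<forall>j\<in>inv_into UNIV \<phi> ` t. j < n" unfolding finite_nat_set_iff_bounded by blast
  have tsub: "t \<subseteq> \<phi> ` {..<n}"
  proof
   fix w assume w: "w \<in> t"
   then have "w = \<phi> (inv_into UNIV \<phi> w)" using t(2) ran by (metis f_inv_into_f subsetD)
   then show "w \<in> \<phi> ` {..<n}" using n w by blast
  qed
  have "(\<Sum>j<n. (if \<phi> j \<in> t then c (\<phi> j) else 0) * \<phi> j x) = v x" for x
  proof -
   have "(\<Sum>j<n. (if \<phi> j \<in> t then c (\<phi> j) else 0) * \<phi> j x) = (\<Sum>w\<in>\<phi> ` {..<n}. (if w \<in> t then c w else 0) * w x)"
    using inj by (subst sum.reindex) (auto simp: inj_on_def)
   also have "\<dots> = (\<Sum>w\<in>t. c w * w x)" using tsub by (intro sum.mono_neutral_cong_right) auto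
   finally show ?thesis by (simp add: t(3) sum_fun_apply)
  qed
  then have "(\<lambda>x. \<Sum>j<n. (if \<phi> j \<in> t then c (\<phi> j) else 0) * \<phi> j x) = v" by (rule ext)
  then show "\<exists>n c. \<forall>x. norm (grad u x - grad (\<lambda>x. \<Sum>j<n. c j * \<phi> j x) x) \<le> \<epsilon>"
   using v(2) by metis
 qed
qed

section \<open>Linking for even functionals\<close>

text \<open>Coefficient vectors are sequences vanishing from \<open>n\<close> on. The spaces of all
  dimensions are then nested in one type, which is also the type of the points of
  \<open>nsphere\<close>.\<close>

definition fin_space :: "nat => (nat => real) set" where
 "fin_space n = {c. \<forall>i\<ge>n. c i = 0}"

lemma tendsto_coordinatewise:
 fixes f :: "'x => nat => real"
 shows "(f \<longlongrightarrow> l) F \<longleftrightarrow> (\<forall>i. ((\<lambda>x. f x i) \<longlongrightarrow> l i) F)"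
proof -
 have "(f \<longlongrightarrow> l) F \<longleftrightarrow> limitin (product_topology (\<lambda>i. euclidean) UNIV) f l F"
  by (simp add: euclidean_product_topology)
 then show ?thesis by (simp add: limitin_componentwise)
qed

lemma closed_fin_space: "closed (fin_space n)"
proof -
 have "closed {c::nat => real. \<forall>i. i \<ge> n \<longrightarrow> c i = 0}"
  by (intro closed_Collect_all closed_Collect_imp closed_Collect_eq open_Collect_const
    continuous_on_product_coordinates continuous_on_const)
 then show ?thesis by (simp add: fin_space_def)
qed

lemma compact_fin_box: "compact {c \<in> fin_space n. \<forall>i. \<bar>c i\<bar> \<le> R}"
proof -
 define S where "S = (\<lambda>i. if i < n then {- R..R} else {0::real} \<inter> {- R..R})"
 have "compactin (product_topology (\<lambda>i. euclidean) UNIV) (PiE UNIV S)"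
  unfolding compactin_PiE by (auto simp: S_def intro!: compact_Int_closed)
 then have "compact (PiE UNIV S)" by (simp add: euclidean_product_topology)
 moreover have "PiE UNIV S = {c \<in> fin_space n. \<forall>i. \<bar>c i\<bar> \<le> R}"
  by (auto simp: S_def fin_space_def PiE_iff abs_le_iff split: if_splits) (metis atLeastAtMost_iff minus_le_iff not_le singletonD IntE IntD1 IntD2)+
 ultimately show ?thesis by simp
qed

lemma continuous_map_nsphere_iff:
 "continuous_map (nsphere m) euclideanreal f \<longleftrightarrow> continuous_on (topspace (nsphere m)) f"
proof -
 have "nsphere m = top_of_set (topspace (nsphere m))"
  unfolding nsphere by (simp add: euclidean_product_topology)
 then show ?thesis by (metis continuous_map_iff_continuous)
qed

text \<open>\<open>J'\<close> lists the partial derivatives, given through derivatives along lines.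
  \<open>J_coercive\<close> bounds the superlevel sets: on finite-dimensional spaces the energy
  tends to minus infinity, which is why deformations go upwards.\<close>

locale even_functional =
 fixes n :: nat and J :: "(nat => real) => real" and J' :: "nat => (nat => real) => real"
 assumes J_cont: "continuous_on (fin_space n) J"
  and J'_cont: "\<And>i. i < n ==> continuous_on (fin_space n) (J' i)"
  and J_deriv: "\<And>c v. c \<in> fin_space n ==> v \<in> fin_space n ==>
   ((\<lambda>t. J (\<lambda>i. c i + t * v i)) has_field_derivative (\<Sum>i<n. J' i c * v i)) (at 0)"
  and J_even: "\<And>c. c \<in> fin_space n ==> J (\<lambda>i. - c i) = J c"
  and J'_odd: "\<And>c i. c \<in> fin_space n ==> i < n ==> J' i (\<lambda>i. - c i) = - J' i c"
  and J_coercive: "\<And>b. \<exists>R. \<forall>c\<in>fin_space n. b \<le> J c \<longrightarrow> (\<forall>i. \<bar>c i\<bar> \<le> R)"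
begin

definition gradJ :: "(nat => real) => nat => real" where
 "gradJ c i = (if i < n then J' i c else 0)"

lemma gradJ_in: "gradJ c \<in> fin_space n"
 by (simp add: fin_space_def gradJ_def)

lemma compact_slab: "compact {c \<in> fin_space n. b \<le> J c \<and> J c \<le> d}"
proof -
 obtain R where R: "\<And>c. c \<in> fin_space n ==> b \<le> J c ==> \<forall>i. \<bar>c i\<bar> \<le> R" using J_coercive[of b] by blast
 have "closed (fin_space n \<inter> J -` {b..d})"
  by (rule continuous_closed_preimage[OF J_cont closed_fin_space]) simp
 then have "compact ({c \<in> fin_space n. \<forall>i. \<bar>c i\<bar> \<le> R} \<inter> (fin_space n \<inter> J -` {b..d}))"
  by (rule compact_Int_closed[OF compact_fin_box])
 also have "{c \<in> fin_space n. \<forall>i. \<bar>c i\<bar> \<le> R} \<inter> (fin_space n \<inter> J -` {b..d}) = {c \<in> fin_space n. b \<le> J c \<and> J c \<le> d}"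
  using R by auto
 finally show ?thesis .
qed

lemma line_in: "c \<in> fin_space n ==> v \<in> fin_space n ==> (\<lambda>i. c i + t * v i) \<in> fin_space n"
 by (simp add: fin_space_def)

lemma J_line_deriv:
 assumes "c \<in> fin_space n" "v \<in> fin_space n"
 shows "((\<lambda>t. J (\<lambda>i. c i + t * v i)) has_field_derivative (\<Sum>i<n. J' i (\<lambda>i. c i + s * v i) * v i)) (at s)"
proof -
 have "((\<lambda>t. J (\<lambda>i. (c i + s * v i) + t * v i)) has_field_derivative (\<Sum>i<n. J' i (\<lambda>i. c i + s * v i) * v i)) (at 0)"
  by (rule J_deriv[OF line_in[OF assms] assms(2)])
 then have "((\<lambda>t. J (\<lambda>i. c i + (t + s) * v i)) has_field_derivative (\<Sum>i<n. J' i (\<lambda>i. c i + s * v i) * v i)) (at 0)"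
  by (simp add: algebra_simps)
 then show ?thesis using DERIV_shift[of "\<lambda>t. J (\<lambda>i. c i + t * v i)" _ 0 s] by simp
qed

text \<open>With \<open>J'\<close> merely continuous, one step length valid on the whole slab is
  sought instead of a flow. If there were none, the mean value theorem would give points approaching
  some \<open>c0\<close> at which the derivative along the gradient is below half of the squared
  gradient; in the limit the squared gradient at \<open>c0\<close> would be at most half of itself,
  hence zero.\<close>

lemma uniform_ascent_step:
 assumes nocrit: "\<And>c. c \<in> fin_space n ==> b \<le> J c ==> J c \<le> d ==> \<exists>i<n. J' i c \<noteq> 0"
 obtains s where "0 < s" "\<And>c t. c \<in> fin_space n ==> b \<le> J c ==> J c \<le> d ==> 0 \<le> t ==> t \<le> s ==>
   J c + t * ((\<Sum>i<n. (J' i c)\<^sup>2) / 2) \<le> J (\<lambda>i. c i + t * gradJ c i)"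
proof (rule ccontr)
 assume no: "\<not> thesis"
 define C where "C = {c \<in> fin_space n. b \<le> J c \<and> J c \<le> d}"
 define G where "G = (\<lambda>c. \<Sum>i<n. (J' i c)\<^sup>2)"
 have "\<exists>c t. c \<in> C \<and> 0 \<le> t \<and> t \<le> inverse (real (Suc j)) \<and> J (\<lambda>i. c i + t * gradJ c i) < J c + t * (G c / 2)"
  (is "\<exists>c t. ?Q j c t") for j
 proof (rule ccontr)
  assume "\<not> ?thesis"
  then have "J c + t * (G c / 2) \<le> J (\<lambda>i. c i + t * gradJ c i)"
   if "c \<in> C" "0 \<le> t" "t \<le> inverse (real (Suc j))" for c t using that by (auto simp: not_less)
  then show False using no that[of "inverse (real (Suc j))"] by (auto simp: C_def G_def)
 qed
 then have "\<exists>c t. \<forall>j. ?Q j (c j) (t j)" by (subst choice_iff[symmetric])+ blast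
 then obtain c t where ct: "\<And>j. c j \<in> C" "\<And>j. 0 \<le> t j" "\<And>j. t j \<le> inverse (real (Suc j))"
  "\<And>j. J (\<lambda>i. c j i + t j * gradJ (c j) i) < J (c j) + t j * (G (c j) / 2)" by blast
 let ?c = "\<lambda>j z i. c j i + z * gradJ (c j) i"
 have cV: "c j \<in> fin_space n" for j using ct(1) by (auto simp: C_def)
 have "\<exists>z. 0 \<le> z \<and> z \<le> inverse (real (Suc j)) \<and> (\<Sum>i<n. J' i (?c j z) * J' i (c j)) < G (c j) / 2" for j
 proof -
  have tpos: "0 < t j" using ct(2)[of j] ct(4)[of j] by (cases "t j = 0") auto
  obtain z where z: "0 < z" "z < t j"
   "J (?c j (t j)) - J (?c j 0) = (t j - 0) * (\<Sum>i<n. J' i (?c j z) * gradJ (c j) i)"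
   using MVT2[OF tpos, of "\<lambda>t. J (?c j t)" "\<lambda>z. \<Sum>i<n. J' i (?c j z) * gradJ (c j) i"]
    J_line_deriv[OF cV gradJ_in] by auto
  from z(3) have "J (?c j (t j)) - J (c j) = t j * (\<Sum>i<n. J' i (?c j z) * gradJ (c j) i)"
   by simp
  then have "t j * (\<Sum>i<n. J' i (?c j z) * gradJ (c j) i) < t j * (G (c j) / 2)"
   using ct(4)[of j] by linarith
  then have "(\<Sum>i<n. J' i (?c j z) * gradJ (c j) i) < G (c j) / 2" using tpos by (simp only: mult_less_cancel_left_pos)
  moreover have "(\<Sum>i<n. J' i (?c j z) * gradJ (c j) i) = (\<Sum>i<n. J' i (?c j z) * J' i (c j))"
   by (intro sum.cong) (auto simp: gradJ_def)
  ultimately show ?thesis using z ct(3)[of j] by (intro exI[of _ z]) auto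
 qed
 then obtain z where z: "\<And>j. 0 \<le> z j" "\<And>j. z j \<le> inverse (real (Suc j))"
  "\<And>j. (\<Sum>i<n. J' i (?c j (z j)) * J' i (c j)) < G (c j) / 2" by metis
 have "z \<longlonglongrightarrow> 0" by (rule tendsto_sandwich[OF _ _ tendsto_const LIMSEQ_inverse_real_of_nat]) (use z in auto)
 have "\<exists>l\<in>C. \<exists>r. strict_mono r \<and> (c \<circ> r) \<longlonglongrightarrow> l"
  using compact_slab[of b d] ct(1) unfolding C_def[symmetric] compact_def by blast
 then obtain c0 r where r: "c0 \<in> C" "strict_mono r" "(\<lambda>j. c (r j)) \<longlonglongrightarrow> c0" by (auto simp: o_def)
 have c0V: "c0 \<in> fin_space n" using r(1) by (simp add: C_def)
 have zr: "(\<lambda>j. z (r j)) \<longlonglongrightarrow> 0" using LIMSEQ_subseq_LIMSEQ[OF \<open>z \<longlonglongrightarrow> 0\<close> r(2)] by (simp add: o_def)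
 have Jlim: "(\<lambda>j. J' i (e j)) \<longlonglongrightarrow> J' i c0" if "i < n" "\<And>j. e j \<in> fin_space n" "e \<longlonglongrightarrow> c0" for i and e :: "nat => nat => real"
  using continuous_on_tendsto_compose[OF J'_cont[OF that(1)] that(3) c0V] that(2) by simp
 have glim: "(\<lambda>j. gradJ (c (r j)) i) \<longlonglongrightarrow> gradJ c0 i" for i
  using Jlim[of i "\<lambda>j. c (r j)"] cV r(3) by (cases "i < n") (auto simp: gradJ_def)
 have "(\<lambda>j. (\<lambda>i. c (r j) i + z (r j) * gradJ (c (r j)) i)) \<longlonglongrightarrow> c0"
 proof (rule tendsto_coordinatewise[THEN iffD2], intro allI)
  fix i
  have "(\<lambda>j. c (r j) i) \<longlonglongrightarrow> c0 i" using r(3) by (simp add: tendsto_coordinatewise)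
  from tendsto_add[OF this tendsto_mult[OF zr glim[of i]]]
  show "(\<lambda>j. c (r j) i + z (r j) * gradJ (c (r j)) i) \<longlonglongrightarrow> c0 i" by simp
 qed
 then have l1: "(\<lambda>j. \<Sum>i<n. J' i (\<lambda>i. c (r j) i + z (r j) * gradJ (c (r j)) i) * J' i (c (r j))) \<longlonglongrightarrow> (\<Sum>i<n. J' i c0 * J' i c0)"
  by (intro tendsto_sum tendsto_mult Jlim) (use cV gradJ_in line_in r(3) in auto)
 have l2: "(\<lambda>j. G (c (r j)) / 2) \<longlonglongrightarrow> G c0 / 2"
  unfolding G_def by (intro tendsto_intros Jlim) (use cV r(3) in auto)
 have "(\<Sum>i<n. J' i c0 * J' i c0) \<le> G c0 / 2"
  by (rule LIMSEQ_le[OF l1 l2]) (use z(3) less_imp_le in blast)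
 then have "G c0 \<le> 0" by (simp add: G_def power2_eq_square)
 moreover obtain i where "i < n" "J' i c0 \<noteq> 0" using nocrit r(1) by (auto simp: C_def)
 then have "0 < G c0" unfolding G_def by (intro sum_pos2[of _ i]) auto
 ultimately show False by simp
qed

text \<open>Iteration of one damped ascent step, which is odd and continuous. From level
  \<open>b\<close> on the energy never drops, and as long as it is at most \<open>d\<close> it gains
  a fixed amount, so a fixed number of steps lifts all these points above \<open>d\<close>.\<close>

lemma odd_ascent_map:
 assumes nocrit: "\<And>c. c \<in> fin_space n ==> b \<le> J c ==> J c \<le> d + 1 ==> \<exists>i<n. J' i c \<noteq> 0"
 obtains h where "continuous_on (fin_space n) h" "\<And>c. c \<in> fin_space n ==> h c \<in> fin_space n"
  "\<And>c. c \<in> fin_space n ==> h (\<lambda>i. - c i) = (\<lambda>i. - h c i)"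
  "\<And>c. c \<in> fin_space n ==> b \<le> J c ==> d < J (h c)"
proof -
 obtain s where s: "0 < s" "\<And>c t. c \<in> fin_space n ==> b \<le> J c ==> J c \<le> d + 1 ==> 0 \<le> t ==> t \<le> s ==>
   J c + t * ((\<Sum>i<n. (J' i c)\<^sup>2) / 2) \<le> J (\<lambda>i. c i + t * gradJ c i)"
  by (rule uniform_ascent_step[of b "d + 1"]) (rule nocrit, assumption+, rule that)
 define C where "C = {c \<in> fin_space n. b \<le> J c \<and> J c \<le> d + 1}"
 define G where "G = (\<lambda>c. \<Sum>i<n. (J' i c)\<^sup>2)"
 have G0: "0 \<le> G c" for c by (auto simp: G_def intro!: sum_nonneg)
 have Gpos: "0 < G c" if "c \<in> C" for c
 proof -
  obtain i where "i < n" "J' i c \<noteq> 0" using nocrit \<open>c \<in> C\<close> by (auto simp: C_def)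
  then show ?thesis unfolding G_def by (intro sum_pos2[of _ i]) auto
 qed
 obtain \<epsilon> where \<epsilon>: "0 < \<epsilon>" "\<And>c. c \<in> C ==> \<epsilon> \<le> G c"
 proof (cases "C = {}")
  case False
  have "continuous_on C G" unfolding G_def
   by (intro continuous_intros continuous_on_subset[OF J'_cont]) (auto simp: C_def)
  then obtain c0 where "c0 \<in> C" "\<And>c. c \<in> C ==> G c0 \<le> G c"
   using continuous_attains_inf[OF compact_slab[of b "d + 1", folded C_def] False] by blast
  then show ?thesis using that Gpos by blast
 qed (use that[of 1] in auto)
 \<comment> \<open>A full step up to level \<open>d\<close> and none above \<open>d + 1\<close>: the
   step estimate is available only up to \<open>d + 1\<close>, and the transition keeps the map
   continuous. This is the origin of the upper level \<open>d + 1\<close>.\<close>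
 define cut where "cut = (\<lambda>y. max 0 (min 1 (d + 1 - y)))"
 define h1 where "h1 = (\<lambda>c i. c i + s * cut (J c) * gradJ c i)"
 have h1_cont: "continuous_on (fin_space n) h1"
 proof (rule continuous_on_coordinatewise_then_product)
  fix i
  have "continuous_on (fin_space n) (\<lambda>c. gradJ c i)"
   using J'_cont[of i] by (cases "i < n") (auto simp: gradJ_def)
  moreover have "continuous_on (fin_space n) (\<lambda>c. cut (J c))"
   unfolding cut_def by (intro continuous_intros J_cont)
  moreover have "continuous_on (fin_space n) (\<lambda>c::nat => real. c i)"
   by (rule continuous_on_subset[OF continuous_on_product_coordinates]) simp
  ultimately show "continuous_on (fin_space n) (\<lambda>c. h1 c i)"
   unfolding h1_def by (intro continuous_intros)
 qed
 have h1_in: "h1 c \<in> fin_space n" if "c \<in> fin_space n" for c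
  using line_in[OF that gradJ_in] by (simp add: h1_def)
 have h1_odd: "h1 (\<lambda>i. - c i) = (\<lambda>i. - h1 c i)" if "c \<in> fin_space n" for c
  using that by (auto simp: h1_def J_even J'_odd gradJ_def fun_eq_iff)
 have h1_J: "J c + s * cut (J c) * (\<epsilon> / 2) \<le> J (h1 c)" if c: "c \<in> fin_space n" "b \<le> J c" for c
 proof (cases "J c \<le> d + 1")
  case True
  have "0 \<le> cut (J c)" "cut (J c) \<le> 1" by (auto simp: cut_def)
  then have t: "0 \<le> s * cut (J c)" "s * cut (J c) \<le> s" using s(1) by (auto simp: mult_left_le)
  have "J c + s * cut (J c) * (\<epsilon> / 2) \<le> J c + s * cut (J c) * (G c / 2)"
   using \<epsilon>(2)[of c] True c t by (intro add_left_mono mult_left_mono) (auto simp: C_def)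
  also have "\<dots> \<le> J (h1 c)" using s(2)[OF c True t] by (simp add: h1_def G_def)
  finally show ?thesis .
 next
  case False
  then have "cut (J c) = 0" by (simp add: cut_def)
  then show ?thesis by (simp add: h1_def)
 qed
 \<comment> \<open>The gain of a full step: its length times half of a lower bound for the squared
   gradient on the slab.\<close>
 define \<eta> where "\<eta> = s * \<epsilon> / 2"
 have \<eta>: "0 < \<eta>" using s \<epsilon> by (simp add: \<eta>_def)
 have iter: "(h1 ^^ m) c \<in> fin_space n \<and> b \<le> J ((h1 ^^ m) c) \<and> (d < J ((h1 ^^ m) c) \<or> b + real m * \<eta> \<le> J ((h1 ^^ m) c))"
  if c: "c \<in> fin_space n" "b \<le> J c" for c m
 proof (induction m)
  case (Suc m)
  let ?e = "(h1 ^^ m) c"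
  have step: "J ?e + s * cut (J ?e) * (\<epsilon> / 2) \<le> J (h1 ?e)" using h1_J Suc by simp
  moreover have "0 \<le> s * cut (J ?e) * (\<epsilon> / 2)" using s \<epsilon> by (simp add: cut_def)
  ultimately have le: "J ?e \<le> J (h1 ?e)" by linarith
  show ?case
  proof (cases "J ?e \<le> d")
   case True
   then have "cut (J ?e) = 1" by (simp add: cut_def)
   then have "J ?e + \<eta> \<le> J (h1 ?e)" using step by (simp add: \<eta>_def)
   then show ?thesis using Suc h1_in le True by (auto simp: distrib_right)
  next
   case False
   then show ?thesis using Suc h1_in le by auto
  qed
 qed (use that in auto)
 obtain m :: nat where "(d - b) / \<eta> < real m" using reals_Archimedean2 by blast
 then have m: "d < b + real m * \<eta>" using \<eta> by (simp add: field_simps)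
 have mem: "(h1 ^^ j) c \<in> fin_space n" if "c \<in> fin_space n" for j c
  by (induction j) (use that h1_in in auto)
 show thesis
 proof (rule that[of "h1 ^^ m"])
  have "continuous_on (fin_space n) (h1 ^^ j)" for j
  proof (induction j)
   case (Suc j)
   then show ?case using continuous_on_compose2[OF h1_cont, of "fin_space n" "h1 ^^ j"] mem by (auto simp: o_def)
  qed (auto simp: id_def)
  then show "continuous_on (fin_space n) (h1 ^^ m)" .
  have "(h1 ^^ j) (\<lambda>i. - c i) = (\<lambda>i. - (h1 ^^ j) c i)" if "c \<in> fin_space n" for c j
   by (induction j) (use mem that h1_odd in auto)
  then show "(h1 ^^ m) (\<lambda>i. - c i) = (\<lambda>i. - (h1 ^^ m) c i)" if "c \<in> fin_space n" for c using that .
  show "d < J ((h1 ^^ m) c)" if "c \<in> fin_space n" "b \<le> J c" for c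
   using iter[OF that, of m] m by auto
 qed (use mem in auto)
qed

text \<open>Without a critical point between the levels, \<open>h\<close> lifts above
  \<open>d\<close> every \<open>\<sigma> c\<close> for which the k functionals vanish at
  \<open>c\<close>. The Borsuk--Ulam theorem on the sphere of dimension n - 1 is applied to n - 1
  odd functions: the k functionals, and the coordinates of \<open>h (\<sigma> c)\<close> from k + 1
  on. A common zero is sent into \<open>fin_space (Suc k)\<close>, where the energy is at most
  \<open>d\<close>, a contradiction.\<close>

theorem critical_point_linking:
 fixes L :: "nat => (nat => real) => real"
 assumes k: "k < n"
  and L: "\<And>i. i < k ==> continuous_on (fin_space n) (L i)" "\<And>i c. i < k ==> L i (\<lambda>j. - c j) = - L i c"
  and \<sigma>: "continuous_on (fin_space n - {\<lambda>i. 0}) \<sigma>" "\<And>c. c \<in> fin_space n ==> \<sigma> c \<in> fin_space n"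
   "\<And>c. \<sigma> (\<lambda>i. - c i) = (\<lambda>i. - \<sigma> c i)"
  and low: "\<And>c. c \<in> fin_space n ==> c \<noteq> (\<lambda>i. 0) ==> (\<And>i. i < k ==> L i c = 0) ==> b \<le> J (\<sigma> c)"
  and up: "\<And>c. c \<in> fin_space (Suc k) ==> J c \<le> d"
 obtains c where "c \<in> fin_space n" "b \<le> J c" "J c \<le> d + 1" "\<And>i. i < n ==> J' i c = 0"
proof (rule ccontr)
 assume no: "\<not> thesis"
 note crit = that
 have nocrit: "\<exists>i<n. J' i c \<noteq> 0" if "c \<in> fin_space n" "b \<le> J c" "J c \<le> d + 1" for c
  using crit[OF that] no by blast
 obtain h where h: "continuous_on (fin_space n) h" "\<And>c. c \<in> fin_space n ==> h c \<in> fin_space n"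
  "\<And>c. c \<in> fin_space n ==> h (\<lambda>i. - c i) = (\<lambda>i. - h c i)"
  "\<And>c. c \<in> fin_space n ==> b \<le> J c ==> d < J (h c)"
  by (rule odd_ascent_map[of b d]) (rule nocrit, assumption+, rule that)
 define m where "m = n - 1"
 have S: "c \<in> fin_space n - {\<lambda>i. 0}" if "c \<in> topspace (nsphere m)" for c
  using that k by (force simp: nsphere fin_space_def m_def)
 \<comment> \<open>The shift to \<open>Suc i\<close> is the dimension count: the indices k to n - 2
   stand for the coordinates k + 1 to n - 1, and the coordinates 0 to k stay free.\<close>
 define g where "g = (\<lambda>i c. if i < k then L i c else h (\<sigma> c) (Suc i))"
 have "continuous_map (nsphere m) euclideanreal (g i)" if "i < m" for i
  unfolding continuous_map_nsphere_iff
 proof (cases "i < k")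
  case True
  have "continuous_on (topspace (nsphere m)) (L i)"
   by (rule continuous_on_subset[OF L(1)[OF True]]) (use S in auto)
  then show "continuous_on (topspace (nsphere m)) (g i)" using True by (simp add: g_def)
 next
  case False
  have "continuous_on (topspace (nsphere m)) (\<lambda>c. h (\<sigma> c))"
   by (rule continuous_on_compose2[OF h(1) continuous_on_subset[OF \<sigma>(1)]]) (use S \<sigma>(2) in auto)
  then have "continuous_on (topspace (nsphere m)) (\<lambda>c. h (\<sigma> c) (Suc i))"
   by (rule continuous_on_product_then_coordinatewise)
  then show "continuous_on (topspace (nsphere m)) (g i)" using False by (simp add: g_def)
 qed
 moreover have "g i (\<lambda>j. - c j) = - g i c" if "i < m" "c \<in> topspace (nsphere m)" for i c
  using L(2)[of i c] h(3)[OF \<sigma>(2)] \<sigma>(3) S[OF that(2)] by (auto simp: g_def)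
 ultimately obtain c where c: "c \<in> topspace (nsphere m)" "\<And>i. i < m ==> g i c = 0"
  using borsuk_ulam[of m g] by metis
 have cV: "c \<in> fin_space n" "c \<noteq> (\<lambda>i. 0)" using S[OF c(1)] by auto
 have "L i c = 0" if "i < k" for i using c(2)[of i] that k by (simp add: g_def m_def)
 then have "b \<le> J (\<sigma> c)" by (intro low cV)
 then have "d < J (h (\<sigma> c))" by (intro h(4) \<sigma>(2) cV)
 moreover have "h (\<sigma> c) \<in> fin_space (Suc k)"
 proof -
  have "h (\<sigma> c) j = 0" if kj: "Suc k \<le> j" for j
  proof (cases "j < n")
   case True
   obtain i where "j = Suc i" using kj by (cases j) auto
   then show ?thesis using c(2)[of i] kj True by (simp add: g_def m_def)
  next
   case False
   then show ?thesis using h(2)[OF \<sigma>(2)[OF cV(1)]] by (simp add: fin_space_def)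
  qed
  then show ?thesis by (simp add: fin_space_def)
 qed
 then have "J (h (\<sigma> c)) \<le> d" by (rule up)
 ultimately show False by simp
qed

end

section \<open>The energy\<close>

lemma borel_measurable_lebesgue_on_AE:
 fixes f g :: "'a::euclidean_space => real"
 assumes S: "S \<in> sets lebesgue" and f: "f \<in> borel_measurable (lebesgue_on S)" and AE: "AE x in lebesgue_on S. f x = g x"
 shows "g \<in> borel_measurable (lebesgue_on S)"
proof -
 have "(\<lambda>x. if x \<in> S then f x else 0) \<in> borel_measurable lebesgue"
  using f S by (subst borel_measurable_if) auto
 moreover have "AE x in lebesgue. x \<in> S \<longrightarrow> f x = g x"
  using AE S by (subst (asm) AE_restrict_space_iff) auto
 then have "AE x in lebesgue. (if x \<in> S then f x else 0) = (if x \<in> S then g x else 0)"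
  by eventually_elim auto
 ultimately have "(\<lambda>x. if x \<in> S then g x else 0) \<in> borel_measurable lebesgue"
  by (rule borel_measurable_AE)
 then show ?thesis using S by (subst (asm) borel_measurable_if) auto
qed

text \<open>Rounding t down to the grid of mesh 1 / (n + 1) gives countably many measurable pieces,
  and continuity in t recovers the function in the limit.\<close>

lemma caratheodory_jointly_measurable:
 fixes g :: "'x => real => real"
 assumes meas: "\<And>t. (\<lambda>x. g x t) \<in> borel_measurable M" and cont: "\<And>x. x \<in> space M ==> continuous_on UNIV (g x)"
 shows "(\<lambda>(x, t). g x t) \<in> borel_measurable (M \<Otimes>\<^sub>M borel)"
proof (rule borel_measurable_LIMSEQ_real)
 fix n :: nat
 have "(\<lambda>z. (\<lambda>(i::int) z. g (fst z) (real_of_int i / real (Suc n))) \<lfloor>real (Suc n) * snd z\<rfloor> z) \<in> borel_measurable (M \<Otimes>\<^sub>M borel)"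
 proof (rule measurable_compose_countable[where f = "\<lambda>i z. g (fst z) (real_of_int i / real (Suc n))"])
  show "(\<lambda>z. g (fst z) (real_of_int i / real (Suc n))) \<in> borel_measurable (M \<Otimes>\<^sub>M borel)" for i
   using measurable_compose[OF measurable_fst meas] .
  show "(\<lambda>z. \<lfloor>real (Suc n) * snd z\<rfloor>) \<in> M \<Otimes>\<^sub>M borel \<rightarrow>\<^sub>M count_space UNIV"
   by measurable
 qed
 then show "(\<lambda>z. g (fst z) (real_of_int \<lfloor>real (Suc n) * snd z\<rfloor> / real (Suc n))) \<in> borel_measurable (M \<Otimes>\<^sub>M borel)" .
next
 fix z assume "z \<in> space (M \<Otimes>\<^sub>M (borel :: real measure))"
 then have x: "fst z \<in> space M" by (auto simp: space_pair_measure)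
 have "(\<lambda>n. real_of_int \<lfloor>real (Suc n) * snd z\<rfloor> / real (Suc n)) \<longlonglongrightarrow> snd z"
 proof (rule LIM_zero_cancel, rule Lim_null_comparison[OF _ LIMSEQ_inverse_real_of_nat], intro always_eventually allI)
  fix n
  have "\<bar>real_of_int \<lfloor>real (Suc n) * snd z\<rfloor> - real (Suc n) * snd z\<bar> \<le> 1" by linarith
  moreover have "real_of_int \<lfloor>real (Suc n) * snd z\<rfloor> / real (Suc n) - snd z = (real_of_int \<lfloor>real (Suc n) * snd z\<rfloor> - real (Suc n) * snd z) / real (Suc n)"
   by (simp add: field_simps del: of_nat_Suc)
  ultimately show "norm (real_of_int \<lfloor>real (Suc n) * snd z\<rfloor> / real (Suc n) - snd z) \<le> inverse (real (Suc n))"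
   by (simp add: inverse_eq_divide divide_right_mono del: of_nat_Suc)
 qed
 from continuous_on_tendsto_compose[OF cont[OF x] this]
 show "(\<lambda>n. g (fst z) (real_of_int \<lfloor>real (Suc n) * snd z\<rfloor> / real (Suc n))) \<longlonglongrightarrow> (case z of (x, t) => g x t)"
  by (simp add: case_prod_unfold)
qed

lemma caratheodory_compose_measurable:
 fixes g :: "'x => real => real"
 assumes "\<And>t. (\<lambda>x. g x t) \<in> borel_measurable M" "\<And>x. x \<in> space M ==> continuous_on UNIV (g x)"
  and "u \<in> borel_measurable M"
 shows "(\<lambda>x. g x (u x)) \<in> borel_measurable M"
 using measurable_compose[OF measurable_Pair[OF measurable_ident assms(3)] caratheodory_jointly_measurable[OF assms(1,2)]]
 by simp

lemma primitive_has_derivative: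
 assumes "continuous_on UNIV g"
 shows "(primitive g has_field_derivative g t) (at t)"
proof -
 define R where "R = \<bar>t\<bar> + 1"
 have "((\<lambda>u. LBINT y=ereal 0..ereal u. g y) has_vector_derivative g t) (at t within {- R..R})"
  by (rule interval_integral_FTC2) (use assms in \<open>auto simp: R_def elim: continuous_on_subset\<close>)
 moreover have "at t within {- R..R} = at t" by (rule at_within_interior) (auto simp: R_def)
 ultimately show ?thesis
  by (simp add: primitive_def[abs_def] has_real_derivative_iff_has_vector_derivative)
qed

lemma primitive_0 [simp]: "primitive g 0 = 0"
 by (simp add: primitive_def)

lemma primitive_caratheodory_measurable:
 fixes g :: "'x => real => real"
 assumes "\<And>t. (\<lambda>x. g x t) \<in> borel_measurable M" "\<And>x. x \<in> space M ==> continuous_on UNIV (g x)"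
 shows "(\<lambda>x. primitive (g x) t) \<in> borel_measurable M"
proof -
 have j: "(\<lambda>(x, s). g x s) \<in> borel_measurable (M \<Otimes>\<^sub>M borel)"
  by (rule caratheodory_jointly_measurable[OF assms])
 have "(\<lambda>x. \<integral>s. indicator S s * g x s \<partial>lborel) \<in> borel_measurable M" if [measurable]: "S \<in> sets borel" for S :: "real set"
 proof (rule lborel.borel_measurable_lebesgue_integral)
  have "(\<lambda>z. indicator S (snd z) * (case z of (x, s) => g x s)) \<in> borel_measurable (M \<Otimes>\<^sub>M borel)"
   using j by measurable
  then show "(\<lambda>(x, s). indicator S s * g x s) \<in> borel_measurable (M \<Otimes>\<^sub>M lborel)"
   by (simp add: case_prod_unfold measurable_cong_sets[OF sets_pair_measure_cong[OF refl sets_lborel] refl])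
 qed
 then show ?thesis
  unfolding primitive_def interval_lebesgue_integral_def set_lebesgue_integral_def
  by (cases "0 \<le> t") auto
qed

lemma primitive_even:
 assumes "continuous_on UNIV g" "\<And>t. g (- t) = - g t"
 shows "primitive g (- t) = primitive g t"
proof -
 have "((\<lambda>t. primitive g (- t) - primitive g t) has_field_derivative 0) (at s)" for s
 proof -
  have "(uminus has_field_derivative - 1) (at s)" by (auto intro!: derivative_eq_intros)
  from DERIV_chain2[OF primitive_has_derivative[OF assms(1)] this] primitive_has_derivative[OF assms(1), of s]
  show ?thesis by (auto intro!: derivative_eq_intros simp: assms(2))
 qed
 then have "primitive g (- t) - primitive g t = primitive g (- 0) - primitive g 0"
  by (rule DERIV_isconst_all[rule_format])
 then show ?thesis by simp
qed

lemma primitive_growth: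
 assumes cont: "continuous_on UNIV g" and bd: "\<And>t. \<bar>g t\<bar> \<le> C * (1 + \<bar>t\<bar> powr (r - 1))" and r: "1 < r"
 shows "\<bar>primitive g t\<bar> \<le> C * (\<bar>t\<bar> + \<bar>t\<bar> powr r)"
proof -
 have C: "0 \<le> C" using order.trans[OF abs_ge_zero bd[of 0]] by simp
 have "norm (primitive g t - primitive g 0) \<le> (C * (1 + \<bar>t\<bar> powr (r - 1))) * norm (t - 0)"
 proof (rule field_differentiable_bound[where S = "{- \<bar>t\<bar>..\<bar>t\<bar>}" and f' = g])
  fix s assume s: "s \<in> {- \<bar>t\<bar>..\<bar>t\<bar>}"
  have "\<bar>s\<bar> powr (r - 1) \<le> \<bar>t\<bar> powr (r - 1)" using s r by (intro powr_mono2) auto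
  then have "C * (1 + \<bar>s\<bar> powr (r - 1)) \<le> C * (1 + \<bar>t\<bar> powr (r - 1))" using C by (intro mult_left_mono) auto
  then show "norm (g s) \<le> C * (1 + \<bar>t\<bar> powr (r - 1))" using bd[of s] by simp
 qed (use primitive_has_derivative[OF cont] in \<open>auto intro: has_field_derivative_at_within\<close>)
 also have "\<dots> = C * (\<bar>t\<bar> + \<bar>t\<bar> powr (r - 1) * \<bar>t\<bar>)" by (simp add: algebra_simps)
 also have "\<bar>t\<bar> powr (r - 1) * \<bar>t\<bar> = \<bar>t\<bar> powr r"
  using powr_mult_base[of "\<bar>t\<bar>" "r - 1"] by (simp add: mult.commute)
 finally show ?thesis by simp
qed

text \<open>The Ambrosetti--Rabinowitz condition makes \<open>t powr - \<sigma> * primitive g t\<close> nondecreasing.\<close>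

lemma primitive_ambrosetti_rabinowitz:
 assumes cont: "continuous_on UNIV g" and t0: "0 < t0" and \<sigma>: "0 < \<sigma>"
  and AR: "\<And>t. t0 \<le> t ==> c \<le> \<sigma> * primitive g t \<and> \<sigma> * primitive g t \<le> t * g t"
  and t: "t0 \<le> t"
 shows "c / \<sigma> * (t / t0) powr \<sigma> \<le> primitive g t"
proof -
 let ?h = "\<lambda>t. primitive g t * t powr (- \<sigma>)"
 have "?h t0 \<le> ?h t"
 proof (rule DERIV_nonneg_imp_nondecreasing[OF t])
  fix s assume s: "t0 \<le> s" "s \<le> t"
  have spos: "0 < s" using s t0 by simp
  have "(?h has_field_derivative (g s * s powr (- \<sigma>) + primitive g s * (- \<sigma> * s powr (- \<sigma> - 1)))) (at s)"
   using spos by (auto intro!: derivative_eq_intros primitive_has_derivative[OF cont])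
  moreover have "g s * s powr (- \<sigma>) + primitive g s * (- \<sigma> * s powr (- \<sigma> - 1)) = s powr (- \<sigma> - 1) * (s * g s - \<sigma> * primitive g s)"
   using powr_mult_base[of s "- \<sigma> - 1"] spos by (simp add: algebra_simps)
  moreover have "0 \<le> s powr (- \<sigma> - 1) * (s * g s - \<sigma> * primitive g s)" using AR[of s] s by simp
  ultimately show "\<exists>y. (?h has_field_derivative y) (at s) \<and> 0 \<le> y" by metis
 qed
 then have "primitive g t0 * t0 powr (- \<sigma>) * t powr \<sigma> \<le> primitive g t * t powr (- \<sigma>) * t powr \<sigma>"
  by (intro mult_right_mono) auto
 also have "\<dots> = primitive g t" using t t0 by (simp add: powr_minus)
 finally have "primitive g t0 * (t / t0) powr \<sigma> \<le> primitive g t"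
  using t t0 by (simp add: powr_divide powr_minus_divide mult_ac)
 moreover have "c / \<sigma> * (t / t0) powr \<sigma> \<le> primitive g t0 * (t / t0) powr \<sigma>"
  using AR[of t0] \<sigma> by (intro mult_right_mono) (auto simp: field_simps)
 ultimately show ?thesis by linarith
qed

section \<open>Derivatives and tangents of powers of the norm\<close>

lemma norm_powr_has_derivative:
 fixes W V :: "'b::real_inner"
 assumes p: "1 < p"
 shows "((\<lambda>t. norm (W + t *\<^sub>R V) powr p) has_field_derivative p * (norm (W + s *\<^sub>R V) powr (p - 2) * ((W + s *\<^sub>R V) \<bullet> V))) (at s)"
proof (cases "W + s *\<^sub>R V = 0")
 case False
 let ?w = "W + s *\<^sub>R V"
 have "((\<lambda>t. (norm (W + t *\<^sub>R V))\<^sup>2) has_field_derivative 2 * (?w \<bullet> V)) (at s)"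
  unfolding power2_norm_eq_inner
  by (auto intro!: derivative_eq_intros simp: has_field_derivative_def inner_commute)
 then have "((\<lambda>t. ((norm (W + t *\<^sub>R V))\<^sup>2) powr (p / 2)) has_field_derivative (p / 2) * ((norm ?w)\<^sup>2) powr (p / 2 - 1) * (2 * (?w \<bullet> V))) (at s)"
  using False by (intro DERIV_chain2[where f = "\<lambda>y. y powr (p / 2)"] has_real_derivative_powr) auto
 moreover have "((norm y)\<^sup>2) powr a = norm y powr (2 * a)" for y :: 'b and a
  by (cases "y = 0") (simp_all add: powr_powr flip: powr_numeral)
 ultimately show ?thesis by (simp add: right_diff_distrib)
next
 case True
 \<comment> \<open>Where the line passes through 0 the function is the p-th power of |t - s| times
   that of the norm of V; its derivative vanishes because p > 1, in agreement with the
   formula.\<close>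
 have eq: "W + t *\<^sub>R V = (t - s) *\<^sub>R V" for t
 proof -
  have "W = - (s *\<^sub>R V)" using True by (simp add: eq_neg_iff_add_eq_0)
  then show ?thesis by (simp add: scaleR_left_diff_distrib)
 qed
 have "((\<lambda>h. norm (h *\<^sub>R V) powr p / h) \<longlongrightarrow> 0) (at 0)"
 proof (rule Lim_null_comparison)
  show "\<forall>\<^sub>F h in at 0. norm (norm (h *\<^sub>R V) powr p / h) \<le> \<bar>h\<bar> powr (p - 1) * norm V powr p"
  proof (intro eventually_at_filter[THEN iffD2] always_eventually allI impI)
   fix h :: real assume "h \<noteq> 0"
   then show "norm (norm (h *\<^sub>R V) powr p / h) \<le> \<bar>h\<bar> powr (p - 1) * norm V powr p"
    by (simp add: powr_mult powr_diff)
  qed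
  have "((\<lambda>h::real. \<bar>h\<bar> powr (p - 1) * norm V powr p) \<longlongrightarrow> \<bar>0\<bar> powr (p - 1) * norm V powr p) (at 0)"
   using p by (intro tendsto_intros tendsto_powr') auto
  then show "((\<lambda>h::real. \<bar>h\<bar> powr (p - 1) * norm V powr p) \<longlongrightarrow> 0) (at 0)" by simp
 qed
 then show ?thesis unfolding DERIV_def eq using p by simp
qed

text \<open>For p < 2 the first factor is unbounded near 0, but the inner product compensates it:
  the modulus is at most the power p - 1 of the norm of z, times the norm of V.\<close>

lemma norm_powr_scaled_continuous:
 fixes V :: "'b::real_inner"
 assumes p: "1 < p"
 shows "continuous_on UNIV (\<lambda>z::'b. norm z powr (p - 2) * (z \<bullet> V))"
proof -
 have "isCont (\<lambda>z::'b. norm z powr (p - 2) * (z \<bullet> V)) z" for z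
 proof (cases "z = 0")
  case True
  have "((\<lambda>z::'b. norm z powr (p - 2) * (z \<bullet> V)) \<longlongrightarrow> 0) (at 0)"
  proof (rule Lim_null_comparison[OF always_eventually], intro allI)
   fix z :: 'b
   have "\<bar>z \<bullet> V\<bar> \<le> norm z * norm V" by (rule Cauchy_Schwarz_ineq2)
   then have "norm z powr (p - 2) * \<bar>z \<bullet> V\<bar> \<le> norm z powr (p - 2) * (norm z * norm V)" by (intro mult_left_mono) auto
   also have "\<dots> = norm z powr (p - 1) * norm V" using powr_mult_base[of "norm z" "p - 2"] by (simp add: mult_ac)
   finally show "norm (norm z powr (p - 2) * (z \<bullet> V)) \<le> norm z powr (p - 1) * norm V" by (simp add: abs_mult)
   have "((\<lambda>z::'b. norm z powr (p - 1) * norm V) \<longlongrightarrow> norm (0::'b) powr (p - 1) * norm V) (at 0)"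
    using p by (intro tendsto_intros tendsto_powr') auto
   then show "((\<lambda>z::'b. norm z powr (p - 1) * norm V) \<longlongrightarrow> 0) (at 0)" by simp
  qed
  then show ?thesis using True by (simp add: isCont_def)
 next
  case False
  then show ?thesis by (intro continuous_intros) auto
 qed
 then show ?thesis by (simp add: continuous_at_imp_continuous_on)
qed

lemma norm_powr_scaled_bound:
 fixes z V :: "'b::real_inner"
 shows "\<bar>norm z powr (p - 2) * (z \<bullet> V)\<bar> \<le> norm z powr (p - 1) * norm V"
proof -
 have "norm z powr (p - 2) * \<bar>z \<bullet> V\<bar> \<le> norm z powr (p - 2) * (norm z * norm V)"
  using Cauchy_Schwarz_ineq2[of z V] by (intro mult_left_mono) auto
 also have "\<dots> = norm z powr (p - 1) * norm V" using powr_mult_base[of "norm z" "p - 2"] by (simp add: mult_ac)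
 finally show ?thesis by (simp add: abs_mult)
qed

text \<open>The Cauchy--Schwarz inequality reduces the claim to the scalar tangent inequality for
  the norms.\<close>

lemma norm_powr_convex_tangent:
 fixes z w :: "'b::real_inner"
 assumes p: "1 < p"
 shows "norm z powr p + p * (norm z powr (p - 2) * (z \<bullet> (w - z))) \<le> norm w powr p"
proof (cases "z = 0")
 case False
 have "norm z powr p + p * norm z powr (p - 1) * (norm w - norm z) \<le> norm w powr p"
  by (rule powr_tangent[OF p]) (use False in auto)
 moreover have "norm z powr (p - 2) * (z \<bullet> (w - z)) \<le> norm z powr (p - 1) * (norm w - norm z)"
 proof -
  have "z \<bullet> (w - z) \<le> norm z * (norm w - norm z)"
   using norm_cauchy_schwarz[of z w] by (simp add: inner_diff_right right_diff_distrib power2_norm_eq_inner[symmetric] power2_eq_square)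
  then have "norm z powr (p - 2) * (z \<bullet> (w - z)) \<le> norm z powr (p - 2) * (norm z * (norm w - norm z))" by (intro mult_left_mono) auto
  also have "\<dots> = norm z powr (p - 1) * (norm w - norm z)" using powr_mult_base[of "norm z" "p - 2"] by (simp add: mult_ac)
  finally show ?thesis .
 qed
 then have "p * (norm z powr (p - 2) * (z \<bullet> (w - z))) \<le> p * (norm z powr (p - 1) * (norm w - norm z))"
  using p by (intro mult_left_mono) auto
 ultimately show ?thesis by (simp add: mult.assoc)
qed (use p in auto)

section \<open>The Kirchhoff coefficient and its primitive\<close>

locale kirchhoff_coefficient =
 fixes M :: "real => real" and \<theta> :: real
 assumes M_cont: "continuous_on {0..} M" and M_nonneg: "\<And>t. 0 \<le> t ==> 0 \<le> M t"
  and theta: "1 \<le> \<theta>" and M_theta: "\<And>t. 0 \<le> t ==> t * M t \<le> \<theta> * primitive M t"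
  and M_pos: "\<And>\<tau>. 0 < \<tau> ==> \<exists>\<kappa>>0. \<forall>t\<ge>\<tau>. \<kappa> \<le> M t"
begin

lemma primM_deriv:
 assumes t: "0 \<le> t"
 shows "(primitive M has_field_derivative M t) (at t within {0..})"
proof -
 have "((\<lambda>u. LBINT y=ereal 0..ereal u. M y) has_vector_derivative M t) (at t within {0..t + 1})"
  by (rule interval_integral_FTC2) (use t M_cont in \<open>auto elim: continuous_on_subset\<close>)
 moreover have "at t within {0..t + 1} = at t within {0..}"
  by (rule at_within_nhd[of t "{..<t + 1}"]) auto
 ultimately show ?thesis
  by (simp add: primitive_def[abs_def] has_real_derivative_iff_has_vector_derivative)
qed

lemma primM_cont: "continuous_on {0..} (primitive M)"
 using primM_deriv by (intro DERIV_continuous_on) auto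

lemma primM_deriv_at: "0 < t ==> (primitive M has_field_derivative M t) (at t)"
proof -
 assume t: "0 < t"
 then have "at t within {0..} = at t" by (intro at_within_interior) (simp add: interior_real_atLeast)
 then show ?thesis using primM_deriv[of t] t by simp
qed

lemma primM_mono:
 assumes "0 \<le> s" "s \<le> t"
 shows "primitive M s \<le> primitive M t"
proof (rule DERIV_nonneg_imp_increasing_open[OF assms(2)])
 show "\<exists>y. (primitive M has_field_derivative y) (at x) \<and> 0 \<le> y" if "s < x" "x < t" for x
  using primM_deriv_at[of x] M_nonneg[of x] assms that by (intro exI[of _ "M x"]) auto
 show "continuous_on {s..t} (primitive M)" by (rule continuous_on_subset[OF primM_cont]) (use assms in auto)
qed

lemma primM_nonneg: "0 \<le> t ==> 0 \<le> primitive M t"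
 using primM_mono[of 0 t] by simp

text \<open>From t = 1 on \<open>M\<close> stays above some \<kappa> > 0, so the primitive grows at
  least linearly; for t \<le> 1 the lower bound is not positive.\<close>

lemma primM_lower:
 obtains \<kappa> where "0 < \<kappa>" "\<And>t. 0 \<le> t ==> \<kappa> * (t - 1) \<le> primitive M t"
proof -
 obtain \<kappa> where \<kappa>: "0 < \<kappa>" "\<And>t. 1 \<le> t ==> \<kappa> \<le> M t" using M_pos[of 1] by auto
 have "\<kappa> * (t - 1) \<le> primitive M t" if "0 \<le> t" for t
 proof (cases "t \<le> 1")
  case True
  then have "\<kappa> * (t - 1) \<le> 0" using \<kappa>(1) by (simp add: mult_nonneg_nonpos)
  then show ?thesis using primM_nonneg[OF that] by linarith
 next
  case False
  have "primitive M 1 - \<kappa> * (1 - 1) \<le> primitive M t - \<kappa> * (t - 1)"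
  proof (rule DERIV_nonneg_imp_nondecreasing[of 1 t])
   fix x assume x: "1 \<le> x" "x \<le> t"
   have "((\<lambda>x. primitive M x - \<kappa> * (x - 1)) has_field_derivative M x - \<kappa>) (at x)"
    using x by (auto intro!: derivative_eq_intros primM_deriv_at)
   then show "\<exists>y. ((\<lambda>x. primitive M x - \<kappa> * (x - 1)) has_field_derivative y) (at x) \<and> 0 \<le> y"
    using \<kappa>(2)[OF x(1)] by (intro exI[of _ "M x - \<kappa>"]) auto
  qed (use False in auto)
  then show ?thesis using primM_nonneg[of 1] by simp
 qed
 then show thesis using that \<kappa>(1) by blast
qed

text \<open>\<open>M_theta\<close> says that t^-\<theta> times the primitive does not increase, so
  beyond 1 the primitive is at most its value at 1 times t^\<theta>.\<close>

lemma primM_upper: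
 assumes t: "0 \<le> t"
 shows "primitive M t \<le> primitive M 1 * (1 + t powr \<theta>)"
proof (cases "t \<le> 1")
 case True
 have "primitive M t \<le> primitive M 1 * 1" using primM_mono[OF t True] by simp
 also have "\<dots> \<le> primitive M 1 * (1 + t powr \<theta>)" using primM_nonneg[of 1] by (intro mult_left_mono) auto
 finally show ?thesis .
next
 case False
 let ?h = "\<lambda>t. primitive M t * t powr (- \<theta>)"
 have "?h t \<le> ?h 1"
 proof (rule DERIV_nonpos_imp_nonincreasing[of 1 t])
  fix s assume s: "1 \<le> s" "s \<le> t"
  then have spos: "0 < s" by simp
  have "(?h has_field_derivative (M s * s powr (- \<theta>) + primitive M s * (- \<theta> * s powr (- \<theta> - 1)))) (at s)"
   using spos by (auto intro!: derivative_eq_intros primM_deriv_at)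
  moreover have "M s * s powr (- \<theta>) + primitive M s * (- \<theta> * s powr (- \<theta> - 1)) = s powr (- \<theta> - 1) * (s * M s - \<theta> * primitive M s)"
   using powr_mult_base[of s "- \<theta> - 1"] spos by (simp add: algebra_simps)
  moreover have "s powr (- \<theta> - 1) * (s * M s - \<theta> * primitive M s) \<le> 0"
   using M_theta[of s] spos by (intro mult_nonneg_nonpos) auto
  ultimately show "\<exists>y. (?h has_field_derivative y) (at s) \<and> y \<le> 0" by metis
 qed (use False in auto)
 then have "primitive M t * t powr (- \<theta>) * t powr \<theta> \<le> primitive M 1 * t powr \<theta>"
  using False by (intro mult_right_mono) auto
 moreover have "primitive M t * t powr (- \<theta>) * t powr \<theta> = primitive M t"
  using False by (simp add: mult.assoc powr_add[symmetric])
 ultimately have "primitive M t \<le> primitive M 1 * t powr \<theta>" by linarith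
 also have "\<dots> \<le> primitive M 1 * (1 + t powr \<theta>)" using primM_nonneg[of 1] by (intro mult_left_mono) auto
 finally show ?thesis .
qed

lemma M_eq_0_iff: "0 \<le> t ==> M t = 0 ==> t = 0"
 using M_pos[of t] by force

lemma M_tendsto: "X \<longlonglongrightarrow> l ==> (\<And>n. 0 \<le> X n) ==> (\<lambda>n. M (X n)) \<longlonglongrightarrow> M l" for X :: "nat => real"
 by (rule continuous_on_tendsto_compose[OF M_cont]) (auto intro: LIMSEQ_le_const)

lemma primM_tendsto: "X \<longlonglongrightarrow> l ==> (\<And>n. 0 \<le> X n) ==> (\<lambda>n. primitive M (X n)) \<longlonglongrightarrow> primitive M l" for X :: "nat => real"
 by (rule continuous_on_tendsto_compose[OF primM_cont]) (auto intro: LIMSEQ_le_const)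

end

text \<open>The conditions on \<open>f\<close> hold at every point; a modification on a null set
  provides this at the end. \<open>r_sub\<close> and \<open>q_sub\<close> say that r and q are below
  the critical exponent of p, in the form in which they enter the Sobolev estimate as a power of
  h.\<close>

locale kirchhoff = double_phase \<Omega> p q A a + kirchhoff_coefficient M \<theta>
 for \<Omega> :: "'a::euclidean_space set" and p q A :: real and a :: "'a => real" and M :: "real => real" and \<theta> :: real +
 fixes f :: "'a => real => real" and r C \<sigma> c0 t0 :: real
 assumes nonempty: "\<Omega> \<noteq> {}"
  and f_meas: "\<And>t. (\<lambda>x. f x t) \<in> borel_measurable (lebesgue_on \<Omega>)"
  and f_cont: "\<And>x. continuous_on UNIV (f x)"
  and p_less_r: "p < r"
  and r_sub: "0 < r - real DIM('a) * (r - p) / p" and q_sub: "0 < q - real DIM('a) * (q - p) / p"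
  and f_growth: "\<And>x t. \<bar>f x t\<bar> \<le> C * (1 + \<bar>t\<bar> powr (r - 1))"
  and sigma: "q * \<theta> < \<sigma>" and c0: "0 < c0" and t0: "0 < t0"
  and f_AR: "\<And>x t. t0 \<le> \<bar>t\<bar> ==> c0 \<le> \<sigma> * primitive (f x) t \<and> \<sigma> * primitive (f x) t \<le> t * f x t"
  and f_odd: "\<And>x t. f x (- t) = - f x t"
begin

abbreviation F :: "'a => real => real" where "F x \<equiv> primitive (f x)"

lemma r_gt_1: "1 < r" using p_gt_1 p_less_r by simp

lemma C_nonneg: "0 \<le> C"
 using order.trans[OF abs_ge_zero f_growth[of _ 0]] by simp

lemma f_compose_meas: "u \<in> borel_measurable \<mu> ==> (\<lambda>x. f x (u x)) \<in> borel_measurable \<mu>"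
 by (rule caratheodory_compose_measurable) (use f_meas f_cont in auto)

lemma F_deriv: "(F x has_field_derivative f x t) (at t)"
 by (rule primitive_has_derivative[OF f_cont])

lemma F_cont: "continuous_on UNIV (F x)"
 using F_deriv by (intro continuous_at_imp_continuous_on ballI DERIV_isCont) auto

lemma F_compose_meas: "u \<in> borel_measurable \<mu> ==> (\<lambda>x. F x (u x)) \<in> borel_measurable \<mu>"
 by (rule caratheodory_compose_measurable)
  (use primitive_caratheodory_measurable[of f \<mu>] f_meas f_cont F_cont in auto)

lemma F_growth: "\<bar>F x t\<bar> \<le> 2 * C * (1 + \<bar>t\<bar> powr r)"
proof -
 have "\<bar>F x t\<bar> \<le> C * (\<bar>t\<bar> + \<bar>t\<bar> powr r)" by (rule primitive_growth[OF f_cont f_growth r_gt_1])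
 also have "\<dots> \<le> C * (2 * (1 + \<bar>t\<bar> powr r))"
  using powr_le_1_powr[of "\<bar>t\<bar>" 1 r] r_gt_1 C_nonneg by (intro mult_left_mono) auto
 finally show ?thesis by (simp only: mult_ac)
qed

lemma F_even: "F x (- t) = F x t"
 by (rule primitive_even[OF f_cont f_odd])

lemma bounded_growth:
 assumes "\<bar>t\<bar> \<le> R"
 shows "\<bar>f x t\<bar> \<le> C * (1 + R powr (r - 1))" "\<bar>F x t\<bar> \<le> 2 * C * (1 + R powr r)"
proof -
 have "C * (1 + \<bar>t\<bar> powr (r - 1)) \<le> C * (1 + R powr (r - 1))" "2 * C * (1 + \<bar>t\<bar> powr r) \<le> 2 * C * (1 + R powr r)"
  using assms C_nonneg r_gt_1 by (intro mult_left_mono add_left_mono powr_mono2; simp)+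
 then show "\<bar>f x t\<bar> \<le> C * (1 + R powr (r - 1))" "\<bar>F x t\<bar> \<le> 2 * C * (1 + R powr r)"
  using f_growth[of x t] F_growth[of x t] by linarith+
qed

definition Ap :: "('a => 'a) => real" where "Ap g = (LINT x|\<mu>. norm (g x) powr p)"
definition Aq :: "('a => 'a) => real" where "Aq g = (LINT x|\<nu>. norm (g x) powr q)"
definition Bp :: "('a => 'a) => ('a => 'a) => real" where
 "Bp g h = (LINT x|\<mu>. norm (g x) powr (p - 2) * (g x \<bullet> h x))"
definition Bq :: "('a => 'a) => ('a => 'a) => real" where
 "Bq g h = (LINT x|\<nu>. norm (g x) powr (q - 2) * (g x \<bullet> h x))"

text \<open>Function and gradient are separate arguments, so the same functional serves test
  functions with their classical gradient and limits with a weak one.\<close>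

definition En :: "('a => real) => ('a => 'a) => real" where
 "En u g = 1 / p * primitive M (Ap g) + 1 / q * primitive M (Aq g) - (LINT x|\<mu>. F x (u x))"

definition dEn :: "('a => real) => ('a => 'a) => ('a => real) => ('a => 'a) => real" where
 "dEn u g v h = M (Ap g) * Bp g h + M (Aq g) * Bq g h - (LINT x|\<mu>. f x (u x) * v x)"

abbreviation energy_of ("\<E>") where "\<E> u \<equiv> En u (grad u)"

abbreviation energy_derivative ("\<D>") where "\<D> u v \<equiv> dEn u (grad u) v (grad v)"

lemma Ap_nonneg: "0 \<le> Ap g" and Aq_nonneg: "0 \<le> Aq g"
 by (auto simp: Ap_def Aq_def intro!: integral_nonneg_AE)

lemma Bp_self: "Bp g g = Ap g" and Bq_self: "Bq g g = Aq g"
proof -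
 have "norm y powr (s - 2) * (y \<bullet> y) = norm y powr s" for y :: 'a and s
  by (cases "y = 0") (simp_all add: power2_norm_eq_inner[symmetric] powr_diff powr_numeral)
 then show "Bp g g = Ap g" "Bq g g = Aq g" by (simp_all add: Ap_def Aq_def Bp_def Bq_def)
qed

lemma integrable_bounded:
 fixes k :: "'a => real"
 assumes "k \<in> borel_measurable \<mu>" "AE x in \<mu>. \<bar>k x\<bar> \<le> K"
 shows "integrable \<mu> k" "integrable \<nu> k"
proof -
 interpret m: finite_measure \<mu> by (rule finite_\<mu>)
 show "integrable \<mu> k" by (rule m.integrable_const_bound[of _ K]) (use assms in auto)
 then show "integrable \<nu> k" by (rule integrable_\<nu>I)
qed

lemma norm_powr_integral_deriv:
 assumes u: "u \<in> \<T>" and v: "v \<in> \<T>" and s: "1 < s" and Q: "Q = \<mu> \<or> Q = \<nu>"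
 shows "((\<lambda>t. LINT x|Q. norm (grad u x + t *\<^sub>R grad v x) powr s) has_field_derivative
   s * (LINT x|Q. norm (grad u x) powr (s - 2) * (grad u x \<bullet> grad v x))) (at 0)"
proof -
 let ?g = "\<lambda>t x. grad u x + t *\<^sub>R grad v x"
 note [measurable] = test_borel_\<mu>[OF u] test_borel_\<mu>[OF v]
 obtain Cu where Cu: "\<And>x. norm (grad u x) \<le> Cu" using test_functions_grad_bounded[OF u] by metis
 obtain Cv where Cv: "\<And>x. norm (grad v x) \<le> Cv" using test_functions_grad_bounded[OF v] by metis
 have C0: "0 \<le> Cu" "0 \<le> Cv" using order.trans[OF norm_ge_zero Cu] order.trans[OF norm_ge_zero Cv] by auto
 let ?k' = "\<lambda>x t. s * (norm (?g t x) powr (s - 2) * ((?g t x) \<bullet> grad v x))"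
 have nb: "norm (?g t x) \<le> Cu + \<bar>t\<bar> * Cv" for x t
  using norm_triangle_ineq[of "grad u x" "t *\<^sub>R grad v x"] Cu[of x] mult_left_mono[OF Cv[of x], of "\<bar>t\<bar>"] by simp
 have Qi: "integrable Q k" if k: "k \<in> borel_measurable \<mu>" "\<And>x. \<bar>k x\<bar> \<le> B" for k :: "'a => real" and B
  using integrable_bounded[OF k(1), of B] k(2) Q by auto
 have "((\<lambda>t. LINT x|Q. norm (?g t x) powr s) has_field_derivative (LINT x|Q. ?k' x 0)) (at 0)"
 proof (rule has_field_derivative_integral[where k' = ?k' and w = "\<lambda>_. s * ((Cu + Cv) powr (s - 1) * Cv)"])
  show "integrable Q (\<lambda>x. norm (?g t x) powr s)" for t
   by (rule Qi[of _ "(Cu + \<bar>t\<bar> * Cv) powr s"]) (use nb[of _ t] s in \<open>auto intro!: powr_mono2\<close>)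
  have "?k' x 0 = s * (norm (grad u x) powr (s - 2) * (grad u x \<bullet> grad v x))" for x by simp
  then show "(\<lambda>x. ?k' x 0) \<in> borel_measurable Q" using Q by auto
  show "AE x in Q. \<forall>t. ((\<lambda>t. norm (?g t x) powr s) has_field_derivative ?k' x t) (at t)"
   using norm_powr_has_derivative[OF s] by (intro AE_I2) blast
  show "AE x in Q. \<forall>t\<in>{0 - 1..0 + 1}. \<bar>?k' x t\<bar> \<le> s * ((Cu + Cv) powr (s - 1) * Cv)"
  proof (intro AE_I2 ballI)
   fix x and t :: real assume t: "t \<in> {0 - 1..0 + 1}"
   have "\<bar>t\<bar> * Cv \<le> 1 * Cv" using t C0 by (intro mult_right_mono) auto
   then have n1: "norm (?g t x) \<le> Cu + Cv" using nb[of x t] by simp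
   have "\<bar>norm (?g t x) powr (s - 2) * ((?g t x) \<bullet> grad v x)\<bar>
    \<le> norm (?g t x) powr (s - 1) * norm (grad v x)" by (rule norm_powr_scaled_bound)
   also have "\<dots> \<le> (Cu + Cv) powr (s - 1) * Cv"
    using n1 s Cv C0 by (intro mult_mono powr_mono2) auto
   finally show "\<bar>?k' x t\<bar> \<le> s * ((Cu + Cv) powr (s - 1) * Cv)"
    using s by (subst abs_mult) (auto intro!: mult_left_mono)
  qed
  show "integrable Q (\<lambda>x. s * ((Cu + Cv) powr (s - 1) * Cv))" by (rule Qi) auto
 qed
 then show ?thesis by simp
qed

lemma En_line_deriv:
 assumes u: "u \<in> \<T>" and v: "v \<in> \<T>"
 shows "((\<lambda>t. \<E> (\<lambda>x. u x + t * v x)) has_field_derivative \<D> u v) (at 0)"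
proof -
 note [measurable] = test_borel_\<mu>[OF u] test_borel_\<mu>[OF v]
 have g: "grad (\<lambda>x. u x + t * v x) = (\<lambda>x. grad u x + t *\<^sub>R grad v x)" for t
  using grad_add[OF u test_functions_cmult[OF v, of t]] grad_cmult[OF v, of t] by (simp add: fun_eq_iff)
 \<comment> \<open>At 0 the primitive of \<open>M\<close> is differentiable only from the right. The
   Dirichlet energies are nonnegative, so a derivative within their range is enough for the chain
   rule.\<close>
 have Md: "((\<lambda>t. primitive M (X t)) has_field_derivative M (X 0) * D) (at 0)"
  if X: "(X has_field_derivative D) (at 0)" "\<And>t. 0 \<le> X t" for X D
 proof -
  have "(primitive M has_field_derivative M (X 0)) (at (X 0) within (X ` UNIV))"
   by (rule DERIV_subset[OF primM_deriv]) (use X in auto)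
  from DERIV_image_chain[OF this X(1)] show ?thesis by (simp add: o_def)
 qed
 have 1: "((\<lambda>t. Ap (\<lambda>x. grad u x + t *\<^sub>R grad v x)) has_field_derivative p * Bp (grad u) (grad v)) (at 0)"
  unfolding Ap_def Bp_def by (rule norm_powr_integral_deriv[OF u v p_gt_1]) simp
 have 2: "((\<lambda>t. Aq (\<lambda>x. grad u x + t *\<^sub>R grad v x)) has_field_derivative q * Bq (grad u) (grad v)) (at 0)"
  unfolding Aq_def Bq_def by (rule norm_powr_integral_deriv[OF u v]) (use p_gt_1 p_less_q in auto)
 obtain Cu where Cu: "\<And>x. \<bar>u x\<bar> \<le> Cu" using test_functions_grad_bounded[OF u] by metis
 obtain Cv where Cv: "\<And>x. \<bar>v x\<bar> \<le> Cv" using test_functions_grad_bounded[OF v] by metis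
 have C0: "0 \<le> Cu" "0 \<le> Cv" using order.trans[OF abs_ge_zero Cu] order.trans[OF abs_ge_zero Cv] by auto
 have nb: "\<bar>u x + t * v x\<bar> \<le> Cu + \<bar>t\<bar> * Cv" for x t
  using abs_triangle_ineq[of "u x" "t * v x"] Cu[of x] mult_left_mono[OF Cv[of x], of "\<bar>t\<bar>"] by (simp add: abs_mult)
 have 3: "((\<lambda>t. LINT x|\<mu>. F x (u x + t * v x)) has_field_derivative (LINT x|\<mu>. f x (u x + 0 * v x) * v x)) (at 0)"
 proof (rule has_field_derivative_integral[where k' = "\<lambda>x t. f x (u x + t * v x) * v x" and w = "\<lambda>_. C * (1 + (Cu + Cv) powr (r - 1)) * Cv"])
  show "integrable \<mu> (\<lambda>x. F x (u x + t * v x))" for t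
   by (rule integrable_bounded(1)[OF F_compose_meas AE_I2[OF bounded_growth(2)[OF nb]]]) measurable
  show "(\<lambda>x. f x (u x + 0 * v x) * v x) \<in> borel_measurable \<mu>"
   by (intro borel_measurable_times f_compose_meas) measurable
  show "AE x in \<mu>. \<forall>t. ((\<lambda>t. F x (u x + t * v x)) has_field_derivative f x (u x + t * v x) * v x) (at t)"
  proof (intro AE_I2 allI)
   fix x t
   have "((\<lambda>t. u x + t * v x) has_field_derivative v x) (at t)" by (auto intro!: derivative_eq_intros)
   from DERIV_chain2[OF F_deriv this] show "((\<lambda>t. F x (u x + t * v x)) has_field_derivative f x (u x + t * v x) * v x) (at t)" .
  qed
  show "AE x in \<mu>. \<forall>t\<in>{0 - 1..0 + 1}. \<bar>f x (u x + t * v x) * v x\<bar> \<le> C * (1 + (Cu + Cv) powr (r - 1)) * Cv"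
  proof (intro AE_I2 ballI)
   fix x and t :: real assume t: "t \<in> {0 - 1..0 + 1}"
   have "\<bar>t\<bar> * Cv \<le> 1 * Cv" using t C0 by (intro mult_right_mono) auto
   then have n1: "\<bar>u x + t * v x\<bar> \<le> Cu + Cv" using nb[of x t] by simp
   show "\<bar>f x (u x + t * v x) * v x\<bar> \<le> C * (1 + (Cu + Cv) powr (r - 1)) * Cv"
    unfolding abs_mult using Cv[of x] C_nonneg by (intro mult_mono bounded_growth n1) auto
  qed
  show "integrable \<mu> (\<lambda>x. C * (1 + (Cu + Cv) powr (r - 1)) * Cv)" by (rule integrable_bounded(1)[where K = "\<bar>C * (1 + (Cu + Cv) powr (r - 1)) * Cv\<bar>"]) auto
 qed
 have "((\<lambda>t. En (\<lambda>x. u x + t * v x) (\<lambda>x. grad u x + t *\<^sub>R grad v x)) has_field_derivative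
   (1 / p * (M (Ap (\<lambda>x. grad u x + 0 *\<^sub>R grad v x)) * (p * Bp (grad u) (grad v))) + 1 / q * (M (Aq (\<lambda>x. grad u x + 0 *\<^sub>R grad v x)) * (q * Bq (grad u) (grad v)))
    - (LINT x|\<mu>. f x (u x + 0 * v x) * v x))) (at 0)"
  unfolding En_def
  by (intro DERIV_diff DERIV_add DERIV_cmult Md 1 2 3 Ap_nonneg Aq_nonneg)
 then show ?thesis unfolding g using p_gt_1 p_less_q by (simp add: dEn_def)
qed

end

section \<open>Integrability, Sobolev bound and continuity of the energy\<close>

context kirchhoff
begin

lemma sigma_gt: "1 < \<sigma>" "q < \<sigma>"
proof -
 have q: "1 < q" using p_gt_1 p_less_q by simp
 then have "q * 1 \<le> q * \<theta>" using theta by (intro mult_left_mono) auto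
 then show "1 < \<sigma>" "q < \<sigma>" using sigma q by linarith+
qed

text \<open>Bounding 1 + |u|^(r-1) by twice (1 + |u|)^(r-1) brings the growth condition into the
  product form of the Young estimates, with a factor whose r-th power is integrable.\<close>

lemma f_young_bound:
 assumes u: "u \<in> borel_measurable \<mu>" and ur: "integrable \<mu> (\<lambda>x. norm (u x) powr r)"
 shows "integrable \<mu> (\<lambda>x. \<bar>1 + \<bar>u x\<bar>\<bar> powr r)"
  "(LINT x|\<mu>. \<bar>1 + \<bar>u x\<bar>\<bar> powr r) \<le> 2 powr r * (measure \<mu> \<Omega> + (LINT x|\<mu>. norm (u x) powr r))"
  "AE x in \<mu>. \<bar>f x (u x) * y x\<bar> \<le> 2 * C * (\<bar>1 + \<bar>u x\<bar>\<bar> powr (r - 1) * norm (y x :: real))"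
proof -
 interpret m: finite_measure \<mu> by (rule finite_\<mu>)
 note [measurable] = u
 have le: "\<bar>1 + \<bar>t\<bar>\<bar> powr r \<le> 2 powr r * (1 + norm t powr r)" for t :: real
  using norm_add_powr_le[of r 1 "\<bar>t\<bar>"] r_gt_1 by simp
 have R: "integrable \<mu> (\<lambda>x. 2 powr r * (1 + norm (u x) powr r))"
  by (intro integrable_mult_right Bochner_Integration.integrable_add m.integrable_const ur)
 show i: "integrable \<mu> (\<lambda>x. \<bar>1 + \<bar>u x\<bar>\<bar> powr r)"
  by (rule Bochner_Integration.integrable_bound[OF R]) (use le in auto)
 have "(LINT x|\<mu>. \<bar>1 + \<bar>u x\<bar>\<bar> powr r) \<le> (LINT x|\<mu>. 2 powr r * (1 + norm (u x) powr r))" by (rule integral_mono[OF i R le])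
 also have "\<dots> = 2 powr r * (measure \<mu> \<Omega> + (LINT x|\<mu>. norm (u x) powr r))"
  unfolding integral_mult_right_zero by (subst Bochner_Integration.integral_add[OF m.integrable_const ur]) simp
 finally show "(LINT x|\<mu>. \<bar>1 + \<bar>u x\<bar>\<bar> powr r) \<le> 2 powr r * (measure \<mu> \<Omega> + (LINT x|\<mu>. norm (u x) powr r))" .
 show "AE x in \<mu>. \<bar>f x (u x) * y x\<bar> \<le> 2 * C * (\<bar>1 + \<bar>u x\<bar>\<bar> powr (r - 1) * norm (y x))"
 proof (rule AE_I2)
  fix x
  have "1 powr (r - 1) \<le> \<bar>1 + \<bar>u x\<bar>\<bar> powr (r - 1)" "\<bar>u x\<bar> powr (r - 1) \<le> \<bar>1 + \<bar>u x\<bar>\<bar> powr (r - 1)"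
   using r_gt_1 by (intro powr_mono2; simp)+
  then have "C * (1 + \<bar>u x\<bar> powr (r - 1)) \<le> C * (2 * \<bar>1 + \<bar>u x\<bar>\<bar> powr (r - 1))" using C_nonneg by (intro mult_left_mono) auto
  then have "\<bar>f x (u x)\<bar> \<le> C * (2 * \<bar>1 + \<bar>u x\<bar>\<bar> powr (r - 1))" using f_growth[of x "u x"] by linarith
  then have "\<bar>f x (u x)\<bar> * \<bar>y x\<bar> \<le> C * (2 * \<bar>1 + \<bar>u x\<bar>\<bar> powr (r - 1)) * \<bar>y x\<bar>" by (intro mult_right_mono) auto
  then show "\<bar>f x (u x) * y x\<bar> \<le> 2 * C * (\<bar>1 + \<bar>u x\<bar>\<bar> powr (r - 1) * norm (y x))" by (simp add: abs_mult mult_ac)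
 qed
qed

lemma F_integrable:
 assumes u: "u \<in> borel_measurable \<mu>" and ur: "integrable \<mu> (\<lambda>x. norm (u x) powr r)"
 shows "integrable \<mu> (\<lambda>x. F x (u x))"
proof (rule Bochner_Integration.integrable_bound)
 interpret m: finite_measure \<mu> by (rule finite_\<mu>)
 show "integrable \<mu> (\<lambda>x. 2 * C * (1 + norm (u x) powr r))"
  by (intro integrable_mult_right Bochner_Integration.integrable_add m.integrable_const ur)
 show "AE x in \<mu>. norm (F x (u x)) \<le> norm (2 * C * (1 + norm (u x) powr r))"
  using F_growth C_nonneg by (intro AE_I2) simp
qed (rule F_compose_meas[OF u])

lemma test_integrable:
 assumes u: "u \<in> \<T>" and v: "v \<in> \<T>"
 shows "integrable \<mu> (\<lambda>x. F x (u x))" "integrable \<mu> (\<lambda>x. f x (u x) * v x)"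
  and "\<And>s. 1 < s ==> integrable \<mu> (\<lambda>x. norm (grad u x) powr (s - 2) * (grad u x \<bullet> grad v x))"
  and "\<And>s. 1 < s ==> integrable \<nu> (\<lambda>x. norm (grad u x) powr (s - 2) * (grad u x \<bullet> grad v x))"
  and "\<And>s. 0 \<le> s ==> integrable \<mu> (\<lambda>x. \<bar>u x\<bar> powr s)"
  and "\<And>s. 0 \<le> s ==> integrable \<mu> (\<lambda>x. norm (grad u x) powr s)"
  and "\<And>s. 0 \<le> s ==> integrable \<nu> (\<lambda>x. norm (grad u x) powr s)"
proof -
 let ?k = "\<lambda>s x. norm (grad u x) powr (s - 2) * (grad u x \<bullet> grad v x)"
 have r: "0 \<le> r" "1 \<le> r" using r_gt_1 by auto
 have i: "integrable \<mu> (\<lambda>x. \<bar>w x\<bar> powr s)" "integrable \<mu> (\<lambda>x. norm (grad w x) powr s)" "integrable \<nu> (\<lambda>x. norm (grad w x) powr s)"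
  if w: "w \<in> \<T>" and s: "0 \<le> s" for w s
 proof -
  note [measurable] = test_borel_\<mu>[OF w]
  obtain R where R: "\<And>x. \<bar>w x\<bar> \<le> R" "\<And>x. norm (grad w x) \<le> R" by (rule test_functions_grad_bounded[OF w]) (rule that)
  show "integrable \<mu> (\<lambda>x. \<bar>w x\<bar> powr s)"
   by (rule integrable_bounded[where K = "R powr s"]) (use R s in \<open>auto intro!: powr_mono2\<close>)
  show "integrable \<mu> (\<lambda>x. norm (grad w x) powr s)" "integrable \<nu> (\<lambda>x. norm (grad w x) powr s)"
   by (rule integrable_bounded[where K = "R powr s"]; use R s in \<open>simp add: powr_mono2\<close>)+
 qed
 show "integrable \<mu> (\<lambda>x. \<bar>u x\<bar> powr s)" "integrable \<mu> (\<lambda>x. norm (grad u x) powr s)" "integrable \<nu> (\<lambda>x. norm (grad u x) powr s)" if "0 \<le> s" for s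
  using i[OF u that] by simp_all
 note [measurable] = test_borel_\<mu>[OF u] test_borel_\<mu>[OF v]
 have ur: "integrable \<mu> (\<lambda>x. norm (u x) powr r)" and vr: "integrable \<mu> (\<lambda>x. norm (v x) powr r)" using i(1)[OF u r(1)] i(1)[OF v r(1)] by simp_all
 show "integrable \<mu> (\<lambda>x. F x (u x))" by (rule F_integrable[OF test_borel_\<mu>(1)[OF u] ur])
 have m: "(\<lambda>x. f x (u x) * v x) \<in> borel_measurable \<mu>" by (intro borel_measurable_times f_compose_meas) measurable
 note Y = f_young_bound[OF test_borel_\<mu>(1)[OF u] ur]
 show "integrable \<mu> (\<lambda>x. f x (u x) * v x)"
  by (rule young_integral_bound(1)[OF m Y(3) _ Y(1) vr r(2) zero_less_one]) (simp add: C_nonneg)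
 have k: "integrable Q (?k s)"
  if s: "1 \<le> s" and Q: "sets Q = sets \<mu>" "integrable Q (\<lambda>x. norm (grad u x) powr s)" "integrable Q (\<lambda>x. norm (grad v x) powr s)" for Q s
 proof (rule young_integral_bound(1)[OF _ _ zero_le_one _ Q(3) s zero_less_one])
  show "(?k s) \<in> borel_measurable Q"
   unfolding measurable_cong_sets[OF Q(1) refl] by measurable
  show "AE x in Q. \<bar>?k s x\<bar> \<le> 1 * (\<bar>norm (grad u x)\<bar> powr (s - 1) * norm (grad v x))"
   using norm_powr_scaled_bound by (intro AE_I2) simp
 qed (use Q(2) in simp)
 show "integrable \<mu> (?k s)"
  "integrable \<nu> (?k s)" if "1 < s" for s
  by (rule k; use i(2,3)[OF u, of s] i(2,3)[OF v, of s] that in simp)+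
qed

text \<open>The case \<epsilon> = 1 of the Sobolev--Rellich inequality; the finitely many
  functionals are bounded by the p-energy as well and go into the constant.\<close>

lemma sobolev_bound:
 assumes s: "p \<le> s" "0 < s - real DIM('a) * (s - p) / p"
 obtains D where "0 \<le> D" "\<And>u. u \<in> \<T> ==> (LINT x|\<mu>. norm (u x) powr s) \<le> D * Ap (grad u) powr (s / p)"
proof -
 have p0: "0 < p" "0 < s" using p_gt_1 s by auto
 obtain k :: nat and l C where kl: "0 \<le> C" "\<And>i u. i < k ==> u \<in> \<T> ==> \<bar>l i u\<bar> powr p \<le> C * (LINT x|lborel. norm (grad u x) powr p)"
  "\<And>u. u \<in> \<T> ==> (LINT x|lborel. \<bar>u x\<bar> powr s) \<le>
   1 * (LINT x|lborel. norm (grad u x) powr p) powr (s / p) + C * (\<Sum>i<k. \<bar>l i u\<bar> powr s)"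
  by (rule sobolev_rellich[OF open_domain bounded_domain p_gt_1 s zero_less_one]) (rule that)
 have "(LINT x|\<mu>. norm (u x) powr s) \<le> (1 + C * (real k * C powr (s / p))) * Ap (grad u) powr (s / p)" if u: "u \<in> \<T>" for u
 proof -
  have "\<bar>l i u\<bar> powr s \<le> C powr (s / p) * Ap (grad u) powr (s / p)" if "i < k" for i
  proof -
   have "(\<bar>l i u\<bar> powr p) powr (s / p) \<le> (C * Ap (grad u)) powr (s / p)"
    using kl(2)[OF that u] p0 by (intro powr_mono2) (auto simp: test_integral_lborel[OF u] Ap_def)
   then show ?thesis using p0 kl(1) Ap_nonneg by (simp add: powr_powr powr_mult)
  qed
  then have "(\<Sum>i<k. \<bar>l i u\<bar> powr s) \<le> (\<Sum>i<k. C powr (s / p) * Ap (grad u) powr (s / p))" by (intro sum_mono) simp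
  then have "C * (\<Sum>i<k. \<bar>l i u\<bar> powr s) \<le> C * (real k * (C powr (s / p) * Ap (grad u) powr (s / p)))"
   using kl(1) by (intro mult_left_mono) auto
  then have "C * (\<Sum>i<k. \<bar>l i u\<bar> powr s) \<le> C * (real k * C powr (s / p)) * Ap (grad u) powr (s / p)" by (simp add: mult.assoc)
  then show ?thesis
   using kl(3)[OF u] p0 by (simp add: test_integral_lborel[OF u] Ap_def distrib_right)
 qed
 then show thesis by (intro that[of "1 + C * (real k * C powr (s / p))"]) (use kl(1) in auto)
qed

text \<open>All three parts are linear in the direction, so differences of directions are estimated
  by Young's inequality with a fixed factor coming from \<open>g\<close> or \<open>u\<close>. This
  extends the equation from a dense set of directions to all of them.\<close>

lemma dEn_direction_tendsto:
 assumes g: "Lpq g" and u: "u \<in> borel_measurable \<mu>" "integrable \<mu> (\<lambda>x. norm (u x) powr r)"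
  and h: "\<And>j. Lpq (h j)" "Lpq h'" "converges_pq h h'"
  and v: "\<And>j. v j \<in> borel_measurable \<mu>" "v' \<in> borel_measurable \<mu>" "\<And>j. integrable \<mu> (\<lambda>x. norm (v j x) powr r)"
   "\<And>j. integrable \<mu> (\<lambda>x. norm (v j x - v' x) powr r)" "(\<lambda>j. LINT x|\<mu>. norm (v j x - v' x) powr r) \<longlonglongrightarrow> 0"
 shows "(\<lambda>j. dEn u g (v j) (h j)) \<longlonglongrightarrow> dEn u g v' h'"
proof -
 let ?k = "\<lambda>s h x. norm (g x) powr (s - 2) * (g x \<bullet> h x)"
 have pq: "1 \<le> p" "1 \<le> q" "1 \<le> r" using p_gt_1 p_less_q r_gt_1 by auto
 have hc: "Lpq (\<lambda>x. h j x - h' x)" "(\<lambda>n. LINT x|\<mu>. norm (h n x - h' x) powr p) \<longlonglongrightarrow> 0" "(\<lambda>n. LINT x|\<nu>. norm (h n x - h' x) powr q) \<longlonglongrightarrow> 0" for j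
  using h(3) by (auto simp: converges_pq_def)
 have [measurable]: "g \<in> borel_measurable \<mu>" "\<And>j. h j \<in> borel_measurable \<mu>" "h' \<in> borel_measurable \<mu>" using g h by (auto simp: Lpq_def)
 note [measurable] = u(1) v(1,2)
 have part: "(\<lambda>j. \<integral>x. ?k s (h j) x \<partial>Q) \<longlonglongrightarrow> (LINT x|Q. ?k s h' x)"
  if s: "1 \<le> s" and Q: "sets Q = sets \<mu>" and gs: "integrable Q (\<lambda>x. norm (g x) powr s)"
   and hs: "\<And>j. integrable Q (\<lambda>x. norm (h j x) powr s)" "integrable Q (\<lambda>x. norm (h' x) powr s)" "\<And>j. integrable Q (\<lambda>x. norm (h j x - h' x) powr s)"
   and lim: "(\<lambda>j. \<integral>x. norm (h j x - h' x) powr s \<partial>Q) \<longlonglongrightarrow> 0" for s Q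
 proof -
  have gs': "integrable Q (\<lambda>x. \<bar>norm (g x)\<bar> powr s)" using gs by simp
  have bd: "AE x in Q. \<bar>?k s k x\<bar> \<le> 1 * (\<bar>norm (g x)\<bar> powr (s - 1) * norm (k x))" for k
   using norm_powr_scaled_bound[of "g _" s "k _"] by (intro AE_I2) simp
  have m: "(\<lambda>x. ?k s (h j) x) \<in> borel_measurable Q" "(\<lambda>x. ?k s h' x) \<in> borel_measurable Q"
   "(\<lambda>x. norm (g x) powr (s - 2) * (g x \<bullet> (h j x - h' x))) \<in> borel_measurable Q" for j
   unfolding measurable_cong_sets[OF Q refl] by measurable
  have i: "integrable Q (\<lambda>x. ?k s (h j) x)" "integrable Q (\<lambda>x. ?k s h' x)" for j
   by (rule young_integral_bound(1)[OF m(1) bd zero_le_one gs' hs(1) s zero_less_one],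
     rule young_integral_bound(1)[OF m(2) bd zero_le_one gs' hs(2) s zero_less_one])
  have "(\<lambda>j. \<integral>x. norm (g x) powr (s - 2) * (g x \<bullet> (h j x - h' x)) \<partial>Q) \<longlonglongrightarrow> 0"
   by (rule young_integral_tendsto[OF m(3) bd zero_le_one gs' hs(3) s lim])
  moreover have "(LINT x|Q. norm (g x) powr (s - 2) * (g x \<bullet> (h j x - h' x))) = (LINT x|Q. ?k s (h j) x) - (LINT x|Q. ?k s h' x)" for j
   unfolding inner_diff_right right_diff_distrib by (rule Bochner_Integration.integral_diff[OF i])
  ultimately show ?thesis by (simp add: LIM_zero_iff)
 qed
 have 1: "(\<lambda>j. Bp g (h j)) \<longlonglongrightarrow> Bp g h'"
  unfolding Bp_def by (rule part[OF pq(1)]) (use g h hc in \<open>auto simp: Lpq_def\<close>)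
 have 2: "(\<lambda>j. Bq g (h j)) \<longlonglongrightarrow> Bq g h'"
  unfolding Bq_def by (rule part[OF pq(2)]) (use g h hc in \<open>auto simp: Lpq_def\<close>)
 note Y = f_young_bound[OF u]
 have C2: "0 \<le> 2 * C" using C_nonneg by simp
 have m: "(\<lambda>x. f x (u x) * v j x) \<in> borel_measurable \<mu>" "(\<lambda>x. f x (u x) * v' x) \<in> borel_measurable \<mu>" "(\<lambda>x. f x (u x) * (v j x - v' x)) \<in> borel_measurable \<mu>" for j
  by (intro borel_measurable_times f_compose_meas; measurable)+
 have v'r: "integrable \<mu> (\<lambda>x. norm (v' x) powr r)"
  using norm_diff_powr(1)[of "v 0" \<mu> "\<lambda>x. v 0 x - v' x" r] v pq by simp
 have i: "integrable \<mu> (\<lambda>x. f x (u x) * v j x)" "integrable \<mu> (\<lambda>x. f x (u x) * v' x)" for j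
  by (rule young_integral_bound(1)[OF m(1) Y(3) C2 Y(1) v(3) pq(3) zero_less_one],
    rule young_integral_bound(1)[OF m(2) Y(3) C2 Y(1) v'r pq(3) zero_less_one])
 have "(\<lambda>j. LINT x|\<mu>. f x (u x) * (v j x - v' x)) \<longlonglongrightarrow> 0"
  by (rule young_integral_tendsto[OF m(3) Y(3) C2 Y(1) v(4) pq(3) v(5)])
 moreover have "(LINT x|\<mu>. f x (u x) * (v j x - v' x)) = (LINT x|\<mu>. f x (u x) * v j x) - (LINT x|\<mu>. f x (u x) * v' x)" for j
  unfolding right_diff_distrib by (rule Bochner_Integration.integral_diff[OF i])
 ultimately have 3: "(\<lambda>j. LINT x|\<mu>. f x (u x) * v j x) \<longlonglongrightarrow> (LINT x|\<mu>. f x (u x) * v' x)" by (simp add: LIM_zero_iff)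
 show ?thesis unfolding dEn_def by (intro tendsto_intros 1 2 3)
qed

lemma sobolev_Cauchy:
 assumes s: "p \<le> s" "0 < s - real DIM('a) * (s - p) / p" and z: "\<And>n. z n \<in> \<T>"
  and C: "\<And>e. 0 < e ==> \<exists>N. \<forall>m\<ge>N. \<forall>n\<ge>N. (LINT x|\<mu>. norm (grad (z m) x - grad (z n) x) powr p) < e" and e: "0 < e"
 shows "\<exists>N. \<forall>m\<ge>N. \<forall>n\<ge>N. (LINT x|\<mu>. norm (z m x - z n x) powr s) < e"
proof -
 have p: "0 < p" "0 < s" using p_gt_1 s by auto
 obtain S where S: "0 \<le> S" "\<And>u. u \<in> \<T> ==> (LINT x|\<mu>. norm (u x) powr s) \<le> S * Ap (grad u) powr (s / p)"
  by (rule sobolev_bound[OF s]) (rule that)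
 define t where "t = (e / (S + 1)) powr (p / s)"
 have t: "0 < t" using e S by (simp add: t_def)
 have "(LINT x|\<mu>. norm (z m x - z n x) powr s) < e" if lt: "(LINT x|\<mu>. norm (grad (z m) x - grad (z n) x) powr p) < t" for m n
 proof -
  let ?d = "\<lambda>x. z m x - z n x"
  have "Ap (grad ?d) \<le> t" using lt by (simp add: Ap_def grad_diff[OF z z])
  then have "Ap (grad ?d) powr (s / p) \<le> t powr (s / p)" using Ap_nonneg p by (intro powr_mono2) auto
  also have "\<dots> = e / (S + 1)" using p e S by (simp add: t_def powr_powr)
  finally have "S * Ap (grad ?d) powr (s / p) \<le> S * (e / (S + 1))" using S by (intro mult_left_mono) auto
  also have "\<dots> < e" using e S by (simp add: field_simps)
  finally show ?thesis using S(2)[OF test_functions_diff[OF z z], of m n] by linarith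
 qed
 then show ?thesis using C[OF t] by meson
qed

text \<open>The gradients are Cauchy in L^p, so the Sobolev inequality makes the functions Cauchy in
  L^r; their limit there is \<open>u\<close> because it already is the limit in L^p.\<close>

lemma approximates_Lr:
 assumes ap: "approximates v u g"
 shows "\<And>j. integrable \<mu> (\<lambda>x. norm (v j x - u x) powr r)" "(\<lambda>j. LINT x|\<mu>. norm (v j x - u x) powr r) \<longlonglongrightarrow> 0"
proof -
 have p: "0 < p" "0 \<le> p" "1 \<le> r" "0 \<le> r" using p_gt_1 r_gt_1 by auto
 note D = approximatesD[OF ap]
 note v = D(1)
 have um: "u \<in> borel_measurable \<mu>" using D(2) by (simp add: Lpq_def)
 have [measurable]: "g \<in> borel_measurable \<mu>" using D(3) by (simp add: Lpq_def)
 note [measurable] = test_borel_\<mu>[OF v]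
 have vi: "integrable \<mu> (v j)" for j by (rule Lpq_integrable(1)[OF test_Lpq(1)[OF v]])
 have int: "integrable \<mu> (\<lambda>x. norm (v m x - v n x) powr r)" for m n
  using test_integrable(5)[OF test_functions_diff[OF v v] v p(4)] by simp
 have gc: "integrable \<mu> (\<lambda>x. norm (grad (v n) x - g x) powr p)" "(\<lambda>n. LINT x|\<mu>. norm (grad (v n) x - g x) powr p) \<longlonglongrightarrow> 0" for n
  using D(5) by (auto simp: converges_pq_def Lpq_def)
 let ?I = "\<lambda>n. LINT x|\<mu>. norm (grad (v n) x - g x) powr p"
 have grad_Cauchy: "\<exists>N. \<forall>m\<ge>N. \<forall>n\<ge>N. (LINT x|\<mu>. norm (grad (v m) x - grad (v n) x) powr p) < e" if e: "0 < e" for e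
 proof -
  have "(\<lambda>n. 2 powr p * (2 * ?I n)) \<longlonglongrightarrow> 2 powr p * (2 * 0)" by (intro tendsto_intros gc)
  then have "\<forall>\<^sub>F n in sequentially. 2 powr p * (2 * ?I n) < e" by (rule order_tendstoD) (use e in simp)
  then obtain N where N: "\<And>n. N \<le> n ==> 2 powr p * (2 * ?I n) < e" by (auto simp: eventually_sequentially)
  show ?thesis
  proof (intro exI[of _ N] allI impI)
   fix m n assume mn: "N \<le> m" "N \<le> n"
   have "(LINT x|\<mu>. norm (grad (v m) x - grad (v n) x) powr p) \<le> 2 powr p * (?I m + ?I n)"
    using norm_diff_powr(2)[of "\<lambda>x. grad (v m) x - g x" \<mu> "\<lambda>x. grad (v n) x - g x" p] gc p by simp
   also have "\<dots> = (2 powr p * (2 * ?I m) + 2 powr p * (2 * ?I n)) / 2" by (simp add: algebra_simps)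
   also have "\<dots> < e" using N[OF mn(1)] N[OF mn(2)] by simp
   finally show "(LINT x|\<mu>. norm (grad (v m) x - grad (v n) x) powr p) < e" .
  qed
 qed
 note Cauchy = sobolev_Cauchy[OF less_imp_le[OF p_less_r] r_sub v grad_Cauchy]
 have c: "integrable \<mu> (\<lambda>x. norm (v n x - u x) powr p)" "(\<lambda>n. LINT x|\<mu>. norm (v n x - u x) powr p) \<longlonglongrightarrow> 0" for n
  using D(4) by (auto simp: converges_pq_def Lpq_def)
 show "integrable \<mu> (\<lambda>x. norm (v j x - u x) powr r)" for j
  by (rule Ls_Cauchy_limit(1)[OF c(1) p(1) c(2) finite_\<mu> p(3) vi int Cauchy _ um])
 show "(\<lambda>j. LINT x|\<mu>. norm (v j x - u x) powr r) \<longlonglongrightarrow> 0"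
  by (rule Ls_Cauchy_limit(2)[OF c(1) p(1) c(2) finite_\<mu> p(3) vi int Cauchy _ um])
qed

text \<open>Each integral is a superposition operator, of the gradient in L^p or weighted L^q, or of
  the function in L^r; the coefficients follow by continuity of \<open>M\<close> and of its
  primitive.\<close>

lemma approximates_limits:
 assumes ap: "approximates z u g" and v: "v \<in> \<T>"
 shows "(\<lambda>n. Ap (grad (z n))) \<longlonglongrightarrow> Ap g" "(\<lambda>n. Aq (grad (z n))) \<longlonglongrightarrow> Aq g"
  "(\<lambda>n. \<E> (z n)) \<longlonglongrightarrow> En u g"
  "(\<lambda>n. \<D> (z n) v) \<longlonglongrightarrow> dEn u g v (grad v)"
  "integrable \<mu> (\<lambda>x. norm (u x) powr r)"
proof -
 interpret m: finite_measure \<mu> by (rule finite_\<mu>)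
 interpret n: finite_measure \<nu> by (rule finite_\<nu>)
 have pq: "1 < p" "1 < q" "0 < p" "0 < q" "0 \<le> p" "0 \<le> q" "0 < r" "0 \<le> r" "1 \<le> r" using p_gt_1 p_less_q r_gt_1 by auto
 note D = approximatesD[OF ap]
 note z = D(1)
 have [measurable]: "u \<in> borel_measurable \<mu>" "g \<in> borel_measurable \<mu>" using D by (auto simp: Lpq_def)
 note [measurable] = test_borel_\<mu>[OF z] test_borel_\<mu>[OF v]
 have gc: "integrable \<mu> (\<lambda>x. norm (grad (z n) x - g x) powr p)" "(\<lambda>n. LINT x|\<mu>. norm (grad (z n) x - g x) powr p) \<longlonglongrightarrow> 0"
  "integrable \<nu> (\<lambda>x. norm (grad (z n) x - g x) powr q)" "(\<lambda>n. LINT x|\<nu>. norm (grad (z n) x - g x) powr q) \<longlonglongrightarrow> 0" for n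
  using D(5) by (auto simp: converges_pq_def Lpq_def)
 have gi: "integrable \<mu> (\<lambda>x. norm (g x) powr p)" "integrable \<nu> (\<lambda>x. norm (g x) powr q)" using D(3) by (auto simp: Lpq_def)
 note L = approximates_Lr[OF ap]
 show ur: "integrable \<mu> (\<lambda>x. norm (u x) powr r)"
  using norm_diff_powr(1)[of "z 0" \<mu> "\<lambda>x. z 0 x - u x" r] test_integrable(5)[OF z z pq(8)] L(1) pq by simp
 obtain V where V: "\<And>x. \<bar>v x\<bar> \<le> V" "\<And>x. norm (grad v x) \<le> V" by (rule test_functions_grad_bounded[OF v]) (rule that)
 have V0: "0 \<le> V" using order.trans[OF abs_ge_zero V(1)] .
 have gr: "\<bar>norm t powr s\<bar> \<le> 1 * (0 + norm t powr s)" for t :: 'a and s by simp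
 have ct: "continuous_on UNIV (\<lambda>t::'a. norm t powr s)" if "0 < s" for s
  using that by (intro continuous_on_powr' continuous_intros) auto
 have z0: "integrable \<mu> (\<lambda>x. 0::real)" "integrable \<nu> (\<lambda>x. 0::real)" and o1: "integrable \<mu> (\<lambda>x. 1::real)" "integrable \<nu> (\<lambda>x. 1::real)" by auto
 show 1: "(\<lambda>n. Ap (grad (z n))) \<longlonglongrightarrow> Ap g"
  unfolding Ap_def
  by (rule nemytskii(1)[OF gc(1) pq(3) gc(2) gi(1) z0(1), where \<Phi> = "\<lambda>_ t. norm t powr p" and C = 1])
   (use gr ct[OF pq(3)] in auto)
 show 2: "(\<lambda>n. Aq (grad (z n))) \<longlonglongrightarrow> Aq g"
  unfolding Aq_def
  by (rule nemytskii(1)[OF gc(3) pq(4) gc(4) gi(2) z0(2), where \<Phi> = "\<lambda>_ t. norm t powr q" and C = 1])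
   (use gr ct[OF pq(4)] in auto)
 have B: "\<bar>norm t powr (s - 2) * (t \<bullet> grad v x)\<bar> \<le> V * (1 + norm t powr s)" if "1 < s" for t s x
 proof -
  have "\<bar>norm t powr (s - 2) * (t \<bullet> grad v x)\<bar> \<le> norm t powr (s - 1) * norm (grad v x)" by (rule norm_powr_scaled_bound)
  also have "\<dots> \<le> (1 + norm t powr s) * V" using powr_le_1_powr[of "norm t" "s - 1" s] that V V0 by (intro mult_mono) auto
  finally show ?thesis by (simp add: mult.commute)
 qed
 have 3: "(\<lambda>n. Bp (grad (z n)) (grad v)) \<longlonglongrightarrow> Bp g (grad v)"
  unfolding Bp_def
 proof (rule nemytskii(1)[OF gc(1) pq(3) gc(2) gi(1) o1(1), where \<Phi> = "\<lambda>x t. norm t powr (p - 2) * (t \<bullet> grad v x)" and C = V])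
  show "AE x in \<mu>. continuous_on UNIV (\<lambda>t. norm t powr (p - 2) * (t \<bullet> grad v x))" by (rule AE_I2, rule norm_powr_scaled_continuous[OF pq(1)])
  show "AE x in \<mu>. \<forall>t. \<bar>norm t powr (p - 2) * (t \<bullet> grad v x)\<bar> \<le> V * (1 + norm t powr p)" by (rule AE_I2, rule allI, rule B[OF pq(1)])
 qed measurable
 have 4: "(\<lambda>n. Bq (grad (z n)) (grad v)) \<longlonglongrightarrow> Bq g (grad v)"
  unfolding Bq_def
 proof (rule nemytskii(1)[OF gc(3) pq(4) gc(4) gi(2) o1(2), where \<Phi> = "\<lambda>x t. norm t powr (q - 2) * (t \<bullet> grad v x)" and C = V])
  show "AE x in \<nu>. continuous_on UNIV (\<lambda>t. norm t powr (q - 2) * (t \<bullet> grad v x))" by (rule AE_I2, rule norm_powr_scaled_continuous[OF pq(2)])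
  show "AE x in \<nu>. \<forall>t. \<bar>norm t powr (q - 2) * (t \<bullet> grad v x)\<bar> \<le> V * (1 + norm t powr q)" by (rule AE_I2, rule allI, rule B[OF pq(2)])
 qed (simp_all, measurable)
 have 5: "(\<lambda>n. LINT x|\<mu>. F x (z n x)) \<longlonglongrightarrow> (LINT x|\<mu>. F x (u x))"
 proof (rule nemytskii(1)[OF L(1) pq(7) L(2) ur o1(1), where \<Phi> = F and C = "2 * C"])
  show "AE x in \<mu>. continuous_on UNIV (F x)" by (rule AE_I2) (simp add: F_cont)
  show "AE x in \<mu>. \<forall>t. \<bar>F x t\<bar> \<le> 2 * C * (1 + norm t powr r)" by (simp add: F_growth)
 qed (rule F_compose_meas; measurable)+
 have 6: "(\<lambda>n. LINT x|\<mu>. f x (z n x) * v x) \<longlonglongrightarrow> (LINT x|\<mu>. f x (u x) * v x)"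
 proof (rule nemytskii(1)[OF L(1) pq(7) L(2) ur o1(1), where \<Phi> = "\<lambda>x t. f x t * v x" and C = "2 * C * V"])
  show "AE x in \<mu>. continuous_on UNIV (\<lambda>t. f x t * v x)" by (rule AE_I2) (auto intro!: continuous_intros f_cont)
  show "AE x in \<mu>. \<forall>t. \<bar>f x t * v x\<bar> \<le> 2 * C * V * (1 + norm t powr r)"
  proof (intro AE_I2 allI)
   fix x t
   have "1 + \<bar>t\<bar> powr (r - 1) \<le> 2 * (1 + norm t powr r)"
    using powr_le_1_powr[of "\<bar>t\<bar>" "r - 1" r] pq powr_ge_zero[of "\<bar>t\<bar>" r] unfolding real_norm_def distrib_left by linarith
   then have "C * (1 + \<bar>t\<bar> powr (r - 1)) \<le> C * (2 * (1 + norm t powr r))" using C_nonneg by (intro mult_left_mono)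
   then have "\<bar>f x t\<bar> \<le> C * (2 * (1 + norm t powr r))" using f_growth[of x t] by linarith
   then have "\<bar>f x t\<bar> * \<bar>v x\<bar> \<le> (C * (2 * (1 + norm t powr r))) * V" using V(1)[of x] C_nonneg by (intro mult_mono) auto
   then show "\<bar>f x t * v x\<bar> \<le> 2 * C * V * (1 + norm t powr r)" by (simp add: abs_mult mult_ac)
  qed
 qed (intro borel_measurable_times f_compose_meas; measurable)+
 show "(\<lambda>n. \<E> (z n)) \<longlonglongrightarrow> En u g"
  unfolding En_def by (intro tendsto_intros primM_tendsto 1 2 5 Ap_nonneg Aq_nonneg)
 show "(\<lambda>n. \<D> (z n) v) \<longlonglongrightarrow> dEn u g v (grad v)"
  unfolding dEn_def by (intro tendsto_intros M_tendsto 1 2 3 4 6 Ap_nonneg Aq_nonneg)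
qed

lemma bounded_pointwise_Ls:
 fixes h :: "nat => 'a => 'b::euclidean_space"
 assumes h: "\<And>j. h j \<in> borel_measurable \<mu>" "h' \<in> borel_measurable \<mu>" and bd: "\<And>j x. norm (h j x) \<le> R"
  and lim: "\<And>x. (\<lambda>j. h j x) \<longlonglongrightarrow> h' x" and s: "0 < s"
 shows "(\<lambda>j. LINT x|\<mu>. norm (h j x - h' x) powr s) \<longlonglongrightarrow> 0" "(\<lambda>j. LINT x|\<nu>. norm (h j x - h' x) powr s) \<longlonglongrightarrow> 0"
proof -
 note [measurable] = h
 have "norm (h' x) \<le> R" for x by (rule LIMSEQ_le_const2[OF tendsto_norm[OF lim]]) (use bd in blast)
 then have "norm (h j x - h' x) \<le> 2 * R" for j x
  using norm_triangle_ineq4[of "h j x" "h' x"] bd[of j x] by (smt (verit))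
 then have b: "AE x in Q. norm (norm (h j x - h' x) powr s) \<le> (2 * R) powr s" for j Q
  using s by (intro AE_I2) (simp add: powr_mono2)
 have l: "(\<lambda>j. norm (h j x - h' x) powr s) \<longlonglongrightarrow> 0" for x
 proof -
  have "(\<lambda>j. h j x - h' x) \<longlonglongrightarrow> 0" using lim[of x] by (simp add: LIM_zero)
  from tendsto_powr'[OF tendsto_norm[OF this] tendsto_const[of s]] show ?thesis using s by simp
 qed
 have K: "integrable \<mu> (\<lambda>x. (2 * R) powr s)" "integrable \<nu> (\<lambda>x. (2 * R) powr s)"
  by (rule integrable_bounded[where K = "\<bar>(2 * R) powr s\<bar>"]; simp)+
 show "(\<lambda>j. LINT x|\<mu>. norm (h j x - h' x) powr s) \<longlonglongrightarrow> 0"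
  using integral_dominated_convergence[OF _ _ K(1) AE_I2[OF l] b] by simp
 show "(\<lambda>j. LINT x|\<nu>. norm (h j x - h' x) powr s) \<longlonglongrightarrow> 0"
  using integral_dominated_convergence[OF _ _ K(2) AE_I2[OF l] b] by simp
qed

lemma bounded_pointwise_tendsto:
 assumes u: "\<And>j. u j \<in> \<T>" "u' \<in> \<T>" and v: "v \<in> \<T>"
  and bd: "\<And>j x. \<bar>u j x\<bar> \<le> R" "\<And>j x. norm (grad (u j) x) \<le> R"
  and lim: "\<And>x. (\<lambda>j. u j x) \<longlonglongrightarrow> u' x" "\<And>x. (\<lambda>j. grad (u j) x) \<longlonglongrightarrow> grad u' x"
 shows "(\<lambda>j. Ap (grad (u j))) \<longlonglongrightarrow> Ap (grad u')" "(\<lambda>j. Aq (grad (u j))) \<longlonglongrightarrow> Aq (grad u')"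
  "(\<lambda>j. LINT x|\<mu>. \<bar>u j x\<bar> powr \<sigma>) \<longlonglongrightarrow> (LINT x|\<mu>. \<bar>u' x\<bar> powr \<sigma>)"
  "(\<lambda>j. \<E> (u j)) \<longlonglongrightarrow> \<E> u'"
  "(\<lambda>j. \<D> (u j) v) \<longlonglongrightarrow> \<D> u' v"
proof -
 note m = test_borel_\<mu>[OF u(1)] test_borel_\<mu>[OF u(2)]
 have bd': "norm (u j x) \<le> R" for j x using bd(1) by simp
 have pq: "0 < p" "0 < q" "0 < \<sigma>" "0 \<le> \<sigma>" using p_gt_1 p_less_q sigma_gt by auto
 note U = bounded_pointwise_Ls[OF m(1,3) bd' lim(1)] and G = bounded_pointwise_Ls[OF m(2,4) bd(2) lim(2)]
 have ap: "approximates u u' (grad u')"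
  using u m U[OF pq(1)] U[OF pq(2)] G[OF pq(1)] G[OF pq(2)]
  by (simp add: approximates_def converges_pq_def Lpq_diff test_Lpq)
 note L = approximates_limits[OF ap v]
 show "(\<lambda>j. Ap (grad (u j))) \<longlonglongrightarrow> Ap (grad u')" "(\<lambda>j. Aq (grad (u j))) \<longlonglongrightarrow> Aq (grad u')"
  "(\<lambda>j. \<E> (u j)) \<longlonglongrightarrow> \<E> u'"
  "(\<lambda>j. \<D> (u j) v) \<longlonglongrightarrow> \<D> u' v" by (fact L)+
 have i: "integrable \<mu> (\<lambda>x. norm (w x) powr \<sigma>)" if "w \<in> \<T>" for w using test_integrable(5)[OF that that pq(4)] by simp
 show "(\<lambda>j. LINT x|\<mu>. \<bar>u j x\<bar> powr \<sigma>) \<longlonglongrightarrow> (LINT x|\<mu>. \<bar>u' x\<bar> powr \<sigma>)"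
  unfolding real_norm_def[symmetric]
 proof (rule nemytskii(1)[OF i[OF test_functions_diff[OF u]] pq(3) U(1)[OF pq(3)] i[OF u(2)], where \<Phi> = "\<lambda>_ t. norm t powr \<sigma>" and w = "\<lambda>_. 0" and C = 1])
  show "AE x in \<mu>. continuous_on UNIV (\<lambda>t::real. norm t powr \<sigma>)"
   using pq by (intro AE_I2 continuous_on_powr' continuous_intros) auto
 qed (use m in auto)
qed

end

section \<open>Galerkin approximation\<close>

context kirchhoff
begin

text \<open>For |t| \<ge> t0 the Ambrosetti--Rabinowitz condition gives growth of order \<sigma>,
  and evenness reduces negative t to positive ones; for smaller |t| the growth bound is a constant,
  absorbed in \<open>c2\<close>.\<close>

lemma F_lower:
 obtains c1 c2 where "0 < c1" "\<And>x t. c1 * \<bar>t\<bar> powr \<sigma> - c2 \<le> F x t"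
proof -
 define c1 where "c1 = c0 / \<sigma> * t0 powr (- \<sigma>)"
 define c2 where "c2 = c0 / \<sigma> + 2 * C * (1 + t0 powr r)"
 have c: "0 < c1" "0 \<le> c2" using c0 t0 sigma_gt C_nonneg by (auto simp: c1_def c2_def)
 have "c1 * \<bar>t\<bar> powr \<sigma> - c2 \<le> F x t" for x t
 proof (cases "t0 \<le> \<bar>t\<bar>")
  case True
  have "c0 / \<sigma> * (\<bar>t\<bar> / t0) powr \<sigma> \<le> F x \<bar>t\<bar>"
   by (rule primitive_ambrosetti_rabinowitz[OF f_cont t0 _ f_AR True]) (use sigma_gt in auto)
  moreover have "c1 * \<bar>t\<bar> powr \<sigma> = c0 / \<sigma> * (\<bar>t\<bar> / t0) powr \<sigma>"
   using t0 True by (simp add: c1_def powr_divide powr_minus divide_simps)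
  moreover have "F x \<bar>t\<bar> = F x t" using F_even[of x t] by (cases "0 \<le> t") auto
  ultimately show ?thesis using c(2) by simp
 next
  case False
  then have "\<bar>F x t\<bar> \<le> 2 * C * (1 + t0 powr r)" by (intro bounded_growth) simp
  moreover have "c1 * \<bar>t\<bar> powr \<sigma> \<le> c1 * t0 powr \<sigma>"
   using False c sigma_gt by (intro mult_left_mono powr_mono2) auto
  moreover have "c1 * t0 powr \<sigma> = c0 / \<sigma>" using t0 by (simp add: c1_def powr_minus)
  ultimately show ?thesis by (simp add: c2_def)
 qed
 then show thesis using that c(1) by blast
qed

lemma En_minus: "En (\<lambda>x. - u x) (\<lambda>x. - g x) = En u g"
 by (simp add: En_def Ap_def Aq_def F_even)

lemma dEn_minus: "dEn (\<lambda>x. - u x) (\<lambda>x. - g x) v h = - dEn u g v h"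
 by (simp add: dEn_def Ap_def Aq_def Bp_def Bq_def f_odd)

lemma dEn_sum:
 fixes n :: nat
 assumes u: "u \<in> \<T>" and \<phi>: "\<And>i. i < n ==> \<phi> i \<in> \<T>"
 shows "\<D> u (\<lambda>x. \<Sum>i<n. v i * \<phi> i x) = (\<Sum>i<n. v i * \<D> u (\<phi> i))"
proof -
 have g: "grad (\<lambda>x. \<Sum>i<n. v i * \<phi> i x) = (\<lambda>x. \<Sum>i<n. v i *\<^sub>R grad (\<phi> i) x)"
 proof
  fix x
  show "grad (\<lambda>x. \<Sum>i<n. v i * \<phi> i x) x = (\<Sum>i<n. v i *\<^sub>R grad (\<phi> i) x)"
   by (rule grad_sum[where \<Omega> = \<Omega>]) (simp_all add: \<phi>)
 qed
 have q1: "1 < q" using p_gt_1 p_less_q by simp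
 note i = test_integrable[OF u \<phi>]
 have 1: "Bp (grad u) (\<lambda>x. \<Sum>i<n. v i *\<^sub>R grad (\<phi> i) x) = (\<Sum>i<n. v i * Bp (grad u) (grad (\<phi> i)))"
  unfolding Bp_def inner_sum_right sum_distrib_left inner_scaleR_right mult.left_commute[of _ "v _"]
  by (subst Bochner_Integration.integral_sum) (use i(3)[OF _ p_gt_1] in auto)
 have 2: "Bq (grad u) (\<lambda>x. \<Sum>i<n. v i *\<^sub>R grad (\<phi> i) x) = (\<Sum>i<n. v i * Bq (grad u) (grad (\<phi> i)))"
  unfolding Bq_def inner_sum_right sum_distrib_left inner_scaleR_right mult.left_commute[of _ "v _"]
  by (subst Bochner_Integration.integral_sum) (use i(4)[OF _ q1] in auto)
 have 3: "(LINT x|\<mu>. f x (u x) * (\<Sum>i<n. v i * \<phi> i x)) = (\<Sum>i<n. v i * (LINT x|\<mu>. f x (u x) * \<phi> i x))"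
  unfolding sum_distrib_left mult.left_commute[of _ "v _"]
  by (subst Bochner_Integration.integral_sum) (use i(2) in auto)
 show ?thesis
  unfolding g dEn_def 1 2 3 by (simp add: sum_distrib_left sum.distrib sum_subtractf algebra_simps)
qed

end

section \<open>The energy on the Galerkin spaces\<close>

locale galerkin = kirchhoff \<Omega> p q A a M \<theta> f r C \<sigma> c0 t0
 for \<Omega> :: "'a::euclidean_space set" and p q A :: real and a :: "'a => real" and M :: "real => real" and \<theta> :: real
  and f :: "'a => real => real" and r C \<sigma> c0 t0 :: real +
 fixes \<phi> :: "nat => 'a => real"
 assumes \<phi>: "\<And>j. \<phi> j \<in> test_functions \<Omega>"
  and independent: "\<forall>n c. (\<forall>x. (\<Sum>j<n. c j * \<phi> j x) = 0) \<longrightarrow> (\<forall>j<n. c j = 0)"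
begin

definition comb :: "nat => (nat => real) => 'a => real" where
 "comb n c x = (\<Sum>j<n. c j * \<phi> j x)"

lemma comb_test: "comb n c \<in> \<T>"
 unfolding comb_def[abs_def] by (rule test_functions_sum) (simp_all add: \<phi>)

lemma grad_comb: "grad (comb n c) x = (\<Sum>j<n. c j *\<^sub>R grad (\<phi> j) x)"
 unfolding comb_def[abs_def] by (rule grad_sum[OF finite_lessThan \<phi>])

lemma comb_minus: "comb n (\<lambda>i. - c i) = (\<lambda>x. - comb n c x)" "grad (comb n (\<lambda>i. - c i)) = (\<lambda>x. - grad (comb n c) x)"
 by (simp_all add: comb_def grad_comb fun_eq_iff sum_negf)

lemma comb_scale: "comb n (\<lambda>i. s * c i) = (\<lambda>x. s * comb n c x)" "grad (comb n (\<lambda>i. s * c i)) = (\<lambda>x. s *\<^sub>R grad (comb n c) x)"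
 by (simp_all add: comb_def grad_comb fun_eq_iff sum_distrib_left scaleR_right.sum mult_ac)

lemma comb_line: "comb n (\<lambda>i. c i + t * v i) = (\<lambda>x. comb n c x + t * comb n v x)"
 by (simp add: comb_def[abs_def] fun_eq_iff sum_distrib_left sum.distrib algebra_simps)

lemma comb_extend:
 assumes "c \<in> fin_space k" "k \<le> n"
 shows "comb n c = comb k c"
proof
 fix x
 show "comb n c x = comb k c x"
  unfolding comb_def by (rule sum.mono_neutral_right) (use assms in \<open>auto simp: fin_space_def\<close>)
qed

text \<open>Convergent coefficients are bounded, and so are the basis functions and their gradients.
  Pointwise convergence with a uniform bound is the input of
  \<open>bounded_pointwise_tendsto\<close>.\<close>

lemma comb_tendsto:
 assumes lim: "\<And>i. (\<lambda>j. c j i) \<longlonglongrightarrow> c' i"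
 obtains R where "\<And>j x. \<bar>comb n (c j) x\<bar> \<le> R" "\<And>j x. norm (grad (comb n (c j)) x) \<le> R"
  "\<And>x. (\<lambda>j. comb n (c j) x) \<longlonglongrightarrow> comb n c' x" "\<And>x. (\<lambda>j. grad (comb n (c j)) x) \<longlonglongrightarrow> grad (comb n c') x"
proof -
 have "\<exists>K. \<forall>j. \<bar>c j i\<bar> \<le> K" for i
  using convergent_imp_Bseq[OF convergentI[OF lim[of i]]] by (auto simp: Bseq_def)
 then obtain K where K: "\<And>i j. \<bar>c j i\<bar> \<le> K i" by metis
 have "\<exists>B. \<forall>x. \<bar>\<phi> i x\<bar> \<le> B \<and> norm (grad (\<phi> i) x) \<le> B" for i
 proof -
  obtain B where "\<And>x. \<bar>\<phi> i x\<bar> \<le> B" "\<And>x. norm (grad (\<phi> i) x) \<le> B" by (rule test_functions_grad_bounded[OF \<phi>[of i]]) (rule that)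
  then show ?thesis by blast
 qed
 then obtain B where B: "\<And>i x. \<bar>\<phi> i x\<bar> \<le> B i" "\<And>i x. norm (grad (\<phi> i) x) \<le> B i" by metis
 have K0: "0 \<le> K i" and B0: "0 \<le> B i" for i using order.trans[OF abs_ge_zero K] order.trans[OF abs_ge_zero B(1)] by auto
 define R where "R = (\<Sum>i<n. K i * B i)"
 have "\<bar>comb n (c j) x\<bar> \<le> R" for j x
 proof -
  have "\<bar>comb n (c j) x\<bar> \<le> (\<Sum>i<n. \<bar>c j i * \<phi> i x\<bar>)" unfolding comb_def by (rule sum_abs)
  also have "\<dots> \<le> R" unfolding R_def abs_mult by (intro sum_mono mult_mono K B K0) auto
  finally show ?thesis .
 qed
 moreover have "norm (grad (comb n (c j)) x) \<le> R" for j x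
 proof -
  have "norm (grad (comb n (c j)) x) \<le> (\<Sum>i<n. norm (c j i *\<^sub>R grad (\<phi> i) x))" unfolding grad_comb by (rule norm_sum)
  also have "\<dots> \<le> R" unfolding R_def norm_scaleR by (intro sum_mono mult_mono K B K0) auto
  finally show ?thesis .
 qed
 moreover have "(\<lambda>j. comb n (c j) x) \<longlonglongrightarrow> comb n c' x" "(\<lambda>j. grad (comb n (c j)) x) \<longlonglongrightarrow> grad (comb n c') x" for x
  unfolding comb_def grad_comb by (intro tendsto_intros lim)+
 ultimately show thesis by (rule that)
qed

lemma comb_continuous:
 "continuous_on S (\<lambda>c. Ap (grad (comb n c)))" "continuous_on S (\<lambda>c. Aq (grad (comb n c)))"
 "continuous_on S (\<lambda>c. LINT x|\<mu>. \<bar>comb n c x\<bar> powr \<sigma>)"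
 "continuous_on S (\<lambda>c. \<E> (comb n c))"
 "v \<in> \<T> ==> continuous_on S (\<lambda>c. \<D> (comb n c) v)"
proof -
 have H: "((\<lambda>j. Ap (grad (comb n (c j)))) \<longlonglongrightarrow> Ap (grad (comb n c'))) \<and>
  ((\<lambda>j. Aq (grad (comb n (c j)))) \<longlonglongrightarrow> Aq (grad (comb n c'))) \<and>
  ((\<lambda>j. LINT x|\<mu>. \<bar>comb n (c j) x\<bar> powr \<sigma>) \<longlonglongrightarrow> (LINT x|\<mu>. \<bar>comb n c' x\<bar> powr \<sigma>)) \<and>
  ((\<lambda>j. \<E> (comb n (c j))) \<longlonglongrightarrow> \<E> (comb n c')) \<and>
  (v \<in> \<T> \<longrightarrow> ((\<lambda>j. \<D> (comb n (c j)) v) \<longlonglongrightarrow> \<D> (comb n c') v))"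
  if c: "c \<longlonglongrightarrow> c'" for c c' v
 proof -
  have lim: "(\<lambda>j. c j i) \<longlonglongrightarrow> c' i" for i using c tendsto_coordinatewise[of c c' sequentially] by blast
  obtain R where R: "\<And>j x. \<bar>comb n (c j) x\<bar> \<le> R" "\<And>j x. norm (grad (comb n (c j)) x) \<le> R"
   "\<And>x. (\<lambda>j. comb n (c j) x) \<longlonglongrightarrow> comb n c' x" "\<And>x. (\<lambda>j. grad (comb n (c j)) x) \<longlonglongrightarrow> grad (comb n c') x"
   by (rule comb_tendsto[OF lim, where n = n]) (rule that)
  note T = bounded_pointwise_tendsto[OF comb_test comb_test _ R]
  show ?thesis by (intro conjI impI T(1-4)[OF comb_test] T(5))
 qed
 show "continuous_on S (\<lambda>c. Ap (grad (comb n c)))"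
  by (rule continuous_on_sequentiallyI) (use H in blast)
 show "continuous_on S (\<lambda>c. Aq (grad (comb n c)))"
  by (rule continuous_on_sequentiallyI) (use H in blast)
 show "continuous_on S (\<lambda>c. LINT x|\<mu>. \<bar>comb n c x\<bar> powr \<sigma>)"
  by (rule continuous_on_sequentiallyI) (use H in blast)
 show "continuous_on S (\<lambda>c. \<E> (comb n c))"
  by (rule continuous_on_sequentiallyI) (use H in blast)
 show "continuous_on S (\<lambda>c. \<D> (comb n c) v)" if "v \<in> \<T>"
  by (rule continuous_on_sequentiallyI) (use H that in blast)
qed

text \<open>A continuous function vanishing almost everywhere on an open set vanishes on it, and off
  \<open>\<Omega>\<close> a test function vanishes anyway; linear independence then removes all
  coefficients.\<close>

lemma comb_powr_pos:
 assumes c: "c \<in> fin_space n" "c \<noteq> (\<lambda>i. 0)" and s: "0 < s"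
 shows "0 < (LINT x|\<mu>. \<bar>comb n c x\<bar> powr s)"
proof (rule ccontr)
 assume no: "\<not> ?thesis"
 have i: "integrable \<mu> (\<lambda>x. \<bar>comb n c x\<bar> powr s)" using test_integrable(5)[OF comb_test comb_test] s by simp
 have "0 \<le> (LINT x|\<mu>. \<bar>comb n c x\<bar> powr s)" by (rule integral_nonneg_AE) simp
 then have "(LINT x|\<mu>. \<bar>comb n c x\<bar> powr s) = 0" using no by linarith
 then have "AE x in \<mu>. \<bar>comb n c x\<bar> powr s = 0" by (subst (asm) integral_nonneg_eq_0_iff_AE[OF i]) auto
 then have "AE x in lebesgue. x \<in> \<Omega> \<longrightarrow> comb n c x = 0"
  using domain_sets by (subst (asm) AE_restrict_space_iff) auto
 then have "negligible {x. \<not> (x \<in> \<Omega> \<longrightarrow> comb n c x = 0)}"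
  unfolding AE_iff_null_sets negligible_iff_null_sets
  by (auto simp: eventually_ae_filter negligible_iff_null_sets[symmetric] intro: negligible_subset)
 moreover have "{x. \<not> (x \<in> \<Omega> \<longrightarrow> comb n c x = 0)} = \<Omega> \<inter> {x. comb n c x \<noteq> 0}" by auto
 moreover have "open (\<Omega> \<inter> {x. comb n c x \<noteq> 0})"
  using test_functions_continuous(1)[OF comb_test[where n = n and c = c], of UNIV]
  by (intro open_Int open_domain open_Collect_neq continuous_on_const)
 ultimately have "\<Omega> \<inter> {x. comb n c x \<noteq> 0} = {}" using open_not_negligible by metis
 moreover obtain K where "K \<subseteq> \<Omega>" "\<And>x. x \<notin> K ==> comb n c x = 0" by (rule test_functionsE[OF comb_test[where n = n and c = c]]) (rule that)
 ultimately have "comb n c x = 0" for x by blast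
 then have "c j = 0" if "j < n" for j using independent that unfolding comb_def by blast
 then have "c = (\<lambda>i. 0)" using c(1) by (auto simp: fin_space_def fun_eq_iff) (metis not_le)
 then show False using c(2) by simp
qed

lemma eventually_dominating_power:
 fixes K1 K2 K3 s1 s2 b :: real
 assumes "0 < s1" "s1 < s2" "0 < K3"
 obtains T where "1 \<le> T" "\<And>t. T < t ==> K1 + K2 * t powr s1 - K3 * t powr s2 < b"
proof -
 let ?R = "\<lambda>t. (K1 - b) * t powr - s2 + K2 * t powr - (s2 - s1) - K3"
 have "(?R \<longlongrightarrow> (K1 - b) * 0 + K2 * 0 - K3) at_top"
  by (intro tendsto_intros tendsto_neg_powr filterlim_ident) (use assms in auto)
 then have "\<forall>\<^sub>F t in at_top. ?R t < 0" by (rule order_tendstoD) (use assms in simp)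
 then obtain T where T: "\<And>t. T \<le> t ==> ?R t < 0" by (auto simp: eventually_at_top_linorder)
 show thesis
 proof (rule that[of "max 1 T"])
  fix t assume t: "max 1 T < t"
  have "t powr - s2 * t powr s2 = 1" "t powr - (s2 - s1) * t powr s2 = t powr s1" using t by (simp_all flip: powr_add)
  then have "?R t * t powr s2 = K1 - b + K2 * t powr s1 - K3 * t powr s2" by (simp add: left_diff_distrib distrib_right mult.assoc)
  moreover have "?R t * t powr s2 < 0" using T[of t] t by (intro mult_neg_pos) auto
  ultimately show "K1 + K2 * t powr s1 - K3 * t powr s2 < b" by linarith
 qed simp
qed

text \<open>A coefficient vector is written as t times a vector \<open>d\<close> of the compact l1
  unit sphere \<open>S\<close>. The Kirchhoff terms grow at most like t^(q \<theta>) and the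
  integral of F at least like t^\<sigma>, so \<sigma> > q \<theta> decides. Independence of the
  basis enters through the positive minimum \<beta> on \<open>S\<close>.\<close>

lemma coercive: "\<exists>R. \<forall>c\<in>fin_space n. b \<le> \<E> (comb n c) \<longrightarrow> (\<forall>i. \<bar>c i\<bar> \<le> R)"
proof -
 let ?I = "\<lambda>c. LINT x|\<mu>. \<bar>comb n c x\<bar> powr \<sigma>"
 interpret m: finite_measure \<mu> by (rule finite_\<mu>)
 define S where "S = {c \<in> fin_space n. \<forall>i. \<bar>c i\<bar> \<le> 1} \<inter> {c. (\<Sum>i<n. \<bar>c i\<bar>) = 1}"
 have S: "compact S"
  unfolding S_def
  by (intro compact_Int_closed compact_fin_box closed_Collect_eq continuous_intros continuous_on_product_coordinates)
 have "\<exists>\<alpha>\<ge>0. \<forall>c\<in>S. Ap (grad (comb n c)) \<le> \<alpha> \<and> Aq (grad (comb n c)) \<le> \<alpha>"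
 proof -
  obtain a1 a2 where "\<And>c. c \<in> S ==> norm (Ap (grad (comb n c))) \<le> a1" "\<And>c. c \<in> S ==> norm (Aq (grad (comb n c))) \<le> a2"
   using compact_imp_bounded[OF compact_continuous_image[OF comb_continuous(1) S, of n]]
    compact_imp_bounded[OF compact_continuous_image[OF comb_continuous(2) S, of n]]
   unfolding bounded_iff by blast
  then show ?thesis by (intro exI[of _ "max 0 (max a1 a2)"]) (fastforce simp: le_max_iff_disj)
 qed
 then obtain \<alpha> where \<alpha>: "0 \<le> \<alpha>" "\<And>c. c \<in> S ==> Ap (grad (comb n c)) \<le> \<alpha>" "\<And>c. c \<in> S ==> Aq (grad (comb n c)) \<le> \<alpha>" by blast
 have "\<exists>\<beta>>0. \<forall>c\<in>S. \<beta> \<le> ?I c"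
 proof (cases "S = {}")
  case False
  obtain e where e: "e \<in> S" "\<And>c. c \<in> S ==> ?I e \<le> ?I c"
   using continuous_attains_inf[OF S False comb_continuous(3)[of S n]] by blast
  have "0 < ?I e"
   using e(1) sigma_gt by (intro comb_powr_pos) (auto simp: S_def)
  then show ?thesis using e(2) by blast
 qed (auto intro: exI[of _ 1])
 then obtain \<beta> where \<beta>: "0 < \<beta>" "\<And>c. c \<in> S ==> \<beta> \<le> ?I c" by blast
 obtain c1 c2 where c: "0 < c1" "\<And>x t. c1 * \<bar>t\<bar> powr \<sigma> - c2 \<le> F x t" by (rule F_lower) (rule that)
 define P1 where "P1 = primitive M 1"
 define K where "K = measure \<mu> \<Omega>"
 have P1: "0 \<le> P1" using primM_nonneg[of 1] by (simp add: P1_def)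
 have q\<theta>: "0 < q * \<theta>" using p_gt_1 p_less_q theta by simp
 obtain T where T: "1 \<le> T" "\<And>t. T < t ==> (2 * P1 + c2 * K) + (2 * P1 * \<alpha> powr \<theta>) * t powr (q * \<theta>) - (c1 * \<beta>) * t powr \<sigma> < b"
  by (rule eventually_dominating_power[OF q\<theta> sigma, of "c1 * \<beta>"]) (use c \<beta> in auto)
 have "\<bar>e i\<bar> \<le> T" if e: "e \<in> fin_space n" "b \<le> \<E> (comb n e)" for e i
 proof (rule ccontr)
  assume no: "\<not> \<bar>e i\<bar> \<le> T"
  define t where "t = (\<Sum>i<n. \<bar>e i\<bar>)"
  have le_t: "\<bar>e j\<bar> \<le> t" for j
  proof (cases "j < n")
   case True
   then show ?thesis unfolding t_def by (intro member_le_sum) auto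
  qed (use e(1) in \<open>auto simp: fin_space_def t_def intro!: sum_nonneg\<close>)
  have t: "T < t" "1 < t" using le_t[of i] no T(1) by auto
  define d where "d = (\<lambda>j. e j / t)"
  have ed: "e = (\<lambda>j. t * d j)" using t by (simp add: d_def)
  have dS: "d \<in> S"
   using e(1) le_t t by (auto simp: S_def d_def fin_space_def abs_divide sum_divide_distrib[symmetric] t_def[symmetric])
  have Ap: "Ap (grad (comb n e)) = t powr p * Ap (grad (comb n d))" and Aq: "Aq (grad (comb n e)) = t powr q * Aq (grad (comb n d))"
   unfolding ed comb_scale(2) Ap_def Aq_def using t by (simp_all add: powr_mult)
  have up: "primitive M (t powr q * \<alpha>) \<le> P1 * (1 + \<alpha> powr \<theta> * t powr (q * \<theta>))"
   using primM_upper[of "t powr q * \<alpha>"] \<alpha>(1) by (simp add: P1_def powr_mult powr_powr mult.commute)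
  have "primitive M (Ap (grad (comb n e))) \<le> primitive M (t powr q * \<alpha>)"
   unfolding Ap
  proof (rule primM_mono)
   show "0 \<le> t powr p * Ap (grad (comb n d))" by (simp add: Ap_nonneg)
   have "t powr p \<le> t powr q" using t p_less_q by (intro powr_mono) auto
   then show "t powr p * Ap (grad (comb n d)) \<le> t powr q * \<alpha>" using \<alpha>(2)[OF dS] Ap_nonneg by (intro mult_mono) auto
  qed
  then have 1: "primitive M (Ap (grad (comb n e))) \<le> P1 * (1 + \<alpha> powr \<theta> * t powr (q * \<theta>))" using up by linarith
  have "primitive M (Aq (grad (comb n e))) \<le> primitive M (t powr q * \<alpha>)"
   unfolding Aq by (rule primM_mono) (use \<alpha>(3)[OF dS] Aq_nonneg in \<open>auto intro!: mult_left_mono\<close>)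
  then have 2: "primitive M (Aq (grad (comb n e))) \<le> P1 * (1 + \<alpha> powr \<theta> * t powr (q * \<theta>))" using up by linarith
  have "(c1 * \<beta>) * t powr \<sigma> - c2 * K \<le> c1 * ?I e - c2 * K"
  proof -
   have "?I e = t powr \<sigma> * ?I d"
    unfolding ed comb_scale using t by (simp add: abs_mult powr_mult)
   then have "t powr \<sigma> * \<beta> \<le> ?I e" using \<beta>(2)[OF dS] by (simp add: mult_left_mono)
   then have "c1 * (t powr \<sigma> * \<beta>) \<le> c1 * ?I e" using c(1) by (intro mult_left_mono) auto
   then show ?thesis by (simp add: mult_ac)
  qed
  also have "\<dots> = (LINT x|\<mu>. c1 * \<bar>comb n e x\<bar> powr \<sigma> - c2)"
   using test_integrable(5)[OF comb_test comb_test, where s = \<sigma>] sigma_gt by (subst Bochner_Integration.integral_diff) (auto simp: K_def)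
  also have "\<dots> \<le> (LINT x|\<mu>. F x (comb n e x))"
  proof (rule integral_mono_AE)
   show "integrable \<mu> (\<lambda>x. c1 * \<bar>comb n e x\<bar> powr \<sigma> - c2)"
    using test_integrable(5)[OF comb_test comb_test, where s = \<sigma>] sigma_gt by auto
   show "integrable \<mu> (\<lambda>x. F x (comb n e x))" by (rule test_integrable(1)[OF comb_test comb_test])
   show "AE x in \<mu>. c1 * \<bar>comb n e x\<bar> powr \<sigma> - c2 \<le> F x (comb n e x)" using c(2) by simp
  qed
  finally have 3: "(c1 * \<beta>) * t powr \<sigma> - c2 * K \<le> (LINT x|\<mu>. F x (comb n e x))" .
  have d1: "1 / p * y \<le> z" "1 / q * y \<le> z" if "0 \<le> y" "y \<le> z" for y z :: real
  proof -
   have "y * 1 \<le> y * p" "y * 1 \<le> y * q" using that p_gt_1 p_less_q by (intro mult_left_mono; simp)+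
   moreover have "1 / p * y \<le> y" "1 / q * y \<le> y" using that calculation p_gt_1 p_less_q by (auto simp: field_simps)
   ultimately show "1 / p * y \<le> z" "1 / q * y \<le> z" using that by linarith+
  qed
  have "\<E> (comb n e) \<le> P1 * (1 + \<alpha> powr \<theta> * t powr (q * \<theta>)) + P1 * (1 + \<alpha> powr \<theta> * t powr (q * \<theta>)) - ((c1 * \<beta>) * t powr \<sigma> - c2 * K)"
   unfolding En_def
   by (intro diff_mono add_mono 3 d1 1 2 primM_nonneg Ap_nonneg Aq_nonneg)
  also have "\<dots> = (2 * P1 + c2 * K) + (2 * P1 * \<alpha> powr \<theta>) * t powr (q * \<theta>) - (c1 * \<beta>) * t powr \<sigma>" by (simp add: algebra_simps)
  also have "\<dots> < b" by (rule T(2)[OF t(1)])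
  finally show False using e(2) by simp
 qed
 then show ?thesis by blast
qed

lemma even_functional_En:
 "even_functional n (\<lambda>c. \<E> (comb n c)) (\<lambda>i c. \<D> (comb n c) (\<phi> i))"
proof
 show "continuous_on (fin_space n) (\<lambda>c. \<E> (comb n c))" by (rule comb_continuous)
 show "continuous_on (fin_space n) (\<lambda>c. \<D> (comb n c) (\<phi> i))" for i
  by (rule comb_continuous) (rule \<phi>)
 show "((\<lambda>t. \<E> (comb n (\<lambda>i. c i + t * v i))) has_field_derivative
   (\<Sum>i<n. \<D> (comb n c) (\<phi> i) * v i)) (at 0)" for c v
 proof -
  have "\<D> (comb n c) (comb n v) = (\<Sum>i<n. v i * \<D> (comb n c) (\<phi> i))"
   using dEn_sum[OF comb_test[of n c], of n \<phi> v] \<phi> by (simp add: comb_def[abs_def])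
  then show ?thesis
   using En_line_deriv[OF comb_test[of n c] comb_test[of n v]] by (simp add: comb_line mult.commute)
 qed
 show "\<E> (comb n (\<lambda>i. - c i)) = \<E> (comb n c)" for c
  unfolding comb_minus(2) unfolding comb_minus(1) by (rule En_minus)
 show "\<D> (comb n (\<lambda>i. - c i)) (\<phi> i) = - \<D> (comb n c) (\<phi> i)" for c i
  unfolding comb_minus(2) unfolding comb_minus(1) by (rule dEn_minus)
 show "\<exists>R. \<forall>c\<in>fin_space n. b \<le> \<E> (comb n c) \<longrightarrow> (\<forall>i. \<bar>c i\<bar> \<le> R)" for b
  by (rule coercive)
qed

text \<open>The order of the constants matters. \<open>P\<close> is so large that the p-part of the
  energy, at least \<kappa> (P - 1) / p, covers |K|, the constant part of the growth bound for F,
  and 1. Then \<open>\<epsilon>\<close> is so small that the integral of |u|^r costs at most 1 when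
  the p-energy is \<open>P\<close> and the functionals vanish; \<open>k\<close> and the functionals
  belong to this \<open>\<epsilon>\<close>. The q-part is nonnegative.\<close>

lemma linking_lower:
 obtains k :: nat and l :: "nat => ('a => real) => real" and P where "0 < P"
  "\<forall>i c d. \<forall>u\<in>\<T>. \<forall>v\<in>\<T>. l i (\<lambda>x. c * u x + d * v x) = c * l i u + d * l i v"
  "\<forall>u\<in>\<T>. Ap (grad u) = P \<longrightarrow> (\<forall>i<k. l i u = 0) \<longrightarrow> K \<le> \<E> u"
proof -
 let ?I = "\<lambda>u. LINT x|\<mu>. \<bar>u x\<bar> powr r"
 interpret m: finite_measure \<mu> by (rule finite_\<mu>)
 obtain \<kappa> where \<kappa>: "0 < \<kappa>" "\<And>t. 0 \<le> t ==> \<kappa> * (t - 1) \<le> primitive M t" by (rule primM_lower) blast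
 define V where "V = measure \<mu> \<Omega>"
 define P where "P = 1 + p * (\<bar>K\<bar> + 2 * C * V + 1) / \<kappa>"
 have V: "0 \<le> V" "0 \<le> C" by (simp_all add: V_def C_nonneg)
 have P: "1 \<le> P" "\<kappa> * (P - 1) = p * (\<bar>K\<bar> + 2 * C * V + 1)"
  using \<kappa>(1) p_gt_1 V by (auto simp: P_def)
 define \<epsilon> where "\<epsilon> = 1 / (2 * C * P powr (r / p) + 1)"
 have den: "0 < 2 * C * P powr (r / p) + 1" using V by (intro add_nonneg_pos) auto
 have \<epsilon>: "0 < \<epsilon>" "2 * C * (\<epsilon> * P powr (r / p)) \<le> 1" using den by (auto simp: \<epsilon>_def field_simps)
 have pr: "p \<le> r" using p_less_r by simp
 obtain k l D where kl: "\<And>i u v c d. u \<in> \<T> ==> v \<in> \<T> ==> l i (\<lambda>x. c * u x + d * v x) = c * l i u + d * l i v"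
  "\<And>u. u \<in> \<T> ==> (LINT x|lborel. \<bar>u x\<bar> powr r) \<le>
    \<epsilon> * (LINT x|lborel. norm (grad u x) powr p) powr (r / p) + D * (\<Sum>i<(k::nat). \<bar>l i u\<bar> powr r)"
  by (rule sobolev_rellich[OF open_domain bounded_domain p_gt_1 pr r_sub \<epsilon>(1)]) (rule that)
 have low: "K \<le> \<E> u" if u: "u \<in> \<T>" "Ap (grad u) = P" "\<And>i. i < k ==> l i u = 0" for u
 proof -
  have r0: "0 < r" "0 < p" using r_gt_1 p_gt_1 by auto
  have "?I u \<le> \<epsilon> * P powr (r / p)"
   using kl(2)[OF u(1)] u(2,3) r0 by (simp add: test_integral_lborel[OF u(1)] Ap_def)
  then have "2 * C * ?I u \<le> 2 * C * (\<epsilon> * P powr (r / p))" using V by (intro mult_left_mono) auto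
  then have 1: "2 * C * ?I u \<le> 1" using \<epsilon>(2) by linarith
  have ir: "integrable \<mu> (\<lambda>x. \<bar>u x\<bar> powr r)" using test_integrable(5)[OF u(1) u(1)] r0 by simp
  have "(LINT x|\<mu>. F x (u x)) \<le> (LINT x|\<mu>. 2 * C * (1 + \<bar>u x\<bar> powr r))"
   by (rule integral_mono) (use ir test_integrable(1)[OF u(1) u(1)] F_growth in \<open>auto simp: abs_le_iff\<close>)
  also have "\<dots> = 2 * C * V + 2 * C * ?I u"
  proof -
   have "(LINT x|\<mu>. 1 + \<bar>u x\<bar> powr r) = (LINT x|\<mu>. 1) + ?I u"
    by (rule Bochner_Integration.integral_add[OF m.integrable_const ir])
   also have "(LINT x|\<mu>. (1::real)) = V" by (simp add: V_def)
   finally have e: "(LINT x|\<mu>. 1 + \<bar>u x\<bar> powr r) = V + ?I u" .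
   show ?thesis unfolding integral_mult_right_zero e by (rule distrib_left)
  qed
  finally have 2: "(LINT x|\<mu>. F x (u x)) \<le> 2 * C * V + 1" using 1 by linarith
  have "\<bar>K\<bar> + 2 * C * V + 1 = 1 / p * (\<kappa> * (P - 1))" using P(2) r0 by simp
  also have "\<dots> \<le> 1 / p * primitive M P" using \<kappa>(2)[of P] P(1) r0 by (intro mult_left_mono) auto
  finally have 3: "\<bar>K\<bar> + 2 * C * V + 1 \<le> 1 / p * primitive M P" .
  have "0 \<le> 1 / q * primitive M (Aq (grad u))" using primM_nonneg[OF Aq_nonneg] p_gt_1 p_less_q by simp
  then show ?thesis using 2 3 u(2) by (simp add: En_def)
 qed
 show thesis
 proof (rule that)
  show "0 < P" using P(1) by simp
  show "\<forall>i c d. \<forall>u\<in>\<T>. \<forall>v\<in>\<T>. l i (\<lambda>x. c * u x + d * v x) = c * l i u + d * l i v" by (intro allI ballI kl(1))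
  show "\<forall>u\<in>\<T>. Ap (grad u) = P \<longrightarrow> (\<forall>i<k. l i u = 0) \<longrightarrow> K \<le> \<E> u" using low by blast
 qed
qed

lemma linear_comb:
 assumes "\<And>u v c d. u \<in> \<T> ==> v \<in> \<T> ==> l (\<lambda>x. c * u x + d * v x) = c * l u + d * l v"
 shows "l (comb n c) = (\<Sum>j<n. c j * l (\<phi> j))"
proof (induction n)
 case 0
 show ?case using assms[OF \<phi> \<phi>, of 0 0 0 0] by (simp add: comb_def[abs_def])
next
 case (Suc n)
 have "comb (Suc n) c = (\<lambda>x. 1 * comb n c x + c n * \<phi> n x)" by (simp add: comb_def[abs_def])
 then show ?case using assms[OF comb_test \<phi>, of 1 n c "c n" n] Suc by simp
qed

theorem galerkin_critical_points:
 obtains k d where "\<And>n. k < n ==> \<exists>c. K \<le> \<E> (comb n c) \<and> \<E> (comb n c) \<le> d \<and>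
  (\<forall>v. \<D> (comb n c) (comb n v) = 0)"
proof -
 obtain k :: nat and l P where P: "0 < P" and l': "\<forall>i c d. \<forall>u\<in>\<T>. \<forall>v\<in>\<T>. l i (\<lambda>x. c * u x + d * v x) = c * l i u + d * l i v"
  and low': "\<forall>u\<in>\<T>. Ap (grad u) = P \<longrightarrow> (\<forall>i<k. l i u = 0) \<longrightarrow> K \<le> \<E> u"
  by (rule linking_lower[where K = K]) (rule that)
 have l: "l i (\<lambda>x. c * u x + d * v x) = c * l i u + d * l i v" if "u \<in> \<T>" "v \<in> \<T>" for i u v c d
  using l'[rule_format, OF that] .
 have lin: "l i (comb n c) = (\<Sum>j<n. c j * l i (\<phi> j))" for i n c
  by (rule linear_comb) (rule l)
 have low: "K \<le> \<E> u" if "u \<in> \<T>" "Ap (grad u) = P" "\<And>i. i < k ==> l i u = 0" for u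
  using low' that by blast
 let ?E = "\<lambda>n c. \<E> (comb n c)"
 obtain R where R: "\<And>c. c \<in> fin_space (Suc k) ==> 0 \<le> ?E (Suc k) c ==> \<forall>i. \<bar>c i\<bar> \<le> R"
  using coercive[of "Suc k" 0] by blast
 \<comment> \<open>Where the energy is nonnegative on the span of the first k + 1 functions, the
   coefficients lie in a compact box, so it is bounded above there. The bound involves no larger
   dimension.\<close>
 obtain d where d: "\<And>c. c \<in> fin_space (Suc k) ==> ?E (Suc k) c \<le> d"
 proof -
  have "bounded (?E (Suc k) ` {c \<in> fin_space (Suc k). \<forall>i. \<bar>c i\<bar> \<le> R})"
   by (rule compact_imp_bounded[OF compact_continuous_image[OF comb_continuous(4) compact_fin_box]])
  then obtain d0 where d0: "\<And>c. c \<in> fin_space (Suc k) ==> \<forall>i. \<bar>c i\<bar> \<le> R ==> norm (?E (Suc k) c) \<le> d0"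
   unfolding bounded_iff by blast
  have "?E (Suc k) c \<le> max 0 d0" if c: "c \<in> fin_space (Suc k)" for c
  proof (cases "0 \<le> ?E (Suc k) c")
   case True
   then show ?thesis using d0[OF c R[OF c True]] by simp
  qed simp
  then show thesis by (rule that)
 qed
 have "\<exists>c. K \<le> ?E n c \<and> ?E n c \<le> d + 1 \<and> (\<forall>v. \<D> (comb n c) (comb n v) = 0)"
  if n: "k < n" for n
 proof -
  interpret J: even_functional n "?E n" "\<lambda>i c. \<D> (comb n c) (\<phi> i)"
   by (rule even_functional_En)
  \<comment> \<open>The radial factor that moves a nonzero vector onto the set where the p-energy
    equals \<open>P\<close>. It is even in c, which makes the normalisation an odd map.\<close>
  define s where "s = (\<lambda>c. (P / Ap (grad (comb n c))) powr (1 / p))"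
  \<comment> \<open>Positivity is the Poincare inequality, that is, the Sobolev bound for the
    exponent p itself.\<close>
  have Ap_pos: "0 < Ap (grad (comb n c))" if "c \<in> fin_space n" "c \<noteq> (\<lambda>i. 0)" for c
  proof -
   obtain D where D: "\<And>u. u \<in> \<T> ==> (LINT x|\<mu>. norm (u x) powr p) \<le> D * Ap (grad u) powr (p / p)"
    by (rule sobolev_bound[of p]) (use p_gt_1 in auto)
   have "0 < (LINT x|\<mu>. \<bar>comb n c x\<bar> powr p)" using comb_powr_pos[OF that] p_gt_1 by simp
   also have "\<dots> \<le> D * Ap (grad (comb n c)) powr (p / p)" using D[OF comb_test[of n c]] by simp
   finally show ?thesis using Ap_nonneg[of "grad (comb n c)"] by (cases "Ap (grad (comb n c)) = 0") auto
  qed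
  obtain c where c: "c \<in> fin_space n" "K \<le> ?E n c" "?E n c \<le> d + 1"
   "\<And>i. i < n ==> \<D> (comb n c) (\<phi> i) = 0"
  proof (rule J.critical_point_linking[OF n, where L = "\<lambda>i c. l i (comb n c)" and \<sigma> = "\<lambda>c i. s c * c i" and b = K and d = d])
   show "continuous_on (fin_space n) (\<lambda>c. l i (comb n c))" for i
    unfolding lin by (intro continuous_intros continuous_on_subset[OF continuous_on_product_coordinates subset_UNIV])
   show "l i (comb n (\<lambda>j. - c j)) = - l i (comb n c)" for i c
    by (simp add: lin sum_negf)
   have "continuous_on (fin_space n - {\<lambda>i. 0}) s"
    unfolding s_def
    by (intro continuous_on_powr continuous_intros comb_continuous) (use Ap_pos P in \<open>fastforce simp: less_imp_neq[symmetric]\<close>)+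
   then show "continuous_on (fin_space n - {\<lambda>i. 0}) (\<lambda>c i. s c * c i)"
    by (intro continuous_on_coordinatewise_then_product continuous_on_mult continuous_on_subset[OF continuous_on_product_coordinates subset_UNIV])
   show "(\<lambda>i. s c * c i) \<in> fin_space n" if "c \<in> fin_space n" for c using that by (auto simp: fin_space_def)
   show "(\<lambda>i. s (\<lambda>i. - c i) * - c i) = (\<lambda>i. - (s c * c i))" for c
    by (simp add: s_def comb_minus(2) Ap_def)
   show "K \<le> ?E n (\<lambda>i. s c * c i)" if c: "c \<in> fin_space n" "c \<noteq> (\<lambda>i. 0)" "\<And>i. i < k ==> l i (comb n c) = 0" for c
   proof (rule low[OF comb_test])
    have "Ap (grad (comb n (\<lambda>i. s c * c i))) = \<bar>s c\<bar> powr p * Ap (grad (comb n c))"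
     unfolding comb_scale(2) Ap_def by (simp add: powr_mult)
    also have "\<bar>s c\<bar> powr p = P / Ap (grad (comb n c))" using P Ap_pos[OF c(1,2)] p_gt_1 by (simp add: s_def powr_powr)
    finally show "Ap (grad (comb n (\<lambda>i. s c * c i))) = P" using Ap_pos[OF c(1,2)] by simp
    fix i assume "i < k"
    have "l i (comb n (\<lambda>j. s c * c j)) = s c * l i (comb n c)"
     by (simp add: lin sum_distrib_left mult.assoc)
    then show "l i (comb n (\<lambda>j. s c * c j)) = 0" using c(3)[OF \<open>i < k\<close>] by simp
   qed
   show "?E n c \<le> d" if "c \<in> fin_space (Suc k)" for c
    using d[OF that] comb_extend[OF that, of n] n by simp
  qed (rule that)
  have "\<D> (comb n c) (comb n v) = 0" for v
   using dEn_sum[OF comb_test[of n c], of n \<phi> v] \<phi> c(4) by (simp add: comb_def[abs_def])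
  then show ?thesis using c by blast
 qed
 then show thesis by (rule that)
qed

end

section \<open>Compactness of the Galerkin sequence\<close>

context kirchhoff
begin

lemma AR_lower:
 obtains c3 where "\<And>x t. - c3 \<le> t * f x t - \<sigma> * F x t"
proof
 fix x t
 let ?K = "t0 * (C * (1 + t0 powr (r - 1)))" and ?L = "\<sigma> * (2 * C * (1 + t0 powr r))"
 show "- (?K + ?L) \<le> t * f x t - \<sigma> * F x t"
 proof (cases "t0 \<le> \<bar>t\<bar>")
  case True
  moreover have "0 \<le> ?K + ?L" using t0 sigma_gt C_nonneg by (intro add_nonneg_nonneg mult_nonneg_nonneg) auto
  ultimately show ?thesis using f_AR[of t x] by simp
 next
  case False
  then have b: "\<bar>f x t\<bar> \<le> C * (1 + t0 powr (r - 1))" "\<bar>F x t\<bar> \<le> 2 * C * (1 + t0 powr r)" by (intro bounded_growth; simp)+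
  have "\<bar>t * f x t\<bar> \<le> ?K" unfolding abs_mult using False t0 b(1) by (intro mult_mono) auto
  moreover have "\<bar>\<sigma> * F x t\<bar> \<le> ?L" unfolding abs_mult using sigma_gt b(2) by (intro mult_mono) auto
  ultimately show ?thesis by linarith
 qed
qed

text \<open>In \<sigma> times the energy minus the vanishing derivative \<open>\<D> u u\<close>, the
  terms with f are bounded below by a constant. By \<open>M_theta\<close> and p < q the Kirchhoff
  terms dominate (\<sigma>/q - \<theta>) times the sum of both primitives, and this factor is
  positive. The primitives grow at least linearly, so both Dirichlet energies are bounded.\<close>

lemma critical_points_bounded:
 obtains B where "0 \<le> B" "\<And>u. u \<in> \<T> ==> \<E> u \<le> d ==> \<D> u u = 0 ==> Ap (grad u) \<le> B \<and> Aq (grad u) \<le> B"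
proof -
 interpret m: finite_measure \<mu> by (rule finite_\<mu>)
 obtain c3 where c3: "\<And>x t. - c3 \<le> t * f x t - \<sigma> * F x t" by (rule AR_lower) (rule that)
 obtain \<kappa> where \<kappa>: "0 < \<kappa>" "\<And>t. 0 \<le> t ==> \<kappa> * (t - 1) \<le> primitive M t" by (rule primM_lower) blast
 define V where "V = c3 * measure \<mu> \<Omega>"
 define e where "e = \<sigma> / q - \<theta>"
 have q0: "0 < q" "0 < p" using p_gt_1 p_less_q by auto
 have e: "0 < e" using sigma q0 by (simp add: e_def field_simps)
 define B where "B = max 0 (1 + (\<sigma> * d + V) / (e * \<kappa>))"
 have main: "Ap (grad u) \<le> B \<and> Aq (grad u) \<le> B" if u: "u \<in> \<T>" and E: "\<E> u \<le> d" and D: "\<D> u u = 0" for u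
 proof -
  let ?X = "primitive M (Ap (grad u))" and ?Y = "primitive M (Aq (grad u))"
  have XY: "0 \<le> ?X" "0 \<le> ?Y" by (simp_all add: primM_nonneg Ap_nonneg Aq_nonneg)
  note i = test_integrable[OF u u]
  have "- V = (LINT x|\<mu>. - c3)" by (simp add: V_def)
  also have "\<dots> \<le> (LINT x|\<mu>. f x (u x) * u x - \<sigma> * F x (u x))"
   by (rule integral_mono) (use i c3 in \<open>auto simp: mult.commute\<close>)
  also have "\<dots> = (LINT x|\<mu>. f x (u x) * u x) - \<sigma> * (LINT x|\<mu>. F x (u x))" using i by simp
  finally have 1: "- V \<le> (LINT x|\<mu>. f x (u x) * u x) - \<sigma> * (LINT x|\<mu>. F x (u x))" .
  have 2: "(LINT x|\<mu>. f x (u x) * u x) = Ap (grad u) * M (Ap (grad u)) + Aq (grad u) * M (Aq (grad u))"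
   using D by (simp add: dEn_def Bp_self Bq_self mult.commute)
  have 3: "\<sigma> * (1 / p * ?X + 1 / q * ?Y - (LINT x|\<mu>. F x (u x))) \<le> \<sigma> * d"
   using E sigma_gt by (intro mult_left_mono) (auto simp: En_def)
  have "\<sigma> / q \<le> \<sigma> / p" using p_less_q q0 sigma_gt by (simp add: frac_le)
  then have "\<sigma> / q * ?X \<le> \<sigma> / p * ?X" using XY by (intro mult_right_mono)
  then have "\<sigma> / q * ?X + \<sigma> / q * ?Y - \<theta> * ?X - \<theta> * ?Y \<le> \<sigma> * d + V"
   using 1 3 M_theta[OF Ap_nonneg[of "grad u"]] M_theta[OF Aq_nonneg[of "grad u"]] unfolding 2
   by (simp add: algebra_simps)
  then have sum: "e * ?X + e * ?Y \<le> \<sigma> * d + V" by (simp add: e_def algebra_simps)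
  have eXY: "0 \<le> e * ?X" "0 \<le> e * ?Y" using e XY by auto
  have "T \<le> B" if T: "0 \<le> T" "e * primitive M T \<le> \<sigma> * d + V" for T
  proof -
   have "e * (\<kappa> * (T - 1)) \<le> e * primitive M T" using \<kappa>(2)[OF T(1)] e by (intro mult_left_mono) auto
   then have "(e * \<kappa>) * (T - 1) \<le> \<sigma> * d + V" using T(2) by simp
   then have "T - 1 \<le> (\<sigma> * d + V) / (e * \<kappa>)" using e \<kappa>(1) by (simp add: pos_le_divide_eq mult.commute)
   then show ?thesis by (simp add: B_def)
  qed
  from this[OF Ap_nonneg] this[OF Aq_nonneg] sum eXY show ?thesis by fastforce
 qed
 show thesis by (rule that[OF _ main]) (simp_all add: B_def)
qed

text \<open>For each \<epsilon> = 1/(j+1) finitely many functionals control the L^s norm up to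
  \<epsilon>. Their values along the sequence, for all j together, are points of a compact product
  of intervals, so one subsequence makes all of them converge; compactness of the product stands for
  the diagonal argument.\<close>

lemma rellich_subsequence:
 assumes w: "\<And>n. w n \<in> \<T>" and B: "\<And>n. Ap (grad (w n)) \<le> B" and s: "p \<le> s" "0 < s - real DIM('a) * (s - p) / p"
 obtains \<rho> where "strict_mono (\<rho> :: nat => nat)"
  "\<And>e. 0 < e ==> \<exists>N. \<forall>m\<ge>N. \<forall>n\<ge>N. (LINT x|\<mu>. norm (w (\<rho> m) x - w (\<rho> n) x) powr s) < e"
proof -
 have p0: "0 < p" "0 < s" using p_gt_1 s by auto
 have B0: "0 \<le> B" using order.trans[OF Ap_nonneg B] .
 define rel where "rel = (\<lambda>j (k::nat) (l :: nat => ('a => real) => real) C. 0 \<le> C \<and>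
  (\<forall>i c d. \<forall>u\<in>\<T>. \<forall>v\<in>\<T>. l i (\<lambda>x. c * u x + d * v x) = c * l i u + d * l i v) \<and>
  (\<forall>i<k. \<forall>u\<in>\<T>. \<bar>l i u\<bar> powr p \<le> C * Ap (grad u)) \<and>
  (\<forall>u\<in>\<T>. (LINT x|\<mu>. \<bar>u x\<bar> powr s) \<le> inverse (real (Suc j)) * Ap (grad u) powr (s / p) + C * (\<Sum>i<k. \<bar>l i u\<bar> powr s)))"
 have "\<exists>k l C. rel j k l C" for j
 proof -
  have \<epsilon>: "0 < inverse (real (Suc j))" by simp
  obtain k :: nat and l C where kl: "0 \<le> C" "\<And>i u v c d. u \<in> \<T> ==> v \<in> \<T> ==> l i (\<lambda>x. c * u x + d * v x) = c * l i u + d * l i v"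
   "\<And>i u. i < k ==> u \<in> \<T> ==> \<bar>l i u\<bar> powr p \<le> C * (LINT x|lborel. norm (grad u x) powr p)"
   "\<And>u. u \<in> \<T> ==> (LINT x|lborel. \<bar>u x\<bar> powr s) \<le>
    inverse (real (Suc j)) * (LINT x|lborel. norm (grad u x) powr p) powr (s / p) + C * (\<Sum>i<k. \<bar>l i u\<bar> powr s)"
   by (rule sobolev_rellich[OF open_domain bounded_domain p_gt_1 s \<epsilon>]) (rule that)
  have "rel j k l C"
   unfolding rel_def
  proof (intro conjI allI ballI impI)
   show "\<bar>l i u\<bar> powr p \<le> C * Ap (grad u)" if "i < k" "u \<in> \<T>" for i u
    using kl(3)[OF that] p0 by (simp add: test_integral_lborel[OF that(2)] Ap_def)
   show "(LINT x|\<mu>. \<bar>u x\<bar> powr s) \<le> inverse (real (Suc j)) * Ap (grad u) powr (s / p) + C * (\<Sum>i<k. \<bar>l i u\<bar> powr s)" if "u \<in> \<T>" for u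
    using kl(4)[OF that] unfolding test_integral_lborel[OF that p0(1)] test_integral_lborel[OF that p0(2)] Ap_def .
  qed (rule kl(1) kl(2); assumption)+
  then show ?thesis by blast
 qed
 then obtain k l D where rel: "\<And>j. rel j (k j) (l j) (D j)" by metis
 \<comment> \<open>All pairs of a level j and a functional i are numbered by
   \<open>prod_decode\<close>; places with i beyond the range of level j hold 0.\<close>
 define y where "y = (\<lambda>n m. case prod_decode m of (j, i) => if i < k j then l j i (w n) else 0)"
 define b where "b = (\<lambda>m. (D (fst (prod_decode m)) * B) powr (1 / p))"
 have yb: "\<bar>y n m\<bar> \<le> b m" for n m
 proof (cases "prod_decode m")
  case (Pair j i)
  show ?thesis
  proof (cases "i < k j")
   case True
   have "0 \<le> D j" "\<bar>l j i (w n)\<bar> powr p \<le> D j * Ap (grad (w n))" using rel[of j] w[of n] True unfolding rel_def by blast+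
   then have "\<bar>l j i (w n)\<bar> powr p \<le> D j * B" using mult_left_mono[OF B[of n], of "D j"] by linarith
   then have "(\<bar>l j i (w n)\<bar> powr p) powr (1 / p) \<le> b m" unfolding b_def Pair fst_conv using p0 by (intro powr_mono2) auto
   then show ?thesis using p0 True by (simp add: powr_powr y_def Pair)
  qed (simp add: y_def b_def Pair)
 qed
 have "compactin (product_topology (\<lambda>i. euclidean) UNIV) (PiE UNIV (\<lambda>m. {- b m..b m}))"
  unfolding compactin_PiE by auto
 then have "compact (PiE UNIV (\<lambda>m. {- b m..b m}))" by (simp add: euclidean_product_topology)
 then have "seq_compact (PiE UNIV (\<lambda>m. {- b m..b m}))" by (rule compact_imp_seq_compact)
 moreover have "y n \<in> PiE UNIV (\<lambda>m. {- b m..b m})" for n using yb[of n] by (auto simp: abs_le_iff minus_le_iff)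
 ultimately obtain y' \<rho> where \<rho>: "strict_mono (\<rho> :: nat => nat)" "(y \<circ> \<rho>) \<longlonglongrightarrow> y'"
  unfolding seq_compact_def by blast
 have lim: "(\<lambda>n. l j i (w (\<rho> n))) \<longlonglongrightarrow> y' (prod_encode (j, i))" if "i < k j" for j i
  using \<rho>(2) that unfolding tendsto_coordinatewise by (auto simp: y_def o_def dest: spec[of _ "prod_encode (j, i)"])
 have Cauchy: "\<exists>N. \<forall>m\<ge>N. \<forall>n\<ge>N. (LINT x|\<mu>. norm (w (\<rho> m) x - w (\<rho> n) x) powr s) < e" if e: "0 < e" for e
 proof -
  define G where "G = 2 powr p * (B + B)"
  have Gb: "Ap (grad (\<lambda>x. w m x - w n x)) \<le> G" for m n
  proof -
   have "Ap (grad (\<lambda>x. w m x - w n x)) \<le> 2 powr p * (Ap (grad (w m)) + Ap (grad (w n)))"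
    using norm_diff_powr(2)[OF test_borel_\<mu>(2)[OF w] test_borel_\<mu>(2)[OF w], of m p n] test_integrable(6)[OF w w] p0
    by (simp add: Ap_def grad_diff[OF w w])
   also have "\<dots> \<le> G" unfolding G_def using B by (intro mult_left_mono add_mono) auto
   finally show ?thesis .
  qed
  obtain j :: nat where j: "inverse (real (Suc j)) * G powr (s / p) < e / 2"
  proof -
   have "0 < e / 2 / (G powr (s / p) + 1)" using e by (simp add: add_nonneg_pos)
   then obtain j where "inverse (real (Suc j)) < e / 2 / (G powr (s / p) + 1)" using reals_Archimedean by blast
   then have "inverse (real (Suc j)) * (G powr (s / p) + 1) < e / 2" by (subst (asm) pos_less_divide_eq) (auto intro: add_nonneg_pos)
   moreover have "inverse (real (Suc j)) * G powr (s / p) \<le> inverse (real (Suc j)) * (G powr (s / p) + 1)" by (intro mult_left_mono) auto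
   ultimately have "inverse (real (Suc j)) * G powr (s / p) < e / 2" by (rule le_less_trans[rotated])
   then show thesis by (rule that)
  qed
  have D0: "0 \<le> D j" using rel by (simp add: rel_def)
  define z where "z = (\<lambda>i. y' (prod_encode (j, i)))"
  let ?S = "\<lambda>n. D j * (\<Sum>i<k j. 2 powr s * (2 * \<bar>l j i (w (\<rho> n)) - z i\<bar> powr s))"
  have "(\<lambda>n. ?S n) \<longlonglongrightarrow> D j * (\<Sum>i<k j. 2 powr s * (2 * \<bar>z i - z i\<bar> powr s))"
   unfolding z_def by (intro tendsto_intros tendsto_powr' lim) (use p0 in auto)
  then have "(\<lambda>n. ?S n) \<longlonglongrightarrow> 0" using p0 by simp
  then have "\<forall>\<^sub>F n in sequentially. ?S n < e / 2"
   by (rule order_tendstoD) (use e in simp)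
  then obtain N where N: "\<And>n. N \<le> n ==> ?S n < e / 2"
   by (auto simp: eventually_sequentially)
  show ?thesis
  proof (intro exI[of _ N] allI impI)
   fix m n assume mn: "N \<le> m" "N \<le> n"
   let ?d = "\<lambda>x. w (\<rho> m) x - w (\<rho> n) x"
   let ?a = "\<lambda>m i. \<bar>l j i (w (\<rho> m)) - z i\<bar> powr s"
   have dT: "?d \<in> \<T>" by (rule test_functions_diff[OF w w])
   have ld: "l j i ?d = l j i (w (\<rho> m)) - l j i (w (\<rho> n))" for i
   proof -
    have "l j i (\<lambda>x. 1 * w (\<rho> m) x + (- 1) * w (\<rho> n) x) = 1 * l j i (w (\<rho> m)) + (- 1) * l j i (w (\<rho> n))"
     using rel[of j] w unfolding rel_def by blast
    then show ?thesis by simp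
   qed
   have "\<bar>l j i ?d\<bar> powr s \<le> 2 powr s * (?a m i + ?a n i)" for i
    using norm_add_powr_le[of s "l j i (w (\<rho> m)) - z i" "z i - l j i (w (\<rho> n))"] p0 by (simp add: ld abs_minus_commute)
   then have "D j * (\<Sum>i<k j. \<bar>l j i ?d\<bar> powr s) \<le> D j * (\<Sum>i<k j. 2 powr s * (?a m i + ?a n i))"
    using D0 by (intro mult_left_mono sum_mono)
   also have "\<dots> = (D j * (\<Sum>i<k j. 2 powr s * (2 * ?a m i)) + D j * (\<Sum>i<k j. 2 powr s * (2 * ?a n i))) / 2"
    by (simp add: sum.distrib sum_distrib_left[symmetric] algebra_simps)
   also have "\<dots> < e / 2" using N[OF mn(1)] N[OF mn(2)] by simp
   finally have 1: "D j * (\<Sum>i<k j. \<bar>l j i ?d\<bar> powr s) < e / 2" .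
   have "(LINT x|\<mu>. \<bar>?d x\<bar> powr s) \<le> inverse (real (Suc j)) * Ap (grad ?d) powr (s / p) + D j * (\<Sum>i<k j. \<bar>l j i ?d\<bar> powr s)"
   proof -
    have "\<forall>u\<in>\<T>. (LINT x|\<mu>. \<bar>u x\<bar> powr s) \<le> inverse (real (Suc j)) * Ap (grad u) powr (s / p) + D j * (\<Sum>i<k j. \<bar>l j i u\<bar> powr s)"
     using rel[of j] unfolding rel_def by (elim conjE)
    from bspec[OF this dT] show ?thesis .
   qed
   moreover have "inverse (real (Suc j)) * Ap (grad ?d) powr (s / p) \<le> inverse (real (Suc j)) * G powr (s / p)"
    using Gb[of "\<rho> m" "\<rho> n"] p0 Ap_nonneg by (intro mult_left_mono powr_mono2) auto
   ultimately have "(LINT x|\<mu>. \<bar>?d x\<bar> powr s) < e" using 1 j by linarith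
   then show "(LINT x|\<mu>. norm (?d x) powr s) < e" by simp
  qed
 qed
 show thesis by (rule that[OF \<rho>(1) Cauchy])
qed

text \<open>Nonnegativity is midpoint convexity. For the upper bound the power at the midpoint is
  bounded below by its tangent at the gradient of u, which brings in the derivative at u in the
  direction v - u, the quantity that the equation controls.\<close>

lemma midpoint_gap:
 assumes u: "u \<in> \<T>" and v: "v \<in> \<T>" and s: "1 < s" and Q: "Q = \<mu> \<or> Q = \<nu>"
 defines "G \<equiv> ((LINT x|Q. norm (grad v x) powr s) + (LINT x|Q. norm (grad u x) powr s)) / 2 - (LINT x|Q. norm ((1/2) *\<^sub>R (grad v x + grad u x)) powr s)"
 shows "0 \<le> G"
  "G \<le> ((LINT x|Q. norm (grad v x) powr s) - (LINT x|Q. norm (grad u x) powr s)) / 2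
   - s / 2 * (LINT x|Q. norm (grad u x) powr (s - 2) * (grad u x \<bullet> grad (\<lambda>x. v x - u x) x))"
proof -
 let ?k = "\<lambda>x. norm (grad u x) powr (s - 2) * (grad u x \<bullet> grad (\<lambda>x. v x - u x) x)" and ?N = "\<lambda>g. \<integral>x. norm (g x) powr s \<partial>Q"
 let ?m = "\<lambda>x. (1/2) *\<^sub>R (grad v x + grad u x)"
 have g: "grad (\<lambda>x. 1/2 * (v x + u x)) x = ?m x" for x
  using grad_cmult[OF test_functions_add[OF v u], of "1/2" x] grad_add[OF v u, of x] by simp
 have s0: "0 \<le> s" using s by simp
 have T: "(\<lambda>x. 1/2 * (v x + u x)) \<in> \<T>" by (rule test_functions_cmult[OF test_functions_add[OF v u]])
 have iu: "integrable Q (\<lambda>x. norm (grad u x) powr s)" and iv: "integrable Q (\<lambda>x. norm (grad v x) powr s)"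
  and im: "integrable Q (\<lambda>x. norm (?m x) powr s)"
  and id: "integrable Q (\<lambda>x. ?k x)"
  using Q test_integrable(6,7)[OF u u s0] test_integrable(6,7)[OF v v s0] test_integrable(6,7)[OF T T s0]
   test_integrable(3,4)[OF u test_functions_diff[OF v u] s] unfolding g by blast+
 have "(LINT x|Q. norm (?m x) powr s) \<le> (LINT x|Q. (norm (grad v x) powr s + norm (grad u x) powr s) / 2)"
  by (rule integral_mono[OF im]) (use iu iv convex_gap_nonneg(1)[OF s] in auto)
 also have "\<dots> = (?N (grad v) + ?N (grad u)) / 2"
  using iu iv by simp
 finally show "0 \<le> G" by (simp add: G_def)
 have "?N (grad u) + s / 2 * (LINT x|Q. ?k x)
  = (LINT x|Q. norm (grad u x) powr s + s / 2 * (?k x))"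
  using iu id by simp
 also have "\<dots> \<le> (LINT x|Q. norm (?m x) powr s)"
 proof (rule integral_mono)
  fix x
  have "?m x - grad u x = (1/2) *\<^sub>R grad (\<lambda>x. v x - u x) x"
   unfolding grad_diff[OF v u] by (rule euclidean_eqI) (simp add: inner_diff_left inner_add_left)
  then show "norm (grad u x) powr s + s / 2 * (?k x) \<le> norm (?m x) powr s"
   using norm_powr_convex_tangent[OF s, of "grad u x" "?m x"] by (simp add: inner_scaleR_right)
 qed (use iu id im in auto)
 finally show "G \<le> (?N (grad v) - ?N (grad u)) / 2
   - s / 2 * (LINT x|Q. ?k x)"
  by (simp add: G_def field_simps)
qed

text \<open>The two gap bounds are divided by p and q, weighted with the coefficients
  \<open>M\<close> at u, and added. The derivative terms then form half of the left side of the
  equation tested with v - u, which equals half of the integral of f. Since both gaps are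
  nonnegative, the bound for the sum holds for each weighted gap alone.\<close>

lemma critical_gap:
 assumes u: "u \<in> \<T>" and v: "v \<in> \<T>" and crit: "\<D> u (\<lambda>x. v x - u x) = 0"
 defines "G \<equiv> \<lambda>Q s. ((LINT x|Q. norm (grad v x) powr s) + (LINT x|Q. norm (grad u x) powr s)) / 2 - (LINT x|Q. norm ((1/2) *\<^sub>R (grad v x + grad u x)) powr s)"
 defines "\<Delta> \<equiv> M (Ap (grad u)) * \<bar>Ap (grad v) - Ap (grad u)\<bar> + M (Aq (grad u)) * \<bar>Aq (grad v) - Aq (grad u)\<bar>
   + \<bar>LINT x|\<mu>. f x (u x) * (v x - u x)\<bar>"
 shows "0 \<le> G \<mu> p" "0 \<le> G \<nu> q" "M (Ap (grad u)) * G \<mu> p \<le> q * \<Delta>" "M (Aq (grad u)) * G \<nu> q \<le> q * \<Delta>"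
proof -
 have pq: "1 < p" "1 < q" "p < q" using p_gt_1 p_less_q by auto
 let ?d = "\<lambda>x. v x - u x"
 define a b f' where "a = M (Ap (grad u))" and "b = M (Aq (grad u))" and "f' = (LINT x|\<mu>. f x (u x) * (v x - u x))"
 define dA dB where "dA = Ap (grad v) - Ap (grad u)" and "dB = Aq (grad v) - Aq (grad u)"
 have ab: "0 \<le> a" "0 \<le> b" by (simp_all add: a_def b_def M_nonneg Ap_nonneg Aq_nonneg)
 show G0: "0 \<le> G \<mu> p" "0 \<le> G \<nu> q"
  unfolding G_def by (rule midpoint_gap(1)[OF u v pq(1)], simp, rule midpoint_gap(1)[OF u v pq(2)], simp)
 have G1: "G \<mu> p \<le> dA / 2 - p / 2 * Bp (grad u) (grad ?d)"
  unfolding G_def Ap_def Bp_def dA_def by (rule midpoint_gap(2)[OF u v pq(1)]) simp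
 have G2: "G \<nu> q \<le> dB / 2 - q / 2 * Bq (grad u) (grad ?d)"
  unfolding G_def Aq_def Bq_def dB_def by (rule midpoint_gap(2)[OF u v pq(2)]) simp
 have e: "a * Bp (grad u) (grad ?d) + b * Bq (grad u) (grad ?d) = f'"
  using crit by (simp add: dEn_def a_def b_def f'_def)
 define X Y where "X = Bp (grad u) (grad ?d)" and "Y = Bq (grad u) (grad ?d)"
 have "a / p * G \<mu> p \<le> a / p * (dA / 2 - p / 2 * X)" using G1 ab pq unfolding X_def by (intro mult_left_mono) auto
 also have "\<dots> = a / p * (dA / 2) - a * X / 2" using pq by (simp add: field_simps)
 finally have 1: "a / p * G \<mu> p \<le> a / p * (dA / 2) - a * X / 2" .
 have "b / q * G \<nu> q \<le> b / q * (dB / 2 - q / 2 * Y)" using G2 ab pq unfolding Y_def by (intro mult_left_mono) auto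
 also have "\<dots> = b / q * (dB / 2) - b * Y / 2" using pq by (simp add: field_simps)
 finally have "a / p * G \<mu> p + b / q * G \<nu> q \<le> a / p * (dA / 2) + b / q * (dB / 2) - f' / 2"
  using 1 e unfolding X_def[symmetric] Y_def[symmetric] by argo
 also have "\<dots> \<le> \<Delta>"
 proof -
  have "a / p * (dA / 2) \<le> a * \<bar>dA\<bar>"
  proof -
   have "a / p * (dA / 2) \<le> a / p * \<bar>dA\<bar>" using ab pq by (intro mult_left_mono) auto
   also have "\<dots> \<le> a * \<bar>dA\<bar>" using ab pq by (intro mult_right_mono) (auto simp: field_simps mult_le_cancel_left1)
   finally show ?thesis .
  qed
  moreover have "b / q * (dB / 2) \<le> b * \<bar>dB\<bar>"
  proof -
   have "b / q * (dB / 2) \<le> b / q * \<bar>dB\<bar>" using ab pq by (intro mult_left_mono) auto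
   also have "\<dots> \<le> b * \<bar>dB\<bar>" using ab pq by (intro mult_right_mono) (auto simp: field_simps mult_le_cancel_left1)
   finally show ?thesis .
  qed
  moreover have "- f' / 2 \<le> \<bar>f'\<bar>" by simp
  ultimately show ?thesis unfolding \<Delta>_def a_def[symmetric] b_def[symmetric] f'_def[symmetric] dA_def[symmetric] dB_def[symmetric] by linarith
 qed
 finally have main: "a / p * G \<mu> p + b / q * G \<nu> q \<le> \<Delta>" .
 have n: "0 \<le> a / p * G \<mu> p" "0 \<le> b / q * G \<nu> q" using ab G0 pq by auto
 then have "a / p * G \<mu> p \<le> \<Delta>" "b / q * G \<nu> q \<le> \<Delta>" "0 \<le> \<Delta>" using main by linarith+
 then have 1: "a * G \<mu> p \<le> p * \<Delta>" "b * G \<nu> q \<le> q * \<Delta>" using pq by (simp_all add: field_simps)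
 have "p * \<Delta> \<le> q * \<Delta>" using pq \<open>0 \<le> \<Delta>\<close> by (intro mult_right_mono) auto
 then show "M (Ap (grad u)) * G \<mu> p \<le> q * \<Delta>" "M (Aq (grad u)) * G \<nu> q \<le> q * \<Delta>" using 1 by (simp_all add: a_def b_def)
qed

text \<open>If the coefficient degenerates in the limit, then so does the Dirichlet energy it multiplies;
 hence no case distinction on \<open>M\<close> survives.\<close>

lemma gap_vanishes:
 fixes X :: "nat => real" and G \<Delta> :: "nat => nat => real"
 assumes X: "X \<longlonglongrightarrow> L" "\<And>n. 0 \<le> X n" and G: "\<And>m n. m \<le> n ==> M (X n) * G m n \<le> q * \<Delta> m n" "\<And>m n. G m n \<le> (X m + X n) / 2"
  and \<Delta>: "\<And>e. 0 < e ==> \<exists>N. \<forall>m\<ge>N. \<forall>n\<ge>m. \<Delta> m n < e" and e: "0 < e"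
 shows "\<exists>N. \<forall>m\<ge>N. \<forall>n\<ge>m. G m n < e"
proof (cases "M L = 0")
 case True
 have L: "0 \<le> L" by (rule LIMSEQ_le_const[OF X(1)]) (use X(2) in auto)
 then have "L = 0" using M_eq_0_iff True by simp
 then have "\<forall>\<^sub>F n in sequentially. X n < e" using order_tendstoD(2)[OF X(1)] e by simp
 then obtain N where N: "\<And>n. N \<le> n ==> X n < e" by (auto simp: eventually_sequentially)
 show ?thesis
 proof (intro exI[of _ N] allI impI)
  fix m n assume mn: "N \<le> m" "m \<le> n"
  then have "X m < e" "X n < e" using N[of m] N[of n] by auto
  then show "G m n < e" using G(2)[of m n] by simp
 qed
next
 case False
 have "0 \<le> L" by (rule LIMSEQ_le_const[OF X(1)]) (use X(2) in auto)
 then have Mpos: "0 < M L" using M_nonneg[of L] False by simp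
 have "\<forall>\<^sub>F n in sequentially. M L / 2 < M (X n)"
  by (rule order_tendstoD(1)[OF M_tendsto[OF X]]) (use Mpos in simp)
 then obtain N1 where N1: "\<And>n. N1 \<le> n ==> M L / 2 < M (X n)" by (auto simp: eventually_sequentially)
 have q: "0 < q" using p_gt_1 p_less_q by simp
 obtain N2 where N2: "\<And>m n. N2 \<le> m ==> m \<le> n ==> \<Delta> m n < M L / 2 * e / q" using \<Delta>[of "M L / 2 * e / q"] Mpos e q by auto
 show ?thesis
 proof (intro exI[of _ "max N1 N2"] allI impI)
  fix m n assume mn: "max N1 N2 \<le> m" "m \<le> n"
  show "G m n < e"
  proof (rule ccontr)
   assume "\<not> G m n < e"
   then have "M L / 2 * e \<le> M (X n) * G m n" using N1[of n] mn Mpos e by (intro mult_mono) auto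
   also have "\<dots> \<le> q * \<Delta> m n" by (rule G(1)[OF mn(2)])
   also have "\<dots> < q * (M L / 2 * e / q)" using N2[of m n] mn q by (intro mult_strict_left_mono) auto
   finally show False using q by simp
  qed
 qed
qed

lemma Cauchy_real_seq:
 fixes X :: "nat => real"
 assumes "X \<longlonglongrightarrow> L" "0 < e"
 shows "\<exists>N. \<forall>m\<ge>N. \<forall>n\<ge>N. \<bar>X m - X n\<bar> < e"
 using LIMSEQ_imp_Cauchy[OF assms(1)] assms(2) unfolding Cauchy_def dist_real_def by blast

text \<open>Compactness in L^r makes the integrals with f small, and a further subsequence makes
  both Dirichlet energies converge, so the right side \<open>\<Delta>\<close> of the gap estimate
  tends to 0. Vanishing gaps make the gradients Cauchy in both phases, and the Sobolev inequality
  then makes the functions Cauchy.\<close>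

lemma critical_sequence_converges:
 assumes w: "\<And>n. w n \<in> \<T>" and B: "0 \<le> B" "\<And>n. Ap (grad (w n)) \<le> B" "\<And>n. Aq (grad (w n)) \<le> B"
  and crit: "\<And>m n. m \<le> n ==> \<D> (w n) (\<lambda>x. w m x - w n x) = 0"
 obtains \<rho> u g where "strict_mono (\<rho> :: nat => nat)" "approximates (\<lambda>n. w (\<rho> n)) u g"
proof -
 interpret m: finite_measure \<mu> by (rule finite_\<mu>)
 have pq: "1 < p" "1 < q" "p < q" using p_gt_1 p_less_q by auto
 have pr: "p \<le> r" "1 \<le> r" "0 \<le> r" using p_less_r r_gt_1 by auto
 obtain \<rho>1 where \<rho>1: "strict_mono (\<rho>1 :: nat => nat)"
  "\<And>e. 0 < e ==> \<exists>N. \<forall>m\<ge>N. \<forall>n\<ge>N. (LINT x|\<mu>. norm (w (\<rho>1 m) x - w (\<rho>1 n) x) powr r) < e"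
  by (rule rellich_subsequence[OF w B(2) pr(1) r_sub]) (rule that)
 have "bounded (range (\<lambda>n. (Ap (grad (w (\<rho>1 n))), Aq (grad (w (\<rho>1 n))))))"
  by (rule bounded_subset[OF bounded_Times[of "{0..B}" "{0..B}"]]) (auto simp: Ap_nonneg Aq_nonneg B)
 then obtain L \<rho>2 where \<rho>2: "strict_mono (\<rho>2 :: nat => nat)" "((\<lambda>n. (Ap (grad (w (\<rho>1 n))), Aq (grad (w (\<rho>1 n))))) \<circ> \<rho>2) \<longlonglongrightarrow> L"
  using bounded_imp_convergent_subsequence by blast
 define \<rho> where "\<rho> = (\<lambda>n. \<rho>1 (\<rho>2 n))"
 define z where "z = (\<lambda>n. w (\<rho> n))"
 have \<rho>: "strict_mono \<rho>" using strict_mono_o[OF \<rho>1(1) \<rho>2(1)] by (simp add: \<rho>_def o_def)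
 have z: "z n \<in> \<T>" for n by (simp add: z_def w)
 note [measurable] = test_borel_\<mu>[OF z]
 have lim: "(\<lambda>n. Ap (grad (z n))) \<longlonglongrightarrow> fst L" "(\<lambda>n. Aq (grad (z n))) \<longlonglongrightarrow> snd L"
  using tendsto_fst[OF \<rho>2(2)] tendsto_snd[OF \<rho>2(2)] by (simp_all add: z_def \<rho>_def o_def)
 have zB: "Ap (grad (z n)) \<le> B" "Aq (grad (z n)) \<le> B" for n by (simp_all add: z_def B)
 have zcrit: "\<D> (z n) (\<lambda>x. z m x - z n x) = 0" if "m \<le> n" for m n
  unfolding z_def by (rule crit) (use strict_mono_mono[OF \<rho>] that in \<open>auto simp: mono_def\<close>)
 have int: "integrable \<mu> (\<lambda>x. norm (z m x - z n x) powr t)" if "0 \<le> t" for m n t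
  using test_integrable(5)[OF test_functions_diff[OF z z] z that] by simp
 have Cauchy: "\<exists>N. \<forall>m\<ge>N. \<forall>n\<ge>N. (LINT x|\<mu>. norm (z m x - z n x) powr r) < e" if e: "0 < e" for e
 proof -
  obtain N where N: "\<And>m n. N \<le> m ==> N \<le> n ==> (LINT x|\<mu>. norm (w (\<rho>1 m) x - w (\<rho>1 n) x) powr r) < e" using \<rho>1(2)[OF e] by blast
  have "N \<le> \<rho>2 n" if "N \<le> n" for n using seq_suble[OF \<rho>2(1), of n] that by simp
  then show ?thesis unfolding z_def \<rho>_def using N by blast
 qed
 obtain D where D: "0 \<le> D" "\<And>u. u \<in> \<T> ==> (LINT x|\<mu>. norm (u x) powr r) \<le> D * Ap (grad u) powr (r / p)"
  by (rule sobolev_bound[of r]) (use p_less_r r_sub in auto)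
 define Br where "Br = 2 powr r * (measure \<mu> \<Omega> + D * B powr (r / p))"
 have Br: "0 \<le> Br" using D by (simp add: Br_def)
 have fsmall: "\<exists>N. \<forall>m\<ge>N. \<forall>n\<ge>N. \<bar>LINT x|\<mu>. f x (z n x) * (z m x - z n x)\<bar> < e" if e: "0 < e" for e
 proof -
  have C2: "0 \<le> 2 * C" using C_nonneg by simp
  have zr: "integrable \<mu> (\<lambda>x. norm (z n x) powr r)" for n using test_integrable(5)[OF z z] pr by simp
  note Y = f_young_bound[OF test_borel_\<mu>(1)[OF z] zr]
  have mm: "(\<lambda>x. f x (z n x) * (z m x - z n x)) \<in> borel_measurable \<mu>" for m n
   by (intro borel_measurable_times f_compose_meas) measurable
  have bd: "(LINT x|\<mu>. \<bar>1 + \<bar>z n x\<bar>\<bar> powr r) \<le> Br" for n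
  proof -
   have "(LINT x|\<mu>. norm (z n x) powr r) \<le> D * B powr (r / p)"
    by (rule order.trans[OF D(2)[OF z]], intro mult_left_mono powr_mono2) (use pq pr zB Ap_nonneg D in auto)
   then have "2 powr r * (measure \<mu> \<Omega> + (LINT x|\<mu>. norm (z n x) powr r)) \<le> Br" unfolding Br_def by (intro mult_left_mono add_left_mono) auto
   then show ?thesis using Y(2)[of n] by linarith
  qed
  show ?thesis
  proof (rule young_integral_small[where ?'b = real and ?'x = 'a, OF C2 Br pr(2) e], goal_cases)
   case (1 \<eta>)
   show ?case using Cauchy[OF 1(1)] 1(2)[OF mm Y(3) Y(1) int[OF pr(3)] bd] by meson
  qed
 qed
 define \<Delta> where "\<Delta> m n = M (Ap (grad (z n))) * \<bar>Ap (grad (z m)) - Ap (grad (z n))\<bar> + M (Aq (grad (z n))) * \<bar>Aq (grad (z m)) - Aq (grad (z n))\<bar>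
   + \<bar>LINT x|\<mu>. f x (z n x) * (z m x - z n x)\<bar>" for m n
 have \<Delta>: "\<exists>N. \<forall>m\<ge>N. \<forall>n\<ge>m. \<Delta> m n < e" if e: "0 < e" for e
 proof -
  have "\<exists>K. 0 < K \<and> (\<forall>n. M (X n) \<le> K)" if X: "X \<longlonglongrightarrow> l" "\<And>n. 0 \<le> X n" for X :: "nat => real" and l
  proof -
   have "Bseq (\<lambda>n. M (X n))" by (rule convergent_imp_Bseq[OF convergentI[OF M_tendsto[OF X]]])
   then obtain K where K: "0 < K" "\<And>n. norm (M (X n)) \<le> K" by (auto simp: Bseq_def)
   have "M (X n) \<le> K" for n using K(2)[of n] by (simp add: abs_le_iff)
   then show ?thesis using K(1) by blast
  qed
  then obtain K1 K2 where K: "0 < K1" "\<And>n. M (Ap (grad (z n))) \<le> K1" "0 < K2" "\<And>n. M (Aq (grad (z n))) \<le> K2"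
   using lim Ap_nonneg Aq_nonneg by meson
  have e3: "0 < e / 3 / K1" "0 < e / 3 / K2" "0 < e / 3" using e K by auto
  obtain N1 where N1: "\<And>m n. N1 \<le> m ==> N1 \<le> n ==> \<bar>Ap (grad (z m)) - Ap (grad (z n))\<bar> < e / 3 / K1"
   using Cauchy_real_seq[OF lim(1) e3(1)] by blast
  obtain N2 where N2: "\<And>m n. N2 \<le> m ==> N2 \<le> n ==> \<bar>Aq (grad (z m)) - Aq (grad (z n))\<bar> < e / 3 / K2"
   using Cauchy_real_seq[OF lim(2) e3(2)] by blast
  obtain N3 where N3: "\<And>m n. N3 \<le> m ==> N3 \<le> n ==> \<bar>LINT x|\<mu>. f x (z n x) * (z m x - z n x)\<bar> < e / 3"
   using fsmall[OF e3(3)] by blast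
  show ?thesis
  proof (intro exI[of _ "max N1 (max N2 N3)"] allI impI)
   fix m n assume mn: "max N1 (max N2 N3) \<le> m" "m \<le> n"
   have "M (Ap (grad (z n))) * \<bar>Ap (grad (z m)) - Ap (grad (z n))\<bar> \<le> K1 * (e / 3 / K1)"
    by (rule mult_mono) (use K N1[of m n] mn in auto)
   moreover have "M (Aq (grad (z n))) * \<bar>Aq (grad (z m)) - Aq (grad (z n))\<bar> \<le> K2 * (e / 3 / K2)"
    by (rule mult_mono) (use K N2[of m n] mn in auto)
   moreover have "K1 * (e / 3 / K1) = e / 3" "K2 * (e / 3 / K2) = e / 3" using K by auto
   moreover have "\<bar>LINT x|\<mu>. f x (z n x) * (z m x - z n x)\<bar> < e / 3" using N3[of m n] mn by auto
   ultimately show "\<Delta> m n < e" unfolding \<Delta>_def by linarith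
  qed
 qed
 have p0: "0 \<le> p" "0 \<le> q" using pq by auto
 have gint: "integrable \<mu> (\<lambda>x. norm (grad (z n) x) powr p)" "integrable \<nu> (\<lambda>x. norm (grad (z n) x) powr q)"
  "integrable \<mu> (\<lambda>x. norm (grad (z m) x - grad (z n) x) powr p)" "integrable \<nu> (\<lambda>x. norm (grad (z m) x - grad (z n) x) powr q)" for m n
  using test_integrable(6,7)[OF z z] test_integrable(6,7)[OF test_functions_diff[OF z z] z] p0 by (simp_all add: grad_diff[OF z z])
 have gm: "grad (z n) \<in> borel_measurable \<mu>" "grad (z n) \<in> borel_measurable \<nu>" for n by simp_all
 let ?N = "\<lambda>s Q n. \<integral>x. norm (grad (z n) x) powr s \<partial>Q"
 have CG: "\<exists>N. \<forall>m\<ge>N. \<forall>n\<ge>N. (LINT x|Q. norm (grad (z m) x - grad (z n) x) powr s) < e"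
  if s: "1 < s" and m: "\<And>n. grad (z n) \<in> borel_measurable Q" and i: "\<And>n. integrable Q (\<lambda>x. norm (grad (z n) x) powr s)"
   and X: "?N s Q \<longlonglongrightarrow> l" "\<And>n. ?N s Q n \<le> B"
   and G: "\<And>m n. m \<le> n ==> M (?N s Q n) * ((?N s Q m + ?N s Q n) / 2
    - (LINT x|Q. norm ((1/2) *\<^sub>R (grad (z m) x + grad (z n) x)) powr s)) \<le> q * \<Delta> m n"
   and e: "0 < e" for s Q l e
 proof (rule convex_gap_Cauchy[OF s i m X(2) _ e])
  have pos: "0 \<le> (LINT x|Q. norm (g x) powr s)" for g :: "'a => 'a" by (rule integral_nonneg_AE) simp
  show "\<exists>N. \<forall>m\<ge>N. \<forall>n\<ge>m. (?N s Q m + ?N s Q n) / 2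
    - (LINT x|Q. norm ((1/2) *\<^sub>R (grad (z m) x + grad (z n) x)) powr s) < e" if "0 < e" for e
   by (rule gap_vanishes[OF X(1) pos G _ \<Delta> that]) (use pos[of "\<lambda>x. (1/2) *\<^sub>R (grad (z _) x + grad (z _) x)"] in \<open>simp_all add: field_simps\<close>)
 qed
 note CP = CG[OF pq(1) gm(1) gint(1) lim(1)[unfolded Ap_def] zB(1)[unfolded Ap_def] critical_gap(3)[OF z z zcrit, folded \<Delta>_def, unfolded Ap_def]]
 note CQ = CG[OF pq(2) gm(2) gint(2) lim(2)[unfolded Aq_def] zB(2)[unfolded Aq_def] critical_gap(4)[OF z z zcrit, folded \<Delta>_def, unfolded Aq_def]]
 have p1: "1 \<le> p" "1 \<le> q" "0 < p" using pq by auto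
 have gi: "integrable \<mu> (grad (z n))" "integrable \<nu> (grad (z n))" for n by (rule Lpq_integrable[OF test_Lpq(2)[OF z]])+
 obtain g where g[measurable]: "g \<in> borel_measurable \<mu>" and gp: "\<And>n. integrable \<mu> (\<lambda>x. norm (grad (z n) x - g x) powr p)"
  "(\<lambda>n. LINT x|\<mu>. norm (grad (z n) x - g x) powr p) \<longlonglongrightarrow> 0"
  by (rule Ls_complete[OF finite_\<mu> p1(1) gi(1) gint(3) CP]) (assumption | rule that)+
 have g\<nu>: "g \<in> borel_measurable \<nu>" by simp
 note gq = Ls_Cauchy_limit[OF gp(1) p1(3) gp(2) finite_\<nu> p1(2) gi(2) gint(4) CQ AE_\<nu> g\<nu>]
 have zi: "integrable \<mu> (z n)" for n by (rule Lpq_integrable(1)[OF test_Lpq(1)[OF z]])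
 have q0: "0 \<le> q" "p \<le> q" "0 < p" "0 < q" using pq by auto
 \<comment> \<open>The limit of the functions is taken in L^q of \<open>\<mu>\<close>, which serves
   all purposes: on a finite measure space the smaller exponent p follows, and \<open>\<nu>\<close>
   is bounded by a multiple of \<open>\<mu>\<close>. Here q below the critical exponent of p is
   spent.\<close>
 obtain u where u[measurable]: "u \<in> borel_measurable \<mu>" and us: "\<And>n. integrable \<mu> (\<lambda>x. norm (z n x - u x) powr q)"
  "(\<lambda>n. LINT x|\<mu>. norm (z n x - u x) powr q) \<longlonglongrightarrow> 0"
  by (rule Ls_complete[OF finite_\<mu> p1(2) zi int[OF q0(1)] sobolev_Cauchy[OF q0(2) q_sub z CP]]) (assumption | rule that)+
 have up: "integrable \<mu> (\<lambda>x. norm (z n x - u x) powr p)" "(\<lambda>n. LINT x|\<mu>. norm (z n x - u x) powr p) \<longlonglongrightarrow> 0" for n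
  using Ls_lower_exponent[OF finite_\<mu>, of "\<lambda>n x. z n x - u x" q p] us q0 by auto
 have uq: "(\<lambda>n. LINT x|\<nu>. norm (z n x - u x) powr q) \<longlonglongrightarrow> 0"
 proof (rule Lim_null_comparison[OF always_eventually])
  show "\<forall>n. norm (LINT x|\<nu>. norm (z n x - u x) powr q) \<le> \<bar>A\<bar> * (LINT x|\<mu>. norm (z n x - u x) powr q)"
   using integrable_\<nu>I(2)[OF us(1)] by simp
  show "(\<lambda>n. \<bar>A\<bar> * (LINT x|\<mu>. norm (z n x - u x) powr q)) \<longlonglongrightarrow> 0" using tendsto_mult_left[OF us(2), of "\<bar>A\<bar>"] by simp
 qed
 have "approximates z u g"
  unfolding approximates_def converges_pq_def Lpq_def
  using z up uq integrable_\<nu>I(1)[OF us(1)] gp gq by auto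
 then show thesis by (intro that[OF \<rho>, of u g]) (simp add: z_def)
qed

lemma converges_pq_cong_AE:
 fixes g g' :: "'a => 'b::euclidean_space"
 assumes c: "converges_pq h g" and AE: "AE x in \<mu>. g x = g' x" and m: "\<And>n. h n \<in> borel_measurable \<mu>" "g' \<in> borel_measurable \<mu>"
 shows "converges_pq h g'"
proof -
 note [measurable] = m
 have L: "Lpq (\<lambda>x. h n x - g x)" for n using c by (simp add: converges_pq_def)
 have AE': "AE x in \<mu>. norm (h n x - g x) = norm (h n x - g' x)" for n using AE by eventually_elim simp
 have L': "Lpq (\<lambda>x. h n x - g' x)" for n by (rule Lpq_cong_AE[OF L AE']) measurable
 have m': "(\<lambda>x. norm (k x) powr s) \<in> borel_measurable \<mu>" if "Lpq k" for k :: "'a => 'b" and s using that by (auto simp: Lpq_def)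
 have AEs: "AE x in \<mu>. norm (h n x - g x) powr s = norm (h n x - g' x) powr s" for n s using AE'[of n] by eventually_elim simp
 have "(LINT x|\<mu>. norm (h n x - g x) powr p) = (LINT x|\<mu>. norm (h n x - g' x) powr p)"
  "(LINT x|\<nu>. norm (h n x - g x) powr q) = (LINT x|\<nu>. norm (h n x - g' x) powr q)" for n
  by (rule integral_cong_AE[OF m'[OF L] m'[OF L'] AEs], rule integral_cong_AE[OF _ _ AE_\<nu>[OF AEs]]) (use m'[OF L] m'[OF L'] in simp_all)
 then show ?thesis using c L' by (simp add: converges_pq_def)
qed

lemma W1_H_0_Lpq: "u \<in> W1_H_0 \<Omega> p q a ==> Lpq u" "u \<in> W1_H_0 \<Omega> p q a ==> Lpq (weak_gradient \<Omega> u)"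
 using W1_H_iff by (auto simp: W1_H_0_def)

lemma approximates_weak_gradient:
 assumes ap: "approximates z u g"
 shows "approximates z u (weak_gradient \<Omega> u)"
proof -
 note D = approximatesD[OF ap] and W = approximates_W1_H_0[OF ap]
 have m: "weak_gradient \<Omega> u \<in> borel_measurable \<mu>" using W1_H_0_Lpq(2)[OF W(1)] by (simp add: Lpq_def)
 have "AE x in \<mu>. g x = weak_gradient \<Omega> u x" using W(2) by eventually_elim simp
 from converges_pq_cong_AE[OF D(5) this test_borel_\<mu>(2)[OF D(1)] m]
 show ?thesis using ap m by (simp add: approximates_def)
qed

text \<open>\<open>weak_gradient\<close> chooses a gradient separately for each function, even for
  two that agree almost everywhere. A sequence approximating \<open>u\<close> also approximates
  \<open>v\<close>, which fixes the gradient up to a null set.\<close>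

lemma weak_gradient_cong_AE:
 assumes u: "u \<in> W1_H_0 \<Omega> p q a" and v: "v \<in> W1_H_0 \<Omega> p q a" and AE: "AE x in \<mu>. u x = v x"
 shows "AE x in \<mu>. weak_gradient \<Omega> v x = weak_gradient \<Omega> u x"
proof -
 obtain z where z: "approximates z u (weak_gradient \<Omega> u)" by (rule W1_H_0_approximates[OF u])
 note D = approximatesD[OF z]
 have m: "v \<in> borel_measurable \<mu>" using W1_H_0_Lpq(1)[OF v] by (simp add: Lpq_def)
 from converges_pq_cong_AE[OF D(4) AE test_borel_\<mu>(1)[OF D(1)] m]
 have "approximates z v (weak_gradient \<Omega> u)" using z m by (simp add: approximates_def)
 then show ?thesis by (rule approximates_W1_H_0(2))
qed

text \<open>Convergence is strong, so the lower energy bound and the equation pass to the limit;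
  against a fixed combination of basis functions the equation holds from some index on. Density of
  the gradients in the uniform norm extends it to test functions, and approximation extends it to
  the whole space.\<close>

theorem high_energy_solution:
 obtains u where "u \<in> W1_H_0 \<Omega> p q a" "K \<le> En u (weak_gradient \<Omega> u)"
  "\<And>v. v \<in> W1_H_0 \<Omega> p q a ==> dEn u (weak_gradient \<Omega> u) v (weak_gradient \<Omega> v) = 0"
proof -
 interpret m: finite_measure \<mu> by (rule finite_\<mu>)
 have q0: "0 < q" "0 < p" using p_gt_1 p_less_q by auto
 obtain \<phi> :: "nat => 'a => real" where \<phi>: "\<And>j. \<phi> j \<in> \<T>"
  "\<forall>n c. (\<forall>x. (\<Sum>j<n. c j * \<phi> j x) = 0) \<longrightarrow> (\<forall>j<n. c j = 0)"
  "\<And>u \<epsilon>. u \<in> \<T> ==> 0 < \<epsilon> ==> \<exists>n c. \<forall>x. norm (grad u x - grad (\<lambda>x. \<Sum>j<n. c j * \<phi> j x) x) \<le> \<epsilon>"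
  by (rule independent_dense_sequence[OF open_domain bounded_domain nonempty]) (rule that)
 interpret G: galerkin \<Omega> p q A a M \<theta> f r C \<sigma> c0 t0 \<phi>
  by unfold_locales (rule \<phi>)+
 obtain k d where kd: "\<And>n. k < n ==> \<exists>c. K \<le> \<E> (G.comb n c) \<and> \<E> (G.comb n c) \<le> d \<and>
  (\<forall>v. \<D> (G.comb n c) (G.comb n v) = 0)"
  by (rule G.galerkin_critical_points[where K = K]) (rule that)
 \<comment> \<open>The dimensions start above \<open>k\<close>, where critical points are available,
   and increase, so that earlier solutions lie in the later spaces.\<close>
 define N where "N = (\<lambda>n. Suc (k + n))"
 have "\<exists>c. K \<le> \<E> (G.comb (N n) c) \<and> \<E> (G.comb (N n) c) \<le> d \<and>
  (\<forall>v. \<D> (G.comb (N n) c) (G.comb (N n) v) = 0)" for n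
  by (rule kd) (simp add: N_def)
 then obtain c where c: "\<And>n. K \<le> \<E> (G.comb (N n) (c n))" "\<And>n. \<E> (G.comb (N n) (c n)) \<le> d"
  "\<And>n v. \<D> (G.comb (N n) (c n)) (G.comb (N n) v) = 0" by metis
 define w where "w = (\<lambda>n. G.comb (N n) (c n))"
 have w: "w n \<in> \<T>" for n by (simp add: w_def G.comb_test)
 have wc: "\<D> (w n) (G.comb l v) = 0" if "l \<le> N n" for n l v
 proof -
  let ?v = "\<lambda>i. if i < l then v i else 0"
  have "G.comb (N n) ?v = G.comb l ?v" by (rule G.comb_extend) (use that in \<open>auto simp: fin_space_def\<close>)
  also have "\<dots> = G.comb l v" by (simp add: G.comb_def[abs_def])
  finally show ?thesis using c(3)[of n ?v] by (simp add: w_def)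
 qed
 obtain B where B: "0 \<le> B" "\<And>u. u \<in> \<T> ==> \<E> u \<le> d ==> \<D> u u = 0 ==> Ap (grad u) \<le> B \<and> Aq (grad u) \<le> B"
  by (rule critical_points_bounded[where d = d]) (rule that)
 have wB: "Ap (grad (w n)) \<le> B" "Aq (grad (w n)) \<le> B" for n
  using B(2)[OF w, of n] c(2)[of n] c(3)[of n "c n"] by (simp_all add: w_def)
 \<comment> \<open>For m \<le> n the function \<open>w m\<close>, with its coefficients padded by
   zeros, belongs to the space of \<open>w n\<close>, so the difference is an admissible
   direction.\<close>
 have crit: "\<D> (w n) (\<lambda>x. w m x - w n x) = 0" if "m \<le> n" for m n
 proof -
  let ?v = "\<lambda>i. (if i < N m then c m i else 0)"
  have "G.comb (N n) ?v = G.comb (N m) ?v" by (rule G.comb_extend) (use that in \<open>auto simp: fin_space_def N_def\<close>)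
  also have "\<dots> = w m" by (simp add: G.comb_def[abs_def] w_def)
  finally have "G.comb (N n) (\<lambda>i. ?v i + (- 1) * c n i) = (\<lambda>x. w m x - w n x)"
   using G.comb_line[of "N n" ?v "- 1" "c n"] by (simp add: w_def)
  then show ?thesis using c(3)[of n "\<lambda>i. ?v i + (- 1) * c n i"] by (simp add: w_def)
 qed
 obtain \<rho> u g where \<rho>: "strict_mono (\<rho> :: nat => nat)" and ap0: "approximates (\<lambda>n. w (\<rho> n)) u g"
  by (rule critical_sequence_converges[OF w B(1) wB crit]) (assumption | rule that)+
 let ?w = "weak_gradient \<Omega> u"
 note ap = approximates_weak_gradient[OF ap0]
 note D = approximatesD[OF ap]
 note L = approximates_limits(3-5)[OF ap]
 have u1: "u \<in> W1_H_0 \<Omega> p q a" by (rule approximates_W1_H_0(1)[OF ap])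
 have u2: "K \<le> En u ?w"
  by (rule LIMSEQ_le_const[OF L(1)[OF w[of 0]]]) (use c(1) in \<open>auto simp: w_def\<close>)
 have um: "u \<in> borel_measurable \<mu>" using D(2) by (simp add: Lpq_def)
 note dir = dEn_direction_tendsto[OF D(3) um L(3)[OF w[of 0]]]
 have comb: "dEn u ?w (G.comb l v) (grad (G.comb l v)) = 0" for l v
 proof (rule LIMSEQ_unique[OF L(2)[OF G.comb_test]])
  have ev: "\<forall>\<^sub>F n in sequentially. \<D> (w (\<rho> n)) (G.comb l v) = 0"
  proof (rule eventually_sequentiallyI[of l])
   fix n assume "l \<le> n"
   then have "l \<le> N (\<rho> n)" using seq_suble[OF \<rho>, of n] by (simp add: N_def)
   then show "\<D> (w (\<rho> n)) (G.comb l v) = 0" by (rule wc)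
  qed
  show "(\<lambda>n. \<D> (w (\<rho> n)) (G.comb l v)) \<longlonglongrightarrow> 0"
   by (rule tendsto_eventually[OF ev])
 qed
 have r0: "0 \<le> r" using r_gt_1 by simp
 have test: "dEn u ?w v (grad v) = 0" if v: "v \<in> \<T>" for v
 proof -
  have "\<exists>l y. \<forall>x. norm (grad v x - grad (G.comb l y) x) \<le> inverse (real (Suc j))" for j
   using \<phi>(3)[OF v, of "inverse (real (Suc j))"] by (simp add: G.comb_def[abs_def])
  then obtain l y where ly: "\<And>j x. norm (grad v x - grad (G.comb (l j) (y j)) x) \<le> inverse (real (Suc j))" by metis
  define e where "e = (\<lambda>j. G.comb (l j) (y j))"
  have e: "e j \<in> \<T>" for j by (simp add: e_def G.comb_test)
  have d: "grad (\<lambda>x. e j x - v x) x = grad (e j) x - grad v x" for j x by (rule grad_diff[OF e v])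
  have dT: "(\<lambda>x. e j x - v x) \<in> \<T>" for j by (rule test_functions_diff[OF e v])
  have le: "norm (grad (e j) x - grad v x) \<le> inverse (real (Suc j))" for j x
   unfolding e_def norm_minus_commute[of _ "grad v x"] by (rule ly)
  obtain R where R: "\<And>x. norm (grad v x) \<le> R" using test_functions_grad_bounded[OF v] by metis
  have bd: "norm (grad (e j) x) \<le> R + 1" for j x
  proof -
   have "inverse (real (Suc j)) \<le> 1" by (simp add: inverse_eq_divide)
   then show ?thesis using le[of j x] R[of x] norm_triangle_sub[of "grad (e j) x" "grad v x"] by linarith
  qed
  have lim: "(\<lambda>j. grad (e j) x) \<longlonglongrightarrow> grad v x" for x
   by (rule LIM_zero_cancel, rule Lim_null_comparison[OF always_eventually LIMSEQ_inverse_real_of_nat]) (use le in blast)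
  note I = bounded_pointwise_Ls[OF test_borel_\<mu>(2)[OF e] test_borel_\<mu>(2)[OF v] bd lim]
  have conv: "converges_pq (\<lambda>j. grad (e j)) (grad v)"
   unfolding converges_pq_def using I(1)[OF q0(2)] I(2)[OF q0(1)] Lpq_diff[OF test_Lpq(2)[OF e] test_Lpq(2)[OF v]] by simp
  \<comment> \<open>The density statement concerns gradients only; convergence of the functions in
    L^r comes from the Sobolev inequality.\<close>
  obtain S where S: "0 \<le> S" "\<And>u. u \<in> \<T> ==> (LINT x|\<mu>. norm (u x) powr r) \<le> S * Ap (grad u) powr (r / p)"
   by (rule sobolev_bound[of r]) (use p_less_r r_sub in auto)
  have er: "(\<lambda>j. LINT x|\<mu>. norm (e j x - v x) powr r) \<longlonglongrightarrow> 0"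
  proof (rule Lim_null_comparison[OF always_eventually])
   show "\<forall>j. norm (LINT x|\<mu>. norm (e j x - v x) powr r) \<le> S * (LINT x|\<mu>. norm (grad (e j) x - grad v x) powr p) powr (r / p)"
    using S(2)[OF dT] by (simp add: Ap_def d integral_nonneg_AE)
   have "(\<lambda>j. S * (LINT x|\<mu>. norm (grad (e j) x - grad v x) powr p) powr (r / p)) \<longlonglongrightarrow> S * 0 powr (r / p)"
    by (intro tendsto_mult_left tendsto_powr' I(1)[OF q0(2)] tendsto_const) (use q0 r_gt_1 in \<open>auto simp: integral_nonneg_AE\<close>)
   then show "(\<lambda>j. S * (LINT x|\<mu>. norm (grad (e j) x - grad v x) powr p) powr (r / p)) \<longlonglongrightarrow> 0" by simp
  qed
  have "(\<lambda>j. dEn u ?w (e j) (grad (e j))) \<longlonglongrightarrow> dEn u ?w v (grad v)"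
  proof (rule dir[OF test_Lpq(2)[OF e] test_Lpq(2)[OF v] conv test_borel_\<mu>(1)[OF e] test_borel_\<mu>(1)[OF v] _ _ er])
   show "integrable \<mu> (\<lambda>x. norm (e j x) powr r)" "integrable \<mu> (\<lambda>x. norm (e j x - v x) powr r)" for j
    using test_integrable(5)[OF e e r0] test_integrable(5)[OF dT dT r0] by simp_all
  qed
  then show ?thesis using comb by (simp add: e_def LIMSEQ_const_iff)
 qed
 have "dEn u ?w v (weak_gradient \<Omega> v) = 0" if v: "v \<in> W1_H_0 \<Omega> p q a" for v
 proof -
  obtain z where z: "approximates z v (weak_gradient \<Omega> v)" by (rule W1_H_0_approximates[OF v])
  note Z = approximatesD[OF z]
  have vm: "v \<in> borel_measurable \<mu>" using Z(2) by (simp add: Lpq_def)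
  have zr: "integrable \<mu> (\<lambda>x. norm (z j x) powr r)" for j using test_integrable(5)[OF Z(1) Z(1) r0] by simp
  have "(\<lambda>j. dEn u ?w (z j) (grad (z j))) \<longlonglongrightarrow> dEn u ?w v (weak_gradient \<Omega> v)"
   by (rule dir[OF test_Lpq(2)[OF Z(1)] Z(3) Z(5) test_borel_\<mu>(1)[OF Z(1)] vm zr approximates_Lr[OF z]])
  then show ?thesis using test[OF Z(1)] by (simp add: LIMSEQ_const_iff)
 qed
 then show thesis using that u1 u2 by blast
qed

end

section \<open>Infinitely many solutions\<close>

context kirchhoff
begin

lemma grad_energy_eq:
 assumes "u \<in> W1_H_0 \<Omega> p q a"
 shows "grad_energy_p \<Omega> p u = Ap (weak_gradient \<Omega> u)" "grad_energy_q \<Omega> q a u = Aq (weak_gradient \<Omega> u)"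
proof -
 have [measurable]: "weak_gradient \<Omega> u \<in> borel_measurable \<mu>" using W1_H_0_Lpq(2)[OF assms] by (simp add: Lpq_def)
 show "grad_energy_p \<Omega> p u = Ap (weak_gradient \<Omega> u)" by (simp add: grad_energy_p_def Ap_def)
 show "grad_energy_q \<Omega> q a u = Aq (weak_gradient \<Omega> u)"
  unfolding grad_energy_q_def Aq_def by (subst integral_\<nu>) auto
qed

lemma energy_eq_En: "u \<in> W1_H_0 \<Omega> p q a ==> energy \<Omega> p q a M f u = En u (weak_gradient \<Omega> u)"
 by (simp add: energy_def En_def grad_energy_eq)

lemma weak_solution_iff:
 "weak_solution \<Omega> p q a M f u \<longleftrightarrow> u \<in> W1_H_0 \<Omega> p q a \<and>
   (\<forall>v\<in>W1_H_0 \<Omega> p q a. dEn u (weak_gradient \<Omega> u) v (weak_gradient \<Omega> v) = 0)"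
proof -
 have "(LINT x|\<mu>. a x * norm (weak_gradient \<Omega> u x) powr (q - 2) * (weak_gradient \<Omega> u x \<bullet> weak_gradient \<Omega> v x)) = Bq (weak_gradient \<Omega> u) (weak_gradient \<Omega> v)"
  if "u \<in> W1_H_0 \<Omega> p q a" "v \<in> W1_H_0 \<Omega> p q a" for v
 proof -
  have [measurable]: "weak_gradient \<Omega> u \<in> borel_measurable \<mu>" "weak_gradient \<Omega> v \<in> borel_measurable \<mu>"
   using W1_H_0_Lpq(2)[OF that(1)] W1_H_0_Lpq(2)[OF that(2)] by (simp_all add: Lpq_def)
  show ?thesis unfolding Bq_def by (subst integral_\<nu>) (auto simp: mult.assoc)
 qed
 then show ?thesis
  unfolding weak_solution_def by (auto simp: grad_energy_eq dEn_def Bp_def[symmetric])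
qed

text \<open>Needed for distinctness: solutions with different energies must then differ on a set of
  positive measure.\<close>

lemma energy_cong_AE:
 assumes u: "u \<in> W1_H_0 \<Omega> p q a" and v: "v \<in> W1_H_0 \<Omega> p q a" and AE: "AE x in \<mu>. u x = v x"
 shows "energy \<Omega> p q a M f u = energy \<Omega> p q a M f v"
proof -
 have [measurable]: "weak_gradient \<Omega> u \<in> borel_measurable \<mu>" "weak_gradient \<Omega> v \<in> borel_measurable \<mu>"
  and m: "u \<in> borel_measurable \<mu>" "v \<in> borel_measurable \<mu>"
  using W1_H_0_Lpq[OF u] W1_H_0_Lpq[OF v] by (simp_all add: Lpq_def)
 note W = weak_gradient_cong_AE[OF u v AE]
 have "Ap (weak_gradient \<Omega> u) = Ap (weak_gradient \<Omega> v)"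
  unfolding Ap_def by (rule integral_cong_AE) (use W in \<open>auto elim!: eventually_mono\<close>)
 moreover have "Aq (weak_gradient \<Omega> u) = Aq (weak_gradient \<Omega> v)"
  unfolding Aq_def by (rule integral_cong_AE) (use AE_\<nu>[OF W] in \<open>auto elim!: eventually_mono\<close>)
 moreover have "(LINT x|\<mu>. F x (u x)) = (LINT x|\<mu>. F x (v x))"
  by (rule integral_cong_AE) (use AE m in \<open>auto elim!: eventually_mono intro: F_compose_meas\<close>)
 ultimately show ?thesis by (simp add: energy_eq_En u v En_def)
qed

text \<open>Solutions exist above every energy level, so they can be picked with energies growing by
  at least 1 at each step. This gives unboundedness and pairwise distinctness at once.\<close>

theorem unbounded_solutions:
 "\<exists>u :: nat => 'a => real. (\<forall>j. weak_solution \<Omega> p q a M f (u j)) \<and>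
   (\<forall>i j. i \<noteq> j \<longrightarrow> \<not> (AE x in \<mu>. u i x = u j x)) \<and> \<not> bounded (range (\<lambda>j. energy \<Omega> p q a M f (u j)))"
proof -
 let ?E = "energy \<Omega> p q a M f" and ?W = "weak_solution \<Omega> p q a M f"
 have high: "\<exists>u. ?W u \<and> K \<le> ?E u" for K
 proof -
  obtain u where "u \<in> W1_H_0 \<Omega> p q a" "K \<le> En u (weak_gradient \<Omega> u)"
   "\<And>v. v \<in> W1_H_0 \<Omega> p q a ==> dEn u (weak_gradient \<Omega> u) v (weak_gradient \<Omega> v) = 0" by (rule high_energy_solution[where K = K]) (rule that)
  then have "?W u \<and> K \<le> ?E u" by (simp add: weak_solution_iff energy_eq_En)
  then show ?thesis by blast
 qed
 have "\<exists>u. \<forall>n. ?W (u n) \<and> ?E (u n) + 1 \<le> ?E (u (Suc n))"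
  by (rule dependent_nat_choice) (use high in blast)+
 then obtain u where u: "\<And>n. ?W (u n)" "\<And>n. ?E (u n) + 1 \<le> ?E (u (Suc n))" by blast
 have mono: "strict_mono (\<lambda>n. ?E (u n))" using u(2) by (intro strict_mono_Suc_iff[THEN iffD2]) (metis less_add_one less_le_trans)
 have "\<not> (AE x in \<mu>. u i x = u j x)" if "i \<noteq> j" for i j
 proof
  assume "AE x in \<mu>. u i x = u j x"
  then have "?E (u i) = ?E (u j)" using u(1) by (intro energy_cong_AE) (auto simp: weak_solution_def)
  then show False using strict_mono_eq[OF mono] that by auto
 qed
 moreover have "\<not> bounded (range (\<lambda>j. ?E (u j)))"
 proof
  assume "bounded (range (\<lambda>j. ?E (u j)))"
  then obtain B where B: "\<And>j. \<bar>?E (u j)\<bar> \<le> B" by (auto simp: bounded_iff)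
  have "?E (u 0) + real n \<le> ?E (u n)" for n
  proof (induction n)
   case (Suc n)
   then show ?case using u(2)[of n] by simp
  qed simp
  moreover obtain n :: nat where "B - ?E (u 0) < real n" using reals_Archimedean2 by blast
  ultimately show False using B[of n] by (smt (verit))
 qed
 ultimately show ?thesis using u(1) by blast
qed

end

section \<open>Passage from the stated hypotheses to the locale\<close>

theorem theorem1p4:
  fixes \<Omega> :: "'a::euclidean_space set"
    and p q \<theta> :: real
    and a :: "'a \<Rightarrow> real"
    and M :: "real \<Rightarrow> real"
    and f :: "'a \<Rightarrow> real \<Rightarrow> real"
  assumes "DIM('a) \<ge> 2"
    and "open \<Omega>" and "bounded \<Omega>" and "\<Omega> \<noteq> {}" and "lipschitz_boundary \<Omega>"
    and "1 < p" and "p < q" and "q < real DIM('a)" and "q / p < 1 + 1 / real DIM('a)"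
    and "\<exists>L. L-lipschitz_on (closure \<Omega>) a" and "\<forall>x\<in>closure \<Omega>. a x \<ge> 0"
    and "continuous_on {0..} M" and "\<forall>t\<ge>0. M t \<ge> 0"
    and "1 \<le> \<theta>" and "\<theta> < sobolev_conjugate (real DIM('a)) p / q"
    and "\<forall>t\<ge>0. t * M t \<le> \<theta> * primitive M t"
    and "\<forall>\<tau>>0. \<exists>\<kappa>>0. \<forall>t\<ge>\<tau>. M t \<ge> \<kappa>"
    and "caratheodory \<Omega> f"
    and "\<exists>r C. p < r \<and> r < sobolev_conjugate (real DIM('a)) p \<and> C > 0 \<and>
           (AE x in lebesgue_on \<Omega>. \<forall>t. \<bar>f x t\<bar> \<le> C * (1 + \<bar>t\<bar> powr (r - 1)))"
    and "\<exists>\<sigma> c t\<^sub>0. q * \<theta> < \<sigma> \<and> \<sigma> < sobolev_conjugate (real DIM('a)) p \<and> c > 0 \<and> t\<^sub>0 \<ge> 0 \<and>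
           (AE x in lebesgue_on \<Omega>. \<forall>t. \<bar>t\<bar> \<ge> t\<^sub>0 \<longrightarrow>
              c \<le> \<sigma> * primitive (f x) t \<and> \<sigma> * primitive (f x) t \<le> t * f x t)"
    and "AE x in lebesgue_on \<Omega>. \<forall>t. f x (- t) = - f x t"
  shows "\<exists>u :: nat \<Rightarrow> 'a \<Rightarrow> real.
           (\<forall>j. weak_solution \<Omega> p q a M f (u j)) \<and>
           (\<forall>i j. i \<noteq> j \<longrightarrow> \<not> (AE x in lebesgue_on \<Omega>. u i x = u j x)) \<and>
           \<not> bounded (range (\<lambda>j. energy \<Omega> p q a M f (u j)))"
proof -
 define N where "N = real DIM('a)"
 have pqN: "1 < p" "p < q" "q < N" "1 < N" using assms(1,6-8) by (auto simp: N_def)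
 have \<Omega>: "\<Omega> \<in> sets lebesgue" using assms(2) by (auto intro: borel_open)
 obtain L where L: "L-lipschitz_on (closure \<Omega>) a" using assms(10) by blast
 have a_cont: "continuous_on (closure \<Omega>) a" by (rule lipschitz_on_continuous_on[OF L])
 have "compact (closure \<Omega>)" using assms(3) by (simp add: compact_closure)
 from compact_imp_bounded[OF compact_continuous_image[OF a_cont this]]
 obtain A where A: "\<And>x. x \<in> closure \<Omega> ==> norm (a x) \<le> A" unfolding bounded_iff by blast
 have a_bounds: "0 \<le> a x" "a x \<le> A" if "x \<in> \<Omega>" for x
 proof -
  have x: "x \<in> closure \<Omega>" using that closure_subset by blast
  show "0 \<le> a x" using assms(11) x by blast
  show "a x \<le> A" using A[OF x] by simp
 qed
 have a_meas: "a \<in> borel_measurable (lebesgue_on \<Omega>)"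
  by (rule continuous_imp_measurable_on_sets_lebesgue[OF continuous_on_subset[OF a_cont closure_subset] \<Omega>])
 obtain r C where r: "p < r" "r < sobolev_conjugate N p" and C: "0 < C"
  and growth: "AE x in lebesgue_on \<Omega>. \<forall>t. \<bar>f x t\<bar> \<le> C * (1 + \<bar>t\<bar> powr (r - 1))"
  using assms(19) unfolding N_def by blast
 obtain \<sigma> c t0 where \<sigma>: "q * \<theta> < \<sigma>" and c: "0 < c" "0 \<le> t0"
  and AR: "AE x in lebesgue_on \<Omega>. \<forall>t. t0 \<le> \<bar>t\<bar> \<longrightarrow> c \<le> \<sigma> * primitive (f x) t \<and> \<sigma> * primitive (f x) t \<le> t * f x t"
  using assms(20) by blast
 have r_sub: "0 < r - N * (r - p) / p"
 proof -
  have "r * (N - p) < N * p" using r(2) pqN by (simp add: sobolev_conjugate_def pos_less_divide_eq)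
  then show ?thesis using pqN by (simp add: field_simps)
 qed
 \<comment> \<open>The condition on q / p gives N (q - p) < p, and p < p q because q > 1; together
   they say that q is below the critical exponent of p.\<close>
 have q_sub: "0 < q - N * (q - p) / p"
 proof -
  have "N * (q - p) < p" using assms(9) pqN unfolding N_def[symmetric] by (simp add: field_simps)
  moreover have "p * 1 < p * q" using pqN by (intro mult_strict_left_mono) auto
  ultimately have "N * (q - p) < p * q" by simp
  then show ?thesis using pqN by (simp add: field_simps)
 qed
 \<comment> \<open>On the null set where a hypothesis on \<open>f\<close> fails, \<open>f\<close> is replaced by \<open>f x0\<close> for a good point \<open>x0\<close>.\<close>
 define good where "good x \<longleftrightarrow> continuous_on UNIV (f x) \<and> (\<forall>t. \<bar>f x t\<bar> \<le> C * (1 + \<bar>t\<bar> powr (r - 1))) \<and>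
  (\<forall>t. t0 \<le> \<bar>t\<bar> \<longrightarrow> c \<le> \<sigma> * primitive (f x) t \<and> \<sigma> * primitive (f x) t \<le> t * f x t) \<and> (\<forall>t. f x (- t) = - f x t)" for x
 have f_meas: "(\<lambda>x. f x t) \<in> borel_measurable (lebesgue_on \<Omega>)" for t using assms(18) by (simp add: caratheodory_def)
 have "AE x in lebesgue_on \<Omega>. continuous_on UNIV (f x)" using assms(18) by (simp add: caratheodory_def)
 with growth AR assms(21) have good: "AE x in lebesgue_on \<Omega>. good x" unfolding good_def by eventually_elim blast
 \<comment> \<open>A good point exists because a nonempty open set is not a null set.\<close>
 obtain x0 where x0: "good x0"
 proof (rule ccontr)
  assume "\<not> thesis"
  then have "\<not> good x" for x using that by blast
  with good have "AE x in lebesgue. x \<notin> \<Omega>" using \<Omega> by (subst (asm) AE_restrict_space_iff) auto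
  then have "negligible \<Omega>" by (simp add: AE_iff_null_sets negligible_iff_null_sets \<Omega>)
  then show False using open_not_negligible[OF assms(2,4)] by blast
 qed
 define f' where "f' = (\<lambda>x. if good x then f x else f x0)"
 have f': "AE x in lebesgue_on \<Omega>. f' x = f x" using good by eventually_elim (simp add: f'_def)
 have good': "good (if good x then x else x0)" for x using x0 by simp
 have f'_eq: "f' x = f (if good x then x else x0)" for x by (simp add: f'_def)
 \<comment> \<open>The threshold \<open>max t0 1\<close> is positive, and raising it only weakens
   the Ambrosetti--Rabinowitz condition.\<close>
 interpret kirchhoff \<Omega> p q A a M \<theta> f' r C \<sigma> c "max t0 1"
 proof
  show "(\<lambda>x. f' x t) \<in> borel_measurable (lebesgue_on \<Omega>)" for t
   by (rule borel_measurable_lebesgue_on_AE[OF \<Omega> f_meas[of t]]) (use f' in \<open>auto elim!: eventually_mono\<close>)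
  fix x
  show "continuous_on UNIV (f' x)" using good'[of x] unfolding f'_eq good_def by blast
  show "\<bar>f' x t\<bar> \<le> C * (1 + \<bar>t\<bar> powr (r - 1))" "f' x (- t) = - f' x t" for t
   using good'[of x] unfolding f'_eq good_def by blast+
  show "c \<le> \<sigma> * primitive (f' x) t \<and> \<sigma> * primitive (f' x) t \<le> t * f' x t" if "max t0 1 \<le> \<bar>t\<bar>" for t
   using good'[of x] that unfolding f'_eq good_def by simp
 qed (use assms(2-4) pqN assms(12-14,16,17) a_meas a_bounds r r_sub q_sub \<sigma> c in \<open>auto simp: N_def\<close>)
 \<comment> \<open>Composites with the original \<open>f\<close> are measurable because they agree
   almost everywhere with those of \<open>f'\<close> and Lebesgue measure is complete.\<close>
 have eqf: "(LINT x|\<mu>. f x (u x) * v x) = (LINT x|\<mu>. f' x (u x) * v x)" and eqF: "(LINT x|\<mu>. primitive (f x) (u x)) = (LINT x|\<mu>. primitive (f' x) (u x))"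
  if u: "u \<in> borel_measurable \<mu>" and v: "v \<in> borel_measurable \<mu>" for u v
 proof -
  have m: "(\<lambda>x. f' x (u x) * v x) \<in> borel_measurable \<mu>" "(\<lambda>x. primitive (f' x) (u x)) \<in> borel_measurable \<mu>"
   by (intro borel_measurable_times f_compose_meas F_compose_meas u v)+
  have e: "AE x in \<mu>. f' x (u x) * v x = f x (u x) * v x" "AE x in \<mu>. primitive (f' x) (u x) = primitive (f x) (u x)"
   "AE x in \<mu>. f x (u x) * v x = f' x (u x) * v x" "AE x in \<mu>. primitive (f x) (u x) = primitive (f' x) (u x)"
   using f' by (eventually_elim, simp)+
  show "(LINT x|\<mu>. f x (u x) * v x) = (LINT x|\<mu>. f' x (u x) * v x)"
   by (rule integral_cong_AE[OF borel_measurable_lebesgue_on_AE[OF \<Omega> m(1) e(1)] m(1) e(3)])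
  show "(LINT x|\<mu>. primitive (f x) (u x)) = (LINT x|\<mu>. primitive (f' x) (u x))"
   by (rule integral_cong_AE[OF borel_measurable_lebesgue_on_AE[OF \<Omega> m(2) e(2)] m(2) e(4)])
 qed
 have W0: "u \<in> borel_measurable \<mu>" if "u \<in> W1_H_0 \<Omega> p q a" for u using W1_H_0_Lpq(1)[OF that] by (simp add: Lpq_def)
 have ws: "weak_solution \<Omega> p q a M f u = weak_solution \<Omega> p q a M f' u" for u
  unfolding weak_solution_def by (intro conj_cong refl ball_cong) (simp add: eqf W0)
 have en: "energy \<Omega> p q a M f u = energy \<Omega> p q a M f' u" if "u \<in> W1_H_0 \<Omega> p q a" for u
  unfolding energy_def using eqF[OF W0[OF that] W0[OF that]] by simp
 from unbounded_solutions show ?thesis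
 proof (elim exE conjE)
  fix u :: "nat => 'a => real"
  assume u: "\<forall>j. weak_solution \<Omega> p q a M f' (u j)" "\<forall>i j. i \<noteq> j \<longrightarrow> \<not> (AE x in \<mu>. u i x = u j x)"
   "\<not> bounded (range (\<lambda>j. energy \<Omega> p q a M f' (u j)))"
  have "energy \<Omega> p q a M f (u j) = energy \<Omega> p q a M f' (u j)" for j
   by (rule en) (use u(1) in \<open>simp add: weak_solution_def\<close>)
  then have e: "range (\<lambda>j. energy \<Omega> p q a M f (u j)) = range (\<lambda>j. energy \<Omega> p q a M f' (u j))" by simp
  have "\<not> bounded (range (\<lambda>j. energy \<Omega> p q a M f (u j)))" unfolding e by (rule u(3))
  with u(1,2) show ?thesis unfolding ws by blast
 qed
qed

end
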